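(* Let $w$ be a majorant such that there exists $0<\gamma<1$ with $w(t)/t^\gamma$ non-increasing on $(0,1]$, and such that $\int_0^1\frac{w(t)}{t}dt<\infty$. Then any non-trivial singular inner factor $S_\mu$ of a function in $BMOA_w$ satisfies the permanence property in $\mathcal{B}$: $[S_\mu]_{\mathcal{B}}\cap H^\infty=S_\mu H^\infty$. In particular, no non-trivial singular inner divisor of a function in $BMOA_w$ is cyclic in $\mathcal{B}$.
   Context: A majorant is a continuous non-decreasing sub-additive function $w$ on $[0,1]$ with $w(0)=0$. $BMO_w(\partial\mathbb{D})$ is the space of Lebesgue integrable $h$ on $\partial\mathbb{D}$ with $\sup_I\frac{1}{w(|I|)}\frac{1}{|I|}\int_I|h-h_I|\,dm<\infty$, the supremum over arcs $I$, where $|I|$ is normalized length, $m$ normalized Lebesgue measure and $h_I$ the mean of $h$ over $I$; $BMOA_w=H^2\cap BMO_w(\partial\mathbb{D})$ (boundary values). $\mathcal{B}$ is the Bloch space of analytic $f$ with $|f(0)|+\sup_z(1-|z|)|f'(z)|<\infty$, identified with the dual of $W^1=\{g: |g(0)|+\int_{\mathbb{D}}|g'|dA<\infty\}$ via the pairing $\lim_{r\to1^-}\int_{\partial\mathbb{D}}f(r\zeta)\overline{g(r\zeta)}dm(\zeta)$, with the weak-star topology; $[f]_{\mathcal{B}}$ is the weak-star closure of polynomial multiples of $f$, and $f$ is cyclic if $[f]_{\mathcal{B}}=\mathcal{B}$. $S_\mu$ is the singular inner function of a positive singular measure $\mu$. *)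

theory Defs
  imports "HOL-Analysis.Analysis" "HOL-Computational_Algebra.Polynomial"
begin

definition majorant :: "(real \<Rightarrow> real) \<Rightarrow> bool" where
  "majorant w \<longleftrightarrow> continuous_on {0..1} w \<and> mono_on {0..1} w \<and> w 0 = 0 \<and>
     (\<forall>s t. 0 \<le> s \<longrightarrow> 0 \<le> t \<longrightarrow> s + t \<le> 1 \<longrightarrow> w (s + t) \<le> w s + w t)"

text \<open>Functions on the circle are functions on complex numbers, evaluated at cis theta;
  the normalized Lebesgue measure m on the circle is d theta / (2 pi).
  An arc is I = {cis theta | a \<le> theta \<le> a + L} with 0 < L \<le> 2 pi, normalized length L/(2 pi).\<close>

definition arc_mean :: "(complex \<Rightarrow> complex) \<Rightarrow> real \<Rightarrow> real \<Rightarrow> complex" where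
  "arc_mean h a L = (LBINT \<theta>:{a..a+L}. h (cis \<theta>)) / of_real L"

definition BMO_w :: "(real \<Rightarrow> real) \<Rightarrow> (complex \<Rightarrow> complex) \<Rightarrow> bool" where
  "BMO_w w h \<longleftrightarrow> set_integrable lborel {0..2*pi} (\<lambda>\<theta>. h (cis \<theta>)) \<and>
     (\<exists>C. \<forall>a L. 0 < L \<longrightarrow> L \<le> 2*pi \<longrightarrow>
        (LBINT \<theta>:{a..a+L}. cmod (h (cis \<theta>) - arc_mean h a L)) / L \<le> C * w (L / (2*pi)))"

definition H2 :: "(complex \<Rightarrow> complex) \<Rightarrow> bool" where
  "H2 f \<longleftrightarrow> f holomorphic_on ball 0 1 \<and>
     bdd_above ((\<lambda>r. (LBINT \<theta>:{0..2*pi}. (cmod (f (of_real r * cis \<theta>)))\<^sup>2) / (2*pi)) ` {0..<1})"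

definition Hinf :: "(complex \<Rightarrow> complex) \<Rightarrow> bool" where
  "Hinf f \<longleftrightarrow> f holomorphic_on ball 0 1 \<and> bounded (f ` ball 0 1)"

definition boundary_values :: "(complex \<Rightarrow> complex) \<Rightarrow> (complex \<Rightarrow> complex) \<Rightarrow> bool" where
  "boundary_values f h \<longleftrightarrow>
     (AE \<theta> in lborel. ((\<lambda>r. f (of_real r * cis \<theta>)) \<longlongrightarrow> h (cis \<theta>)) (at_left 1))"

definition BMOA_w :: "(real \<Rightarrow> real) \<Rightarrow> (complex \<Rightarrow> complex) \<Rightarrow> bool" where
  "BMOA_w w f \<longleftrightarrow> H2 f \<and> (\<exists>h. boundary_values f h \<and> BMO_w w h)"

definition Bloch :: "(complex \<Rightarrow> complex) \<Rightarrow> bool" where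
  "Bloch f \<longleftrightarrow> f holomorphic_on ball 0 1 \<and>
     bdd_above ((\<lambda>z. (1 - cmod z) * cmod (deriv f z)) ` ball 0 1)"

definition W1 :: "(complex \<Rightarrow> complex) \<Rightarrow> bool" where
  "W1 g \<longleftrightarrow> g holomorphic_on ball 0 1 \<and>
     set_integrable lborel (ball 0 1) (\<lambda>z. cmod (deriv g z))"

definition bloch_pairing :: "(complex \<Rightarrow> complex) \<Rightarrow> (complex \<Rightarrow> complex) \<Rightarrow> complex" where
  "bloch_pairing f g = Lim (at_left 1)
     (\<lambda>r. (LBINT \<theta>:{0..2*pi}. f (of_real r * cis \<theta>) * cnj (g (of_real r * cis \<theta>))) / (2 * pi))"

text \<open>Weak-star closure (w.r.t. the pairing with W1) of the polynomial multiples of f: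
  F lies in it iff every basic weak-star neighbourhood of F meets {p f}.\<close>
definition bloch_invariant_subspace :: "(complex \<Rightarrow> complex) \<Rightarrow> (complex \<Rightarrow> complex) set" where
  "bloch_invariant_subspace f = {F. Bloch F \<and>
     (\<forall>G e. finite G \<longrightarrow> G \<subseteq> Collect W1 \<longrightarrow> e > 0 \<longrightarrow>
        (\<exists>p :: complex poly. \<forall>g\<in>G.
            cmod (bloch_pairing F g - bloch_pairing (\<lambda>z. poly p z * f z) g) < e))}"

definition bloch_cyclic :: "(complex \<Rightarrow> complex) \<Rightarrow> bool" where
  "bloch_cyclic f \<longleftrightarrow> bloch_invariant_subspace f = Collect Bloch"

definition singular_circle_measure :: "complex measure \<Rightarrow> bool" where
  "singular_circle_measure \<mu> \<longleftrightarrow> sets \<mu> = sets borel \<and> finite_measure \<mu> \<and>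
     emeasure \<mu> (UNIV - sphere 0 1) = 0 \<and>
     (\<exists>N \<in> sets borel. emeasure \<mu> (UNIV - N) = 0 \<and>
         emeasure lborel {\<theta> \<in> {0..2*pi}. cis \<theta> \<in> N} = 0)"

definition sing_inner :: "complex measure \<Rightarrow> complex \<Rightarrow> complex" where
  "sing_inner \<mu> z = exp (- (\<integral>\<zeta>. (\<zeta> + z) / (\<zeta> - z) \<partial>\<mu>))"

end

theory Submission
  imports Defs "HOL-Complex_Analysis.Complex_Analysis"
begin

text \<open>Let \<open>H\<close> be the boundary function of \<open>f = S g\<close> and \<open>O\<close> the outer function with \<open>|O| = |H|\<close>. By the John-Nirenberg
  inequality, \<open>E(z)\<^sup>2 = P[|H|\<^sup>2](z) - |f(z)|\<^sup>2\<close> is bounded on the circle \<open>1 - |z| = 2\<^sup>-\<^sup>n\<close> by \<open>V\<^sub>n\<^sup>2\<close> with \<open>V\<close> summable: this is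
  where the Dini condition enters. Since \<open>|f| \<le> |S O| \<le> |O|\<close>, the functions \<open>O\<close> and \<open>S O\<close> oscillate by at most \<open>E\<close> in the Poisson mean,
  which gives \<open>(1 - |z|) |k'(z)| \<le> C E(z)\<close> for the Cauchy integral \<open>k\<close> of \<open>S \<zeta>\<^sup>-\<^sup>N\<^sup>-\<^sup>1 cnj O\<close>; so \<open>k\<close> lies in \<open>W\<^sup>1\<close>. As
  \<open>|S| = 1\<close> on the circle, \<open>k\<close> annihilates all \<open>p S\<close>, hence every bounded \<open>F\<close> in \<open>[S]\<close>. Therefore \<open>F cnj S O\<close> is the boundary function
  of an analytic function, and multiplying by truncations of \<open>1/O\<close> yields \<open>|F| \<le> sup |F| |S|\<close>, that is \<open>F/S\<close> is bounded.
  Conversely the pairing with \<open>g\<close> in \<open>W\<^sup>1\<close> is continuous for bounded pointwise convergence, because the circle means of \<open>|g'|\<close>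
  increase with the radius and are therefore integrable in the radius.\<close>

section \<open>The normalized measure on the circle\<close>

text \<open>Only \<open>f\<close> comes with boundary values. For \<open>S\<close>, the outer
  function and \<open>F\<close>, every boundary integral is a limit of integrals along the radii
  \<open>rr n\<close>, and |S| = 1 on the circle is used in the form that the mean of 1 - |S|^2 over
  the circle of radius \<open>rr n\<close> tends to 0. The John-Nirenberg argument is likewise run
  on the dilations of \<open>f\<close>, which are continuous and inherit the oscillation bound. The
  Dini condition makes w(2^-n) summable. The bound \<open>V n\<close> for E is, up to a constant,
  the convolution of w(2^-n) with (1 + n) 2^(-n/2). The ring 2^-(n+1) \<le> 1 - |z| \<le> 2^-n has
  area of order 2^-n and |k'| is at most of order 2^n V_n there, so the integral of |k'| is
  controlled by the sum of the V_n. The exponents N + 1 run through all positive integers, so all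
  negative Fourier coefficients of F cnj S O vanish in the limit; this is the analyticity that the
  division by S rests on. Non-cyclicity follows by testing with the constant 1: if it lay in [S],
  then 1/S would be bounded, which forces \<mu> = 0.\<close>

definition circ :: "real measure" where
  "circ = density lborel (\<lambda>t. ennreal (indicator {0..2*pi} t / (2*pi)))"

lemma sets_circ [measurable_cong, simp]: "sets circ = sets borel"
  by (simp add: circ_def)

lemma space_circ [simp]: "space circ = UNIV"
  by (simp add: circ_def)

lemma borel_measurable_circ [simp]: "borel_measurable circ = borel_measurable borel"
  by (rule measurable_cong_sets) auto

lemma emeasure_circ_UNIV: "emeasure circ UNIV = 1"
proof -
  have "emeasure circ UNIV = (\<integral>\<^sup>+t. ennreal (1/(2*pi)) * indicator {0..2*pi} t \<partial>lborel)"
    unfolding circ_def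
    by (subst emeasure_density) (auto intro!: nn_integral_cong simp: indicator_def)
  also have "\<dots> = ennreal (1/(2*pi)) * ennreal (2*pi)"
    by (subst nn_integral_cmult_indicator) auto
  also have "\<dots> = 1"
    by (subst ennreal_mult[symmetric]) auto
  finally show ?thesis .
qed

abbreviation circle_mean (binder "\<M>" 10) where
  "circle_mean f \<equiv> integral\<^sup>L circ f"

interpretation circ: finite_measure circ
  by standard (simp add: emeasure_circ_UNIV)

lemma measure_circ_UNIV [simp]: "measure circ UNIV = 1"
  by (simp add: measure_def emeasure_circ_UNIV)

lemma integral_circ:
  fixes f :: "real \<Rightarrow> 'a::{banach, second_countable_topology}"
  assumes [measurable]: "f \<in> borel_measurable borel"
  shows "(\<M> t. f t) = (1/(2*pi)) *\<^sub>R (LBINT t:{0..2*pi}. f t)"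
proof -
  have "(\<M> t. f t) = (\<integral>t. (indicator {0..2*pi} t / (2*pi)) *\<^sub>R f t \<partial>lborel)"
    unfolding circ_def by (subst integral_density) auto
  also have "\<dots> = (\<integral>t. (1/(2*pi)) *\<^sub>R (indicator {0..2*pi} t *\<^sub>R f t) \<partial>lborel)"
    by (intro Bochner_Integration.integral_cong) auto
  also have "\<dots> = (1/(2*pi)) *\<^sub>R (\<integral>t. indicator {0..2*pi} t *\<^sub>R f t \<partial>lborel)"
    by (rule integral_scaleR_right)
  finally show ?thesis by (simp only: set_lebesgue_integral_def)
qed

lemma integrable_circ_iff:
  fixes f :: "real \<Rightarrow> 'a::{banach, second_countable_topology}"
  assumes [measurable]: "f \<in> borel_measurable borel"
  shows "integrable circ f \<longleftrightarrow> set_integrable lborel {0..2*pi} f"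
proof -
  have "integrable circ f \<longleftrightarrow> integrable lborel (\<lambda>t. (indicator {0..2*pi} t / (2*pi)) *\<^sub>R f t)"
    unfolding circ_def by (subst integrable_density) auto
  also have "(\<lambda>t. (indicator {0..2*pi} t / (2*pi)) *\<^sub>R f t)
      = (\<lambda>t. (1/(2*pi)) *\<^sub>R (indicator {0..2*pi} t *\<^sub>R f t))"
    by auto
  also have "integrable lborel \<dots> \<longleftrightarrow> integrable lborel (\<lambda>t. indicator {0..2*pi} t *\<^sub>R f t)"
    using integrable_scaleR_right[of "2*pi" lborel "\<lambda>t. (1/(2*pi)) *\<^sub>R (indicator {0..2*pi} t *\<^sub>R f t)"]
    by (auto simp del: scaleR_scaleR simp: scaleR_scaleR[of "2*pi" "1/(2*pi)"])
  finally show ?thesis by (simp add: set_integrable_def)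
qed

lemma integrable_circ_continuous:
  fixes f :: "real \<Rightarrow> 'a::{banach, second_countable_topology}"
  assumes "continuous_on UNIV f"
  shows "integrable circ f"
proof -
  have "set_integrable lborel {0..2*pi} f"
    unfolding set_integrable_def
    using borel_integrable_compact[of "{0..2*pi}" f] assms
    by (auto intro: continuous_on_subset simp: indicator_def if_distrib cong: if_cong)
  then show ?thesis
    using assms by (subst integrable_circ_iff) (auto intro: borel_measurable_continuous_onI)
qed

lemma AE_circ: "(AE t in lborel. P t) \<Longrightarrow> (AE t in circ. P t)"
  unfolding circ_def by (subst AE_density) auto

lemma integrable_circ_bounded:
  fixes f :: "real \<Rightarrow> 'a::{banach, second_countable_topology}"
  assumes "f \<in> borel_measurable borel" "\<And>x. norm (f x) \<le> B"
  shows "integrable circ f"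
  using assms by (intro circ.integrable_const_bound[where B=B]) auto

lemma integral_circ_const [simp]: "(\<M> t. c) = (c::'a::{banach, second_countable_topology})"
  by simp

text \<open>A non-integrable function has integral 0, and this is the case in which 0 \<le> B is
  used.\<close>

lemma integral_circ_mono_const:
  fixes f :: "real \<Rightarrow> real"
  assumes "\<And>x. f x \<le> B" "0 \<le> B"
  shows "(\<M> t. f t) \<le> B"
proof -
  have "(\<M> t. f t) \<le> (\<M> t. B)" if "integrable circ f"
    using that assms(1) by (rule integral_mono[OF _ circ.integrable_const])
  then show ?thesis using assms(2) by (cases "integrable circ f") (simp_all add: not_integrable_integral_eq)
qed

section \<open>Periodic functions: reduction to one period and invariance under rotations\<close>

lemma periodic_int_shift:
  fixes F :: "real \<Rightarrow> 'a"
  assumes per: "\<And>x. F (x + 2*pi) = F x"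
  shows "F (x + 2*pi* of_int k) = F x"
proof -
  have nat: "F (y + 2*pi*real n) = F y" for y n
  proof (induction n)
    case (Suc n)
    have "F (y + 2*pi*real (Suc n)) = F ((y + 2*pi*real n) + 2*pi)" by (simp add: algebra_simps)
    then show ?case using Suc per by simp
  qed simp
  show ?thesis
  proof (cases "k \<ge> 0")
    case True then show ?thesis using nat[of x "nat k"] by simp
  next
    case False then show ?thesis using nat[of "x + 2*pi* of_int k" "nat (-k)"] by simp
  qed
qed

text \<open>\<open>BMO_w\<close> gives measurability over one period only. Replacing x by its
  representative modulo 2 \<pi>, a measurable operation, carries it to the whole line, where arcs
  across the point 1 are ordinary intervals.\<close>

lemma periodic_measurable:
  fixes F :: "real \<Rightarrow> 'a::{banach, second_countable_topology}"
  assumes per: "\<And>x. F (x + 2*pi) = F x"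
    and m: "set_borel_measurable borel {0..2*pi} F"
  shows "F \<in> borel_measurable borel"
proof -
  define G where "G = (\<lambda>x. indicator {0..2*pi} x *\<^sub>R F x)"
  have [measurable]: "G \<in> borel_measurable borel" using m by (simp add: G_def set_borel_measurable_def)
  have "F x = G (x - 2*pi* of_int \<lfloor>x/(2*pi)\<rfloor>)" for x
  proof -
    have "of_int \<lfloor>x/(2*pi)\<rfloor> \<le> x/(2*pi)" "x/(2*pi) \<le> of_int \<lfloor>x/(2*pi)\<rfloor> + 1" by linarith+
    then have "2*pi * of_int \<lfloor>x/(2*pi)\<rfloor> \<le> 2*pi * (x/(2*pi))" "2*pi * (x/(2*pi)) \<le> 2*pi*(of_int \<lfloor>x/(2*pi)\<rfloor> + 1)"
      by (intro mult_left_mono; simp)+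
    then have "2*pi * of_int \<lfloor>x/(2*pi)\<rfloor> \<le> x" "x \<le> 2*pi* of_int \<lfloor>x/(2*pi)\<rfloor> + 2*pi"
      by (simp_all add: distrib_left)
    then show ?thesis
      using periodic_int_shift[of F, OF per, of x "- \<lfloor>x/(2*pi)\<rfloor>"] by (simp add: G_def)
  qed
  then have "F = (\<lambda>x. G (x - 2*pi* of_int \<lfloor>x/(2*pi)\<rfloor>))" by auto
  moreover have "(\<lambda>x. G (x - 2*pi* of_int \<lfloor>x/(2*pi)\<rfloor>)) \<in> borel_measurable borel" by measurable
  ultimately show ?thesis by simp
qed

lemma nn_integral_lborel_shift:
  fixes F :: "real \<Rightarrow> ennreal"
  assumes [measurable]: "F \<in> borel_measurable borel"
  shows "(\<integral>\<^sup>+x. F (x + a) \<partial>lborel) = (\<integral>\<^sup>+x. F x \<partial>lborel)"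
  using nn_integral_real_affine[of F 1 a] by (simp add: add.commute)

text \<open>Unrolling the line into translates of the period compares any two windows of length \<open>2\<pi>\<close>.\<close>
lemma nn_integral_periodic_window:
  fixes F :: "real \<Rightarrow> ennreal"
  assumes per: "\<And>x. F (x + 2*pi) = F x" and [measurable]: "F \<in> borel_measurable borel"
  shows "(\<integral>\<^sup>+x. F x * indicator {a..<a+2*pi} x \<partial>lborel) = (\<integral>\<^sup>+x. F x * indicator {0..<2*pi} x \<partial>lborel)"
proof -
  have decomp: "(\<integral>\<^sup>+x. F x * indicator {b..<b+2*pi} x \<partial>lborel)
     = (\<Sum>k. \<integral>\<^sup>+x. F x * indicator {b..<b+2*pi} x * indicator {c + 2*pi* of_int (int_decode k)..<c + 2*pi* of_int (int_decode k) + 2*pi} x \<partial>lborel)" for b c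
  proof -
    have "(\<Sum>k. indicator {c + 2*pi* of_int (int_decode k)..<c + 2*pi* of_int (int_decode k) + 2*pi} x) = (1::ennreal)" for x
    proof -
      define m where "m = \<lfloor>(x - c)/(2*pi)\<rfloor>"
      have iff: "x \<in> {c + 2*pi* of_int l..<c + 2*pi* of_int l + 2*pi} \<longleftrightarrow> l = m" for l
      proof -
        have "x \<in> {c + 2*pi* of_int l..<c + 2*pi* of_int l + 2*pi} \<longleftrightarrow> of_int l \<le> (x-c)/(2*pi) \<and> (x-c)/(2*pi) < of_int l + 1"
          by (auto simp: field_simps)
        also have "\<dots> \<longleftrightarrow> l = m" unfolding m_def by linarith
        finally show ?thesis .
      qed
      have "(\<lambda>k. indicator {c + 2*pi* of_int (int_decode k)..<c + 2*pi* of_int (int_decode k) + 2*pi} x :: ennreal)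
          = (\<lambda>k. if k = int_encode m then 1 else 0)"
        using iff by (auto simp: indicator_def fun_eq_iff)
      then show ?thesis
        using suminf_finite[of "{int_encode m}" "\<lambda>k. if k = int_encode m then (1::ennreal) else 0"] by simp
    qed
    then have "(\<integral>\<^sup>+x. F x * indicator {b..<b+2*pi} x \<partial>lborel) = (\<integral>\<^sup>+x. (\<Sum>k. F x * indicator {b..<b+2*pi} x * indicator {c + 2*pi* of_int (int_decode k)..<c + 2*pi* of_int (int_decode k) + 2*pi} x) \<partial>lborel)"
      by (simp add: ennreal_suminf_cmult)
    also have "\<dots> = (\<Sum>k. \<integral>\<^sup>+x. F x * indicator {b..<b+2*pi} x * indicator {c + 2*pi* of_int (int_decode k)..<c + 2*pi* of_int (int_decode k) + 2*pi} x \<partial>lborel)"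
      by (rule nn_integral_suminf) measurable
    finally show ?thesis .
  qed
  \<comment> \<open>Translation by -2 \<pi> l maps the part of the window at \<open>a\<close> inside
    the l-th period onto the part of the basic window inside the (-l)-th translate of the window at
    \<open>a\<close>. The two decompositions therefore have the same terms after the reindexing l
    \<mapsto> -l, which is the bijection \<open>bij\<close>.\<close>
  have sh: "(\<integral>\<^sup>+x. F x * indicator {a..<a+2*pi} x * indicator {0 + 2*pi* of_int l..<0 + 2*pi* of_int l + 2*pi} x \<partial>lborel)
     = (\<integral>\<^sup>+x. F x * indicator {0..<0+2*pi} x * indicator {a + 2*pi* of_int (-l)..<a + 2*pi* of_int (-l) + 2*pi} x \<partial>lborel)" for l
  proof -
    have "(\<integral>\<^sup>+x. F x * indicator {a..<a+2*pi} x * indicator {0 + 2*pi* of_int l..<0 + 2*pi* of_int l + 2*pi} x \<partial>lborel)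
      = (\<integral>\<^sup>+x. F (x + 2*pi* of_int l) * indicator {a..<a+2*pi} (x + 2*pi* of_int l) * indicator {0 + 2*pi* of_int l..<0 + 2*pi* of_int l + 2*pi} (x + 2*pi* of_int l) \<partial>lborel)"
      by (rule nn_integral_lborel_shift[symmetric]) measurable
    also have "\<dots> = (\<integral>\<^sup>+x. F x * indicator {0..<0+2*pi} x * indicator {a + 2*pi* of_int (-l)..<a + 2*pi* of_int (-l) + 2*pi} x \<partial>lborel)"
      by (intro nn_integral_cong) (auto simp: periodic_int_shift[of F, OF per] indicator_def)
    finally show ?thesis .
  qed
  have bij: "bij (\<lambda>k. int_encode (- int_decode k))"
    by (rule bij_betw_byWitness[where f'="\<lambda>k. int_encode (- int_decode k)"]) auto
  define T where "T k = (\<integral>\<^sup>+x. F x * indicator {0..<0+2*pi} x * indicator {a + 2*pi* of_int (int_decode k)..<a + 2*pi* of_int (int_decode k) + 2*pi} x \<partial>lborel)" for k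
  have "(\<integral>\<^sup>+x. F x * indicator {a..<a+2*pi} x \<partial>lborel) = (\<Sum>k. T (int_encode (- int_decode k)))"
    unfolding decomp[of a 0] sh T_def int_encode_inverse ..
  also have "\<dots> = (\<integral>\<^sup>+k. T (int_encode (- int_decode k)) \<partial>count_space UNIV)"
    by (simp add: nn_integral_count_space_nat)
  also have "\<dots> = (\<integral>\<^sup>+k. T k \<partial>count_space UNIV)"
    using nn_integral_bij_count_space[OF bij, of T] by simp
  also have "\<dots> = (\<Sum>k. T k)" by (simp add: nn_integral_count_space_nat)
  also have "\<dots> = (\<integral>\<^sup>+x. F x * indicator {0..<0+2*pi} x \<partial>lborel)"
    unfolding T_def by (rule decomp[symmetric])
  finally show ?thesis by simp
qed

lemma nn_integral_circ_window:
  fixes F :: "real \<Rightarrow> ennreal"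
  assumes per: "\<And>x. F (x + 2*pi) = F x" and [measurable]: "F \<in> borel_measurable borel"
  shows "(\<integral>\<^sup>+x. F x \<partial>circ) = ennreal (1/(2*pi)) * (\<integral>\<^sup>+x. F x * indicator {a..<a+2*pi} x \<partial>lborel)"
proof -
  have "(\<integral>\<^sup>+x. F x \<partial>circ) = (\<integral>\<^sup>+x. ennreal (1/(2*pi)) * (F x * indicator {0..2*pi} x) \<partial>lborel)"
    unfolding circ_def
    by (subst nn_integral_density) (auto intro!: nn_integral_cong simp: indicator_def mult.commute)
  also have "\<dots> = (\<integral>\<^sup>+x. ennreal (1/(2*pi)) * (F x * indicator {0..<2*pi} x) \<partial>lborel)"
  proof (rule nn_integral_cong_AE)
    have "AE x in lborel. x \<noteq> 2*pi" by (rule AE_lborel_singleton)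
    then show "AE x in lborel. ennreal (1/(2*pi)) * (F x * indicator {0..2*pi} x) = ennreal (1/(2*pi)) * (F x * indicator {0..<2*pi} x)"
      by eventually_elim (auto simp: indicator_def)
  qed
  also have "\<dots> = ennreal (1/(2*pi)) * (\<integral>\<^sup>+x. F x * indicator {0..<2*pi} x \<partial>lborel)"
    by (rule nn_integral_cmult) measurable
  also have "(\<integral>\<^sup>+x. F x * indicator {0..<2*pi} x \<partial>lborel) = (\<integral>\<^sup>+x. F x * indicator {a..<a+2*pi} x \<partial>lborel)"
    by (rule nn_integral_periodic_window[OF assms, symmetric])
  finally show ?thesis .
qed

lemma nn_integral_circ_shift:
  fixes F :: "real \<Rightarrow> ennreal"
  assumes per: "\<And>x. F (x + 2*pi) = F x" and [measurable]: "F \<in> borel_measurable borel"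
  shows "(\<integral>\<^sup>+x. F (x + a) \<partial>circ) = (\<integral>\<^sup>+x. F x \<partial>circ)"
proof -
  have "F (x + 2*pi + a) = F (x + a)" for x using per[of "x+a"] by (simp add: algebra_simps)
  then have "(\<integral>\<^sup>+x. F (x + a) \<partial>circ) = ennreal (1/(2*pi)) * (\<integral>\<^sup>+x. F (x+a) * indicator {0-a..<0-a+2*pi} x \<partial>lborel)"
    by (intro nn_integral_circ_window) auto
  also have "(\<integral>\<^sup>+x. F (x+a) * indicator {0-a..<0-a+2*pi} x \<partial>lborel) = (\<integral>\<^sup>+x. F (x+a) * indicator {0..<0+2*pi} (x+a) \<partial>lborel)"
    by (intro nn_integral_cong) (auto simp: indicator_def)
  also have "\<dots> = (\<integral>\<^sup>+x. F x * indicator {0..<0+2*pi} x \<partial>lborel)"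
    by (rule nn_integral_lborel_shift[of "\<lambda>x. F x * indicator {0..<0+2*pi} x"]) measurable
  also have "ennreal (1/(2*pi)) * \<dots> = (\<integral>\<^sup>+x. F x \<partial>circ)"
    by (rule nn_integral_circ_window[OF assms, symmetric])
  finally show ?thesis .
qed

text \<open>The representative modulo 2 \<pi>. Every periodic function factors through it, so
  integrals of periodic functions can be compared by comparing image measures.\<close>

definition fold_period :: "real \<Rightarrow> real" where
  "fold_period x = x - 2*pi* of_int \<lfloor>x/(2*pi)\<rfloor>"

lemma fold_period_measurable [measurable]: "fold_period \<in> borel_measurable borel"
  unfolding fold_period_def by measurable

lemma fold_period_eq:
  assumes per: "\<And>x. F (x + 2*pi) = F x"
  shows "F (fold_period x) = F x"
  using periodic_int_shift[of F, OF per, of x "- \<lfloor>x/(2*pi)\<rfloor>"] by (simp add: fold_period_def)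

lemma fold_period_periodic: "fold_period (x + 2*pi) = fold_period x"
proof -
  have "\<lfloor>(x + 2*pi)/(2*pi)\<rfloor> = \<lfloor>x/(2*pi)\<rfloor> + 1" by (simp add: add_divide_distrib)
  then show ?thesis by (simp add: fold_period_def algebra_simps)
qed

text \<open>Shift invariance is available for nonnegative integrands. As an equality of image
  measures it passes at once to integrability and to Bochner integrals with values in a Banach
  space.\<close>

lemma distr_circ_shift:
  "distr circ borel (\<lambda>x. fold_period (x + a)) = distr circ borel fold_period"
proof (rule measure_eqI)
  fix A assume "A \<in> sets (distr circ borel (\<lambda>x. fold_period (x + a)))"
  then have [measurable]: "A \<in> sets borel" by simp
  have "emeasure (distr circ borel (\<lambda>x. fold_period (x + a))) A = (\<integral>\<^sup>+x. indicator A (fold_period (x+a)) \<partial>circ)"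
    by (subst nn_integral_indicator[symmetric], simp, subst nn_integral_distr) auto
  also have "\<dots> = (\<integral>\<^sup>+x. indicator A (fold_period x) \<partial>circ)"
    by (rule nn_integral_circ_shift[of "\<lambda>x. indicator A (fold_period x)"]) (auto simp: fold_period_periodic)
  also have "\<dots> = emeasure (distr circ borel fold_period) A"
    by (subst nn_integral_indicator[symmetric], simp, subst nn_integral_distr) auto
  finally show "emeasure (distr circ borel (\<lambda>x. fold_period (x + a))) A = emeasure (distr circ borel fold_period) A" .
qed simp

lemma
  fixes F :: "real \<Rightarrow> 'a::{banach, second_countable_topology}"
  assumes per: "\<And>x. F (x + 2*pi) = F x" and [measurable]: "F \<in> borel_measurable borel"
  shows integral_circ_shift: "(\<M> x. F (x + a)) = (\<M> x. F x)"
    and integrable_circ_shift: "integrable circ (\<lambda>x. F (x + a)) \<longleftrightarrow> integrable circ F"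
proof -
  have "(\<M> x. F (x + a)) = (\<M> x. F (fold_period (x + a)))" by (simp add: fold_period_eq[of F, OF per])
  also have "\<dots> = (\<integral>x. F x \<partial>distr circ borel (\<lambda>x. fold_period (x + a)))" by (subst integral_distr) auto
  also have "\<dots> = (\<M> x. F (fold_period x))" unfolding distr_circ_shift by (subst integral_distr) auto
  finally show "(\<M> x. F (x + a)) = (\<M> x. F x)" by (simp add: fold_period_eq[of F, OF per])
  have "integrable circ (\<lambda>x. F (x + a)) \<longleftrightarrow> integrable circ (\<lambda>x. F (fold_period (x + a)))" by (simp add: fold_period_eq[of F, OF per])
  also have "\<dots> \<longleftrightarrow> integrable (distr circ borel (\<lambda>x. fold_period (x + a))) F" by (subst integrable_distr_eq) auto
  also have "\<dots> \<longleftrightarrow> integrable circ (\<lambda>x. F (fold_period x))" unfolding distr_circ_shift by (subst integrable_distr_eq) auto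
  finally show "integrable circ (\<lambda>x. F (x + a)) \<longleftrightarrow> integrable circ F" by (simp add: fold_period_eq[of F, OF per])
qed

lemma
  fixes F :: "real \<Rightarrow> 'a::{banach, second_countable_topology}"
  assumes per: "\<And>x. F (x + 2*pi) = F x" and [measurable]: "F \<in> borel_measurable borel"
  shows integral_circ_window: "(LBINT x:{a..a+2*pi}. F x) = (2*pi) *\<^sub>R (\<M> x. F x)"
    and integrable_circ_window: "set_integrable lborel {a..a+2*pi} F \<longleftrightarrow> integrable circ F"
proof -
  have ind: "indicator {a..a+2*pi} (a + 1 * x) = (indicator {0..2*pi} x :: real)" for x by (auto simp: indicator_def)
  have "(LBINT x:{a..a+2*pi}. F x) = (\<integral>x. indicator {a..a+2*pi} (a + 1 * x) *\<^sub>R F (a + 1 * x) \<partial>lborel)"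
    unfolding set_lebesgue_integral_def
    using lborel_integral_real_affine[of 1 "\<lambda>x. indicator {a..a+2*pi} x *\<^sub>R F x" a] by simp
  also have "\<dots> = (LBINT x:{0..2*pi}. F (x + a))"
    unfolding ind set_lebesgue_integral_def by (simp add: add.commute)
  also have "\<dots> = (2*pi) *\<^sub>R (\<M> x. F (x + a))" by (subst integral_circ) auto
  finally show "(LBINT x:{a..a+2*pi}. F x) = (2*pi) *\<^sub>R (\<M> x. F x)"
    by (simp add: integral_circ_shift[of F, OF per])
  have "set_integrable lborel {a..a+2*pi} F \<longleftrightarrow> integrable lborel (\<lambda>x. indicator {a..a+2*pi} (a + 1 * x) *\<^sub>R F (a + 1 * x))"
    unfolding set_integrable_def
    by (rule lborel_integrable_real_affine_iff[symmetric]) simp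
  also have "\<dots> \<longleftrightarrow> set_integrable lborel {0..2*pi} (\<lambda>x. F (x + a))"
    unfolding ind set_integrable_def by (simp add: add.commute)
  also have "\<dots> \<longleftrightarrow> integrable circ (\<lambda>x. F (x + a))" by (subst integrable_circ_iff) auto
  finally show "set_integrable lborel {a..a+2*pi} F \<longleftrightarrow> integrable circ F"
    by (simp add: integrable_circ_shift[of F, OF per])
qed

section \<open>Square integrable functions\<close>

lemma cnj_borel_measurable [measurable]: "cnj \<in> borel_measurable borel"
  by (intro borel_measurable_continuous_onI continuous_intros)

definition sqint :: "'a measure \<Rightarrow> ('a \<Rightarrow> complex) \<Rightarrow> bool" where
  "sqint M f \<longleftrightarrow> f \<in> borel_measurable M \<and> integrable M (\<lambda>x. (cmod (f x))\<^sup>2)"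

definition l2 :: "'a measure \<Rightarrow> ('a \<Rightarrow> complex) \<Rightarrow> real" where
  "l2 M f = sqrt (\<integral>x. (cmod (f x))\<^sup>2 \<partial>M)"

lemma l2_nonneg [simp]: "0 \<le> l2 M f"
  by (simp add: l2_def)

lemma l2_sq: "(l2 M f)\<^sup>2 = (\<integral>x. (cmod (f x))\<^sup>2 \<partial>M)"
  by (simp add: l2_def)

lemma sqint_measurable: "sqint M f \<Longrightarrow> f \<in> borel_measurable M"
  by (simp add: sqint_def)

lemma sqint_mult_integrable:
  assumes "sqint M f" "sqint M g"
  shows "integrable M (\<lambda>x. f x * g x)"
proof (rule Bochner_Integration.integrable_bound)
  show "integrable M (\<lambda>x. (cmod (f x))\<^sup>2 + (cmod (g x))\<^sup>2)" using assms by (auto simp: sqint_def)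
  show "(\<lambda>x. f x * g x) \<in> borel_measurable M" using assms by (auto simp: sqint_def)
  show "AE x in M. norm (f x * g x) \<le> norm ((cmod (f x))\<^sup>2 + (cmod (g x))\<^sup>2)"
  proof (rule AE_I2)
    fix x
    have "cmod (f x) * cmod (g x) \<le> (cmod (f x))\<^sup>2 + (cmod (g x))\<^sup>2"
      using sum_squares_bound[of "cmod (f x)" "cmod (g x)"] mult_nonneg_nonneg[OF norm_ge_zero[of "f x"] norm_ge_zero[of "g x"]] by linarith
    then show "norm (f x * g x) \<le> norm ((cmod (f x))\<^sup>2 + (cmod (g x))\<^sup>2)" by (simp add: norm_mult)
  qed
qed

text \<open>Integrating 2 |f| |t g| \<le> |f|^2 + |t g|^2 gives 2 I t \<le> a^2 + t^2 b^2 for every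
  real t, and t = a/b is the optimal choice. If one of the norms vanishes, a different t shows I
  \<le> 0.\<close>

lemma l2_Cauchy_Schwarz:
  assumes "sqint M f" "sqint M g"
  shows "(\<integral>x. cmod (f x * g x) \<partial>M) \<le> l2 M f * l2 M g"
proof -
  define a where "a = l2 M f" define b where "b = l2 M g"
  define I where "I = (\<integral>x. cmod (f x * g x) \<partial>M)"
  have int: "integrable M (\<lambda>x. cmod (f x * g x))" using sqint_mult_integrable[OF assms] by auto
  have q: "2 * I * t \<le> a\<^sup>2 + t\<^sup>2 * b\<^sup>2" for t
  proof -
    have "(\<integral>x. 2 * cmod (f x * g x) * t \<partial>M) \<le> (\<integral>x. (cmod (f x))\<^sup>2 + t\<^sup>2 * (cmod (g x))\<^sup>2 \<partial>M)"
    proof (rule integral_mono)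
      show "integrable M (\<lambda>x. 2 * cmod (f x * g x) * t)" using int by auto
      show "integrable M (\<lambda>x. (cmod (f x))\<^sup>2 + t\<^sup>2 * (cmod (g x))\<^sup>2)" using assms by (auto simp: sqint_def)
      show "2 * cmod (f x * g x) * t \<le> (cmod (f x))\<^sup>2 + t\<^sup>2 * (cmod (g x))\<^sup>2" for x
        using sum_squares_bound[of "cmod (f x)" "t * cmod (g x)"] by (simp add: norm_mult power_mult_distrib mult_ac)
    qed
    then show ?thesis using assms int by (simp add: I_def a_def b_def l2_sq sqint_def)
  qed
  have I0: "0 \<le> I" unfolding I_def by simp
  have a0: "0 \<le> a" "0 \<le> b" by (auto simp: a_def b_def)
  show ?thesis
  proof (cases "b = 0")
    case True
    have "I \<le> 0"
    proof (rule ccontr)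
      assume "\<not> I \<le> 0"
      then show False using q[of "(a\<^sup>2 + 1) / (2*I)"] True by (simp add: field_simps)
    qed
    then have "I \<le> a * b" using a0 mult_nonneg_nonneg[of a b] by linarith
    then show ?thesis by (simp add: I_def a_def b_def)
  next
    case False
    then have "b > 0" using a0 by simp
    have "2 * I * (a/b) \<le> a\<^sup>2 + (a/b)\<^sup>2 * b\<^sup>2" by (rule q)
    then have "2 * I * a / b \<le> 2 * a\<^sup>2" using \<open>b > 0\<close> by (simp add: power_divide)
    then have *: "I * a \<le> a * a * b" using \<open>b > 0\<close> by (simp add: field_simps power2_eq_square)
    show ?thesis
    proof (cases "a = 0")
      case True
      have "I \<le> 0"
      proof (rule ccontr)
        assume "\<not> I \<le> 0"
        then have "I > 0" by simp
        have "2 * I * (I/b\<^sup>2) \<le> (I/b\<^sup>2)\<^sup>2 * b\<^sup>2" using q[of "I/b\<^sup>2"] True by simp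
        also have "\<dots> = I * (I/b\<^sup>2)" using \<open>b > 0\<close> by (simp add: power2_eq_square)
        finally show False using \<open>I > 0\<close> \<open>b > 0\<close> by (simp add: field_simps)
      qed
      then have "I \<le> a * b" using a0 mult_nonneg_nonneg[of a b] by linarith
      then show ?thesis by (simp add: I_def a_def b_def)
    next
      case False
      then have "I \<le> a * b" using * a0 by (simp add: mult.commute mult.left_commute)
      then show ?thesis by (simp add: I_def a_def b_def)
    qed
  qed
qed

lemma sqint_add: "sqint M f \<Longrightarrow> sqint M g \<Longrightarrow> sqint M (\<lambda>x. f x + g x)"
proof -
  assume a: "sqint M f" "sqint M g"
  show ?thesis unfolding sqint_def
  proof
    show m: "(\<lambda>x. f x + g x) \<in> borel_measurable M" using a by (auto simp: sqint_def)
    show "integrable M (\<lambda>x. (cmod (f x + g x))\<^sup>2)"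
    proof (rule Bochner_Integration.integrable_bound)
      show "integrable M (\<lambda>x. 2*(cmod (f x))\<^sup>2 + 2*(cmod (g x))\<^sup>2)" using a by (auto simp: sqint_def)
      show "(\<lambda>x. (cmod (f x + g x))\<^sup>2) \<in> borel_measurable M" using m by measurable
      show "AE x in M. norm ((cmod (f x + g x))\<^sup>2) \<le> norm (2*(cmod (f x))\<^sup>2 + 2*(cmod (g x))\<^sup>2)"
      proof (rule AE_I2)
        fix x
        have "(cmod (f x + g x))\<^sup>2 \<le> (cmod (f x) + cmod (g x))\<^sup>2" by (intro power_mono norm_triangle_ineq) auto
        also have "\<dots> \<le> 2*(cmod (f x))\<^sup>2 + 2*(cmod (g x))\<^sup>2"
          using sum_squares_bound[of "cmod (f x)" "cmod (g x)"] by (simp add: power2_sum)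
        finally show "norm ((cmod (f x + g x))\<^sup>2) \<le> norm (2*(cmod (f x))\<^sup>2 + 2*(cmod (g x))\<^sup>2)" by simp
      qed
    qed
  qed
qed

lemma sqint_cmult: "sqint M f \<Longrightarrow> sqint M (\<lambda>x. c * f x)"
  by (auto simp: sqint_def norm_mult power_mult_distrib)

lemma sqint_diff: "sqint M f \<Longrightarrow> sqint M g \<Longrightarrow> sqint M (\<lambda>x. f x - g x)"
  using sqint_add[of M f "\<lambda>x. -1 * g x"] sqint_cmult[of M g "-1"] by simp

lemma sqint_cnj: "sqint M f \<Longrightarrow> sqint M (\<lambda>x. cnj (f x))"
  by (auto simp: sqint_def)

lemma l2_triangle:
  assumes "sqint M f" "sqint M g"
  shows "l2 M (\<lambda>x. f x + g x) \<le> l2 M f + l2 M g"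
proof -
  have int: "integrable M (\<lambda>x. cmod (f x * g x))" using sqint_mult_integrable[OF assms] by auto
  have "(l2 M (\<lambda>x. f x + g x))\<^sup>2 \<le> (\<integral>x. (cmod (f x))\<^sup>2 + (cmod (g x))\<^sup>2 + 2 * cmod (f x * g x) \<partial>M)"
    unfolding l2_sq
  proof (rule integral_mono)
    show "integrable M (\<lambda>x. (cmod (f x + g x))\<^sup>2)" using sqint_add[OF assms] by (simp add: sqint_def)
    show "integrable M (\<lambda>x. (cmod (f x))\<^sup>2 + (cmod (g x))\<^sup>2 + 2 * cmod (f x * g x))" using assms int by (auto simp: sqint_def)
    fix x
    have "(cmod (f x + g x))\<^sup>2 \<le> (cmod (f x) + cmod (g x))\<^sup>2" by (intro power_mono norm_triangle_ineq) auto
    then show "(cmod (f x + g x))\<^sup>2 \<le> (cmod (f x))\<^sup>2 + (cmod (g x))\<^sup>2 + 2 * cmod (f x * g x)"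
      by (simp add: power2_sum norm_mult)
  qed
  also have "\<dots> = (l2 M f)\<^sup>2 + (l2 M g)\<^sup>2 + 2 * (\<integral>x. cmod (f x * g x) \<partial>M)"
    using assms int by (simp add: l2_sq sqint_def)
  also have "\<dots> \<le> (l2 M f + l2 M g)\<^sup>2"
    using l2_Cauchy_Schwarz[OF assms] by (simp add: power2_sum)
  finally show ?thesis by (rule power2_le_imp_le) simp
qed

lemma l2_minus_commute: "l2 M (\<lambda>x. f x - g x) = l2 M (\<lambda>x. g x - f x)"
  by (simp add: l2_def norm_minus_commute)

lemma l2_diff_triangle:
  assumes "sqint M f" "sqint M g" "sqint M h"
  shows "l2 M (\<lambda>x. f x - h x) \<le> l2 M (\<lambda>x. f x - g x) + l2 M (\<lambda>x. g x - h x)"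
  using l2_triangle[OF sqint_diff[OF assms(1,2)] sqint_diff[OF assms(2,3)]] by simp

lemma l2_mono:
  assumes "sqint M g" "f \<in> borel_measurable M" "\<And>x. cmod (f x) \<le> cmod (g x)"
  shows "sqint M f" "l2 M f \<le> l2 M g"
proof -
  show f: "sqint M f" unfolding sqint_def
  proof
    show "integrable M (\<lambda>x. (cmod (f x))\<^sup>2)"
      by (rule Bochner_Integration.integrable_bound[of M "\<lambda>x. (cmod (g x))\<^sup>2"])
         (use assms in \<open>auto simp: sqint_def intro!: power_mono\<close>)
  qed fact
  show "l2 M f \<le> l2 M g" unfolding l2_def
    by (intro real_sqrt_le_mono integral_mono power_mono) (use f assms in \<open>auto simp: sqint_def\<close>)
qed

lemma l2_cmult: "l2 M (\<lambda>x. c * f x) = cmod c * l2 M f"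
  by (simp add: l2_def norm_mult power_mult_distrib real_sqrt_mult)

lemma sqint_circ_bounded:
  assumes "f \<in> borel_measurable borel" "\<And>x. cmod (f x) \<le> B"
  shows "sqint circ f" "l2 circ f \<le> B"
proof -
  have "0 \<le> B" using assms(2)[of 0] norm_ge_zero[of "f 0"] by linarith
  have c: "sqint circ (\<lambda>x. complex_of_real B)" by (simp add: sqint_def)
  show "sqint circ f" using l2_mono(1)[OF c, of f] assms \<open>0 \<le> B\<close> by simp
  show "l2 circ f \<le> B" using l2_mono(2)[OF c, of f] assms \<open>0 \<le> B\<close> by (simp add: l2_def[of _ "\<lambda>x. complex_of_real B"])
qed

lemma l1_le_l2:
  assumes "sqint circ f"
  shows "integrable circ f" "(\<M> x. cmod (f x)) \<le> l2 circ f"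
proof -
  have c: "sqint circ (\<lambda>x. 1)" by (simp add: sqint_def)
  show "integrable circ f" using sqint_mult_integrable[OF assms c] by simp
  show "(\<M> x. cmod (f x)) \<le> l2 circ f" using l2_Cauchy_Schwarz[OF assms c] by (simp add: l2_def)
qed

lemma sqint_mult_bounded:
  assumes "sqint M f" "b \<in> borel_measurable M" "\<And>x. cmod (b x) \<le> B"
  shows "sqint M (\<lambda>x. b x * f x)" "l2 M (\<lambda>x. b x * f x) \<le> B * l2 M f"
proof -
  have B: "cmod (b x) \<le> cmod (complex_of_real B)" for x
    using assms(3)[of x] norm_ge_zero[of "b x"] by (simp del: norm_ge_zero)
  have m: "(\<lambda>x. b x * f x) \<in> borel_measurable M" using assms by (auto simp: sqint_def)
  have c: "cmod (b x * f x) \<le> cmod (complex_of_real B * f x)" for x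
    using B[of x] by (simp add: norm_mult mult_right_mono)
  show "sqint M (\<lambda>x. b x * f x)" by (rule l2_mono(1)[OF sqint_cmult[OF assms(1)] m c])
  have "0 \<le> B \<or> UNIV = ({}::'a set)" using assms(3) norm_ge_zero order_trans by blast
  then have "cmod (complex_of_real B) = B" by auto
  then show "l2 M (\<lambda>x. b x * f x) \<le> B * l2 M f"
    using l2_mono(2)[OF sqint_cmult[OF assms(1)] m c] by (simp add: l2_cmult)
qed

section \<open>The Poisson kernel and the Cauchy formula on the circle\<close>

definition poisson :: "complex \<Rightarrow> real \<Rightarrow> real" where
  "poisson z t = (1 - (cmod z)\<^sup>2) / (cmod (cis t - z))\<^sup>2"

lemma cis_neq: "cmod z < 1 \<Longrightarrow> cis t - z \<noteq> 0" "cmod z < 1 \<Longrightarrow> 1 - cis t * z \<noteq> 0" "cmod z < 1 \<Longrightarrow> 1 - z * cis t \<noteq> 0"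
  by (auto simp: norm_mult dest!: arg_cong[where f=cmod])

lemma cis_diff_ge: "1 - cmod z \<le> cmod (cis t - z)"
  using norm_triangle_ineq2[of "cis t" z] by simp

lemma poisson_pos: "cmod z < 1 \<Longrightarrow> 0 < poisson z t"
  unfolding poisson_def using cis_neq(1)[of z t]
  by (intro divide_pos_pos) (auto simp: power_less_one_iff abs_square_less_1)

lemma poisson_nonneg: "cmod z < 1 \<Longrightarrow> 0 \<le> poisson z t"
  using poisson_pos[of z t] by simp

lemma poisson_le:
  assumes "cmod z < 1"
  shows "poisson z t \<le> 2 / (1 - cmod z)"
proof -
  have "poisson z t \<le> (1 - (cmod z)\<^sup>2) / (1 - cmod z)\<^sup>2"
    unfolding poisson_def using assms cis_diff_ge[of z t]
    by (intro divide_left_mono power_mono mult_pos_pos zero_less_power)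
       (auto simp: abs_square_le_1 cis_neq)
  also have "1 - (cmod z)\<^sup>2 = (1 - cmod z) * (1 + cmod z)" by (simp add: power2_eq_square algebra_simps)
  also have "(1 - cmod z) * (1 + cmod z) / (1 - cmod z)\<^sup>2 = (1 + cmod z) / (1 - cmod z)"
    using assms by (simp add: power2_eq_square)
  also have "\<dots> \<le> 2 / (1 - cmod z)" using assms by (intro divide_right_mono) auto
  finally show ?thesis .
qed

lemma continuous_on_poisson: "cmod z < 1 \<Longrightarrow> continuous_on UNIV (poisson z)"
  unfolding poisson_def by (intro continuous_intros) (auto simp: cis_neq)

lemma poisson_measurable [measurable]: "cmod z < 1 \<Longrightarrow> poisson z \<in> borel_measurable borel"
  by (intro borel_measurable_continuous_onI continuous_on_poisson)

lemma poisson_rotate: "poisson (cis \<alpha> * z) t = poisson z (t - \<alpha>)"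
proof -
  have "cis t - cis \<alpha> * z = cis \<alpha> * (cis (t - \<alpha>) - z)" by (simp add: cis_mult right_diff_distrib)
  then show ?thesis by (simp add: poisson_def norm_mult)
qed

lemma poisson_periodic: "poisson z (t + 2*pi) = poisson z t"
  by (simp add: poisson_def cis_mult[symmetric])

text \<open>On the circle cnj (cis t) = 1 / cis t, so the kernel is a rational function of cis t.
  The first form separates the Cauchy kernel from a part that is analytic near the closed disc and
  vanishes at 0. The second shows that the only pole in the closed disc is at z, which a factor
  vanishing at z can cancel.\<close>

lemma poisson_decomp:
  assumes "cmod z < 1"
  shows "complex_of_real (poisson z t) = cis t / (cis t - z) + cnj z * cis t / (1 - cnj z * cis t)"
    and "complex_of_real (poisson z t) = (1 - z * cnj z) * cis t / ((cis t - z) * (1 - cnj z * cis t))"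
proof -
  define w where "w = cis t"
  have w: "w * cnj w = 1" "w \<noteq> 0" by (simp_all add: w_def cis_cnj cis_mult)
  have n: "w - z \<noteq> 0" "1 - cnj z * w \<noteq> 0" using cis_neq(1)[OF assms] cis_neq(3)[of "cnj z"] assms by (auto simp: w_def)
  have "complex_of_real (poisson z t) = (1 - z * cnj z) / ((w - z) * cnj (w - z))"
    unfolding poisson_def of_real_divide of_real_diff complex_norm_square w_def by simp
  also have "cnj (w - z) = (1 - cnj z * w) / w" using w by (simp add: field_simps)
  finally show 2: "complex_of_real (poisson z t) = (1 - z * cnj z) * cis t / ((cis t - z) * (1 - cnj z * cis t))"
    using w n by (simp add: w_def)
  have "w / (w - z) + cnj z * w / (1 - cnj z * w) = (1 - z * cnj z) * w / ((w - z) * (1 - cnj z * w))"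
    using n by (simp add: add_frac_eq) (simp add: algebra_simps)
  then show "complex_of_real (poisson z t) = cis t / (cis t - z) + cnj z * cis t / (1 - cnj z * cis t)"
    unfolding 2 w_def by simp
qed

lemma poisson_Re:
  assumes "cmod z < 1"
  shows "poisson z t = Re ((cis t + z) / (cis t - z))"
proof -
  have "Re ((cis t + z) / (cis t - z)) = Re ((cis t + z) * cnj (cis t - z)) / (cmod (cis t - z))\<^sup>2"
    by (subst complex_div_cnj) (simp add: Re_divide_of_real)
  also have "Re ((cis t + z) * cnj (cis t - z)) = (cmod (cis t))\<^sup>2 - (cmod z)\<^sup>2"
    unfolding cmod_power2 by (simp add: algebra_simps power2_eq_square)
  finally show ?thesis by (simp add: poisson_def)
qed

lemma continuous_on_circle:
  assumes "G holomorphic_on ball 0 R" "1 < R"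
  shows "continuous_on UNIV (\<lambda>t. G (cis t))"
  by (rule continuous_on_compose2[OF holomorphic_on_imp_continuous_on[OF assms(1)]])
     (use assms in \<open>auto intro!: continuous_intros\<close>)

lemma Cauchy_circ:
  assumes "G holomorphic_on ball 0 R" "1 < R" "cmod z < 1"
  shows "(\<M> \<theta>. G (cis \<theta>) * (cis \<theta> / (cis \<theta> - z))) = G z"
proof -
  have "cball 0 1 \<subseteq> ball (0::complex) R" using assms by auto
  then have "((\<lambda>u. G u/(u-z)) has_contour_integral (2 * of_real pi * \<i> * G z)) (circlepath 0 1)"
    using assms by (intro Cauchy_integral_circlepath_simple holomorphic_on_subset[OF assms(1)]) auto
  then have "((\<lambda>t. G (0 + 1 * cis t) / (0 + 1 * cis t - z) * 1 * \<i> * cis t) has_integral (2 * of_real pi * \<i> * G z)) {0..2*pi}"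
    unfolding circlepath_def by (subst (asm) has_contour_integral_part_circlepath_iff) auto
  then have "((\<lambda>t. \<i> * (G (cis t) * (cis t / (cis t - z)))) has_integral (2 * of_real pi * \<i> * G z)) {0..2*pi}"
    by (simp add: mult_ac)
  then have "((\<lambda>t. (-\<i>) * (\<i> * (G (cis t) * (cis t / (cis t - z))))) has_integral ((-\<i>) * (2 * of_real pi * \<i> * G z))) {0..2*pi}"
    by (rule has_integral_mult_right)
  then have hi: "((\<lambda>t. G (cis t) * (cis t / (cis t - z))) has_integral (2 * of_real pi * G z)) {0..2*pi}"
    by (simp add: mult.assoc[symmetric]) (simp add: mult_ac)
  have c: "continuous_on UNIV (\<lambda>\<theta>. G (cis \<theta>) * (cis \<theta> / (cis \<theta> - z)))"
    by (intro continuous_intros continuous_on_circle[OF assms(1,2)]) (use cis_neq(1)[OF assms(3)] in auto)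
  have m: "(\<lambda>\<theta>. G (cis \<theta>) * (cis \<theta> / (cis \<theta> - z))) \<in> borel_measurable borel"
    using c by (rule borel_measurable_continuous_onI)
  have "set_integrable lborel {0..2*pi} (\<lambda>\<theta>. G (cis \<theta>) * (cis \<theta> / (cis \<theta> - z)))"
    using integrable_circ_continuous[OF c] integrable_circ_iff[OF m] by simp
  then have "(LBINT t:{0..2*pi}. G (cis t) * (cis t / (cis t - z))) = 2 * of_real pi * G z"
    using hi by (simp add: set_borel_integral_eq_integral integral_unique)
  then show ?thesis using m by (simp add: integral_circ scaleR_conv_of_real)
qed

lemma mean_value_circ:
  assumes "G holomorphic_on ball 0 R" "1 < R"
  shows "(\<M> t. G (cis t)) = G 0"
  using Cauchy_circ[OF assms, of 0] by simp

text \<open>The Cauchy kernel reproduces G z. The other summand of the kernel times G is analytic on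
  the disc of radius \<open>R'\<close>, which stays clear of the pole 1 / cnj z, and it vanishes at
  0, so its mean is 0.\<close>

lemma Poisson_formula:
  assumes "G holomorphic_on ball 0 R" "1 < R" "cmod z < 1"
  shows "(\<M> t. G (cis t) * poisson z t) = G z"
proof -
  define R' where "R' = (if z = 0 then R else min R (1/cmod z))"
  have R': "1 < R'" "R' \<le> R" using assms by (auto simp: R'_def)
  have nz: "1 - cnj z * u \<noteq> 0" if "u \<in> ball 0 R'" for u
  proof
    assume "1 - cnj z * u = 0"
    then have "cmod (cnj z * u) = 1" by (metis norm_one right_minus_eq)
    then have *: "cmod z * cmod u = 1" by (simp add: norm_mult)
    then have "z \<noteq> 0" by auto
    then have "cmod u < 1 / cmod z" using that by (auto simp: R'_def)
    then show False using * \<open>z \<noteq> 0\<close> by (simp add: field_simps)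
  qed
  have h: "(\<lambda>u. G u * (cnj z * u / (1 - cnj z * u))) holomorphic_on ball 0 R'"
    by (intro holomorphic_intros holomorphic_on_subset[OF assms(1)]) (use nz R' in auto)
  have c1: "continuous_on UNIV (\<lambda>t. G (cis t) * (cis t / (cis t - z)))"
    by (intro continuous_intros continuous_on_circle[OF assms(1,2)]) (use cis_neq(1)[OF assms(3)] in auto)
  have "(\<M> t. G (cis t) * poisson z t) =
    (\<M> t. G (cis t) * (cis t / (cis t - z)) + G (cis t) * (cnj z * cis t / (1 - cnj z * cis t)))"
    unfolding poisson_decomp(1)[OF assms(3)] by (simp add: distrib_left)
  also have "\<dots> = (\<M> t. G (cis t) * (cis t / (cis t - z))) + (\<M> t. G (cis t) * (cnj z * cis t / (1 - cnj z * cis t)))"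
    by (intro Bochner_Integration.integral_add integrable_circ_continuous c1 continuous_on_circle[OF h R'(1)])
  also have "\<dots> = G z" using Cauchy_circ[OF assms] mean_value_circ[OF h R'(1)] by simp
  finally show ?thesis .
qed

lemma integrable_poisson_mult:
  fixes f :: "real \<Rightarrow> real"
  assumes "integrable circ f" "cmod z < 1"
  shows "integrable circ (\<lambda>t. f t * poisson z t)"
proof (rule Bochner_Integration.integrable_bound)
  show "integrable circ (\<lambda>t. 2 / (1 - cmod z) * norm (f t))" using assms by auto
  have [measurable]: "f \<in> borel_measurable borel" using borel_measurable_integrable[OF assms(1)] by simp
  show "(\<lambda>t. f t * poisson z t) \<in> borel_measurable circ" using assms(2) by simp
  show "AE t in circ. norm (f t * poisson z t) \<le> norm (2 / (1 - cmod z) * norm (f t))"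
  proof (rule AE_I2)
    fix t
    have "poisson z t * \<bar>f t\<bar> \<le> 2 / (1 - cmod z) * \<bar>f t\<bar>"
      by (intro mult_right_mono poisson_le assms) simp
    then show "norm (f t * poisson z t) \<le> norm (2 / (1 - cmod z) * norm (f t))"
      using poisson_nonneg[OF assms(2), of t] assms(2) by (simp add: abs_mult mult.commute)
  qed
qed

lemma integrable_poisson_mult_complex:
  fixes f :: "real \<Rightarrow> complex"
  assumes "integrable circ f" "cmod z < 1"
  shows "integrable circ (\<lambda>t. f t * poisson z t)"
proof -
  have [measurable]: "f \<in> borel_measurable borel" using borel_measurable_integrable[OF assms(1)] by simp
  have i: "integrable circ (\<lambda>t. cmod (f t) * poisson z t)" using integrable_poisson_mult[of "\<lambda>t. cmod (f t)"] assms by auto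
  show ?thesis
    by (rule Bochner_Integration.integrable_bound[OF i])
       (use poisson_nonneg[OF assms(2)] assms(2) in \<open>auto simp: norm_mult\<close>)
qed

lemma integrable_poisson: "cmod z < 1 \<Longrightarrow> integrable circ (poisson z)"
  by (intro integrable_circ_continuous continuous_on_poisson)

lemma integral_poisson: "cmod z < 1 \<Longrightarrow> (\<M> t. poisson z t) = 1"
proof -
  assume z: "cmod z < 1"
  have "complex_of_real (\<M> t. poisson z t) = (\<M> t. complex_of_real (poisson z t))"
    by simp
  also have "\<dots> = 1" using Poisson_formula[of "\<lambda>_. 1" 2 z] z by simp
  finally show ?thesis by (metis of_real_eq_1_iff)
qed

lemma poisson_integral_mono:
  fixes f g :: "real \<Rightarrow> real"
  assumes "integrable circ f" "integrable circ g" "cmod z < 1" "\<And>x. f x \<le> g x"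
  shows "(\<M> t. f t * poisson z t) \<le> (\<M> t. g t * poisson z t)"
  by (intro integral_mono integrable_poisson_mult assms mult_right_mono poisson_nonneg)

lemma poisson_integral_le_norm:
  fixes f :: "real \<Rightarrow> complex"
  assumes "integrable circ f" "cmod z < 1"
  shows "cmod (\<M> t. f t * poisson z t) \<le> (\<M> t. cmod (f t) * poisson z t)"
proof -
  have "cmod (\<M> t. f t * poisson z t) \<le> (\<M> t. cmod (f t * poisson z t))" by (rule integral_norm_bound)
  then show ?thesis using poisson_nonneg[OF assms(2)] by (simp add: norm_mult)
qed

section \<open>Dilations of functions on the disc\<close>

abbreviation dil :: "(complex \<Rightarrow> complex) \<Rightarrow> real \<Rightarrow> real \<Rightarrow> complex" where
  "dil G r \<equiv> \<lambda>t. G (of_real r * cis t)"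

lemma dil_holomorphic:
  assumes "G holomorphic_on ball 0 1" "0 \<le> r" "r < 1"
  obtains R where "1 < R" "(\<lambda>z. G (of_real r * z)) holomorphic_on ball 0 R"
proof -
  define R where "R = (if r = 0 then 2 else 1/r)"
  have "1 < R" using assms by (auto simp: R_def)
  have "(G \<circ> (\<lambda>z. of_real r * z)) holomorphic_on ball 0 R"
  proof (rule holomorphic_on_compose_gen[OF _ assms(1)])
    show "(*) (complex_of_real r) ` ball 0 R \<subseteq> ball 0 1"
      using assms by (auto simp: R_def norm_mult field_simps)
  qed (intro holomorphic_intros)
  then show ?thesis using \<open>1 < R\<close> that by (simp add: o_def)
qed

lemma continuous_on_dil:
  assumes "G holomorphic_on ball 0 1" "0 \<le> r" "r < 1"
  shows "continuous_on UNIV (dil G r)"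
proof -
  obtain R where "1 < R" "(\<lambda>z. G (of_real r * z)) holomorphic_on ball 0 R" using dil_holomorphic[OF assms] .
  then show ?thesis using continuous_on_circle[of "\<lambda>z. G (of_real r * z)"] by simp
qed

lemma dil_measurable:
  assumes "G holomorphic_on ball 0 1" "0 \<le> r" "r < 1"
  shows "dil G r \<in> borel_measurable borel"
  by (intro borel_measurable_continuous_onI continuous_on_dil assms)

lemma dil_bounded:
  assumes "G holomorphic_on ball 0 1" "0 \<le> r" "r < 1"
  obtains B where "\<And>t. cmod (G (of_real r * cis t)) \<le> B"
proof -
  have "compact ((\<lambda>t. G (of_real r * t)) ` sphere 0 1)"
  proof (rule compact_continuous_image)
    show "continuous_on (sphere 0 1) (\<lambda>t. G (of_real r * t))"
      by (rule continuous_on_compose2[OF holomorphic_on_imp_continuous_on[OF assms(1)]])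
         (use assms in \<open>auto intro!: continuous_intros simp: norm_mult\<close>)
  qed simp
  then have "bounded ((\<lambda>t. G (of_real r * t)) ` sphere 0 1)" by (rule compact_imp_bounded)
  then obtain B where "\<And>t. t \<in> sphere 0 1 \<Longrightarrow> cmod (G (of_real r * t)) \<le> B" unfolding bounded_iff by blast
  then show ?thesis by (intro that[of B]) simp
qed

lemma sqint_dil:
  assumes "G holomorphic_on ball 0 1" "0 \<le> r" "r < 1"
  shows "sqint circ (dil G r)"
proof -
  obtain B where "\<And>t. cmod (G (of_real r * cis t)) \<le> B" by (rule dil_bounded[OF assms]) blast
  then show ?thesis using sqint_circ_bounded(1)[OF dil_measurable[OF assms]] by blast
qed

lemma Poisson_dil:
  assumes "G holomorphic_on ball 0 1" "0 \<le> r" "r < 1" "cmod z < 1"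
  shows "(\<M> t. dil G r t * poisson z t) = G (of_real r * z)"
proof -
  obtain R where "1 < R" "(\<lambda>z. G (of_real r * z)) holomorphic_on ball 0 R" using dil_holomorphic[OF assms(1-3)] .
  then show ?thesis using Poisson_formula[of "\<lambda>z. G (of_real r * z)"] assms by simp
qed

section \<open>Power series and Parseval's identity\<close>

lemma integral_cis_powers: "(\<M> t. cis t ^ m * cnj (cis t ^ n)) = (if m = n then 1 else 0)"
proof -
  have mean: "(\<M> t. cis t ^ k) = (if k = 0 then 1 else 0)" for k
  proof -
    have "(\<lambda>z::complex. z ^ k) holomorphic_on ball 0 2" by (intro holomorphic_intros)
    then show ?thesis using mean_value_circ[of "\<lambda>z. z^k" 2] by (simp add: power_0_left)
  qed
  have cc: "cis t ^ k * cnj (cis t) ^ k = 1" for t k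
    by (simp add: cis_cnj cis_mult flip: power_mult_distrib)
  show ?thesis
  proof (cases "n \<le> m")
    case True
    have "cis t ^ m * cnj (cis t ^ n) = cis t ^ (m - n)" for t
      using cc[of t n] True by (metis complex_cnj_power le_add_diff_inverse2 mult.assoc mult.right_neutral power_add)
    then show ?thesis using mean[of "m-n"] True by simp
  next
    case False
    have "cis t ^ m * cnj (cis t ^ n) = cnj (cis t ^ (n - m))" for t
      using cc[of t m] False
      by (metis complex_cnj_power le_add_diff_inverse mult.assoc mult.left_neutral power_add nat_le_linear)
    then have "(\<M> t. cis t ^ m * cnj (cis t ^ n)) = cnj (\<M> t. cis t ^ (n - m))"
      by (simp del: complex_cnj_power flip: integral_cnj)
    then show ?thesis using mean[of "n-m"] False by simp
  qed
qed

lemma Fourier_coeff_series: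
  assumes s: "summable (\<lambda>n. cmod (c n))" and g: "\<And>t. (\<lambda>n. c n * cis t ^ n) sums g t"
  shows "(\<M> t. g t * cnj (cis t ^ m)) = c m"
proof -
  define F where "F = (\<lambda>n t. c n * (cis t ^ n * cnj (cis t ^ m)))"
  have int: "integrable circ (F n)" for n
    unfolding F_def by (intro integrable_circ_continuous continuous_intros)
  have nrm: "norm (F n t) = cmod (c n)" for n t by (simp add: F_def norm_mult norm_power)
  have sm: "(\<lambda>n. F n t) sums (g t * cnj (cis t ^ m))" for t
    using sums_mult2[OF g[of t], of "cnj (cis t ^ m)"] by (simp add: F_def mult.assoc)
  have "(\<lambda>n. integral\<^sup>L circ (F n)) sums (\<M> t. (\<Sum>n. F n t))"
    by (rule sums_integral[OF int]) (use s nrm in auto)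
  moreover have "(\<lambda>t. \<Sum>n. F n t) = (\<lambda>t. g t * cnj (cis t ^ m))" using sm by (auto simp: sums_iff)
  moreover have "integral\<^sup>L circ (F n) = (if n = m then c m else 0)" for n
    unfolding F_def by (subst integral_mult_right_zero) (simp only: integral_cis_powers, simp)
  ultimately have "(\<lambda>n. if n = m then c m else 0) sums (\<M> t. g t * cnj (cis t ^ m))" by simp
  moreover have "(\<lambda>n. if n = m then c m else 0) sums c m" by (rule sums_single)
  ultimately show ?thesis by (rule sums_unique2)
qed

text \<open>Only one factor of g cnj g is expanded. The integral of each term is then a Fourier
  coefficient of \<open>g\<close>, so that no double series has to be rearranged.\<close>

lemma Parseval:
  assumes s: "summable (\<lambda>n. cmod (c n))" and g: "\<And>t. (\<lambda>n. c n * cis t ^ n) sums g t"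
    and gm: "g \<in> borel_measurable borel"
  shows "(\<lambda>n. (cmod (c n))\<^sup>2) sums (l2 circ g)\<^sup>2"
proof -
  define B where "B = (\<Sum>n. cmod (c n))"
  have gB: "cmod (g t) \<le> B" for t
  proof -
    have "g t = (\<Sum>n. c n * cis t ^ n)" using g[of t] by (simp add: sums_iff)
    also have "cmod \<dots> \<le> (\<Sum>n. cmod (c n * cis t ^ n))" using s by (intro summable_norm) (simp add: norm_mult norm_power)
    finally show ?thesis by (simp add: B_def norm_mult norm_power)
  qed
  define F where "F = (\<lambda>n t. cnj (c n) * (g t * cnj (cis t ^ n)))"
  have [measurable]: "g \<in> borel_measurable borel" by fact
  have cm [measurable]: "(\<lambda>t. cnj (cis t ^ n)) \<in> borel_measurable borel" for n
    by (intro borel_measurable_continuous_onI continuous_intros)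
  have nrm: "norm (F n t) \<le> cmod (c n) * B" for n t
    using gB[of t] by (auto simp: F_def norm_mult norm_power intro!: mult_left_mono)
  have int: "integrable circ (F n)" for n
    by (rule integrable_circ_bounded[OF _ nrm]) (unfold F_def, measurable)
  have sm: "(\<lambda>n. F n t) sums (g t * cnj (g t))" for t
    using sums_mult[OF sums_cnj[THEN iffD2, OF g[of t]], of "g t"] by (simp add: F_def mult_ac)
  have "(\<lambda>n. integral\<^sup>L circ (F n)) sums (\<M> t. (\<Sum>n. F n t))"
  proof (rule sums_integral[OF int])
    show "AE x in circ. summable (\<lambda>i. norm (F i x))"
      by (intro AE_I2 summable_comparison_test[OF _ summable_mult2[OF s, of B]]) (use nrm in auto)
    show "summable (\<lambda>i. LINT x|circ. norm (F i x))"
    proof (rule summable_comparison_test[OF _ summable_mult2[OF s, of B]], intro exI[of _ 0] allI impI)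
      fix i
      have "B \<ge> 0" using gB[of 0] norm_ge_zero[of "g 0"] by linarith
      then have "(LINT x|circ. norm (F i x)) \<le> cmod (c i) * B" by (intro integral_circ_mono_const nrm) auto
      then show "norm (LINT x|circ. norm (F i x)) \<le> cmod (c i) * B" by simp
    qed
  qed
  moreover have "(\<lambda>t. \<Sum>n. F n t) = (\<lambda>t. complex_of_real ((cmod (g t))\<^sup>2))" unfolding complex_norm_square using sm by (auto simp: sums_iff)
  moreover have "integral\<^sup>L circ (F n) = complex_of_real ((cmod (c n))\<^sup>2)" for n
    unfolding F_def complex_norm_square
    by (subst integral_mult_right_zero) (simp only: Fourier_coeff_series[OF s g], simp add: mult.commute)
  ultimately have "(\<lambda>n. complex_of_real ((cmod (c n))\<^sup>2)) sums complex_of_real ((l2 circ g)\<^sup>2)"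
    by (simp add: l2_sq del: of_real_power)
  then show ?thesis by (simp only: sums_of_real_iff)
qed

section \<open>The Hardy space \<open>H\<^sup>2\<close>\<close>

text \<open>The condition of \<open>H2\<close> in terms of norms over \<open>circ\<close>, so that
  the norms of dilations can be read off from Taylor coefficients.\<close>

definition hardy :: "(complex \<Rightarrow> complex) \<Rightarrow> bool" where
  "hardy f \<longleftrightarrow> f holomorphic_on ball 0 1 \<and> (\<exists>B. \<forall>r. 0 \<le> r \<longrightarrow> r < 1 \<longrightarrow> l2 circ (dil f r) \<le> B)"

lemma H2_imp_hardy:
  assumes "H2 f" shows "hardy f"
proof -
  have hol: "f holomorphic_on ball 0 1" using assms by (simp add: H2_def)
  obtain B where B': "\<forall>r\<in>{0..<1}. (LBINT t:{0..2*pi}. (cmod (f (of_real r * cis t)))\<^sup>2) / (2*pi) \<le> B"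
    using assms unfolding H2_def bdd_above_def by auto
  then have B: "(LBINT t:{0..2*pi}. (cmod (f (of_real r * cis t)))\<^sup>2) / (2*pi) \<le> B" if "0 \<le> r" "r < 1" for r
    using that by auto
  have "l2 circ (dil f r) \<le> sqrt B" if "0 \<le> r" "r < 1" for r
  proof -
    have [measurable]: "dil f r \<in> borel_measurable borel" by (rule dil_measurable[OF hol that])
    have "(\<M> t. (cmod (dil f r t))\<^sup>2) = (LBINT t:{0..2*pi}. (cmod (dil f r t))\<^sup>2) / (2*pi)"
      by (subst integral_circ) auto
    then show ?thesis using B[OF that] unfolding l2_def by (intro real_sqrt_le_mono) simp
  qed
  then show ?thesis using hol unfolding hardy_def by blast
qed

lemma hardy_holomorphic: "hardy f \<Longrightarrow> f holomorphic_on ball 0 1"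
  by (simp add: hardy_def)

lemma bounded_imp_hardy:
  assumes "f holomorphic_on ball 0 1" "\<And>z. z \<in> ball 0 1 \<Longrightarrow> cmod (f z) \<le> B"
  shows "hardy f"
proof -
  have "l2 circ (dil f r) \<le> B" if "0 \<le> r" "r < 1" for r
    by (rule sqint_circ_bounded(2)[OF dil_measurable[OF assms(1) that]]) (use assms(2) that in \<open>auto simp: norm_mult\<close>)
  then show ?thesis using assms(1) unfolding hardy_def by blast
qed

lemma disc_power_series:
  assumes "f holomorphic_on ball 0 1"
  obtains a where "\<And>z. cmod z < 1 \<Longrightarrow> (\<lambda>n. a n * z^n) sums f z"
    and "\<And>r. 0 \<le> r \<Longrightarrow> r < 1 \<Longrightarrow> summable (\<lambda>n. cmod (a n) * r^n)"
proof -
  define a where "a = (\<lambda>n. (deriv ^^ n) f 0 / fact n)"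
  have 1: "(\<lambda>n. a n * z^n) sums f z" if "cmod z < 1" for z
    using holomorphic_power_series[OF assms, of z] that by (simp add: a_def)
  have "summable (\<lambda>n. cmod (a n) * r^n)" if "0 \<le> r" "r < 1" for r
  proof -
    obtain s where s: "r < s" "s < 1" using \<open>r < 1\<close> dense by blast
    have "summable (\<lambda>n. a n * of_real s^n)" using 1[of "of_real s"] s that by (auto simp: sums_iff)
    then have "summable (\<lambda>n. norm (a n * of_real r^n))" by (rule powser_insidea) (use s that in auto)
    then show ?thesis using that by (simp add: norm_mult norm_power)
  qed
  with 1 show ?thesis using that by blast
qed

lemma dil_sums:
  assumes "\<And>z. cmod z < 1 \<Longrightarrow> (\<lambda>n. a n * z^n) sums f z" "0 \<le> r" "r < 1"
  shows "(\<lambda>n. a n * of_real r ^ n * cis t ^ n) sums dil f r t"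
  using assms(1)[of "of_real r * cis t"] assms(2,3) by (simp add: norm_mult power_mult_distrib mult.assoc)

text \<open>By Parseval this is the termwise inequality (r^n - s^n)^2 \<le> r^(2n) - s^(2n). It
  shows that the norms increase with the radius and that distances of dilations are controlled by
  increments of a bounded monotone quantity.\<close>

lemma dil_norm_series:
  assumes "f holomorphic_on ball 0 1" "0 \<le> s" "s \<le> r" "r < 1"
  shows "(l2 circ (\<lambda>\<theta>. dil f r \<theta> - dil f s \<theta>))\<^sup>2 \<le> (l2 circ (dil f r))\<^sup>2 - (l2 circ (dil f s))\<^sup>2"
proof -
  obtain a where a: "\<And>z. cmod z < 1 \<Longrightarrow> (\<lambda>n. a n * z^n) sums f z"
    and sa: "\<And>r. 0 \<le> r \<Longrightarrow> r < 1 \<Longrightarrow> summable (\<lambda>n. cmod (a n) * r^n)" using disc_power_series[OF assms(1)] by blast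
  have s1: "s < 1" "0 \<le> r" using assms by auto
  have P: "(\<lambda>n. (cmod (a n * of_real t ^ n))\<^sup>2) sums (l2 circ (dil f t))\<^sup>2" if "0 \<le> t" "t < 1" for t
    by (rule Parseval[OF _ dil_sums[OF a] dil_measurable[OF assms(1)]]) (use that sa in \<open>auto simp: norm_mult norm_power\<close>)
  have Q: "(\<lambda>n. (cmod (a n * of_real r ^ n - a n * of_real s ^ n))\<^sup>2) sums (l2 circ (\<lambda>\<theta>. dil f r \<theta> - dil f s \<theta>))\<^sup>2"
  proof (rule Parseval)
    show "summable (\<lambda>n. cmod (a n * of_real r ^ n - a n * of_real s ^ n))"
      by (rule summable_comparison_test[OF _ summable_add[OF sa[OF s1(2) assms(4)] sa[OF assms(2) s1(1)]]])
         (use s1 assms in \<open>auto intro!: exI[of _ 0] order_trans[OF norm_triangle_ineq4] simp: norm_mult norm_power\<close>)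
    show "(\<lambda>n. (a n * of_real r ^ n - a n * of_real s ^ n) * cis \<theta> ^ n) sums (dil f r \<theta> - dil f s \<theta>)" for \<theta>
      using sums_diff[OF dil_sums[OF a s1(2) assms(4)] dil_sums[OF a assms(2) s1(1)]] by (simp add: left_diff_distrib)
    show "(\<lambda>\<theta>. dil f r \<theta> - dil f s \<theta>) \<in> borel_measurable borel"
      using assms s1 by (intro borel_measurable_diff dil_measurable) auto
  qed
  have "(cmod (a n * of_real r ^ n - a n * of_real s ^ n))\<^sup>2 \<le> (cmod (a n * of_real r ^ n))\<^sup>2 - (cmod (a n * of_real s ^ n))\<^sup>2" for n
  proof -
    have "cmod (a n * of_real r ^ n - a n * of_real s ^ n) = cmod (a n) * (r^n - s^n)"
      using assms s1 by (simp add: right_diff_distrib[symmetric] norm_mult flip: of_real_power of_real_diff) (simp add: power_mono)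
    then have "(cmod (a n * of_real r ^ n - a n * of_real s ^ n))\<^sup>2 = (cmod (a n))\<^sup>2 * (r^n - s^n)\<^sup>2"
      by (simp only: power_mult_distrib)
    moreover have "(r^n - s^n)\<^sup>2 \<le> (r^n)\<^sup>2 - (s^n)\<^sup>2"
    proof -
      have "0 \<le> s^n * (r^n - s^n)" using assms s1 by (intro mult_nonneg_nonneg) (auto simp: power_mono)
      then show ?thesis by (simp add: power2_eq_square algebra_simps)
    qed
    then have "(cmod (a n))\<^sup>2 * (r^n - s^n)\<^sup>2 \<le> (cmod (a n))\<^sup>2 * ((r^n)\<^sup>2 - (s^n)\<^sup>2)" by (intro mult_left_mono) auto
    ultimately show ?thesis using assms s1 by (simp add: norm_mult norm_power power_mult_distrib right_diff_distrib)
  qed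
  then show ?thesis by (rule sums_le[OF _ Q sums_diff[OF P[OF s1(2) assms(4)] P[OF assms(2) s1(1)]]])
qed

lemma hardy_Cauchy:
  assumes "hardy f" "\<epsilon> > 0"
  obtains s0 where "0 \<le> s0" "s0 < 1"
    "\<And>r s. s0 \<le> r \<Longrightarrow> s0 \<le> s \<Longrightarrow> r < 1 \<Longrightarrow> s < 1 \<Longrightarrow> l2 circ (\<lambda>t. dil f r t - dil f s t) < \<epsilon>"
proof -
  define N where "N r = (l2 circ (dil f r))\<^sup>2" for r
  obtain B where B: "\<And>r. 0 \<le> r \<Longrightarrow> r < 1 \<Longrightarrow> l2 circ (dil f r) \<le> B" and hol: "f holomorphic_on ball 0 1"
    using assms by (auto simp: hardy_def)
  have NB: "N r \<le> B\<^sup>2" if "0 \<le> r" "r < 1" for r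
    unfolding N_def using B[OF that] by (intro power_mono) auto
  \<comment> \<open>The squared norms increase to L; beyond a radius at which they exceed L -
    \<epsilon>^2 any two of them differ by less than \<epsilon>^2.\<close>
  define L where "L = (SUP r\<in>{0..<1}. N r)"
  have bdd: "bdd_above (N ` {0..<1})" using NB by (intro bdd_aboveI[of _ "B\<^sup>2"]) auto
  have "L - \<epsilon>\<^sup>2 < L" using assms by simp
  then obtain s0 where s0: "s0 \<in> {0..<1}" "L - \<epsilon>\<^sup>2 < N s0"
    using less_cSUP_iff[OF _ bdd, of "L - \<epsilon>\<^sup>2"] unfolding L_def by auto
  have main: "l2 circ (\<lambda>t. dil f r t - dil f s t) < \<epsilon>" if "s0 \<le> s" "s \<le> r" "r < 1" for r s
  proof -
    have "(l2 circ (\<lambda>t. dil f s t - dil f s0 t))\<^sup>2 \<le> N s - N s0"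
      unfolding N_def by (rule dil_norm_series[OF hol]) (use that s0 in auto)
    then have "N s0 \<le> N s" by (smt (verit) zero_le_power2)
    have "(l2 circ (\<lambda>t. dil f r t - dil f s t))\<^sup>2 \<le> N r - N s"
      unfolding N_def by (rule dil_norm_series[OF hol]) (use that s0 in auto)
    also have "\<dots> \<le> L - N s0" unfolding L_def using \<open>N s0 \<le> N s\<close> cSUP_upper[OF _ bdd, of r] that s0 by auto
    also have "\<dots> < \<epsilon>\<^sup>2" using s0 by simp
    finally show ?thesis using assms(2) power2_less_imp_less by (simp add: power_less_imp_less_base)
  qed
  show ?thesis
  proof (rule that[of s0])
    fix r s assume "s0 \<le> r" "s0 \<le> s" "r < 1" "s < 1"
    then show "l2 circ (\<lambda>t. dil f r t - dil f s t) < \<epsilon>"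
      using main[of s r] main[of r s] l2_minus_commute[of circ "dil f r" "dil f s"] by (cases "s \<le> r") auto
  qed (use s0 in auto)
qed

lemma poly_sum_monom: "poly (\<Sum>n<N. monom (c n) n) z = (\<Sum>n<N. c n * z ^ n)" for z :: complex
  by (simp add: poly_sum poly_monom)

lemma dil_poly_approx:
  assumes "f holomorphic_on ball 0 1" "0 \<le> r" "r < 1" "\<epsilon> > 0"
  obtains q where "\<And>z. cmod z \<le> 1 \<Longrightarrow> cmod (f (of_real r * z) - poly q z) < \<epsilon>"
proof -
  obtain a where a: "\<And>z. cmod z < 1 \<Longrightarrow> (\<lambda>n. a n * z^n) sums f z"
    and sa: "\<And>r. 0 \<le> r \<Longrightarrow> r < 1 \<Longrightarrow> summable (\<lambda>n. cmod (a n) * r^n)" using disc_power_series[OF assms(1)] by blast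
  have s: "summable (\<lambda>n. cmod (a n) * r^n)" using sa assms by auto
  obtain N where N: "\<And>n. n \<ge> N \<Longrightarrow> norm (\<Sum>i. cmod (a (i + n)) * r ^ (i + n)) < \<epsilon>"
    using suminf_exist_split[OF assms(4) s] by blast
  define q where "q = (\<Sum>n<N. monom (a n * of_real r ^ n) n)"
  have "cmod (f (of_real r * z) - poly q z) < \<epsilon>" if "cmod z \<le> 1" for z
  proof -
    have "cmod (of_real r * z) \<le> r * 1" unfolding norm_mult using that assms by (intro mult_mono) auto
    then have "cmod (of_real r * z) < 1" using assms by simp
    then have sm: "(\<lambda>n. a n * of_real r^n * z^n) sums f (of_real r * z)"
      using a[of "of_real r * z"] by (simp add: power_mult_distrib mult.assoc)
    then have "f (of_real r * z) = (\<Sum>n. a (n + N) * of_real r^(n+N) * z^(n+N)) + poly q z"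
      unfolding q_def poly_sum_monom using suminf_split_initial_segment[of "\<lambda>n. a n * of_real r^n * z^n" N] by (simp add: sums_iff)
    then have "cmod (f (of_real r * z) - poly q z) = cmod (\<Sum>n. a (n + N) * of_real r^(n+N) * z^(n+N))" by simp
    also have "\<dots> \<le> (\<Sum>n. cmod (a (n+N)) * r^(n+N))"
    proof (rule norm_suminf_le)
      show "norm (a (n + N) * of_real r^(n+N) * z^(n+N)) \<le> cmod (a (n+N)) * r^(n+N)" for n
        using assms that by (auto simp: norm_mult norm_power intro!: mult_left_le power_le_one mult_nonneg_nonneg)
      show "summable (\<lambda>n. cmod (a (n+N)) * r^(n+N))" using s by (rule summable_ignore_initial_segment)
    qed
    also have "\<dots> < \<epsilon>" using N[of N] by simp
    finally show ?thesis .
  qed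
  then show ?thesis using that by blast
qed

lemma continuous_poly_cis: "continuous_on UNIV (\<lambda>t. poly q (cis t))"
  by (intro continuous_intros)

lemma sqint_poly: "sqint circ (\<lambda>t. poly q (cis t))"
proof -
  have "poly q holomorphic_on ball 0 2" by (intro holomorphic_intros)
  have "(\<lambda>z. poly q (2 * z)) holomorphic_on ball 0 1" by (intro holomorphic_intros)
  from sqint_dil[OF this, of "1/2"] show ?thesis by simp
qed

text \<open>One polynomial serves all radii beyond \<open>s0\<close>: it approximates the dilation
  by \<open>s0\<close> uniformly, and all later dilations are close to that one in norm.\<close>

lemma hardy_poly_approx:
  assumes "hardy f" "\<epsilon> > 0"
  obtains q s0 where "0 \<le> s0" "s0 < 1"
    "\<And>r. s0 \<le> r \<Longrightarrow> r < 1 \<Longrightarrow> l2 circ (\<lambda>t. dil f r t - poly q (cis t)) < \<epsilon>"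
proof -
  have hol: "f holomorphic_on ball 0 1" using assms by (simp add: hardy_def)
  have "\<epsilon>/2 > 0" using assms by simp
  from hardy_Cauchy[OF assms(1) this] obtain s0 where s0: "0 \<le> s0" "s0 < 1"
    "\<And>r s. s0 \<le> r \<Longrightarrow> s0 \<le> s \<Longrightarrow> r < 1 \<Longrightarrow> s < 1 \<Longrightarrow> l2 circ (\<lambda>t. dil f r t - dil f s t) < \<epsilon>/2" by blast
  from dil_poly_approx[OF hol s0(1,2) \<open>\<epsilon>/2 > 0\<close>] obtain q where
    q: "\<And>z. cmod z \<le> 1 \<Longrightarrow> cmod (f (of_real s0 * z) - poly q z) < \<epsilon>/2" by blast
  have "l2 circ (\<lambda>t. dil f r t - poly q (cis t)) < \<epsilon>" if "s0 \<le> r" "r < 1" for r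
  proof -
    have m: "(\<lambda>t. dil f s0 t - poly q (cis t)) \<in> borel_measurable borel"
      by (intro borel_measurable_diff dil_measurable hol s0 borel_measurable_continuous_onI continuous_poly_cis)
    have "cmod (dil f s0 t - poly q (cis t)) \<le> \<epsilon>/2" for t using q[of "cis t"] by simp
    then have "l2 circ (\<lambda>t. dil f s0 t - poly q (cis t)) \<le> \<epsilon>/2" using sqint_circ_bounded(2)[OF m] by blast
    moreover have "l2 circ (\<lambda>t. dil f r t - dil f s0 t) < \<epsilon>/2" using s0 that by auto
    moreover have "l2 circ (\<lambda>t. dil f r t - poly q (cis t)) \<le> l2 circ (\<lambda>t. dil f r t - dil f s0 t) + l2 circ (\<lambda>t. dil f s0 t - poly q (cis t))"
      by (rule l2_diff_triangle[OF sqint_dil sqint_dil sqint_poly]) (use hol s0 that in auto)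
    ultimately show ?thesis by simp
  qed
  then show ?thesis using that s0 by blast
qed

text \<open>A fixed sequence of radii in (0, 1) increasing to 1. Passing from all radii to a
  sequence makes Fatou's lemma and dominated convergence applicable.\<close>

definition rr :: "nat \<Rightarrow> real" where "rr n = 1 - 1 / (real n + 2)"

lemma rr: "0 \<le> rr n" "0 < rr n" "rr n < 1"
  by (auto simp: rr_def field_simps)

lemma rr_tendsto: "rr \<longlonglongrightarrow> 1"
  unfolding rr_def by real_asymp

lemma rr_at_left: "filterlim rr (at_left 1) sequentially"
  using rr_tendsto rr unfolding filterlim_at by (auto simp: less_imp_neq)

lemma rr_eventually: "s < 1 \<Longrightarrow> eventually (\<lambda>n. s \<le> rr n) sequentially"
  using order_tendstoD(1)[OF rr_tendsto, of s] by (auto elim: eventually_mono)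

text \<open>The radial limits are only pointwise. Fatou's lemma, applied to |f_k - f_n|^2 with k
  fixed and n tending to infinity, turns the Cauchy property of the dilations into a bound for f_k -
  H. This gives convergence in norm, and \<open>H\<close> is square integrable as a difference of
  two square integrable functions.\<close>

lemma
  assumes f: "hardy f" and m: "H \<in> borel_measurable borel"
    and lim: "AE t in circ. ((\<lambda>r. f (of_real r * cis t)) \<longlongrightarrow> H t) (at_left 1)"
  shows hardy_boundary_sqint: "sqint circ H"
    and hardy_boundary_l2: "(\<lambda>n. l2 circ (\<lambda>t. dil f (rr n) t - H t)) \<longlonglongrightarrow> 0"
proof -
  have hol: "f holomorphic_on ball 0 1" using f by (simp add: hardy_def)
  have sq: "sqint circ (dil f (rr n))" for n using sqint_dil[OF hol] rr by auto
  have dm: "dil f (rr n) \<in> borel_measurable borel" for n using dil_measurable[OF hol] rr by auto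
  have lim': "AE t in circ. (\<lambda>n. dil f (rr n) t) \<longlonglongrightarrow> H t"
    using lim by eventually_elim (rule filterlim_compose[OF _ rr_at_left])
  have key: "sqint circ (\<lambda>t. dil f (rr k) t - H t) \<and> l2 circ (\<lambda>t. dil f (rr k) t - H t) \<le> \<epsilon>"
    if ev: "eventually (\<lambda>n. l2 circ (\<lambda>t. dil f (rr k) t - dil f (rr n) t) \<le> \<epsilon>) sequentially" for k \<epsilon>
  proof -
    have e0: "0 \<le> \<epsilon>" using eventually_happens[OF ev] l2_nonneg order_trans by (metis trivial_limit_sequentially)
    have "(\<integral>\<^sup>+t. ennreal ((cmod (dil f (rr k) t - H t))\<^sup>2) \<partial>circ)
      = (\<integral>\<^sup>+t. liminf (\<lambda>n. ennreal ((cmod (dil f (rr k) t - dil f (rr n) t))\<^sup>2)) \<partial>circ)"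
    proof (rule nn_integral_cong_AE, use lim' in eventually_elim)
      case (elim t)
      have "(\<lambda>n. ennreal ((cmod (dil f (rr k) t - dil f (rr n) t))\<^sup>2)) \<longlonglongrightarrow> ennreal ((cmod (dil f (rr k) t - H t))\<^sup>2)"
        by (intro tendsto_ennrealI tendsto_intros elim)
      from lim_imp_Liminf[OF _ this] show ?case by simp
    qed
    also have "\<dots> \<le> liminf (\<lambda>n. \<integral>\<^sup>+t. ennreal ((cmod (dil f (rr k) t - dil f (rr n) t))\<^sup>2) \<partial>circ)"
      using dm by (intro nn_integral_liminf) simp
    also have "\<dots> \<le> liminf (\<lambda>n. ennreal (\<epsilon>\<^sup>2))"
    proof (rule Liminf_mono, use ev in eventually_elim)
      case (elim n)
      have "(\<integral>\<^sup>+t. ennreal ((cmod (dil f (rr k) t - dil f (rr n) t))\<^sup>2) \<partial>circ) = ennreal ((l2 circ (\<lambda>t. dil f (rr k) t - dil f (rr n) t))\<^sup>2)"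
        unfolding l2_sq using sqint_diff[OF sq sq] by (intro nn_integral_eq_integral) (auto simp: sqint_def)
      also have "\<dots> \<le> ennreal (\<epsilon>\<^sup>2)" using elim by (intro ennreal_leI power_mono) auto
      finally show ?case .
    qed
    also have "\<dots> = ennreal (\<epsilon>\<^sup>2)" by (simp add: Liminf_const)
    finally have le: "(\<integral>\<^sup>+t. ennreal ((cmod (dil f (rr k) t - H t))\<^sup>2) \<partial>circ) \<le> ennreal (\<epsilon>\<^sup>2)" .
    have m2: "(\<lambda>t. dil f (rr k) t - H t) \<in> borel_measurable borel" using dm m by simp
    have int: "integrable circ (\<lambda>t. (cmod (dil f (rr k) t - H t))\<^sup>2)"
      by (rule integrableI_bounded) (use m2 le in \<open>auto simp: less_top[symmetric] top_unique\<close>)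
    then have sq2: "sqint circ (\<lambda>t. dil f (rr k) t - H t)" using m2 by (simp add: sqint_def)
    have "ennreal ((l2 circ (\<lambda>t. dil f (rr k) t - H t))\<^sup>2) \<le> ennreal (\<epsilon>\<^sup>2)"
      unfolding l2_sq using le int by (subst (asm) nn_integral_eq_integral) auto
    then have "(l2 circ (\<lambda>t. dil f (rr k) t - H t))\<^sup>2 \<le> \<epsilon>\<^sup>2" by simp
    then show ?thesis using sq2 e0 power2_le_imp_le by blast
  qed
  have C: "\<exists>K. \<forall>k\<ge>K. eventually (\<lambda>n. l2 circ (\<lambda>t. dil f (rr k) t - dil f (rr n) t) \<le> \<epsilon>) sequentially" if "\<epsilon> > 0" for \<epsilon>
  proof -
    from hardy_Cauchy[OF f that] obtain s0 where s0: "0 \<le> s0" "s0 < 1"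
      "\<And>r s. s0 \<le> r \<Longrightarrow> s0 \<le> s \<Longrightarrow> r < 1 \<Longrightarrow> s < 1 \<Longrightarrow> l2 circ (\<lambda>t. dil f r t - dil f s t) < \<epsilon>" by blast
    obtain K where K: "\<And>k. k \<ge> K \<Longrightarrow> s0 \<le> rr k" using rr_eventually[OF s0(2)] by (auto simp: eventually_sequentially)
    show ?thesis
    proof (intro exI[of _ K] allI impI)
      fix k assume "k \<ge> K"
      show "eventually (\<lambda>n. l2 circ (\<lambda>t. dil f (rr k) t - dil f (rr n) t) \<le> \<epsilon>) sequentially"
        unfolding eventually_sequentially using K s0(3) rr \<open>k \<ge> K\<close> by (meson less_imp_le)
    qed
  qed
  show "(\<lambda>n. l2 circ (\<lambda>t. dil f (rr n) t - H t)) \<longlonglongrightarrow> 0"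
  proof (rule LIMSEQ_I)
    fix e :: real assume "0 < e"
    then obtain K where K: "\<forall>k\<ge>K. eventually (\<lambda>n. l2 circ (\<lambda>t. dil f (rr k) t - dil f (rr n) t) \<le> e/2) sequentially" using C[of "e/2"] by auto
    show "\<exists>no. \<forall>n\<ge>no. norm (l2 circ (\<lambda>t. dil f (rr n) t - H t) - 0) < e"
    proof (intro exI[of _ K] allI impI)
      fix k assume "k \<ge> K"
      then have "l2 circ (\<lambda>t. dil f (rr k) t - H t) \<le> e/2" using K key by blast
      then show "norm (l2 circ (\<lambda>t. dil f (rr k) t - H t) - 0) < e" using \<open>0 < e\<close> by simp
    qed
  qed
  obtain K where "\<forall>k\<ge>K. eventually (\<lambda>n. l2 circ (\<lambda>t. dil f (rr k) t - dil f (rr n) t) \<le> 1) sequentially" using C[of 1] by auto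
  then have "sqint circ (\<lambda>t. dil f (rr K) t - H t)" using key by blast
  from sqint_diff[OF sq[of K] this] show "sqint circ H" by simp
qed

section \<open>Herglotz integrals\<close>

text \<open>One formula for two uses: the exponent of the singular inner function, with
  \<open>\<kappa>\<close> the identity, u = 1 and the measure \<mu>, and the analytic completion of
  a Poisson integral, with \<open>\<kappa>\<close> = \<open>cis\<close>, the measure on angles and a
  density u.\<close>

definition herglotz :: "'a measure \<Rightarrow> ('a \<Rightarrow> complex) \<Rightarrow> ('a \<Rightarrow> real) \<Rightarrow> complex \<Rightarrow> complex" where
  "herglotz M \<kappa> u z = (\<integral>x. of_real (u x) * ((\<kappa> x + z) / (\<kappa> x - z)) \<partial>M)"

lemma herglotz_kernel_sums:
  assumes "cmod k = 1" "cmod z < 1"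
  shows "(\<lambda>n. (if n = 0 then 1 else 2) * cnj k ^ n * z ^ n) sums ((k + z) / (k - z))"
proof -
  have kk: "k * cnj k = 1" using assms complex_norm_square[of k] by simp
  have "norm (cnj k * z) < 1" using assms by (simp add: norm_mult)
  from sums_mult[OF geometric_sums[OF this], of 2]
  have "(\<lambda>n. 2 * (cnj k * z) ^ n) sums (2 / (1 - cnj k * z))" by simp
  from sums_diff[OF this sums_single[of 0 "\<lambda>_. 1"]]
  have "(\<lambda>n. 2 * (cnj k * z) ^ n - (if n = 0 then 1 else 0)) sums (2 / (1 - cnj k * z) - 1)" by simp
  moreover have "(\<lambda>n. 2 * (cnj k * z) ^ n - (if n = 0 then 1 else 0)) = (\<lambda>n. (if n = 0 then 1 else 2) * cnj k ^ n * z ^ n)"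
    by (auto simp: power_mult_distrib)
  moreover have "2 / (1 - cnj k * z) - 1 = (k + z) / (k - z)"
  proof -
    have "k \<noteq> 0" "k - z \<noteq> 0" using assms by auto
    have "cnj k = 1 / k" using kk \<open>k \<noteq> 0\<close> by (simp add: field_simps)
    then have e: "1 - cnj k * z = (k - z) / k" using \<open>k \<noteq> 0\<close> by (simp add: field_simps)
    show ?thesis unfolding e using \<open>k \<noteq> 0\<close> \<open>k - z \<noteq> 0\<close> by (simp add: field_simps)
  qed
  ultimately show ?thesis by simp
qed

context
  fixes M :: "'a measure" and \<kappa> :: "'a \<Rightarrow> complex" and u :: "'a \<Rightarrow> real"
  assumes \<kappa> [measurable]: "\<kappa> \<in> borel_measurable M" and unit: "AE x in M. cmod (\<kappa> x) = 1" and u: "integrable M u"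
begin

lemma herglotz_integrable:
  assumes "cmod z < 1"
  shows "integrable M (\<lambda>x. of_real (u x) * ((\<kappa> x + z) / (\<kappa> x - z)))"
proof (rule Bochner_Integration.integrable_bound)
  have [measurable]: "u \<in> borel_measurable M" using u by auto
  show "integrable M (\<lambda>x. u x * (2 / (1 - cmod z)))" using u by auto
  show "(\<lambda>x. of_real (u x) * ((\<kappa> x + z) / (\<kappa> x - z))) \<in> borel_measurable M" by measurable
  show "AE x in M. norm (of_real (u x) * ((\<kappa> x + z) / (\<kappa> x - z))) \<le> norm (u x * (2 / (1 - cmod z)))"
    using unit
  proof eventually_elim
    case (elim x)
    have "cmod (\<kappa> x + z) \<le> 2" using norm_triangle_ineq[of "\<kappa> x" z] elim assms by simp
    moreover have "1 - cmod z \<le> cmod (\<kappa> x - z)" using norm_triangle_ineq2[of "\<kappa> x" z] elim by simp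
    ultimately have "cmod ((\<kappa> x + z) / (\<kappa> x - z)) \<le> 2 / (1 - cmod z)"
      unfolding norm_divide using assms by (intro frac_le) auto
    then have "\<bar>u x\<bar> * cmod ((\<kappa> x + z) / (\<kappa> x - z)) \<le> \<bar>u x\<bar> * (2 / (1 - cmod z))" by (intro mult_left_mono) auto
    moreover have "norm (of_real (u x) * ((\<kappa> x + z) / (\<kappa> x - z))) = \<bar>u x\<bar> * cmod ((\<kappa> x + z) / (\<kappa> x - z))"
      by (simp only: norm_mult norm_of_real)
    moreover have "norm (u x * (2 / (1 - cmod z))) = \<bar>u x\<bar> * (2 / (1 - cmod z))" using assms by (simp add: abs_mult)
    ultimately show ?case by simp
  qed
qed

text \<open>The kernel is expanded in powers of z and the series is integrated term by term; the
  geometric majorant is integrable because |\<kappa>| = 1 almost everywhere.\<close>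

lemma herglotz_holomorphic: "herglotz M \<kappa> u holomorphic_on ball 0 1"
proof (rule power_series_holomorphic)
  fix z :: complex assume "z \<in> ball 0 1"
  then have z: "cmod z < 1" by simp
  have [measurable]: "u \<in> borel_measurable M" using u by auto
  define b where "b = (\<lambda>n. \<integral>x. of_real (u x) * ((if n = 0 then 1 else 2) * cnj (\<kappa> x) ^ n) \<partial>M)"
  define F where "F = (\<lambda>n x. of_real (u x) * ((if n = 0 then 1 else 2) * cnj (\<kappa> x) ^ n) * z ^ n)"
  have nrm: "AE x in M. \<forall>n. norm (F n x) \<le> 2 * \<bar>u x\<bar> * cmod z ^ n"
    using unit by eventually_elim (auto simp: F_def norm_mult norm_power mult_right_mono)
  have int: "integrable M (F n)" for n
  proof (rule Bochner_Integration.integrable_bound)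
    show "integrable M (\<lambda>x. 2 * \<bar>u x\<bar> * cmod z ^ n)" using u by auto
    show "F n \<in> borel_measurable M" unfolding F_def by measurable
    show "AE x in M. norm (F n x) \<le> norm (2 * \<bar>u x\<bar> * cmod z ^ n)" using nrm by eventually_elim (auto simp: abs_mult)
  qed
  have sg: "summable (\<lambda>n. cmod z ^ n)" using z by (simp add: summable_geometric)
  have "(\<lambda>n. integral\<^sup>L M (F n)) sums (\<integral>x. (\<Sum>n. F n x) \<partial>M)"
  proof (rule sums_integral[OF int])
    show "AE x in M. summable (\<lambda>i. norm (F i x))" using nrm
      by eventually_elim (rule summable_comparison_test[OF _ summable_mult[OF sg]], auto)
    show "summable (\<lambda>i. LINT x|M. norm (F i x))"
    proof (rule summable_comparison_test[OF _ summable_mult[OF sg, of "LINT x|M. 2 * \<bar>u x\<bar>"]], intro exI[of _ 0] allI impI)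
      fix i
      have "(LINT x|M. norm (F i x)) \<le> (LINT x|M. 2 * \<bar>u x\<bar> * cmod z ^ i)"
        by (rule integral_mono_AE) (use int u nrm in auto)
      then show "norm (LINT x|M. norm (F i x)) \<le> (LINT x|M. 2 * \<bar>u x\<bar>) * cmod z ^ i" by simp
    qed
  qed
  moreover have "integral\<^sup>L M (F n) = b n * z ^ n" for n unfolding F_def b_def by (rule integral_mult_left_zero)
  moreover have "(\<integral>x. (\<Sum>n. F n x) \<partial>M) = herglotz M \<kappa> u z"
    unfolding herglotz_def
  proof (rule integral_cong_AE)
    show "AE x in M. (\<Sum>n. F n x) = of_real (u x) * ((\<kappa> x + z) / (\<kappa> x - z))" using unit
    proof eventually_elim
      case (elim x)
      show ?case using sums_mult[OF herglotz_kernel_sums[OF elim z], of "of_real (u x)"]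
        by (simp add: F_def mult.assoc sums_iff)
    qed
    show "(\<lambda>x. \<Sum>n. F n x) \<in> borel_measurable M" unfolding F_def by measurable
  qed measurable
  ultimately show "(\<lambda>n. b n * (z - 0) ^ n) sums herglotz M \<kappa> u z" by simp
qed

lemma Re_herglotz:
  assumes "cmod z < 1"
  shows "Re (herglotz M \<kappa> u z) = (\<integral>x. u x * ((1 - (cmod z)\<^sup>2) / (cmod (\<kappa> x - z))\<^sup>2) \<partial>M)"
proof -
  have [measurable]: "u \<in> borel_measurable M" using u by auto
  have "Re (herglotz M \<kappa> u z) = (\<integral>x. Re (of_real (u x) * ((\<kappa> x + z) / (\<kappa> x - z))) \<partial>M)"
    unfolding herglotz_def using herglotz_integrable[OF assms] by (simp only: integral_Re)
  also have "\<dots> = (\<integral>x. u x * ((1 - (cmod z)\<^sup>2) / (cmod (\<kappa> x - z))\<^sup>2) \<partial>M)"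
  proof (rule integral_cong_AE)
    show "AE x in M. Re (of_real (u x) * ((\<kappa> x + z) / (\<kappa> x - z))) = u x * ((1 - (cmod z)\<^sup>2) / (cmod (\<kappa> x - z))\<^sup>2)"
      using unit
    proof eventually_elim
      case (elim x)
      have "\<kappa> x = cis (Arg (\<kappa> x))" using elim by (metis cis_Arg complex_norm_square mult_cancel_right1 norm_zero of_real_1 sgn_eq zero_neq_one div_by_1)
      then have "(1 - (cmod z)\<^sup>2) / (cmod (\<kappa> x - z))\<^sup>2 = Re ((\<kappa> x + z) / (\<kappa> x - z))"
        using poisson_Re[OF assms, of "Arg (\<kappa> x)"] by (simp add: poisson_def)
      moreover have "Re (of_real (u x) * ((\<kappa> x + z) / (\<kappa> x - z))) = u x * Re ((\<kappa> x + z) / (\<kappa> x - z))"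
        unfolding times_complex.sel by simp
      ultimately show ?case by simp
    qed
  qed measurable
  finally show ?thesis .
qed

end

abbreviation log_outer :: "(real \<Rightarrow> real) \<Rightarrow> complex \<Rightarrow> complex" where
  "log_outer u \<equiv> herglotz circ cis u"

lemma cis_measurable [measurable]: "cis \<in> borel_measurable borel"
  by (intro borel_measurable_continuous_onI continuous_intros)

lemma log_outer_holomorphic: "integrable circ u \<Longrightarrow> log_outer u holomorphic_on ball 0 1"
  by (rule herglotz_holomorphic) auto

lemma Re_log_outer: "integrable circ u \<Longrightarrow> cmod z < 1 \<Longrightarrow> Re (log_outer u z) = (\<M> t. u t * poisson z t)"
  by (subst Re_herglotz) (auto simp: poisson_def)

section \<open>Singular inner functions\<close>

locale singular =
  fixes \<mu> :: "complex measure"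
  assumes sing: "singular_circle_measure \<mu>"
begin

sublocale finite_measure \<mu>
  using sing by (simp add: singular_circle_measure_def)

lemma sets_mu [measurable_cong, simp]: "sets \<mu> = sets borel"
  using sing by (simp add: singular_circle_measure_def)

lemma space_mu [simp]: "space \<mu> = UNIV"
  using sets_eq_imp_space_eq[OF sets_mu] by simp

lemma AE_unit: "AE \<zeta> in \<mu>. cmod \<zeta> = 1"
proof (rule AE_I[of _ _ "UNIV - sphere 0 1"])
  show "emeasure \<mu> (UNIV - sphere 0 1) = 0" using sing by (simp add: singular_circle_measure_def)
  show "UNIV - sphere 0 1 \<in> sets \<mu>" by (auto intro!: borel_open open_Diff)
qed auto

lemma id_measurable_mu: "(\<lambda>\<zeta>. \<zeta>) \<in> borel_measurable \<mu>"
  by (simp add: measurable_ident_sets)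

lemma sing_inner_herglotz: "sing_inner \<mu> = (\<lambda>z. exp (- herglotz \<mu> (\<lambda>\<zeta>. \<zeta>) (\<lambda>_. 1) z))"
  by (simp add: sing_inner_def herglotz_def fun_eq_iff)

definition Pmu :: "complex \<Rightarrow> real" where
  "Pmu z = (\<integral>\<zeta>. (1 - (cmod z)\<^sup>2) / (cmod (\<zeta> - z))\<^sup>2 \<partial>\<mu>)"

lemma sing_inner_holomorphic: "sing_inner \<mu> holomorphic_on ball 0 1"
  unfolding sing_inner_herglotz
  by (intro holomorphic_intros herglotz_holomorphic id_measurable_mu AE_unit) simp

lemma norm_sing_inner: "cmod z < 1 \<Longrightarrow> cmod (sing_inner \<mu> z) = exp (- Pmu z)"
  unfolding sing_inner_herglotz Pmu_def norm_exp_eq_Re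
  by (simp add: Re_herglotz[OF id_measurable_mu AE_unit, of "\<lambda>_. 1"])

lemma Pmu_nonneg: "cmod z < 1 \<Longrightarrow> 0 \<le> Pmu z"
  unfolding Pmu_def by (intro integral_nonneg_AE AE_I2 divide_nonneg_nonneg) (auto simp: abs_square_le_1)

lemma norm_sing_inner_le: "cmod z < 1 \<Longrightarrow> cmod (sing_inner \<mu> z) \<le> 1"
  using Pmu_nonneg[of z] by (simp add: norm_sing_inner)

lemma sing_inner_nonzero: "sing_inner \<mu> z \<noteq> 0"
  by (simp add: sing_inner_def)

lemma norm_sing_inner_0: "cmod (sing_inner \<mu> 0) = exp (- measure \<mu> UNIV)"
proof -
  have "Pmu 0 = (\<integral>\<zeta>. 1 \<partial>\<mu>)" unfolding Pmu_def
  proof (rule integral_cong_AE)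
    show "AE x in \<mu>. (1 - (cmod 0)\<^sup>2) / (cmod (x - 0))\<^sup>2 = 1" using AE_unit by eventually_elim simp
  qed auto
  then show ?thesis by (simp add: norm_sing_inner)
qed

text \<open>Lets the Poisson kernel be read as a function of either boundary point, so that after
  Fubini it can be integrated over the angle with the point of the support of \<mu> held
  fixed.\<close>

lemma cmod_swap:
  assumes "cmod a = 1" "cmod b = 1"
  shows "cmod (a - of_real r * b) = cmod (b - of_real r * a)"
proof -
  have "(cmod (a - of_real r * b))\<^sup>2 = (cmod (b - of_real r * a))\<^sup>2"
  proof -
    have "(cmod (x - of_real r * y))\<^sup>2 = (cmod x)\<^sup>2 + r\<^sup>2 * (cmod y)\<^sup>2 - 2 * r * (Re x * Re y + Im x * Im y)" for x y
      unfolding cmod_power2 by (simp add: power2_eq_square algebra_simps)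
    then show ?thesis using assms by (simp add: mult.commute)
  qed
  then show ?thesis by simp
qed

text \<open>Inner regularity applied to a carrier of \<mu> that is null for Lebesgue measure.
  Compactness is wanted because almost every boundary point then has positive distance from all but
  \<epsilon> of the mass.\<close>

lemma compact_carrier:
  assumes "\<epsilon> > 0"
  obtains K where "compact K" "emeasure \<mu> (UNIV - K) \<le> ennreal \<epsilon>" "AE t in circ. cis t \<notin> K"
proof -
  obtain N where N: "N \<in> sets borel" "emeasure \<mu> (UNIV - N) = 0" "emeasure lborel {t \<in> {0..2*pi}. cis t \<in> N} = 0"
    using sing by (auto simp: singular_circle_measure_def)
  have "emeasure \<mu> N = (SUP K \<in> {K. K \<subseteq> N \<and> compact K}. emeasure \<mu> K)"
    by (rule inner_regular) (use N in \<open>auto simp: emeasure_eq_measure\<close>)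
  have "\<exists>K\<in>{K. K \<subseteq> N \<and> compact K}. emeasure \<mu> N \<le> emeasure \<mu> K + ennreal \<epsilon>"
  proof (cases "emeasure \<mu> N = 0")
    case True then show ?thesis by (intro bexI[of _ "{}"]) auto
  next
    case False
    then have "emeasure \<mu> N - ennreal \<epsilon> < emeasure \<mu> N"
      using assms by (intro ennreal_between) (auto simp: emeasure_eq_measure zero_less_measure_iff)
    then obtain K where "K \<in> {K. K \<subseteq> N \<and> compact K}" "emeasure \<mu> N - ennreal \<epsilon> < emeasure \<mu> K"
      using \<open>emeasure \<mu> N = _\<close> by (metis (no_types, lifting) less_SUP_iff)
    then show ?thesis by (intro bexI[of _ K]) (auto simp: emeasure_eq_measure ennreal_minus_le_iff add.commute dest: less_imp_le)
  qed
  then obtain K where K: "K \<subseteq> N" "compact K" "emeasure \<mu> N \<le> emeasure \<mu> K + ennreal \<epsilon>" by auto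
  have Km: "K \<in> sets borel" using K(2) by (auto intro: borel_closed compact_imp_closed)
  have "measure \<mu> (UNIV - K) \<le> \<epsilon>"
  proof -
    have "measure \<mu> (UNIV - K) = measure \<mu> UNIV - measure \<mu> K" using Km finite_measure_compl[of K] by simp
    moreover have "measure \<mu> (UNIV - N) = measure \<mu> UNIV - measure \<mu> N" using N finite_measure_compl[of N] by simp
    moreover have "measure \<mu> (UNIV - N) = 0" using N by (simp add: measure_def)
    moreover have "measure \<mu> N \<le> measure \<mu> K + \<epsilon>"
      using K(3) assms by (simp add: emeasure_eq_measure flip: ennreal_plus)
    ultimately show ?thesis by simp
  qed
  then have 2: "emeasure \<mu> (UNIV - K) \<le> ennreal \<epsilon>" by (simp add: emeasure_eq_measure ennreal_leI)
  have 3: "AE t in circ. cis t \<notin> K"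
  proof -
    have "{t \<in> {0..2*pi}. cis t \<in> N} \<in> sets lborel"
    proof -
      have "{t \<in> {0..2*pi}. cis t \<in> N} = {0..2*pi} \<inter> (cis -` N \<inter> space borel)" by auto
      then show ?thesis using N(1) by (simp only: sets_lborel) (intro sets.Int measurable_sets[OF cis_measurable] ; simp)
    qed
    then have "AE t in lborel. t \<notin> {t \<in> {0..2*pi}. cis t \<in> N}"
      using N(3) by (intro AE_not_in) (simp add: null_sets_def)
    then have "AE t in lborel. 0 < ennreal (indicator {0..2*pi} t / (2*pi)) \<longrightarrow> cis t \<notin> K"
      by eventually_elim (use K(1) in \<open>auto simp: indicator_def zero_less_divide_iff split: if_splits\<close>)
    then show ?thesis unfolding circ_def by (subst AE_density) auto
  qed
  show ?thesis using that[OF K(2) 2 3] .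
qed

text \<open>This stands for the statement that |S| = 1 almost everywhere on the circle. The Poisson
  integral of the mass on K tends to 0 off K, hence almost everywhere; the Poisson integral of the
  remaining mass has mean at most \<epsilon> over every circle, by Fubini.\<close>

lemma integral_one_minus_sing_inner:
  "(\<lambda>n. \<integral>\<theta>. 1 - (cmod (dil (sing_inner \<mu>) (rr n) \<theta>))\<^sup>2 \<partial>circ) \<longlonglongrightarrow> 0"
proof (rule LIMSEQ_I)
  fix e :: real assume e: "0 < e"
  define \<epsilon> where "\<epsilon> = e / 4"
  have "\<epsilon> > 0" using e by (simp add: \<epsilon>_def)
  obtain K where K: "compact K" "emeasure \<mu> (UNIV - K) \<le> ennreal \<epsilon>" "AE \<theta> in circ. cis \<theta> \<notin> K"
    using compact_carrier[OF \<open>\<epsilon> > 0\<close>] .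
  have [measurable]: "K \<in> sets borel" using K(1) by (auto intro: borel_closed compact_imp_closed)
  define pk where "pk n \<theta> \<zeta> = (1 - (rr n)\<^sup>2) / (cmod (\<zeta> - of_real (rr n) * cis \<theta>))\<^sup>2" for n \<theta> \<zeta>
  have pk0: "0 \<le> pk n \<theta> \<zeta>" for n \<theta> \<zeta>
    unfolding pk_def using rr[of n] by (intro divide_nonneg_nonneg) (auto simp: power_le_one)
  have [measurable]: "(\<lambda>x. pk n (fst x) (snd x)) \<in> borel_measurable (borel \<Otimes>\<^sub>M borel)" for n unfolding pk_def by measurable
  have [measurable]: "(\<lambda>\<zeta>. pk n \<theta> \<zeta>) \<in> borel_measurable borel" for n \<theta> unfolding pk_def by measurable
  have pkb: "pk n \<theta> \<zeta> \<le> 2 / (1 - rr n)" if "cmod \<zeta> = 1" for n \<theta> \<zeta>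
  proof -
    have "1 - rr n \<le> cmod (\<zeta> - of_real (rr n) * cis \<theta>)"
      using norm_triangle_ineq2[of \<zeta> "of_real (rr n) * cis \<theta>"] that rr[of n] by (simp add: norm_mult)
    then have "pk n \<theta> \<zeta> \<le> (1 - (rr n)\<^sup>2) / (1 - rr n)\<^sup>2" unfolding pk_def
      using rr[of n] by (intro divide_left_mono power_mono mult_pos_pos zero_less_power) (auto simp: power_le_one)
    also have "1 - (rr n)\<^sup>2 = (1 - rr n) * (1 + rr n)" by (simp add: power2_eq_square algebra_simps)
    also have "(1 - rr n) * (1 + rr n) / (1 - rr n)\<^sup>2 = (1 + rr n) / (1 - rr n)" using rr[of n] by (simp add: power2_eq_square)
    also have "\<dots> \<le> 2 / (1 - rr n)" using rr[of n] by (intro divide_right_mono) auto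
    finally show ?thesis .
  qed
  have AEb: "AE \<zeta> in \<mu>. \<forall>n \<theta>. pk n \<theta> \<zeta> \<le> 2 / (1 - rr n)" using AE_unit by eventually_elim (use pkb in auto)
  have ipk: "integrable \<mu> (\<lambda>\<zeta>. indicator X \<zeta> * pk n \<theta> \<zeta>)" if [measurable]: "X \<in> sets borel" for n \<theta> X
  proof (rule integrable_const_bound[where B="2 / (1 - rr n)"])
    show "AE x in \<mu>. norm (indicator X x * pk n \<theta> x) \<le> 2 / (1 - rr n)"
      using AEb by eventually_elim (use pk0 rr[of n] in \<open>auto simp: abs_mult indicator_def\<close>)
  qed measurable
  \<comment> \<open>\<open>A\<close> is the Poisson integral of the restriction of \<mu> to K and
    \<open>B\<close> that of the rest; together they give -ln |S|.\<close>
  define A where "A n \<theta> = (\<integral>\<zeta>. indicator K \<zeta> * pk n \<theta> \<zeta> \<partial>\<mu>)" for n \<theta>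
  define B where "B n \<theta> = (\<integral>\<zeta>. indicator (UNIV - K) \<zeta> * pk n \<theta> \<zeta> \<partial>\<mu>)" for n \<theta>
  have PAB: "Pmu (of_real (rr n) * cis \<theta>) = A n \<theta> + B n \<theta>" for n \<theta>
  proof -
    have "A n \<theta> + B n \<theta> = (\<integral>\<zeta>. indicator K \<zeta> * pk n \<theta> \<zeta> + indicator (UNIV - K) \<zeta> * pk n \<theta> \<zeta> \<partial>\<mu>)"
      unfolding A_def B_def by (intro Bochner_Integration.integral_add[symmetric] ipk) auto
    also have "\<dots> = (\<integral>\<zeta>. pk n \<theta> \<zeta> \<partial>\<mu>)" by (intro Bochner_Integration.integral_cong) (auto simp: indicator_def)
    finally show ?thesis using rr[of n] by (simp add: Pmu_def pk_def norm_mult)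
  qed
  have A0: "0 \<le> A n \<theta>" "0 \<le> B n \<theta>" for n \<theta>
    unfolding A_def B_def by (intro integral_nonneg_AE AE_I2 mult_nonneg_nonneg pk0; simp)+
  have Am [measurable]: "A n \<in> borel_measurable borel" "B n \<in> borel_measurable borel" for n
    unfolding A_def B_def by (rule borel_measurable_lebesgue_integral, simp add: split_beta', measurable)+
  have BI: "(\<integral>\<^sup>+\<theta>. ennreal (B n \<theta>) \<partial>circ) \<le> ennreal \<epsilon>" for n
  proof -
    interpret pair_sigma_finite circ \<mu> ..
    have "(\<integral>\<^sup>+\<theta>. ennreal (B n \<theta>) \<partial>circ) = (\<integral>\<^sup>+\<theta>. (\<integral>\<^sup>+\<zeta>. ennreal (indicator (UNIV - K) \<zeta> * pk n \<theta> \<zeta>) \<partial>\<mu>) \<partial>circ)"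
      unfolding B_def by (intro nn_integral_cong nn_integral_eq_integral[symmetric] ipk) (auto simp: pk0)
    also have "\<dots> = (\<integral>\<^sup>+\<zeta>. (\<integral>\<^sup>+\<theta>. ennreal (indicator (UNIV - K) \<zeta> * pk n \<theta> \<zeta>) \<partial>circ) \<partial>\<mu>)"
      by (rule Fubini'[symmetric]) (simp add: split_beta')
    also have "\<dots> = (\<integral>\<^sup>+\<zeta>. indicator (UNIV - K) \<zeta> \<partial>\<mu>)"
    proof (rule nn_integral_cong_AE, use AE_unit in eventually_elim)
      case (elim \<zeta>)
      have z1: "cmod (of_real (rr n) * \<zeta>) < 1" using elim rr[of n] by (simp add: norm_mult)
      have eq: "pk n \<theta> \<zeta> = poisson (of_real (rr n) * \<zeta>) \<theta>" for \<theta>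
        using cmod_swap[of \<zeta> "cis \<theta>" "rr n"] elim rr[of n] by (simp add: pk_def poisson_def norm_mult)
      have "(\<integral>\<^sup>+\<theta>. ennreal (poisson (of_real (rr n) * \<zeta>) \<theta>) \<partial>circ) = 1"
        using integral_poisson[OF z1] integrable_poisson[OF z1] poisson_nonneg[OF z1] by (subst nn_integral_eq_integral) auto
      then show ?case by (auto simp: eq indicator_def)
    qed
    also have "\<dots> = emeasure \<mu> (UNIV - K)" by (rule nn_integral_indicator) simp
    finally show ?thesis using K(2) by simp
  qed
  have Bint: "integrable circ (B n)" for n
    using BI[of n] by (intro integrableI_bounded) (auto simp: A0 less_top[symmetric] top_unique)
  have BI': "(\<M> \<theta>. B n \<theta>) \<le> \<epsilon>" for n
    using BI[of n] \<open>\<epsilon> > 0\<close> by (subst (asm) nn_integral_eq_integral[OF Bint]) (auto simp: A0)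
  \<comment> \<open>Truncation at 1 supplies the constant majorant for dominated convergence, since
    \<open>A\<close> itself has no bound that is uniform in n.\<close>
  have lim0: "AE \<theta> in circ. (\<lambda>n. min 1 (2 * A n \<theta>)) \<longlonglongrightarrow> 0" using K(3)
  proof eventually_elim
    case (elim \<theta>)
    have "(\<lambda>n. A n \<theta>) \<longlonglongrightarrow> 0"
    proof (cases "K = {}")
      case False
      define d where "d = setdist {cis \<theta>} K"
      have d: "d > 0" unfolding d_def using elim K(1) False
        by (subst setdist_gt_0_compact_closed) (auto intro: compact_imp_closed)
      have dK: "d \<le> cmod (\<zeta> - cis \<theta>)" if "\<zeta> \<in> K" for \<zeta>
        unfolding d_def using setdist_le_dist[of "cis \<theta>" "{cis \<theta>}" \<zeta> K] that by (simp add: dist_norm norm_minus_commute)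
      have ev: "eventually (\<lambda>n. A n \<theta> \<le> (1 - (rr n)\<^sup>2) / (d/2)\<^sup>2 * measure \<mu> UNIV) sequentially"
        using rr_eventually[of "1 - d/2"]
      proof (rule eventually_mono)
        fix n assume n: "1 - d/2 \<le> rr n"
        have "indicator K \<zeta> * pk n \<theta> \<zeta> \<le> (1 - (rr n)\<^sup>2) / (d/2)\<^sup>2" for \<zeta>
        proof (cases "\<zeta> \<in> K")
          case True
          have "cmod (of_real (1 - rr n) * cis \<theta>) = 1 - rr n" using rr[of n] by (simp only: norm_mult norm_of_real norm_cis) simp
          moreover have "\<zeta> - cis \<theta> = (\<zeta> - of_real (rr n) * cis \<theta>) - of_real (1 - rr n) * cis \<theta>" by (simp add: algebra_simps)
          ultimately have "cmod (\<zeta> - cis \<theta>) \<le> cmod (\<zeta> - of_real (rr n) * cis \<theta>) + (1 - rr n)"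
            using norm_triangle_ineq4[of "\<zeta> - of_real (rr n) * cis \<theta>" "of_real (1 - rr n) * cis \<theta>"] by metis
          \<comment> \<open>Once 1 - \<open>rr n\<close> is at most d/2, moving from the boundary
            point inwards uses up no more than half of the distance to K.\<close>
          then have "d/2 \<le> cmod (\<zeta> - of_real (rr n) * cis \<theta>)" using dK[OF True] n by simp
          then have "pk n \<theta> \<zeta> \<le> (1 - (rr n)\<^sup>2) / (d/2)\<^sup>2" unfolding pk_def
            using rr[of n] d by (intro divide_left_mono power_mono mult_pos_pos zero_less_power) (auto simp: power_le_one)
          then show ?thesis using True by simp
        next
          case False
          then show ?thesis using rr[of n] by (auto simp: power_le_one)
        qed
        then have "A n \<theta> \<le> (\<integral>\<zeta>. (1 - (rr n)\<^sup>2) / (d/2)\<^sup>2 \<partial>\<mu>)" unfolding A_def by (intro integral_mono ipk) auto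
        then show "A n \<theta> \<le> (1 - (rr n)\<^sup>2) / (d/2)\<^sup>2 * measure \<mu> UNIV" by (simp add: mult_ac)
      qed (use d in simp)
      have "(\<lambda>n. (1 - (rr n)\<^sup>2) / (d/2)\<^sup>2 * measure \<mu> UNIV) \<longlonglongrightarrow> (1 - 1\<^sup>2) / (d/2)\<^sup>2 * measure \<mu> UNIV"
        by (intro tendsto_intros rr_tendsto) (use d in auto)
      then have l: "(\<lambda>n. (1 - (rr n)\<^sup>2) / (d/2)\<^sup>2 * measure \<mu> UNIV) \<longlonglongrightarrow> 0" by simp
      show ?thesis by (rule tendsto_sandwich[OF _ ev tendsto_const l]) (simp add: A0)
    qed (simp add: A_def)
    then have "(\<lambda>n. min 1 (2 * A n \<theta>)) \<longlonglongrightarrow> min 1 (2 * 0)" by (intro tendsto_intros)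
    then show ?case by simp
  qed
  have "(\<lambda>n. \<integral>\<theta>. min 1 (2 * A n \<theta>) \<partial>circ) \<longlonglongrightarrow> (\<M> \<theta>. 0)"
    by (rule integral_dominated_convergence[where w="\<lambda>_. 1"]) (use lim0 A0 in auto)
  then have "(\<lambda>n. \<integral>\<theta>. min 1 (2 * A n \<theta>) \<partial>circ) \<longlonglongrightarrow> 0" by simp
  then have "eventually (\<lambda>n. (\<M> \<theta>. min 1 (2 * A n \<theta>)) < \<epsilon>) sequentially" using \<open>\<epsilon> > 0\<close> by (rule order_tendstoD)
  then obtain no where no: "\<And>n. n \<ge> no \<Longrightarrow> (\<M> \<theta>. min 1 (2 * A n \<theta>)) < \<epsilon>" by (auto simp: eventually_sequentially)
  show "\<exists>no. \<forall>n\<ge>no. norm ((\<M> \<theta>. 1 - (cmod (dil (sing_inner \<mu>) (rr n) \<theta>))\<^sup>2) - 0) < e"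
  proof (intro exI[of _ no] allI impI)
    fix n assume n: "n \<ge> no"
    have zz: "cmod (of_real (rr n) * cis \<theta>) < 1" for \<theta> using rr[of n] by (simp add: norm_mult)
    have le1: "(cmod (dil (sing_inner \<mu>) (rr n) \<theta>))\<^sup>2 \<le> 1" for \<theta>
      using norm_sing_inner_le[OF zz] by (simp add: power_le_one)
    \<comment> \<open>From 1 - exp(-x) \<le> x with x = 2 (A + B), together with the trivial bound
      1, which is what allows the truncation of 2 A.\<close>
    have pt: "1 - (cmod (dil (sing_inner \<mu>) (rr n) \<theta>))\<^sup>2 \<le> min 1 (2 * A n \<theta>) + 2 * B n \<theta>" for \<theta>
    proof -
      define t where "t = - 2 * (A n \<theta> + B n \<theta>)"
      have "(cmod (dil (sing_inner \<mu>) (rr n) \<theta>))\<^sup>2 = exp t"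
        unfolding t_def using zz[of \<theta>] by (simp add: norm_sing_inner PAB power2_eq_square flip: exp_add)
      moreover have "1 + t \<le> exp t" by (rule exp_ge_add_one_self)
      moreover have "0 < exp t" "t = - 2 * A n \<theta> - 2 * B n \<theta>" by (simp_all add: t_def)
      ultimately have "1 - (cmod (dil (sing_inner \<mu>) (rr n) \<theta>))\<^sup>2 \<le> 2 * A n \<theta> + 2 * B n \<theta>"
        "1 - (cmod (dil (sing_inner \<mu>) (rr n) \<theta>))\<^sup>2 \<le> 1" by linarith+
      then show ?thesis using A0[where n=n and \<theta>=\<theta>] by (auto simp only: min_def split: if_splits)
    qed
    have [measurable]: "dil (sing_inner \<mu>) (rr n) \<in> borel_measurable borel"
      using rr by (intro dil_measurable sing_inner_holomorphic) auto
    have i1: "integrable circ (\<lambda>\<theta>. min 1 (2 * A n \<theta>))" by (rule integrable_circ_bounded[where B=1]) (use A0 in auto)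
    have "(\<M> \<theta>. 1 - (cmod (dil (sing_inner \<mu>) (rr n) \<theta>))\<^sup>2) \<le> (\<M> \<theta>. min 1 (2 * A n \<theta>) + 2 * B n \<theta>)"
    proof (rule integral_mono)
      show "integrable circ (\<lambda>\<theta>. 1 - (cmod (dil (sing_inner \<mu>) (rr n) \<theta>))\<^sup>2)"
        by (rule integrable_circ_bounded[where B=1]) (use le1 in auto)
      show "integrable circ (\<lambda>\<theta>. min 1 (2 * A n \<theta>) + 2 * B n \<theta>)" using i1 Bint by auto
    qed (rule pt)
    also have "\<dots> = (\<M> \<theta>. min 1 (2 * A n \<theta>)) + 2 * (\<M> \<theta>. B n \<theta>)" using i1 Bint by simp
    also have "\<dots> < \<epsilon> + 2 * \<epsilon>" using no[OF n] BI'[of n] by simp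
    also have "\<dots> < e" using e by (simp add: \<epsilon>_def)
    finally have "(\<M> \<theta>. 1 - (cmod (dil (sing_inner \<mu>) (rr n) \<theta>))\<^sup>2) < e" .
    moreover have "0 \<le> (\<M> \<theta>. 1 - (cmod (dil (sing_inner \<mu>) (rr n) \<theta>))\<^sup>2)"
      using le1 by (intro integral_nonneg_AE AE_I2) simp
    ultimately show "norm ((\<M> \<theta>. 1 - (cmod (dil (sing_inner \<mu>) (rr n) \<theta>))\<^sup>2) - 0) < e" by simp
  qed
qed

end

section \<open>Jensen's inequality and outer functions\<close>

text \<open>Near cis \<phi> the oscillation of v is small and the kernel has mass 1. Where cis t is
  at distance at least d from cis \<phi>, the point z keeps distance at least d/2 from cis t, so the
  kernel there is of order 1 - \<rho>. Both estimates are uniform in \<phi>.\<close>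

lemma Poisson_integral_boundary:
  fixes v :: "complex \<Rightarrow> real"
  assumes v: "continuous_on (sphere 0 1) v" and e: "\<epsilon> > 0"
  obtains \<rho>0 where "0 \<le> \<rho>0" "\<rho>0 < 1"
    "\<And>\<rho> \<phi>. \<rho>0 \<le> \<rho> \<Longrightarrow> \<rho> < 1 \<Longrightarrow> \<bar>(\<M> t. v (cis t) * poisson (of_real \<rho> * cis \<phi>) t) - v (cis \<phi>)\<bar> \<le> \<epsilon>"
proof -
  have "uniformly_continuous_on (sphere 0 1) v" by (rule compact_uniformly_continuous[OF v]) simp
  then obtain d where d: "d > 0" "\<And>x y. x \<in> sphere 0 1 \<Longrightarrow> y \<in> sphere 0 1 \<Longrightarrow> dist x y < d \<Longrightarrow> dist (v x) (v y) < \<epsilon>/2"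
    unfolding uniformly_continuous_on_def using e by (meson half_gt_zero)
  have "bounded (v ` sphere 0 1)" by (intro compact_imp_bounded compact_continuous_image v) simp
  then obtain M where "\<forall>x\<in>sphere 0 1. \<bar>v x\<bar> \<le> M" unfolding bounded_iff by auto
  then have M: "\<bar>v x\<bar> \<le> M" if "x \<in> sphere 0 1" for x using that by blast
  have M0: "0 \<le> M" using M[of 1] by simp
  \<comment> \<open>2 M bounds the oscillation of v, and 8 / d^2 times 1 - \<rho> bounds the kernel
    away from cis \<phi>.\<close>
  define C where "C = 2 * M * (8 / d\<^sup>2)"
  have C0: "0 \<le> C" using M0 by (simp add: C_def)
  define \<rho>0 where "\<rho>0 = max 0 (max (1 - d/2) (1 - \<epsilon>/(2*(C+1))))"
  have r0: "0 \<le> \<rho>0" "\<rho>0 < 1" "1 - d/2 \<le> \<rho>0" "1 - \<epsilon>/(2*(C+1)) \<le> \<rho>0" using d e C0 by (auto simp: \<rho>0_def)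
  have vc: "continuous_on UNIV (\<lambda>t. v (cis t))"
    by (rule continuous_on_compose2[OF v]) (auto intro!: continuous_intros)
  have main: "\<bar>(\<M> t. v (cis t) * poisson (of_real \<rho> * cis \<phi>) t) - v (cis \<phi>)\<bar> \<le> \<epsilon>" if r: "\<rho>0 \<le> \<rho>" "\<rho> < 1" for \<rho> \<phi>
  proof -
    define z where "z = of_real \<rho> * cis \<phi>"
    have nz: "cmod z = \<rho>" using r r0 by (simp add: z_def norm_mult)
    have z: "cmod z < 1" using r nz by simp
    have "(\<M> t. v (cis t) * poisson z t) - v (cis \<phi>) = (\<M> t. v (cis t) * poisson z t - v (cis \<phi>) * poisson z t)"
      using integral_poisson[OF z] integrable_poisson[OF z] integrable_poisson_mult[OF integrable_circ_continuous[OF vc] z] by simp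
    also have "\<bar>\<dots>\<bar> \<le> (\<M> t. \<bar>v (cis t) * poisson z t - v (cis \<phi>) * poisson z t\<bar>)" by (rule integral_abs_bound)
    also have "\<dots> \<le> (\<M> t. \<epsilon>/2 * poisson z t + C * (1 - \<rho>))"
    proof (rule integral_mono)
      show "integrable circ (\<lambda>t. \<bar>v (cis t) * poisson z t - v (cis \<phi>) * poisson z t\<bar>)"
        using integrable_poisson[OF z] integrable_poisson_mult[OF integrable_circ_continuous[OF vc] z] by auto
      show "integrable circ (\<lambda>t. \<epsilon>/2 * poisson z t + C * (1 - \<rho>))" using integrable_poisson[OF z] by auto
      fix t
      have eq: "\<bar>v (cis t) * poisson z t - v (cis \<phi>) * poisson z t\<bar> = \<bar>v (cis t) - v (cis \<phi>)\<bar> * poisson z t"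
        using poisson_nonneg[OF z, of t] by (simp add: left_diff_distrib[symmetric] abs_mult)
      show "\<bar>v (cis t) * poisson z t - v (cis \<phi>) * poisson z t\<bar> \<le> \<epsilon>/2 * poisson z t + C * (1 - \<rho>)"
      proof (cases "dist (cis t) (cis \<phi>) < d")
        case True
        then have "\<bar>v (cis t) - v (cis \<phi>)\<bar> \<le> \<epsilon>/2" using d(2)[of "cis t" "cis \<phi>"] by (simp add: dist_real_def)
        then have "\<bar>v (cis t) - v (cis \<phi>)\<bar> * poisson z t \<le> \<epsilon>/2 * poisson z t" by (intro mult_right_mono poisson_nonneg z)
        moreover have "0 \<le> C * (1 - \<rho>)" using C0 r by simp
        ultimately show ?thesis unfolding eq by simp
      next
        case False
        have "cmod (cis t - cis \<phi>) \<le> cmod (cis t - z) + cmod (z - cis \<phi>)" by (rule norm_diff_triangle_ineq[of "cis t" z z "cis \<phi>", simplified])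
        moreover have "cmod (z - cis \<phi>) = 1 - \<rho>"
        proof -
          have "z - cis \<phi> = of_real (\<rho> - 1) * cis \<phi>" by (simp add: z_def algebra_simps)
          then have "cmod (z - cis \<phi>) = \<bar>\<rho> - 1\<bar>" by (simp only: norm_mult norm_of_real norm_cis mult_1_right)
          then show ?thesis using r by simp
        qed
        ultimately have "d/2 \<le> cmod (cis t - z)" using False r r0 by (simp add: dist_norm)
        then have "poisson z t \<le> (1 - (cmod z)\<^sup>2) / (d/2)\<^sup>2"
          unfolding poisson_def using z d by (intro divide_left_mono power_mono mult_pos_pos zero_less_power) (auto simp: abs_square_le_1 cis_neq)
        also have "1 - (cmod z)\<^sup>2 = (1 + \<rho>) * (1 - \<rho>)" unfolding nz by (simp add: power2_eq_square algebra_simps)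
        also have "(1 + \<rho>) * (1 - \<rho>) / (d/2)\<^sup>2 \<le> 2 * (1 - \<rho>) / (d/2)\<^sup>2" using r by (intro divide_right_mono mult_right_mono) auto
        also have "\<dots> = 8 / d\<^sup>2 * (1 - \<rho>)" by (simp add: power2_eq_square)
        finally have P: "poisson z t \<le> 8 / d\<^sup>2 * (1 - \<rho>)" .
        have "\<bar>v (cis t) - v (cis \<phi>)\<bar> \<le> 2 * M" using M[of "cis t"] M[of "cis \<phi>"] by auto
        then have "\<bar>v (cis t) - v (cis \<phi>)\<bar> * poisson z t \<le> 2 * M * (8 / d\<^sup>2 * (1 - \<rho>))"
          by (intro mult_mono P poisson_nonneg z) (use M0 in auto)
        moreover have "0 \<le> \<epsilon>/2 * poisson z t" using e poisson_nonneg[OF z] by simp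
        moreover have "2 * M * (8 / d\<^sup>2 * (1 - \<rho>)) = C * (1 - \<rho>)" by (simp only: C_def mult.assoc)
        ultimately show ?thesis unfolding eq by linarith
      qed
    qed
    also have "\<dots> = \<epsilon>/2 + C * (1 - \<rho>)" using integrable_poisson[OF z] integral_poisson[OF z] by simp
    also have "\<dots> \<le> \<epsilon>"
    proof -
      have "C * (1 - \<rho>) \<le> (C + 1) * (\<epsilon>/(2*(C+1)))" using r r0 C0 by (intro mult_mono) auto
      also have "\<dots> = \<epsilon>/2" using C0 by (simp add: field_simps)
      finally show ?thesis by simp
    qed
    finally show ?thesis by (simp add: z_def)
  qed
  show ?thesis using that[OF r0(1,2) main] by blast
qed

text \<open>Adding \<delta> makes the logarithm of the modulus continuous on the circle, whatever
  the zeros of g. The function exp A has boundary modulus |g| + \<delta>, so the maximum principle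
  for g exp(-A) on discs of radius close to 1 gives the claim up to a factor exp \<epsilon>.\<close>

lemma Jensen_inequality:
  assumes g: "g holomorphic_on ball 0 1" and r: "0 \<le> r" "r < 1" and d: "\<delta> > 0" and z: "cmod z < 1"
  shows "cmod (g (of_real r * z)) \<le> exp (\<M> t. ln (cmod (dil g r t) + \<delta>) * poisson z t)"
proof -
  define v where "v \<zeta> = ln (cmod (g (of_real r * \<zeta>)) + \<delta>)" for \<zeta>
  have gc: "continuous_on (cball 0 1) (\<lambda>\<zeta>. g (of_real r * \<zeta>))"
  proof (rule continuous_on_compose2[OF holomorphic_on_imp_continuous_on[OF g]])
    have "r * cmod x < 1" if "cmod x \<le> 1" for x using mult_left_mono[OF that r(1)] r(2) by linarith
    then show "(*) (complex_of_real r) ` cball 0 1 \<subseteq> ball 0 1" using r by (auto simp: norm_mult)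
  qed (intro continuous_intros)
  have gcs: "continuous_on (sphere 0 1) (\<lambda>\<zeta>. g (of_real r * \<zeta>))" by (rule continuous_on_subset[OF gc]) auto
  have vc: "continuous_on (sphere 0 1) v"
    unfolding v_def by (intro continuous_intros gcs) (use d in \<open>auto simp: add_nonneg_eq_0_iff\<close>)
  have vcis: "continuous_on UNIV (\<lambda>t. v (cis t))"
    by (rule continuous_on_compose2[OF vc]) (auto intro!: continuous_intros)
  have vint: "integrable circ (\<lambda>t. v (cis t))" using vcis by (rule integrable_circ_continuous)
  define A where "A = log_outer (\<lambda>t. v (cis t))"
  have Ah: "A holomorphic_on ball 0 1" unfolding A_def using vint by (rule log_outer_holomorphic)
  have ReA: "Re (A w) = (\<M> t. v (cis t) * poisson w t)" if "cmod w < 1" for w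
    unfolding A_def using Re_log_outer[OF vint that] .
  have grh: "(\<lambda>\<zeta>. g (of_real r * \<zeta>)) holomorphic_on ball 0 1"
  proof -
    obtain R where "1 < R" "(\<lambda>z. g (of_real r * z)) holomorphic_on ball 0 R" using dil_holomorphic[OF g r] .
    then show ?thesis by (auto intro: holomorphic_on_subset)
  qed
  have main: "cmod (g (of_real r * z)) \<le> exp \<epsilon> * exp (Re (A z))" if e: "\<epsilon> > 0" for \<epsilon>
  proof -
    obtain \<rho>0 where r0: "0 \<le> \<rho>0" "\<rho>0 < 1"
      "\<And>\<rho> \<phi>. \<rho>0 \<le> \<rho> \<Longrightarrow> \<rho> < 1 \<Longrightarrow> \<bar>(\<M> t. v (cis t) * poisson (of_real \<rho> * cis \<phi>) t) - v (cis \<phi>)\<bar> \<le> \<epsilon>"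
      using Poisson_integral_boundary[OF vc e] by blast
    have "uniformly_continuous_on (cball 0 1) (\<lambda>\<zeta>. g (of_real r * \<zeta>))" by (rule compact_uniformly_continuous[OF gc]) simp
    then obtain \<eta> where eta: "\<eta> > 0" "\<And>x y. x \<in> cball 0 1 \<Longrightarrow> y \<in> cball 0 1 \<Longrightarrow> dist x y < \<eta> \<Longrightarrow> dist (g (of_real r * x)) (g (of_real r * y)) < \<delta>"
      unfolding uniformly_continuous_on_def using d by meson
    \<comment> \<open>A radius beyond \<open>m\<close> is large enough for the boundary
      approximation of the Poisson integral, for z to lie inside, and for g to change by less than
      \<delta> on the way to the circle.\<close>
    define m where "m = Max {\<rho>0, cmod z, 1 - \<eta>, 0}"
    have "m < 1" using r0 z eta by (auto simp: m_def)
    then obtain \<rho> where rho: "m < \<rho>" "\<rho> < 1" using dense by blast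
    have rho': "\<rho>0 \<le> \<rho>" "cmod z < \<rho>" "1 - \<eta> < \<rho>" "0 < \<rho>" using rho by (auto simp: m_def)
    have sub: "cball 0 \<rho> \<subseteq> ball (0::complex) 1" using rho by auto
    define F where "F \<zeta> = g (of_real r * \<zeta>) * exp (- A \<zeta>)" for \<zeta>
    have Fh: "F holomorphic_on ball 0 1" unfolding F_def by (intro holomorphic_intros grh Ah)
    have "cmod (F z) \<le> exp \<epsilon>"
    proof (rule maximum_modulus_frontier[where f=F and \<xi>=z and S="ball 0 \<rho>"])
      show "F holomorphic_on interior (ball 0 \<rho>)" using holomorphic_on_subset[OF Fh, of "ball 0 \<rho>"] rho by (simp add: subset_ball)
      show "continuous_on (closure (ball 0 \<rho>)) F"
        using holomorphic_on_imp_continuous_on[OF Fh] sub rho' by (auto intro: continuous_on_subset)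
      show "z \<in> ball 0 \<rho>" using rho' by simp
      fix w :: complex assume "w \<in> frontier (ball 0 \<rho>)"
      then have nw: "cmod w = \<rho>" using rho' by simp
      define \<phi> where "\<phi> = Arg w"
      have w: "w = of_real \<rho> * cis \<phi>" unfolding \<phi>_def using nw rcis_cmod_Arg[of w] by (simp add: rcis_def)
      have "cmod (cis \<phi> - w) = 1 - \<rho>"
      proof -
        have "cis \<phi> - w = of_real (1 - \<rho>) * cis \<phi>" by (simp add: w algebra_simps)
        then have "cmod (cis \<phi> - w) = \<bar>1 - \<rho>\<bar>" by (simp only: norm_mult norm_of_real norm_cis mult_1_right)
        then show ?thesis using rho by simp
      qed
      then have "dist (g (of_real r * w)) (g (of_real r * cis \<phi>)) < \<delta>"
        using nw rho rho' by (intro eta) (auto simp: dist_norm norm_minus_commute)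
      then have "cmod (g (of_real r * w)) \<le> cmod (g (of_real r * cis \<phi>)) + \<delta>"
        using norm_triangle_sub[of "g (of_real r * w)" "g (of_real r * cis \<phi>)"] by (simp add: dist_norm)
      also have "\<dots> = exp (v (cis \<phi>))" unfolding v_def by (simp add: add_nonneg_pos d)
      finally have 1: "cmod (g (of_real r * w)) \<le> exp (v (cis \<phi>))" .
      have 2: "v (cis \<phi>) \<le> Re (A w) + \<epsilon>" using r0(3)[of \<rho> \<phi>] rho rho' nw ReA[of w] by (simp add: w)
      have "cmod (F w) = cmod (g (of_real r * w)) * exp (- Re (A w))" by (simp add: F_def norm_mult)
      also have "\<dots> \<le> exp (v (cis \<phi>)) * exp (- Re (A w))" by (intro mult_right_mono 1) simp
      also have "\<dots> = exp (v (cis \<phi>) - Re (A w))" by (simp flip: exp_add)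
      also have "\<dots> \<le> exp \<epsilon>" using 2 by simp
      finally show "cmod (F w) \<le> exp \<epsilon>" .
    qed auto
    then have "cmod (g (of_real r * z)) * exp (- Re (A z)) \<le> exp \<epsilon>" by (simp add: F_def norm_mult)
    then show ?thesis by (simp add: exp_minus field_simps)
  qed
  have "cmod (g (of_real r * z)) \<le> exp (Re (A z))"
  proof (rule tendsto_lowerbound[OF _ _ trivial_limit_at_right_real])
    have "((\<lambda>\<epsilon>. exp \<epsilon> * exp (Re (A z))) \<longlongrightarrow> exp 0 * exp (Re (A z))) (at_right 0)" by (intro tendsto_intros)
    then show "((\<lambda>\<epsilon>. exp \<epsilon> * exp (Re (A z))) \<longlongrightarrow> exp (Re (A z))) (at_right 0)" by simp
    show "eventually (\<lambda>\<epsilon>. cmod (g (of_real r * z)) \<le> exp \<epsilon> * exp (Re (A z))) (at_right 0)"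
      using eventually_at_right_less[of 0] by eventually_elim (rule main)
  qed
  then show ?thesis using ReA[OF z] by (simp add: v_def)
qed

lemma ln_add_diff_le:
  assumes "0 \<le> a" "0 \<le> b" "\<delta> > 0"
  shows "ln (a + \<delta>) - ln (b + \<delta>) \<le> \<bar>a - b\<bar> / (\<delta>::real)"
proof -
  have "ln (a + \<delta>) - ln (b + \<delta>) = ln ((a + \<delta>) / (b + \<delta>))" using assms by (simp add: ln_div)
  also have "\<dots> \<le> (a + \<delta>) / (b + \<delta>) - 1" using assms by (intro ln_le_minus_one) auto
  also have "\<dots> = (a - b) / (b + \<delta>)" using assms by (simp add: field_simps)
  also have "\<dots> \<le> \<bar>a - b\<bar> / \<delta>" using assms by (intro frac_le) auto
  finally show ?thesis .
qed

lemma ln_add_bound: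
  assumes "0 \<le> a" "\<delta> > 0"
  shows "\<bar>ln (a + \<delta>)\<bar> \<le> a + \<delta> + \<bar>ln (\<delta>::real)\<bar>"
proof -
  have "ln (a + \<delta>) \<le> a + \<delta> - 1" using assms by (intro ln_le_minus_one) auto
  moreover have "ln \<delta> \<le> ln (a + \<delta>)" using assms by simp
  ultimately show ?thesis using assms by linarith
qed

lemma integrable_ln_add:
  assumes "sqint circ H" "\<delta> > 0"
  shows "integrable circ (\<lambda>t. ln (cmod (H t) + \<delta>))"
proof (rule Bochner_Integration.integrable_bound)
  show "integrable circ (\<lambda>t. cmod (H t) + \<delta> + \<bar>ln \<delta>\<bar>)" using l1_le_l2(1)[OF assms(1)] by auto
  have [measurable]: "H \<in> borel_measurable borel" using sqint_measurable[OF assms(1)] by simp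
  show "(\<lambda>t. ln (cmod (H t) + \<delta>)) \<in> borel_measurable circ" by simp
  show "AE t in circ. norm (ln (cmod (H t) + \<delta>)) \<le> norm (cmod (H t) + \<delta> + \<bar>ln \<delta>\<bar>)"
    using ln_add_bound[OF norm_ge_zero assms(2)] assms(2) by (intro AE_I2) (auto intro: order_trans)
qed

text \<open>The regularization by \<open>\<delta>\<close> makes the logarithm Lipschitz.\<close>

lemma log_majorant_regularized:
  assumes g: "g holomorphic_on ball 0 1" and H: "sqint circ H"
    and lim: "(\<lambda>n. \<integral>t. \<bar>cmod (dil g (rr n) t) - cmod (H t)\<bar> \<partial>circ) \<longlonglongrightarrow> 0"
    and d: "\<delta> > 0" and z: "cmod z < 1"
  shows "cmod (g z) \<le> exp (\<M> t. ln (cmod (H t) + \<delta>) * poisson z t)"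
proof -
  define I where "I = (\<M> t. ln (cmod (H t) + \<delta>) * poisson z t)"
  define K where "K = 2 / (1 - cmod z) / \<delta>"
  define D where "D n = (\<M> t. \<bar>cmod (dil g (rr n) t) - cmod (H t)\<bar>)" for n
  have Hi: "integrable circ H" by (rule l1_le_l2(1)[OF H])
  have bd: "cmod (g (of_real (rr n) * z)) \<le> exp (I + K * D n)" for n
  proof -
    have sq: "sqint circ (dil g (rr n))" using g rr by (intro sqint_dil) auto
    have gi: "integrable circ (dil g (rr n))" by (rule l1_le_l2(1)[OF sq])
    have "(\<M> t. ln (cmod (dil g (rr n) t) + \<delta>) * poisson z t) \<le>
      (\<M> t. ln (cmod (H t) + \<delta>) * poisson z t + K * \<bar>cmod (dil g (rr n) t) - cmod (H t)\<bar>)"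
    proof (rule integral_mono)
      show "integrable circ (\<lambda>t. ln (cmod (dil g (rr n) t) + \<delta>) * poisson z t)"
        by (intro integrable_poisson_mult integrable_ln_add sq d z)
      show "integrable circ (\<lambda>t. ln (cmod (H t) + \<delta>) * poisson z t + K * \<bar>cmod (dil g (rr n) t) - cmod (H t)\<bar>)"
        using integrable_poisson_mult[OF integrable_ln_add[OF H d] z] Hi gi by auto
      fix t
      have "(ln (cmod (dil g (rr n) t) + \<delta>) - ln (cmod (H t) + \<delta>)) * poisson z t \<le> (\<bar>cmod (dil g (rr n) t) - cmod (H t)\<bar> / \<delta>) * poisson z t"
        by (intro mult_right_mono ln_add_diff_le poisson_nonneg z d) auto
      also have "\<dots> \<le> (\<bar>cmod (dil g (rr n) t) - cmod (H t)\<bar> / \<delta>) * (2 / (1 - cmod z))"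
        using d by (intro mult_left_mono poisson_le z) auto
      also have "\<dots> = K * \<bar>cmod (dil g (rr n) t) - cmod (H t)\<bar>" by (simp add: K_def mult_ac)
      finally show "ln (cmod (dil g (rr n) t) + \<delta>) * poisson z t \<le> ln (cmod (H t) + \<delta>) * poisson z t + K * \<bar>cmod (dil g (rr n) t) - cmod (H t)\<bar>"
        unfolding left_diff_distrib by linarith
    qed
    also have "\<dots> = I + K * D n"
      unfolding I_def D_def using integrable_poisson_mult[OF integrable_ln_add[OF H d] z] Hi gi by simp
    finally show ?thesis using Jensen_inequality[OF g rr(1) rr(3) d z, of n] by (simp add: order_trans)
  qed
  have "(\<lambda>n. cmod (g (of_real (rr n) * z))) \<longlonglongrightarrow> cmod (g (of_real 1 * z))"
  proof (intro tendsto_norm)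
    have "isCont g z" using holomorphic_on_imp_continuous_on[OF g] z by (simp add: continuous_on_eq_continuous_at)
    moreover have "(\<lambda>n. of_real (rr n) * z) \<longlonglongrightarrow> of_real 1 * z" by (intro tendsto_intros rr_tendsto)
    ultimately show "(\<lambda>n. g (of_real (rr n) * z)) \<longlonglongrightarrow> g (of_real 1 * z)"
      using isCont_tendsto_compose[of z g "\<lambda>n. of_real (rr n) * z"] by simp
  qed
  moreover have "(\<lambda>n. exp (I + K * D n)) \<longlonglongrightarrow> exp (I + K * 0)" unfolding D_def by (intro tendsto_intros lim)
  ultimately have "cmod (g (of_real 1 * z)) \<le> exp (I + K * 0)" using bd by (intro LIMSEQ_le) auto
  then show ?thesis by (simp add: I_def)
qed

section \<open>Integrability of the logarithm of the boundary modulus\<close>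

lemma poisson_lower:
  assumes "cmod z < 1"
  shows "(1 - (cmod z)\<^sup>2) / 4 \<le> poisson z t"
proof -
  have "cmod (cis t - z) \<le> 2" using norm_triangle_ineq4[of "cis t" z] assms by simp
  then have "(cmod (cis t - z))\<^sup>2 \<le> 2\<^sup>2" by (intro power_mono) auto
  then show ?thesis unfolding poisson_def using assms
    by (intro divide_left_mono) (auto simp: abs_square_le_1 cis_neq)
qed

text \<open>The functions ln(|H| + 1) - ln(|H| + \<delta>) with \<delta> \<le> 1 are nonnegative,
  and the assumed lower bound keeps their Poisson means at z below a constant independent of
  \<delta>. By Fatou's lemma the limit is integrable, which excludes zeros of H on a set of positive
  measure. The positive lower bound of the kernel at this single point removes the weight.\<close>

lemma integrable_log_boundary:
  assumes H: "sqint circ H" and z: "cmod z < 1" and c: "c > 0"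
    and bd: "\<And>\<delta>. \<delta> > 0 \<Longrightarrow> c \<le> exp (\<M> t. ln (cmod (H t) + \<delta>) * poisson z t)"
  shows "AE t in circ. H t \<noteq> 0" "integrable circ (\<lambda>t. ln (cmod (H t)))"
proof -
  have [measurable]: "H \<in> borel_measurable borel" using sqint_measurable[OF H] by simp
  define \<delta> where "\<delta> k = 1 / (real k + 1)" for k
  have dpos: "\<delta> k > 0" for k by (simp add: \<delta>_def)
  have d1: "\<delta> k \<le> 1" for k by (simp add: \<delta>_def)
  have dlim: "\<delta> \<longlonglongrightarrow> 0" unfolding \<delta>_def by real_asymp
  define \<phi> where "\<phi> k t = (ln (cmod (H t) + 1) - ln (cmod (H t) + \<delta> k)) * poisson z t" for k t
  have lnmono: "ln (cmod (H t) + \<delta> k) \<le> ln (cmod (H t) + 1)" for k t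
    using d1[of k] add_nonneg_pos[OF norm_ge_zero dpos[of k], of "H t"] by (subst ln_le_cancel_iff) auto
  have phi0: "0 \<le> \<phi> k t" for k t unfolding \<phi>_def using lnmono by (intro mult_nonneg_nonneg poisson_nonneg z) simp
  have pint: "integrable circ (\<phi> k)" for k
    unfolding \<phi>_def by (intro integrable_poisson_mult z Bochner_Integration.integrable_diff integrable_ln_add H dpos) simp
  define C where "C = (\<M> t. ln (cmod (H t) + 1) * poisson z t) - ln c"
  have pI: "(\<M> t. \<phi> k t) \<le> C" for k
  proof -
    have "(\<M> t. \<phi> k t) = (\<M> t. ln (cmod (H t) + 1) * poisson z t) - (\<M> t. ln (cmod (H t) + \<delta> k) * poisson z t)"
      unfolding \<phi>_def left_diff_distrib
      by (intro Bochner_Integration.integral_diff integrable_poisson_mult z integrable_ln_add H dpos) simp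
    moreover have "ln c \<le> (\<M> t. ln (cmod (H t) + \<delta> k) * poisson z t)"
      using bd[OF dpos, of k] c by (metis exp_gt_zero ln_exp ln_le_cancel_iff)
    ultimately show ?thesis by (simp add: C_def)
  qed
  have pm [measurable]: "\<phi> k \<in> borel_measurable borel" for k using borel_measurable_integrable[OF pint[of k]] by simp
  have fin: "(\<integral>\<^sup>+t. liminf (\<lambda>k. ennreal (\<phi> k t)) \<partial>circ) \<le> ennreal C"
  proof -
    have "(\<integral>\<^sup>+t. liminf (\<lambda>k. ennreal (\<phi> k t)) \<partial>circ) \<le> liminf (\<lambda>k. \<integral>\<^sup>+t. ennreal (\<phi> k t) \<partial>circ)"
      by (intro nn_integral_liminf) simp
    also have "\<dots> \<le> liminf (\<lambda>k. ennreal C)"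
      by (intro Liminf_mono always_eventually allI) (subst nn_integral_eq_integral[OF pint], auto intro: ennreal_leI pI simp: phi0)
    finally show ?thesis by (simp add: Liminf_const)
  qed
  have "AE t in circ. liminf (\<lambda>k. ennreal (\<phi> k t)) \<noteq> \<infinity>"
    by (rule nn_integral_noteq_infinite) (use fin in \<open>auto simp: top_unique\<close>)
  then show nz: "AE t in circ. H t \<noteq> 0"
  proof eventually_elim
    case (elim t)
    show ?case
    proof
      assume H0: "H t = 0"
      \<comment> \<open>At a zero of H the k-th function is ln(k + 1) times a positive kernel value,
        so it would be infinite in the limit.\<close>
      have "filterlim (\<lambda>k. ln (real k + 1)) at_top sequentially" by real_asymp
      moreover have "\<phi> k t = ln (real k + 1) * poisson z t" for k by (simp add: \<phi>_def H0 \<delta>_def ln_div)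
      ultimately have "filterlim (\<lambda>k. \<phi> k t) at_top sequentially"
        using filterlim_at_top_mult_tendsto_pos[OF tendsto_const poisson_pos[OF z]] by simp
      then have "(\<lambda>k. ennreal (\<phi> k t)) \<longlonglongrightarrow> \<infinity>" by (simp add: ennreal_tendsto_top_eq_at_top)
      then have "liminf (\<lambda>k. ennreal (\<phi> k t)) = \<infinity>" by (intro lim_imp_Liminf) auto
      then show False using elim by simp
    qed
  qed
  define \<psi> where "\<psi> t = (ln (cmod (H t) + 1) - ln (cmod (H t))) * poisson z t" for t
  have [measurable]: "\<psi> \<in> borel_measurable borel" unfolding \<psi>_def using z by measurable
  have psi_lim: "AE t in circ. ennreal (\<psi> t) = liminf (\<lambda>k. ennreal (\<phi> k t)) \<and> 0 \<le> \<psi> t" using nz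
  proof eventually_elim
    case (elim t)
    have "(\<lambda>k. \<phi> k t) \<longlonglongrightarrow> (ln (cmod (H t) + 1) - ln (cmod (H t) + 0)) * poisson z t"
      unfolding \<phi>_def by (intro tendsto_intros dlim) (use elim in auto)
    then have l: "(\<lambda>k. \<phi> k t) \<longlonglongrightarrow> \<psi> t" by (simp add: \<psi>_def)
    then have "0 \<le> \<psi> t" by (rule LIMSEQ_le_const) (use phi0 in auto)
    moreover have "(\<lambda>k. ennreal (\<phi> k t)) \<longlonglongrightarrow> ennreal (\<psi> t)" using l by (intro tendsto_ennrealI)
    from lim_imp_Liminf[OF _ this] have "liminf (\<lambda>k. ennreal (\<phi> k t)) = ennreal (\<psi> t)" by simp
    ultimately show ?case by simp
  qed
  have "(\<integral>\<^sup>+t. ennreal (\<psi> t) \<partial>circ) = (\<integral>\<^sup>+t. liminf (\<lambda>k. ennreal (\<phi> k t)) \<partial>circ)"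
    by (rule nn_integral_cong_AE) (use psi_lim in eventually_elim, simp)
  with fin have "(\<integral>\<^sup>+t. ennreal (norm (\<psi> t)) \<partial>circ) \<le> ennreal C"
    using psi_lim by (subst nn_integral_cong_AE[of _ "\<lambda>t. ennreal (\<psi> t)"]) (auto elim: eventually_mono)
  then have psi: "integrable circ \<psi>" by (intro integrableI_bounded) (auto simp: less_top[symmetric] top_unique)
  define q where "q = (1 - (cmod z)\<^sup>2) / 4"
  have q: "q > 0" using z by (simp add: q_def abs_square_less_1)
  have "integrable circ (\<lambda>t. ln (cmod (H t) + 1) - ln (cmod (H t)))"
  proof (rule Bochner_Integration.integrable_bound[OF integrable_divide_zero[where c=q, OF psi]])
    show "AE t in circ. norm (ln (cmod (H t) + 1) - ln (cmod (H t))) \<le> norm (\<psi> t / q)"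
      using nz
    proof eventually_elim
      case (elim t)
      have "ln (cmod (H t)) \<le> ln (cmod (H t) + 1)"
        using elim add_nonneg_pos[OF norm_ge_zero zero_less_one, of "H t"] by (subst ln_le_cancel_iff) auto
      then have "0 \<le> ln (cmod (H t) + 1) - ln (cmod (H t))" by simp
      then have "(ln (cmod (H t) + 1) - ln (cmod (H t))) * q \<le> \<psi> t" unfolding \<psi>_def q_def
        by (intro mult_left_mono poisson_lower z)
      then show ?case using q \<open>0 \<le> ln (cmod (H t) + 1) - ln (cmod (H t))\<close>
        by (simp add: field_simps abs_of_nonneg)
    qed
  qed measurable
  from Bochner_Integration.integrable_diff[OF integrable_ln_add[OF H zero_less_one] this]
  show "integrable circ (\<lambda>t. ln (cmod (H t)))" by simp
qed

text \<open>Since \<delta> \<le> 1, the logarithm of |H| + \<delta> lies between those of |H| and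
  |H| + 1. Both are integrable, so the regularization can be removed by dominated
  convergence.\<close>

lemma log_majorant:
  assumes H: "sqint circ H" and z: "cmod z < 1"
    and nz: "AE t in circ. H t \<noteq> 0" and int: "integrable circ (\<lambda>t. ln (cmod (H t)))"
    and bd: "\<And>\<delta>. \<delta> > 0 \<Longrightarrow> c \<le> exp (\<M> t. ln (cmod (H t) + \<delta>) * poisson z t)"
  shows "c \<le> exp (\<M> t. ln (cmod (H t)) * poisson z t)"
proof -
  have [measurable]: "H \<in> borel_measurable borel" using sqint_measurable[OF H] by simp
  define \<delta> where "\<delta> k = 1 / (real k + 1)" for k
  have dpos: "\<delta> k > 0" for k by (simp add: \<delta>_def)
  have d1: "\<delta> k \<le> 1" for k by (simp add: \<delta>_def)
  have dlim: "\<delta> \<longlonglongrightarrow> 0" unfolding \<delta>_def by real_asymp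
  have "(\<lambda>k. \<integral>t. ln (cmod (H t) + \<delta> k) * poisson z t \<partial>circ) \<longlonglongrightarrow> (\<M> t. ln (cmod (H t)) * poisson z t)"
  proof (rule integral_dominated_convergence[where w="\<lambda>t. (\<bar>ln (cmod (H t))\<bar> + \<bar>ln (cmod (H t) + 1)\<bar>) * poisson z t"])
    show "integrable circ (\<lambda>t. (\<bar>ln (cmod (H t))\<bar> + \<bar>ln (cmod (H t) + 1)\<bar>) * poisson z t)"
      using int integrable_ln_add[OF H zero_less_one] by (intro integrable_poisson_mult z) auto
    show "AE t in circ. (\<lambda>k. ln (cmod (H t) + \<delta> k) * poisson z t) \<longlonglongrightarrow> ln (cmod (H t)) * poisson z t"
      using nz
    proof eventually_elim
      case (elim t)
      have "(\<lambda>k. ln (cmod (H t) + \<delta> k) * poisson z t) \<longlonglongrightarrow> ln (cmod (H t) + 0) * poisson z t"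
        by (intro tendsto_intros dlim) (use elim in auto)
      then show ?case by simp
    qed
    show "AE t in circ. norm (ln (cmod (H t) + \<delta> k) * poisson z t) \<le> (\<bar>ln (cmod (H t))\<bar> + \<bar>ln (cmod (H t) + 1)\<bar>) * poisson z t" for k
      using nz
    proof eventually_elim
      case (elim t)
      have "ln (cmod (H t)) \<le> ln (cmod (H t) + \<delta> k)"
        using elim dpos[of k] add_nonneg_pos[OF norm_ge_zero dpos[of k], of "H t"] by (subst ln_le_cancel_iff) auto
      moreover have "ln (cmod (H t) + \<delta> k) \<le> ln (cmod (H t) + 1)"
        using d1[of k] add_nonneg_pos[OF norm_ge_zero dpos[of k], of "H t"] by (subst ln_le_cancel_iff) auto
      ultimately have "\<bar>ln (cmod (H t) + \<delta> k)\<bar> \<le> \<bar>ln (cmod (H t))\<bar> + \<bar>ln (cmod (H t) + 1)\<bar>" by linarith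
      then show ?case using poisson_nonneg[OF z, of t] by (simp add: abs_mult mult_right_mono)
    qed
  qed (use z in measurable)
  then have "(\<lambda>k. exp (\<M> t. ln (cmod (H t) + \<delta> k) * poisson z t)) \<longlonglongrightarrow> exp (\<M> t. ln (cmod (H t)) * poisson z t)"
    by (intro tendsto_intros)
  then show ?thesis by (rule LIMSEQ_le_const) (use bd dpos in auto)
qed

section \<open>Outer functions with prescribed boundary modulus\<close>

definition outer :: "(real \<Rightarrow> real) \<Rightarrow> complex \<Rightarrow> complex" where
  "outer u z = exp (log_outer u z)"

lemma outer_holomorphic: "integrable circ u \<Longrightarrow> outer u holomorphic_on ball 0 1"
  unfolding outer_def by (intro holomorphic_intros log_outer_holomorphic)

lemma norm_outer: "integrable circ u \<Longrightarrow> cmod z < 1 \<Longrightarrow> cmod (outer u z) = exp (\<M> t. u t * poisson z t)"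
  by (simp add: outer_def Re_log_outer)

text \<open>The arithmetic-geometric mean inequality for the probability density
  \<open>poisson z\<close>. It is obtained from the tangent of the logarithm at c, the Poisson mean
  of |H|^2, that is ln x \<le> x/c - 1 + ln c.\<close>

lemma norm_outer_sq_le:
  assumes H: "sqint circ H" and z: "cmod z < 1"
    and nz: "AE t in circ. H t \<noteq> 0" and int: "integrable circ (\<lambda>t. ln (cmod (H t)))"
  shows "(cmod (outer (\<lambda>t. ln (cmod (H t))) z))\<^sup>2 \<le> (\<M> t. (cmod (H t))\<^sup>2 * poisson z t)"
proof -
  define c where "c = (\<M> t. (cmod (H t))\<^sup>2 * poisson z t)"
  have Hs: "integrable circ (\<lambda>t. (cmod (H t))\<^sup>2)" using H by (simp add: sqint_def)
  have Hp: "integrable circ (\<lambda>t. (cmod (H t))\<^sup>2 * poisson z t)" by (rule integrable_poisson_mult[OF Hs z])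
  have c0: "0 \<le> c" unfolding c_def by (intro integral_nonneg_AE AE_I2 mult_nonneg_nonneg poisson_nonneg z) auto
  have "c \<noteq> 0"
  proof
    assume "c = 0"
    then have "AE t in circ. (cmod (H t))\<^sup>2 * poisson z t = 0"
      unfolding c_def using Hp poisson_nonneg[OF z] by (subst (asm) integral_nonneg_eq_0_iff_AE) auto
    with nz have "AE t in circ. False"
      by eventually_elim (use poisson_pos[OF z] in \<open>auto simp: less_imp_neq[symmetric]\<close>)
    then show False using emeasure_circ_UNIV by (auto simp: eventually_ae_filter null_sets_def top_unique)
  qed
  then have c: "c > 0" using c0 by simp
  have "(\<M> t. (2 * ln (cmod (H t))) * poisson z t) \<le> (\<M> t. ((cmod (H t))\<^sup>2 / c - 1 + ln c) * poisson z t)"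
  proof (rule integral_mono_AE)
    show "integrable circ (\<lambda>t. (2 * ln (cmod (H t))) * poisson z t)" using int by (intro integrable_poisson_mult z) auto
    show "integrable circ (\<lambda>t. ((cmod (H t))\<^sup>2 / c - 1 + ln c) * poisson z t)" using Hs by (intro integrable_poisson_mult z) auto
    show "AE t in circ. 2 * ln (cmod (H t)) * poisson z t \<le> ((cmod (H t))\<^sup>2 / c - 1 + ln c) * poisson z t"
      using nz
    proof eventually_elim
      case (elim t)
      have "2 * ln (cmod (H t)) = ln ((cmod (H t))\<^sup>2 / c) + ln c" using elim c by (simp add: ln_div ln_realpow)
      also have "\<dots> \<le> (cmod (H t))\<^sup>2 / c - 1 + ln c" using elim c by (intro add_right_mono ln_le_minus_one) auto
      finally show ?case by (intro mult_right_mono poisson_nonneg z)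
    qed
  qed
  also have "\<dots> = (\<M> t. (cmod (H t))\<^sup>2 * poisson z t / c - poisson z t + ln c * poisson z t)"
    by (simp add: algebra_simps)
  also have "\<dots> = ln c" using Hp integrable_poisson[OF z] integral_poisson[OF z] c by (simp add: c_def[symmetric])
  finally have "2 * (\<M> t. ln (cmod (H t)) * poisson z t) \<le> ln c" by (simp add: mult.assoc)
  then have "exp (2 * (\<M> t. ln (cmod (H t)) * poisson z t)) \<le> c" using c by (metis exp_le_cancel_iff exp_ln)
  then show ?thesis unfolding norm_outer[OF int z] c_def by (simp add: exp_double)
qed

section \<open>Mean oscillation\<close>

definition mn :: "(real \<Rightarrow> complex) \<Rightarrow> real \<Rightarrow> real \<Rightarrow> complex" where
  "mn F x y = integral {x..y} F / of_real (y - x)"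

context
  fixes F :: "real \<Rightarrow> complex"
  assumes cont: "continuous_on UNIV F"
begin

lemma int_norm_diff: "(\<lambda>t. cmod (F t - c)) integrable_on {x..y}"
  and int_norm_diff_sq: "(\<lambda>t. (cmod (F t - c))\<^sup>2) integrable_on {x..y}"
  and int_norm_diff_cmult: "(\<lambda>t. k * cmod (F t - c)) integrable_on {x..y}"
  and int_F: "F integrable_on {x..y}"
  by (intro integrable_continuous_interval continuous_intros continuous_on_subset[OF cont] subset_UNIV)+

lemma mn_diff_le:
  assumes "x < y"
  shows "(y - x) * cmod (mn F x y - c) \<le> integral {x..y} (\<lambda>t. cmod (F t - c))"
proof -
  have "integral {x..y} (\<lambda>t. F t - c) = integral {x..y} F - of_real (y - x) * c"
    using assms by (subst Henstock_Kurzweil_Integration.integral_diff[OF int_F]) (auto simp: scaleR_conv_of_real)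
  also have "\<dots> = of_real (y - x) * (mn F x y - c)" using assms by (simp add: mn_def right_diff_distrib flip: of_real_diff)
  finally have "cmod (of_real (y - x) * (mn F x y - c)) \<le> integral {x..y} (\<lambda>t. cmod (F t - c))"
    using integral_norm_bound_integral[of "\<lambda>t. F t - c" "{x..y}" "\<lambda>t. cmod (F t - c)"]
      Henstock_Kurzweil_Integration.integrable_diff[OF int_F integrable_const_ivl[of c x y]] int_norm_diff by simp
  then show ?thesis using assms by (simp add: norm_mult flip: of_real_diff)
qed

text \<open>The cross term vanishes because F minus its mean has integral 0 over the
  interval.\<close>

lemma integral_square_diff:
  assumes "x < y"
  shows "integral {x..y} (\<lambda>t. (cmod (F t - c))\<^sup>2) = integral {x..y} (\<lambda>t. (cmod (F t - mn F x y))\<^sup>2) + (y - x) * (cmod (mn F x y - c))\<^sup>2"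
proof -
  define m where "m = mn F x y"
  have pt: "(cmod (F t - c))\<^sup>2 = (cmod (F t - m))\<^sup>2 + (cmod (m - c))\<^sup>2 + 2 * Re ((F t - m) * cnj (m - c))" for t
    unfolding cmod_power2 by (simp add: power2_eq_square algebra_simps)
  have i1: "(\<lambda>t. (F t - m) * cnj (m - c)) integrable_on {x..y}"
    by (intro integrable_continuous_interval continuous_intros continuous_on_subset[OF cont] subset_UNIV)
  have "integral {x..y} (\<lambda>t. F t - m) = 0"
    using assms by (subst Henstock_Kurzweil_Integration.integral_diff[OF int_F]) (auto simp: scaleR_conv_of_real m_def mn_def simp flip: of_real_diff)
  then have z: "integral {x..y} (\<lambda>t. (F t - m) * cnj (m - c)) = 0" by simp
  have r: "integral {x..y} (\<lambda>t. Re ((F t - m) * cnj (m - c))) = 0" "(\<lambda>t. Re ((F t - m) * cnj (m - c))) integrable_on {x..y}"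
    using integral_linear[OF i1 bounded_linear_Re] integrable_linear[OF i1 bounded_linear_Re] z by (auto simp: o_def)
  have "integral {x..y} (\<lambda>t. (cmod (F t - c))\<^sup>2) = integral {x..y} (\<lambda>t. ((cmod (F t - m))\<^sup>2 + (cmod (m - c))\<^sup>2) + 2 * Re ((F t - m) * cnj (m - c)))"
    by (simp add: pt)
  also have "\<dots> = integral {x..y} (\<lambda>t. (cmod (F t - m))\<^sup>2 + (cmod (m - c))\<^sup>2) + integral {x..y} (\<lambda>t. 2 * Re ((F t - m) * cnj (m - c)))"
  proof (rule Henstock_Kurzweil_Integration.integral_add)
    show "(\<lambda>t. (cmod (F t - m))\<^sup>2 + (cmod (m - c))\<^sup>2) integrable_on {x..y}"
      by (intro Henstock_Kurzweil_Integration.integrable_add int_norm_diff_sq integrable_const_ivl)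
    show "(\<lambda>t. 2 * Re ((F t - m) * cnj (m - c))) integrable_on {x..y}"
      by (intro integrable_continuous_interval continuous_intros continuous_on_subset[OF cont] subset_UNIV)
  qed
  also have "integral {x..y} (\<lambda>t. 2 * Re ((F t - m) * cnj (m - c))) = 0" using r(1) by (simp only: integral_mult_right mult_zero_right)
  also have "integral {x..y} (\<lambda>t. (cmod (F t - m))\<^sup>2 + (cmod (m - c))\<^sup>2) + 0 = integral {x..y} (\<lambda>t. (cmod (F t - m))\<^sup>2) + (y - x) * (cmod (m - c))\<^sup>2"
    using assms by (subst Henstock_Kurzweil_Integration.integral_add[OF int_norm_diff_sq]) auto
  finally show ?thesis by (simp add: m_def)
qed

text \<open>The stopping-time argument of John and Nirenberg: an interval is split in halves until its mean is
  \<open>2A\<close> away from the mean \<open>a\<close> of the ambient interval; on the stopped intervals the claim is already known.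
  Keeping the integral of \<open>|F - a|\<close> on the right-hand side makes the induction additive.\<close>

lemma John_Nirenberg_strict:
  assumes A: "A > 0" and osc: "\<And>x y. a0 \<le> x \<Longrightarrow> x < y \<Longrightarrow> y \<le> b0 \<Longrightarrow> integral {x..y} (\<lambda>t. cmod (F t - mn F x y)) \<le> A * (y - x)"
    and xy: "a0 \<le> x" "x < y" "y \<le> b0"
  shows "integral {x..y} (\<lambda>t. (cmod (F t - mn F x y))\<^sup>2) \<le> 16 * A\<^sup>2 * (y - x)"
proof -
  have "uniformly_continuous_on {a0..b0} F"
    by (intro compact_uniformly_continuous continuous_on_subset[OF cont]) auto
  then obtain \<delta> where d: "\<delta> > 0" "\<And>s t. s \<in> {a0..b0} \<Longrightarrow> t \<in> {a0..b0} \<Longrightarrow> dist s t < \<delta> \<Longrightarrow> dist (F s) (F t) < A"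
    unfolding uniformly_continuous_on_def using A by meson
  \<comment> \<open>Below the scale \<delta>/2 uniform continuity alone bounds the oscillation by A.
    Both inductions start here; this is where continuity of F replaces a limiting argument over
    infinitely many generations of intervals.\<close>
  have small: "cmod (F t - mn F x y) \<le> A" if "a0 \<le> x" "x < y" "y \<le> b0" "y - x \<le> \<delta>/2" "t \<in> {x..y}" for x y t
  proof -
    have "(y - x) * cmod (mn F x y - F t) \<le> integral {x..y} (\<lambda>s. cmod (F s - F t))" by (rule mn_diff_le) fact
    also have "\<dots> \<le> integral {x..y} (\<lambda>s. A)"
    proof (rule integral_le[OF int_norm_diff])
      fix s assume "s \<in> {x..y}"
      then have "dist (F s) (F t) < A" using that d(1) by (intro d) (auto simp: dist_real_def)
      then show "cmod (F s - F t) \<le> A" by (simp add: dist_norm)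
    qed auto
    also have "\<dots> = (y - x) * A" using that by simp
    finally show ?thesis using that by (simp add: norm_minus_commute)
  qed
  have P: "integral {x..y} (\<lambda>t. (cmod (F t - mn F x y))\<^sup>2) \<le> 16 * A\<^sup>2 * (y - x)"
    if "a0 \<le> x" "x < y" "y \<le> b0" "y - x \<le> 2^n * (\<delta>/2)" for x y n
    using that
  proof (induction n arbitrary: x y)
    case 0
    have "integral {x..y} (\<lambda>t. (cmod (F t - mn F x y))\<^sup>2) \<le> integral {x..y} (\<lambda>t. A\<^sup>2)"
      by (rule integral_le[OF int_norm_diff_sq]) (use small[of x y] 0 in \<open>auto intro!: power_mono\<close>)
    also have "\<dots> = 1 * A\<^sup>2 * (y - x)" using 0 by simp
    also have "\<dots> \<le> 16 * A\<^sup>2 * (y - x)" using 0 by (intro mult_right_mono) auto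
    finally show ?case .
  next
    case (Suc n)
    define a where "a = mn F x y"
    \<comment> \<open>The inner induction counts the halvings still possible before the scale
      \<delta>/2 is reached. Its invariant is that the mean is within 4 A of \<open>a\<close>. The
      outer hypothesis covers intervals of length at most 2^n \<delta>/2, which all the pieces
      are.\<close>
    have Q: "integral {s..t} (\<lambda>u. (cmod (F u - a))\<^sup>2) \<le> 16 * A * integral {s..t} (\<lambda>u. cmod (F u - a))"
      if "x \<le> s" "s < t" "t \<le> y" "t - s \<le> 2^n * (\<delta>/2)" "t - s \<le> 2^k * (\<delta>/2)" "cmod (mn F s t - a) \<le> 4 * A" for s t k
      using that
    proof (induction k arbitrary: s t)
      case (0 s t)
      have "cmod (F u - a) \<le> 16 * A" if "u \<in> {s..t}" for u
      proof -
        have "cmod (F u - mn F s t) \<le> A" using small[of s t u] 0 that Suc.prems by auto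
        then show ?thesis using norm_triangle_ineq[of "F u - mn F s t" "mn F s t - a"] 0 A by simp
      qed
      then have "integral {s..t} (\<lambda>u. (cmod (F u - a))\<^sup>2) \<le> integral {s..t} (\<lambda>u. 16 * A * cmod (F u - a))"
        by (intro integral_le int_norm_diff_sq int_norm_diff_cmult) (auto simp: power2_eq_square intro!: mult_right_mono)
      then show ?case by simp
    next
      case (Suc k s t)
      show ?case
      proof (cases "cmod (mn F s t - a) \<ge> 2 * A")
        case True
        \<comment> \<open>The stopped case. The mean square about \<open>a\<close> is at most 16 A^2
          from the outer hypothesis plus 16 A^2 from the distance of the means. As that distance is
          at least 2 A, the total 32 A^2 is at most 16 A times the distance, which the mean of |F -
          a| dominates.\<close>
        have "integral {s..t} (\<lambda>u. (cmod (F u - mn F s t))\<^sup>2) \<le> 16 * A\<^sup>2 * (t - s)"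
          by (rule \<open>\<And>y x. a0 \<le> x \<Longrightarrow> x < y \<Longrightarrow> y \<le> b0 \<Longrightarrow> y - x \<le> 2 ^ n * (\<delta> / 2) \<Longrightarrow> _\<close>) (use Suc.prems \<open>a0 \<le> x\<close> \<open>y \<le> b0\<close> in auto)
        moreover have "(cmod (mn F s t - a))\<^sup>2 \<le> (4*A)\<^sup>2" using Suc.prems by (intro power_mono) auto
        then have "(t - s) * (cmod (mn F s t - a))\<^sup>2 \<le> (t - s) * (16 * A\<^sup>2)" using Suc.prems by (intro mult_left_mono) auto
        moreover have "16 * A\<^sup>2 * (t - s) + (t - s) * (16 * A\<^sup>2) = 32 * A\<^sup>2 * (t - s)" by (simp add: algebra_simps)
        ultimately have "integral {s..t} (\<lambda>u. (cmod (F u - a))\<^sup>2) \<le> 32 * A\<^sup>2 * (t - s)"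
          unfolding integral_square_diff[OF Suc.prems(2), of a] by linarith
        also have "\<dots> = 16 * A * ((t - s) * (2 * A))" by (simp add: power2_eq_square)
        also have "\<dots> \<le> 16 * A * ((t - s) * cmod (mn F s t - a))" using True A Suc.prems by (intro mult_left_mono) auto
        also have "\<dots> \<le> 16 * A * integral {s..t} (\<lambda>u. cmod (F u - a))" using A Suc.prems by (intro mult_left_mono mn_diff_le) auto
        finally show ?thesis .
      next
        case False
        \<comment> \<open>An oscillation at most A over the whole interval counts at most twice over
          a half, so the mean moves by at most 2 A. Added to a distance below 2 A this keeps the
          invariant 4 A for both halves.\<close>
        define u where "u = (s + t) / 2"
        have su: "s < u" "u < t" "u - s = (t - s)/2" "t - u = (t - s)/2" using Suc.prems by (auto simp: u_def field_simps)
        have osc': "integral {s..t} (\<lambda>v. cmod (F v - mn F s t)) \<le> A * (t - s)"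
          using Suc.prems \<open>a0 \<le> x\<close> \<open>y \<le> b0\<close> by (intro osc) auto
        have comb: "integral {s..u} G + integral {u..t} G = integral {s..t} G" if "G integrable_on {s..t}" for G :: "real \<Rightarrow> real"
          by (rule Henstock_Kurzweil_Integration.integral_combine) (use su that in auto)
        have half: "integral {s..u} (\<lambda>v. cmod (F v - mn F s t)) \<le> A * (t - s)" "integral {u..t} (\<lambda>v. cmod (F v - mn F s t)) \<le> A * (t - s)"
          using osc' comb[OF int_norm_diff[of "mn F s t"]] Henstock_Kurzweil_Integration.integral_nonneg[OF int_norm_diff[of "mn F s t" s u]]
            Henstock_Kurzweil_Integration.integral_nonneg[OF int_norm_diff[of "mn F s t" u t]] by auto
        have "(u - s) * cmod (mn F s u - mn F s t) \<le> A * (t - s)" using mn_diff_le[OF su(1)] half(1) by (rule order_trans)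
        then have "(t - s) * cmod (mn F s u - mn F s t) \<le> (t - s) * (2 * A)" unfolding su by (simp add: field_simps)
        then have 1: "cmod (mn F s u - mn F s t) \<le> 2 * A" using Suc.prems by simp
        have "(t - u) * cmod (mn F u t - mn F s t) \<le> A * (t - s)" using mn_diff_le[OF su(2)] half(2) by (rule order_trans)
        then have "(t - s) * cmod (mn F u t - mn F s t) \<le> (t - s) * (2 * A)" unfolding su by (simp add: field_simps)
        then have 2: "cmod (mn F u t - mn F s t) \<le> 2 * A" using Suc.prems by simp
        have b1: "cmod (mn F s u - a) \<le> 4 * A" using norm_triangle_ineq[of "mn F s u - mn F s t" "mn F s t - a"] 1 False by simp
        have b2: "cmod (mn F u t - a) \<le> 4 * A" using norm_triangle_ineq[of "mn F u t - mn F s t" "mn F s t - a"] 2 False by simp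
        have "integral {s..u} (\<lambda>v. (cmod (F v - a))\<^sup>2) \<le> 16 * A * integral {s..u} (\<lambda>v. cmod (F v - a))"
          by (rule Suc.IH) (use su Suc.prems b1 in auto)
        moreover have "integral {u..t} (\<lambda>v. (cmod (F v - a))\<^sup>2) \<le> 16 * A * integral {u..t} (\<lambda>v. cmod (F v - a))"
          by (rule Suc.IH) (use su Suc.prems b2 in auto)
        ultimately show ?thesis
          unfolding comb[OF int_norm_diff_sq[of a], symmetric] comb[OF int_norm_diff[of a], symmetric] distrib_left by simp
      qed
    qed
    define u where "u = (x + y) / 2"
    have su: "x < u" "u < y" "u - x = (y - x)/2" "y - u = (y - x)/2" using Suc.prems by (auto simp: u_def field_simps)
    have osc': "integral {x..y} (\<lambda>v. cmod (F v - a)) \<le> A * (y - x)" unfolding a_def using Suc.prems by (intro osc) auto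
    have comb: "integral {x..u} G + integral {u..y} G = integral {x..y} G" if "G integrable_on {x..y}" for G :: "real \<Rightarrow> real"
      by (rule Henstock_Kurzweil_Integration.integral_combine) (use su that in auto)
    have half: "integral {x..u} (\<lambda>v. cmod (F v - a)) \<le> A * (y - x)" "integral {u..y} (\<lambda>v. cmod (F v - a)) \<le> A * (y - x)"
      using osc' comb[OF int_norm_diff[of a]] Henstock_Kurzweil_Integration.integral_nonneg[OF int_norm_diff[of a x u]]
        Henstock_Kurzweil_Integration.integral_nonneg[OF int_norm_diff[of a u y]] by auto
    have "(u - x) * cmod (mn F x u - a) \<le> A * (y - x)" using mn_diff_le[OF su(1)] half(1) by (rule order_trans)
    then have "(y - x) * cmod (mn F x u - a) \<le> (y - x) * (2 * A)" unfolding su by (simp add: field_simps)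
    then have 1: "cmod (mn F x u - a) \<le> 4 * A" using Suc.prems A by simp
    have "(y - u) * cmod (mn F u y - a) \<le> A * (y - x)" using mn_diff_le[OF su(2)] half(2) by (rule order_trans)
    then have "(y - x) * cmod (mn F u y - a) \<le> (y - x) * (2 * A)" unfolding su by (simp add: field_simps)
    then have 2: "cmod (mn F u y - a) \<le> 4 * A" using Suc.prems A by simp
    have "integral {x..u} (\<lambda>v. (cmod (F v - a))\<^sup>2) \<le> 16 * A * integral {x..u} (\<lambda>v. cmod (F v - a))"
      by (rule Q[where k=n]) (use su Suc.prems 1 in auto)
    moreover have "integral {u..y} (\<lambda>v. (cmod (F v - a))\<^sup>2) \<le> 16 * A * integral {u..y} (\<lambda>v. cmod (F v - a))"
      by (rule Q[where k=n]) (use su Suc.prems 2 in auto)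
    ultimately have "integral {x..y} (\<lambda>v. (cmod (F v - a))\<^sup>2) \<le> 16 * A * integral {x..y} (\<lambda>v. cmod (F v - a))"
      unfolding comb[OF int_norm_diff_sq[of a], symmetric] comb[OF int_norm_diff[of a], symmetric] distrib_left by simp
    also have "\<dots> \<le> 16 * A * (A * (y - x))" using osc' A by (intro mult_left_mono) auto
    finally show ?case by (simp add: a_def power2_eq_square mult_ac)
  qed
  obtain n where "(y - x) / (\<delta>/2) < 2^n" using real_arch_pow[of 2 "(y - x) / (\<delta>/2)"] by auto
  then have "y - x \<le> 2^n * (\<delta>/2)" using d by (simp add: field_simps)
  then show ?thesis using P xy by blast
qed

lemma John_Nirenberg:
  assumes A: "A \<ge> 0" and osc: "\<And>x y. a0 \<le> x \<Longrightarrow> x < y \<Longrightarrow> y \<le> b0 \<Longrightarrow> integral {x..y} (\<lambda>t. cmod (F t - mn F x y)) \<le> A * (y - x)"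
    and xy: "a0 \<le> x" "x < y" "y \<le> b0"
  shows "integral {x..y} (\<lambda>t. (cmod (F t - mn F x y))\<^sup>2) \<le> 16 * A\<^sup>2 * (y - x)"
proof (rule tendsto_lowerbound[OF _ _ trivial_limit_at_right_real])
  have "((\<lambda>e. 16 * (A + e)\<^sup>2 * (y - x)) \<longlongrightarrow> 16 * (A + 0)\<^sup>2 * (y - x)) (at_right 0)" by (intro tendsto_intros)
  then show "((\<lambda>e. 16 * (A + e)\<^sup>2 * (y - x)) \<longlongrightarrow> 16 * A\<^sup>2 * (y - x)) (at_right 0)" by simp
  show "eventually (\<lambda>e. integral {x..y} (\<lambda>t. (cmod (F t - mn F x y))\<^sup>2) \<le> 16 * (A + e)\<^sup>2 * (y - x)) (at_right 0)"
    using eventually_at_right_less[of 0]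
  proof eventually_elim
    case (elim e)
    show ?case
    proof (rule John_Nirenberg_strict[OF _ _ xy])
      fix x y assume "a0 \<le> x" "x < y" "y \<le> b0"
      then have "integral {x..y} (\<lambda>t. cmod (F t - mn F x y)) \<le> A * (y - x)" by (rule osc)
      also have "\<dots> \<le> (A + e) * (y - x)" using \<open>x < y\<close> elim by (intro mult_right_mono) auto
      finally show "integral {x..y} (\<lambda>t. cmod (F t - mn F x y)) \<le> (A + e) * (y - x)" .
    qed (use A elim in simp)
  qed
qed

end

section \<open>Dyadic domination of the Poisson kernel\<close>

lemma sin_ge_linear:
  assumes "0 \<le> x" "x \<le> pi/2"
  shows "2 / pi * x \<le> sin x"
proof -
  have c: "convex_on {0..pi/2} (\<lambda>x. - sin x)"
  proof (rule f''_ge0_imp_convex[where f'="\<lambda>x. - cos x" and f''="\<lambda>x. sin x"])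
    show "((\<lambda>x. - sin x) has_real_derivative - cos x) (at x)" for x by (auto intro!: derivative_eq_intros)
    show "((\<lambda>x. - cos x) has_real_derivative sin x) (at x)" for x by (auto intro!: derivative_eq_intros)
    show "0 \<le> sin x" if "x \<in> {0..pi/2}" for x using that by (intro sin_ge_zero) auto
  qed auto
  define t where "t = 2 / pi * x"
  have t: "0 \<le> t" "t \<le> 1" using assms by (auto simp: t_def field_simps)
  have "- sin ((1 - t) *\<^sub>R 0 + t *\<^sub>R (pi/2)) \<le> (1 - t) * (- sin 0) + t * (- sin (pi/2))"
    by (rule convex_onD[OF c]) (use t in auto)
  moreover have "t * (pi/2) = x" by (simp add: t_def)
  ultimately show ?thesis by (simp add: t_def)
qed

lemma cis_diff_lower:
  assumes "\<bar>t - \<alpha>\<bar> \<le> pi"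
  shows "2 * \<bar>t - \<alpha>\<bar> / pi \<le> cmod (cis t - cis \<alpha>)"
proof -
  define s where "s = (t - \<alpha>) / 2"
  have "cis t - cis \<alpha> = cis ((t + \<alpha>)/2) * (cis s - cis (-s))"
    by (simp add: right_diff_distrib cis_mult s_def diff_divide_distrib add_divide_distrib)
  also have "cis s - cis (-s) = 2 * \<i> * of_real (sin s)" by (simp add: complex_eq_iff)
  finally have "cmod (cis t - cis \<alpha>) = 2 * \<bar>sin s\<bar>" by (simp add: norm_mult)
  also have "\<bar>sin s\<bar> = \<bar>sin \<bar>s\<bar>\<bar>" by (simp add: abs_if)
  finally have "cmod (cis t - cis \<alpha>) = 2 * \<bar>sin \<bar>s\<bar>\<bar>" .
  moreover have "2 / pi * \<bar>s\<bar> \<le> sin \<bar>s\<bar>"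
    using assms by (intro sin_ge_linear) (auto simp: s_def)
  moreover have "2 / pi * \<bar>s\<bar> = \<bar>t - \<alpha>\<bar> / pi" by (simp add: s_def abs_divide)
  ultimately show ?thesis by simp
qed

text \<open>With 1 - |z| of order 2^-n, the j-th interval has half-length \<pi> 2^j / 2^n and the
  last one is a full period. A point outside the (j-1)-st interval has distance at least 2^(j-1) /
  2^n from z, because chords are at least 2/\<pi> times the arc and 1 - |z| is absorbed. The kernel
  is then at most 8 2^n / 4^j.\<close>

lemma poisson_le_dyadic:
  assumes z: "z = of_real \<rho> * cis \<alpha>" and \<rho>: "0 \<le> \<rho>" "1 / 2^(n+1) \<le> 1 - \<rho>" "1 - \<rho> \<le> 1 / 2^n"
    and t: "\<bar>t - \<alpha>\<bar> \<le> pi"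
  shows "poisson z t \<le> (\<Sum>j\<le>n. 8 * 2^n / 4^j * indicator {\<alpha> - pi * 2^j / 2^n .. \<alpha> + pi * 2^j / 2^n} t)"
proof -
  define s where "s = \<bar>t - \<alpha>\<bar>"
  define S where "S = (\<Sum>j\<le>n. 8 * 2^n / 4^j * indicator {\<alpha> - pi * 2^j / 2^n .. \<alpha> + pi * 2^j / 2^n} t :: real)"
  have r1: "\<rho> < 1" using \<rho>(2) by (smt (verit) zero_less_divide_1_iff zero_less_power)
  have nz: "cmod z = \<rho>" using \<rho> by (simp add: z norm_mult)
  have z1: "cmod z < 1" using r1 nz by simp
  have termS: "8 * 2^n / 4^j \<le> S" if "j \<le> n" "s \<le> pi * 2^j / 2^n" for j
  proof -
    have "8 * 2^n / 4^j = (8 * 2^n / 4^j :: real) * indicator {\<alpha> - pi * 2^j / 2^n .. \<alpha> + pi * 2^j / 2^n} t"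
      using that(2) by (auto simp: s_def indicator_def abs_le_iff)
    also have "\<dots> \<le> S" unfolding S_def by (rule member_le_sum) (use that in auto)
    finally show ?thesis .
  qed
  show ?thesis
  proof (cases "s \<le> pi / 2^n")
    case True
    have "poisson z t \<le> 2 / (1 - cmod z)" by (rule poisson_le[OF z1])
    also have "\<dots> \<le> 2 / (1 / 2^(n+1))" unfolding nz using \<rho> r1 by (intro divide_left_mono) auto
    also have "\<dots> \<le> 8 * 2^n / 4^0" by simp
    also have "\<dots> \<le> S" by (rule termS) (use True in auto)
    finally show ?thesis by (simp add: S_def)
  next
    case False
    have ex: "s \<le> pi * 2^n / 2^n" using t by (simp add: s_def)
    \<comment> \<open>The first interval that contains t; failing to lie in its predecessor yields
      the lower bound for the distance to z.\<close>
    define j where "j = (LEAST j. s \<le> pi * 2^j / 2^n)"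
    have j: "s \<le> pi * 2^j / 2^n" unfolding j_def by (rule LeastI) (rule ex)
    have jn: "j \<le> n" unfolding j_def by (rule Least_le) (rule ex)
    have "j \<noteq> 0" using j False by (intro notI) simp
    then obtain k where k: "j = Suc k" using not0_implies_Suc by blast
    have "\<not> s \<le> pi * 2^k / 2^n" using not_less_Least[of k "\<lambda>j. s \<le> pi * 2^j / 2^n"] k j_def by auto
    then have sk: "2^k / 2^n \<le> s / pi" by (simp add: field_simps)
    have "2 * s / pi \<le> cmod (cis t - cis \<alpha>)" unfolding s_def by (rule cis_diff_lower[OF t])
    also have "\<dots> \<le> cmod (cis t - z) + cmod (z - cis \<alpha>)" by (rule norm_diff_triangle_ineq[of "cis t" z z "cis \<alpha>", simplified])
    also have "cmod (z - cis \<alpha>) = 1 - \<rho>"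
    proof -
      have "z - cis \<alpha> = of_real (\<rho> - 1) * cis \<alpha>" by (simp add: z algebra_simps)
      then have "cmod (z - cis \<alpha>) = \<bar>\<rho> - 1\<bar>" by (simp only: norm_mult norm_of_real norm_cis mult_1_right)
      then show ?thesis using r1 by simp
    qed
    also have "1 - \<rho> \<le> cmod (cis t - z)" using cis_diff_ge[of z t] nz by simp
    finally have "s / pi \<le> cmod (cis t - z)" by simp
    with sk have lo: "2^k / 2^n \<le> cmod (cis t - z)" by simp
    have "poisson z t \<le> (1 - (cmod z)\<^sup>2) / (2^k / 2^n)\<^sup>2"
      unfolding poisson_def using z1 lo by (intro divide_left_mono power_mono mult_pos_pos zero_less_power) (auto simp: abs_square_le_1 cis_neq)
    also have "1 - (cmod z)\<^sup>2 = (1 + \<rho>) * (1 - \<rho>)" unfolding nz by (simp add: power2_eq_square algebra_simps)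
    also have "(1 + \<rho>) * (1 - \<rho>) / (2^k / 2^n)\<^sup>2 \<le> 2 * (1 / 2^n) / (2^k / 2^n)\<^sup>2" using r1 \<rho> by (intro divide_right_mono mult_mono) auto
    also have "(2^k / 2^n :: real)\<^sup>2 = 4^k / 4^n" by (simp add: power_divide power2_eq_square power_mult_distrib[symmetric])
    also have "2 * (1 / 2^n) / (4^k / 4^n :: real) = 8 * 2^n / 4^j"
    proof -
      have "(4::real)^n = 2^n * 2^n" by (simp add: power_mult_distrib[symmetric])
      then show ?thesis unfolding k by simp
    qed
    also have "\<dots> \<le> S" by (rule termS) (use j jn in auto)
    finally show ?thesis by (simp add: S_def)
  qed
qed

lemma set_integral_subset_le:
  fixes f :: "'a \<Rightarrow> real"
  assumes "set_integrable M B f" "A \<in> sets M" "A \<subseteq> B" "\<And>x. x \<in> B \<Longrightarrow> 0 \<le> f x"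
  shows "set_lebesgue_integral M A f \<le> set_lebesgue_integral M B f"
proof -
  have "set_integrable M A f" by (rule set_integrable_subset[OF assms(1-3)])
  then show ?thesis unfolding set_lebesgue_integral_def
    by (intro integral_mono) (use assms in \<open>auto simp: set_integrable_def indicator_def\<close>)
qed

lemma circ_integral_window_HK:
  fixes G :: "real \<Rightarrow> real"
  assumes per: "\<And>x. G (x + 2*pi) = G x" and c: "continuous_on UNIV G"
  shows "(\<M> x. G x) = integral {a..a+2*pi} G / (2*pi)"
proof -
  have m: "G \<in> borel_measurable borel" using c by (rule borel_measurable_continuous_onI)
  have si: "set_integrable lborel {a..a+2*pi} G"
    using integrable_circ_window[of G, OF per m] integrable_circ_continuous[OF c] by simp
  have "(2*pi) *\<^sub>R (\<M> x. G x) = (LBINT x:{a..a+2*pi}. G x)" by (rule integral_circ_window[of G, OF per m, symmetric])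
  also have "\<dots> = integral {a..a+2*pi} G" using si by (rule set_borel_integral_eq_integral)
  finally show ?thesis by (simp add: field_simps)
qed

text \<open>c is the mean over the smallest interval, of length 2 \<pi> / 2^n. Each doubling moves
  the mean by at most 2 \<Phi>, which accounts for the factor 1 + j. Kernel size 8 2^n / 4^j times
  length 2 \<pi> 2^j / 2^n, divided by 2 \<pi>, is 8 / 2^j, and 256 = 8 * 32.\<close>

lemma poisson_oscillation:
  fixes F :: "real \<Rightarrow> complex"
  assumes cont: "continuous_on UNIV F" and per: "\<And>x. F (x + 2*pi) = F x"
    and osc: "\<And>a L. 0 < L \<Longrightarrow> L \<le> 2*pi \<Longrightarrow> integral {a..a+L} (\<lambda>t. cmod (F t - mn F a (a+L))) \<le> L * \<Phi> L"
    and mono: "\<And>s t. 0 < s \<Longrightarrow> s \<le> t \<Longrightarrow> t \<le> 2*pi \<Longrightarrow> \<Phi> s \<le> \<Phi> t"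
    and nn: "\<And>s. 0 < s \<Longrightarrow> s \<le> 2*pi \<Longrightarrow> 0 \<le> \<Phi> s"
    and z: "1 / 2^(n+1) \<le> 1 - cmod z" "1 - cmod z \<le> 1 / 2^n"
  obtains c where "(\<M> \<theta>. (cmod (F \<theta> - c))\<^sup>2 * poisson z \<theta>) \<le> (\<Sum>j\<le>n. 256 / 2^j * ((1 + real j) * \<Phi> (2*pi*2^j/2^n))\<^sup>2)"
proof -
  define \<alpha> where "\<alpha> = Arg z"
  have zeq: "z = of_real (cmod z) * cis \<alpha>" unfolding \<alpha>_def using rcis_cmod_Arg[of z] by (simp add: rcis_def)
  have z1: "cmod z < 1" using z(1) by (smt (verit) zero_less_divide_1_iff zero_less_power)
  define lo where "lo j = \<alpha> - pi * 2^j / 2^n" for j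
  define hi where "hi j = \<alpha> + pi * 2^j / 2^n" for j
  define L where "L j = 2*pi*2^j/2^n" for j
  define m where "m j = mn F (lo j) (hi j)" for j
  define c where "c = m 0"
  have hl: "hi j = lo j + L j" for j by (simp add: hi_def lo_def L_def field_simps)
  have L0: "0 < L j" for j by (simp add: L_def)
  have Ln: "L j \<le> 2*pi" if "j \<le> n" for j
  proof -
    have "(2::real)^j \<le> 2^n" using that by (intro power_increasing) auto
    then show ?thesis by (simp add: L_def field_simps)
  qed
  have Lmono: "L i \<le> L j" if "i \<le> j" for i j
  proof -
    have "(2::real)^i \<le> 2^j" using that by (intro power_increasing) auto
    then show ?thesis by (simp add: L_def divide_right_mono)
  qed
  have pm: "\<Phi> (L i) \<le> \<Phi> (L j)" if "i \<le> j" "j \<le> n" for i j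
    using that by (intro mono L0 Lmono Ln)
  have p0: "0 \<le> \<Phi> (L j)" if "j \<le> n" for j using that by (intro nn L0 Ln)
  \<comment> \<open>The factor 2 is the ratio of the lengths of two consecutive intervals.\<close>
  have step: "cmod (m j - m (Suc j)) \<le> 2 * \<Phi> (L (Suc j))" if "Suc j \<le> n" for j
  proof -
    have sub: "lo (Suc j) \<le> lo j" "hi j \<le> hi (Suc j)" by (simp_all add: lo_def hi_def divide_right_mono)
    have "L j * cmod (m j - m (Suc j)) \<le> integral {lo j..hi j} (\<lambda>t. cmod (F t - m (Suc j)))"
      using mn_diff_le[OF cont, of "lo j" "hi j" "m (Suc j)"] L0[of j] by (simp add: hl m_def)
    also have "\<dots> \<le> integral {lo (Suc j)..hi (Suc j)} (\<lambda>t. cmod (F t - m (Suc j)))"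
      by (rule integral_subset_le) (use sub int_norm_diff[OF cont] in auto)
    also have "\<dots> \<le> L (Suc j) * \<Phi> (L (Suc j))" using osc[OF L0 Ln[OF that], of "lo (Suc j)"] by (simp add: hl m_def)
    finally have "L j * cmod (m j - m (Suc j)) \<le> L (Suc j) * \<Phi> (L (Suc j))" .
    moreover have "L (Suc j) * x = L j * (2 * x)" for x by (simp add: L_def)
    ultimately have "L j * cmod (m j - m (Suc j)) \<le> L j * (2 * \<Phi> (L (Suc j)))" by simp
    then show ?thesis using L0[of j] by simp
  qed
  have md: "cmod (m j - c) \<le> 2 * real j * \<Phi> (L j)" if "j \<le> n" for j
    using that
  proof (induction j)
    case (Suc j)
    have "cmod (m (Suc j) - c) \<le> cmod (m (Suc j) - m j) + cmod (m j - c)"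
      using norm_triangle_ineq[of "m (Suc j) - m j" "m j - c"] by simp
    also have "\<dots> \<le> 2 * \<Phi> (L (Suc j)) + 2 * real j * \<Phi> (L j)"
      using step[OF Suc.prems] Suc by (intro add_mono) (auto simp: norm_minus_commute)
    also have "\<dots> \<le> 2 * \<Phi> (L (Suc j)) + 2 * real j * \<Phi> (L (Suc j))"
      using pm[of j "Suc j"] Suc.prems by (intro add_mono mult_left_mono) auto
    finally show ?case by (simp add: algebra_simps)
  qed (simp add: c_def)
  have I: "integral {lo j..hi j} (\<lambda>t. (cmod (F t - c))\<^sup>2) \<le> L j * (32 * ((1 + real j) * \<Phi> (L j))\<^sup>2)" if j: "j \<le> n" for j
  proof -
    have "integral {lo j..hi j} (\<lambda>t. (cmod (F t - m j))\<^sup>2) \<le> 16 * (\<Phi> (L j))\<^sup>2 * (hi j - lo j)"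
      unfolding m_def
    proof (rule John_Nirenberg[OF cont p0[OF j], where ?a0.0="lo j" and ?b0.0="hi j"])
      fix x y assume xy: "lo j \<le> x" "x < y" "y \<le> hi j"
      have yx: "0 < y - x" "y - x \<le> L j" using xy by (auto simp: hl)
      have "integral {x..x+(y-x)} (\<lambda>t. cmod (F t - mn F x (x+(y-x)))) \<le> (y - x) * \<Phi> (y - x)"
        using yx Ln[OF j] by (intro osc) auto
      also have "\<dots> \<le> (y - x) * \<Phi> (L j)" using yx Ln[OF j] by (intro mult_left_mono mono) auto
      finally show "integral {x..y} (\<lambda>t. cmod (F t - mn F x y)) \<le> \<Phi> (L j) * (y - x)" by (simp add: mult.commute)
    qed (use L0[of j] hl in auto)
    moreover have "(cmod (m j - c))\<^sup>2 \<le> (2 * real j * \<Phi> (L j))\<^sup>2" using md[OF j] by (intro power_mono) auto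
    then have "L j * (cmod (m j - c))\<^sup>2 \<le> L j * (2 * real j * \<Phi> (L j))\<^sup>2" using L0[of j] by (intro mult_left_mono) auto
    moreover have "integral {lo j..hi j} (\<lambda>t. (cmod (F t - c))\<^sup>2) = integral {lo j..hi j} (\<lambda>t. (cmod (F t - m j))\<^sup>2) + (hi j - lo j) * (cmod (m j - c))\<^sup>2"
      unfolding m_def by (rule integral_square_diff[OF cont]) (use L0[of j] hl in simp)
    moreover have "hi j - lo j = L j" by (simp add: hl)
    ultimately have "integral {lo j..hi j} (\<lambda>t. (cmod (F t - c))\<^sup>2) \<le> 16 * (\<Phi> (L j))\<^sup>2 * L j + L j * (2 * real j * \<Phi> (L j))\<^sup>2"
      by simp
    also have "\<dots> = L j * ((16 + 4 * (real j)\<^sup>2) * (\<Phi> (L j))\<^sup>2)" by (simp add: distrib_left distrib_right power_mult_distrib)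
    \<comment> \<open>16 comes from the John-Nirenberg bound and 4 j^2 from the square of the
      distance 2 j \<Phi> of the means.\<close>
    also have "\<dots> \<le> L j * ((32 * (1 + real j)\<^sup>2) * (\<Phi> (L j))\<^sup>2)"
    proof (intro mult_left_mono mult_right_mono)
      have "(real j)\<^sup>2 \<le> (1 + real j)\<^sup>2" "1 \<le> (1 + real j)\<^sup>2" by (auto intro: power_mono simp: one_le_power)
      then show "16 + 4 * (real j)\<^sup>2 \<le> 32 * (1 + real j)\<^sup>2" by linarith
    qed (use L0[of j] in auto)
    finally show ?thesis by (simp only: power_mult_distrib mult.assoc)
  qed
  define G where "G \<theta> = (cmod (F \<theta> - c))\<^sup>2" for \<theta>
  have Gc: "continuous_on X G" for X unfolding G_def by (intro continuous_intros continuous_on_subset[OF cont]) auto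
  have G0: "0 \<le> G \<theta>" for \<theta> by (simp add: G_def)
  define k where "k j = 8 * 2^n / (4::real)^j" for j
  have Gi: "(\<lambda>\<theta>. k j * (indicator {lo j..hi j} \<theta> * G \<theta>)) integrable_on {\<alpha>-pi..\<alpha>+pi}"
    and Gv: "integral {\<alpha>-pi..\<alpha>+pi} (\<lambda>\<theta>. k j * (indicator {lo j..hi j} \<theta> * G \<theta>)) = k j * integral {lo j..hi j} G"
    if j: "j \<le> n" for j
  proof -
    have sub: "{lo j..hi j} \<subseteq> {\<alpha>-pi..\<alpha>+pi}"
    proof -
      have "(2::real)^j \<le> 2^n" using j by (intro power_increasing) auto
      then have "pi * 2^j / 2^n \<le> pi" by (simp add: field_simps)
      then show ?thesis by (auto simp: lo_def hi_def)
    qed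
    have eq: "(\<lambda>\<theta>. indicator {lo j..hi j} \<theta> * G \<theta>) = (\<lambda>\<theta>. if \<theta> \<in> {lo j..hi j} then G \<theta> else 0)" by (auto simp: indicator_def)
    have "(\<lambda>\<theta>. indicator {lo j..hi j} \<theta> * G \<theta>) integrable_on {\<alpha>-pi..\<alpha>+pi}"
      unfolding eq using sub by (subst integrable_restrict_Int) (auto simp: Int_absorb2 Int_absorb1 intro!: integrable_continuous_interval Gc)
    then show "(\<lambda>\<theta>. k j * (indicator {lo j..hi j} \<theta> * G \<theta>)) integrable_on {\<alpha>-pi..\<alpha>+pi}"
      using integrable_on_mult_right by blast
    show "integral {\<alpha>-pi..\<alpha>+pi} (\<lambda>\<theta>. k j * (indicator {lo j..hi j} \<theta> * G \<theta>)) = k j * integral {lo j..hi j} G"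
    proof -
      have "(G has_integral integral {lo j..hi j} G) {lo j..hi j}" by (intro integrable_integral integrable_continuous_interval Gc)
      then have "((\<lambda>\<theta>. if \<theta> \<in> {lo j..hi j} then G \<theta> else 0) has_integral integral {lo j..hi j} G) {\<alpha>-pi..\<alpha>+pi}"
        using has_integral_restrict[OF sub, of G] by simp
      then show ?thesis unfolding integral_mult_right eq by (simp add: integral_unique)
    qed
  qed
  have "(\<M> \<theta>. G \<theta> * poisson z \<theta>) = integral {\<alpha>-pi..\<alpha>-pi+2*pi} (\<lambda>\<theta>. G \<theta> * poisson z \<theta>) / (2*pi)"
    by (rule circ_integral_window_HK)
       (auto simp: poisson_periodic G_def per intro!: continuous_intros continuous_on_poisson z1 cont)
  also have "{\<alpha>-pi..\<alpha>-pi+2*pi} = {\<alpha>-pi..\<alpha>+pi}" by simp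
  also have "integral {\<alpha>-pi..\<alpha>+pi} (\<lambda>\<theta>. G \<theta> * poisson z \<theta>) \<le> integral {\<alpha>-pi..\<alpha>+pi} (\<lambda>\<theta>. \<Sum>j\<le>n. k j * (indicator {lo j..hi j} \<theta> * G \<theta>))"
  proof (rule integral_le)
    show "(\<lambda>\<theta>. G \<theta> * poisson z \<theta>) integrable_on {\<alpha>-pi..\<alpha>+pi}"
      by (intro integrable_continuous_interval continuous_intros Gc continuous_on_subset[OF continuous_on_poisson[OF z1]]) auto
    show "(\<lambda>\<theta>. \<Sum>j\<le>n. k j * (indicator {lo j..hi j} \<theta> * G \<theta>)) integrable_on {\<alpha>-pi..\<alpha>+pi}"
      by (intro integrable_sum) (auto intro: Gi)
    fix \<theta> assume "\<theta> \<in> {\<alpha>-pi..\<alpha>+pi}"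
    then have "\<bar>\<theta> - \<alpha>\<bar> \<le> pi" by auto
    then have "poisson z \<theta> \<le> (\<Sum>j\<le>n. k j * indicator {lo j..hi j} \<theta>)"
      unfolding k_def lo_def hi_def using z by (intro poisson_le_dyadic[OF zeq]) auto
    then have "G \<theta> * poisson z \<theta> \<le> G \<theta> * (\<Sum>j\<le>n. k j * indicator {lo j..hi j} \<theta>)" by (intro mult_left_mono G0)
    also have "G \<theta> * (\<Sum>j\<le>n. k j * indicator {lo j..hi j} \<theta>) = (\<Sum>j\<le>n. k j * (indicator {lo j..hi j} \<theta> * G \<theta>))"
      unfolding sum_distrib_left by (intro sum.cong refl) (simp only: mult_ac)
    finally show "G \<theta> * poisson z \<theta> \<le> (\<Sum>j\<le>n. k j * (indicator {lo j..hi j} \<theta> * G \<theta>))" .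
  qed
  also have "\<dots> = (\<Sum>j\<le>n. integral {\<alpha>-pi..\<alpha>+pi} (\<lambda>\<theta>. k j * (indicator {lo j..hi j} \<theta> * G \<theta>)))"
    by (rule Henstock_Kurzweil_Integration.integral_sum) (auto intro: Gi)
  also have "\<dots> = (\<Sum>j\<le>n. k j * integral {lo j..hi j} G)"
    by (intro sum.cong refl) (simp only: Gv atMost_iff)
  also have "\<dots> \<le> (\<Sum>j\<le>n. k j * (L j * (32 * ((1 + real j) * \<Phi> (L j))\<^sup>2)))"
    using I by (intro sum_mono mult_left_mono) (auto simp: k_def G_def[abs_def])
  also have "\<dots> / (2*pi) = (\<Sum>j\<le>n. 256 / 2^j * ((1 + real j) * \<Phi> (2*pi*2^j/2^n))\<^sup>2)"
    unfolding sum_divide_distrib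
  proof (rule sum.cong[OF refl])
    fix j
    have four: "(4::real)^j = 2^j * 2^j" by (simp add: power_mult_distrib[symmetric])
    have "k j * L j = 8 / 2^j * (2*pi)" unfolding k_def L_def four by (simp add: field_simps)
    then have "k j * (L j * (32 * ((1 + real j) * \<Phi> (L j))\<^sup>2)) = 8 / 2^j * (2*pi) * (32 * ((1 + real j) * \<Phi> (L j))\<^sup>2)"
      by (simp only: mult.assoc[symmetric])
    then show "k j * (L j * (32 * ((1 + real j) * \<Phi> (L j))\<^sup>2)) / (2*pi) = 256 / 2^j * ((1 + real j) * \<Phi> (2*pi*2^j/2^n))\<^sup>2"
      by (simp add: L_def)
  qed
  finally show ?thesis using that[of c] by (simp add: G_def divide_right_mono)
qed

section \<open>The Dini condition on dyadic scales\<close>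

text \<open>On (2^-(N+1), 2^-N] monotonicity bounds w(t)/t from below by w(2^-(N+1)) 2^N, and the
  interval has length 2^-(N+1). Each term thus costs twice its share of the integral.\<close>

lemma Dini_summable:
  assumes w: "majorant w" and int: "set_integrable lborel {0<..1} (\<lambda>t. w t / t)"
  shows "summable (\<lambda>n. w (1 / 2^n))"
proof -
  have mono: "w s \<le> w t" if "0 \<le> s" "s \<le> t" "t \<le> 1" for s t
    using w that unfolding majorant_def mono_on_def by auto
  have nn: "0 \<le> w t" if "0 \<le> t" "t \<le> 1" for t using mono[of 0 t] that w by (auto simp: majorant_def)
  define I where "I N = (LBINT t:{1/2^N<..1}. w t / t)" for N :: nat
  have si: "set_integrable lborel X (\<lambda>t. w t / t)" if "X \<subseteq> {0<..1}" "X \<in> sets lborel" for X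
    using set_integrable_subset[OF int that(2,1)] .
  have sub: "{1/2^N<..b} \<subseteq> {0<..(1::real)}" if "b \<le> 1" for N :: nat and b
  proof -
    have "(0::real) < 1/2^N" by simp
    then show ?thesis using that by (meson atLeastAtMost_iff greaterThanAtMost_iff less_trans order_trans subsetI)
  qed
  have part: "(\<Sum>n<N. w (1/2^Suc n)) / 2 \<le> I N" for N
  proof (induction N)
    case 0 then show ?case by (simp add: I_def set_lebesgue_integral_def)
  next
    case (Suc N)
    have p: "(1::real) / 2^Suc N \<le> 1 / 2^N" "(1::real)/2^N \<le> 1" by (simp_all add: field_simps)
    have "{1/2^Suc N<..1} = {1/2^Suc N<..1/2^N} \<union> {1/2^N<..(1::real)}"
      by (auto simp del: power_Suc intro: order_trans[OF _ p(2)] order.strict_trans1[OF p(1)])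
    then have "I (Suc N) = (LBINT t:{1/2^Suc N<..1/2^N}. w t / t) + I N"
      unfolding I_def using set_integral_Un[of "{1/2^Suc N<..1/2^N}" "{1/2^N<..1}" lborel "\<lambda>t. w t / t"]
        si[OF sub[OF p(2)], of "Suc N"] si[OF sub[OF order_refl], of N] by (simp add: ivl_disj_int_two)
    moreover have "w (1/2^Suc N) / 2 \<le> (LBINT t:{1/2^Suc N<..1/2^N}. w t / t)"
    proof -
      have "w (1/2^Suc N) / 2 = (LBINT t:{1/2^Suc N<..1/2^N::real}. w (1/2^Suc N) * 2^N)"
      proof -
        have "measure lborel {1/2^Suc N<..1/2^N::real} = (1::real)/2^N - 1/2^Suc N" using p by simp
        then have "measure lborel {1/2^Suc N<..1/2^N::real} * 2^N = (1::real)/2" by (simp add: field_simps)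
        then show ?thesis by (simp add: set_lebesgue_integral_def del: power_Suc)
      qed
      also have "\<dots> \<le> (LBINT t:{1/2^Suc N<..1/2^N}. w t / t)"
      proof (rule set_integral_mono)
        show "set_integrable lborel {1/2^Suc N<..1/2^N} (\<lambda>t. w t / t)"
          by (rule si[OF sub[OF p(2)]]) simp
        show "set_integrable lborel {1/2^Suc N<..1/2^N} (\<lambda>t::real. w (1/2^Suc N) * 2^N)"
          unfolding set_integrable_def using p by (intro integrable_scaleR_left) (auto simp: integrable_indicator_iff)
        fix t :: real assume t: "t \<in> {1/2^Suc N<..1/2^N}"
        have "0 < (1::real)/2^Suc N" by simp
        then have t0: "0 < t" using t by (meson greaterThanAtMost_iff less_trans)
        have "2^N \<le> 1 / t" using t t0 by (simp add: field_simps)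
        moreover have t1: "t \<le> 1" using t p(2) by (meson greaterThanAtMost_iff order_trans)
        then have "w (1/2^Suc N) \<le> w t" using t by (intro mono) (auto simp del: power_Suc)
        ultimately have "w (1/2^Suc N) * 2^N \<le> w t * (1 / t)"
          using nn[of t] t0 t1 by (intro mult_mono) auto
        then show "w (1/2^Suc N) * 2^N \<le> w t / t" by simp
      qed
      finally show ?thesis .
    qed
    ultimately show ?case using Suc by simp
  qed
  have IB: "I N \<le> (LBINT t:{0<..1}. w t / t)" for N
    unfolding I_def
    by (rule set_integral_subset_le[OF int _ sub[OF order_refl]]) (auto simp: nn)
  have "summable (\<lambda>n. w (1/2^Suc n))"
  proof (rule summableI_nonneg_bounded)
    show "0 \<le> w (1/2^Suc n)" for n using one_le_power[of "2::real" "Suc n"] by (intro nn) (auto simp: field_simps)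
    show "(\<Sum>i<N. w (1/2^Suc i)) \<le> 2 * (LBINT t:{0<..1}. w t / t)" for N using part[of N] IB[of N] by simp
  qed
  then show ?thesis by (subst (asm) summable_Suc_iff)
qed

text \<open>The weight is the square root of the factor (1 + j)^2 / 2^j with which the j-th scale
  enters the Poisson mean of the squared oscillation.\<close>

lemma summable_weight: "summable (\<lambda>j. (1 + real j) / sqrt (2^j))"
proof -
  have 1: "summable (\<lambda>j. real j * (1 / sqrt 2) ^ j)"
  proof -
    have "summable (\<lambda>n. diffs (\<lambda>_. 1) n * (1 / sqrt 2 :: real) ^ n)"
      by (rule termdiff_converges[where K=1]) (auto simp: summable_geometric)
    then have "summable (\<lambda>n. (real n + 1) * (1 / sqrt 2 :: real) ^ n)" by (simp add: diffs_def add.commute)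
    moreover have "summable (\<lambda>n. (1 / sqrt 2 :: real) ^ n)" by (simp add: summable_geometric)
    ultimately have "summable (\<lambda>n. (real n + 1) * (1 / sqrt 2 :: real) ^ n - (1 / sqrt 2) ^ n)" by (rule summable_diff)
    then show ?thesis by (simp add: distrib_right)
  qed
  have "summable (\<lambda>n. (1 / sqrt 2 :: real) ^ n)" by (simp add: summable_geometric)
  from summable_add[OF this 1] have "summable (\<lambda>n. (1 / sqrt 2) ^ n + real n * (1 / sqrt 2) ^ n)" .
  moreover have "(1 / sqrt 2) ^ n + real n * (1 / sqrt 2) ^ n = (1 + real n) / sqrt (2^n)" for n
    unfolding power_one_over real_sqrt_power by (simp add: add_divide_distrib)
  ultimately show ?thesis by simp
qed

lemma summable_convolution:
  fixes a b :: "nat \<Rightarrow> real"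
  assumes "summable a" "summable b" "\<And>n. 0 \<le> a n" "\<And>n. 0 \<le> b n"
  shows "summable (\<lambda>n. \<Sum>j\<le>n. a j * b (n - j))"
  using summable_Cauchy_product[of a b] assms by simp

section \<open>Garsia's norm of functions of bounded \<open>w\<close>-oscillation\<close>

text \<open>At a fixed z the kernel is bounded by K, so convergence in norm over the circle is
  enough, both for F and for |F|^2.\<close>

lemma l2_poisson_tendsto:
  assumes sq: "\<And>n. sqint circ (F n)" "sqint circ H" and z: "cmod z < 1"
    and lim: "(\<lambda>n. l2 circ (\<lambda>t. F n t - H t)) \<longlonglongrightarrow> 0"
  shows "(\<lambda>n. \<integral>t. F n t * poisson z t \<partial>circ) \<longlonglongrightarrow> (\<M> t. H t * poisson z t)"
    and "(\<lambda>n. \<integral>t. (cmod (F n t))\<^sup>2 * poisson z t \<partial>circ) \<longlonglongrightarrow> (\<M> t. (cmod (H t))\<^sup>2 * poisson z t)"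
proof -
  define K where "K = 2 / (1 - cmod z)"
  have K: "0 \<le> K" "\<And>t. poisson z t \<le> K" using z poisson_le[OF z] by (auto simp: K_def)
  define d where "d n = l2 circ (\<lambda>t. F n t - H t)" for n
  have sqd: "sqint circ (\<lambda>t. F n t - H t)" for n by (rule sqint_diff[OF sq])
  have i: "integrable circ (F n)" "integrable circ H" "integrable circ (\<lambda>t. (cmod (F n t))\<^sup>2)" "integrable circ (\<lambda>t. (cmod (H t))\<^sup>2)"
    "integrable circ (\<lambda>t. (cmod (F n t - H t))\<^sup>2)" for n
    using l1_le_l2(1)[OF sq(1)] l1_le_l2(1)[OF sq(2)] sq sqd by (auto simp: sqint_def)
  have ih: "integrable circ (\<lambda>t. cmod ((F n t - H t) * H t))" for n
    using sqint_mult_integrable[OF sqd sq(2)] by (rule integrable_norm)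
  show "(\<lambda>n. \<integral>t. F n t * poisson z t \<partial>circ) \<longlonglongrightarrow> (\<M> t. H t * poisson z t)"
  proof (rule LIM_zero_cancel, rule tendsto_norm_zero_cancel, rule tendsto_sandwich[OF _ _ tendsto_const])
    have "norm ((\<M> t. F n t * poisson z t) - (\<M> t. H t * poisson z t)) \<le> K * d n" for n
    proof -
      have "(\<M> t. F n t * poisson z t) - (\<M> t. H t * poisson z t) = (\<M> t. (F n t - H t) * poisson z t)"
        unfolding left_diff_distrib by (intro Bochner_Integration.integral_diff[symmetric] integrable_poisson_mult_complex i z)
      also have "norm \<dots> \<le> (\<M> t. cmod (F n t - H t) * poisson z t)"
        by (intro poisson_integral_le_norm z Bochner_Integration.integrable_diff i)
      also have "\<dots> \<le> (\<M> t. K * cmod (F n t - H t))"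
      proof (rule integral_mono)
        show "integrable circ (\<lambda>t. cmod (F n t - H t) * poisson z t)"
          by (intro integrable_poisson_mult z integrable_norm Bochner_Integration.integrable_diff i)
        show "integrable circ (\<lambda>t. K * cmod (F n t - H t))"
          by (intro integrable_mult_right integrable_norm Bochner_Integration.integrable_diff i)
        show "cmod (F n t - H t) * poisson z t \<le> K * cmod (F n t - H t)" for t
          using mult_left_mono[OF K(2)[of t] norm_ge_zero[of "F n t - H t"]] by (simp add: mult.commute)
      qed
      also have "\<dots> = K * (\<M> t. cmod (F n t - H t))" by simp
      also have "\<dots> \<le> K * d n" unfolding d_def using K by (intro mult_left_mono l1_le_l2 sqd)
      finally show ?thesis .
    qed
    then show "\<forall>\<^sub>F n in sequentially. norm ((\<M> t. F n t * poisson z t) - (\<M> t. H t * poisson z t)) \<le> K * d n" by simp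
    show "(\<lambda>n. K * d n) \<longlonglongrightarrow> 0" using tendsto_mult_left[OF lim, of K] by (simp add: d_def)
  qed simp
  show "(\<lambda>n. \<integral>t. (cmod (F n t))\<^sup>2 * poisson z t \<partial>circ) \<longlonglongrightarrow> (\<M> t. (cmod (H t))\<^sup>2 * poisson z t)"
  proof (rule LIM_zero_cancel, rule tendsto_norm_zero_cancel, rule tendsto_sandwich[OF _ _ tendsto_const])
    have "norm ((\<M> t. (cmod (F n t))\<^sup>2 * poisson z t) - (\<M> t. (cmod (H t))\<^sup>2 * poisson z t)) \<le> K * ((d n)\<^sup>2 + 2 * (d n * l2 circ H))" for n
    proof -
      have "(\<M> t. (cmod (F n t))\<^sup>2 * poisson z t) - (\<M> t. (cmod (H t))\<^sup>2 * poisson z t) = (\<M> t. ((cmod (F n t))\<^sup>2 - (cmod (H t))\<^sup>2) * poisson z t)"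
        unfolding left_diff_distrib by (intro Bochner_Integration.integral_diff[symmetric] integrable_poisson_mult i z)
      also have "norm \<dots> \<le> (\<M> t. norm (((cmod (F n t))\<^sup>2 - (cmod (H t))\<^sup>2) * poisson z t))" by (rule integral_norm_bound)
      also have "\<dots> \<le> (\<M> t. K * ((cmod (F n t - H t))\<^sup>2 + 2 * cmod ((F n t - H t) * H t)))"
      proof (rule integral_mono)
        show "integrable circ (\<lambda>t. norm (((cmod (F n t))\<^sup>2 - (cmod (H t))\<^sup>2) * poisson z t))"
          by (intro integrable_norm integrable_poisson_mult z Bochner_Integration.integrable_diff i)
        show "integrable circ (\<lambda>t. K * ((cmod (F n t - H t))\<^sup>2 + 2 * cmod ((F n t - H t) * H t)))"
          by (intro integrable_mult_right Bochner_Integration.integrable_add i ih)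
        fix t
        define x where "x = cmod (F n t)" define y where "y = cmod (H t)" define e where "e = cmod (F n t - H t)"
        have xy: "x \<le> y + e" "y \<le> x + e" "0 \<le> x" "0 \<le> y" "0 \<le> e"
          using norm_triangle_ineq2[of "F n t" "H t"] norm_triangle_ineq2[of "H t" "F n t"]
          by (auto simp: x_def y_def e_def norm_minus_commute)
        have "\<bar>x\<^sup>2 - y\<^sup>2\<bar> = \<bar>x - y\<bar> * (x + y)" using xy by (simp add: power2_eq_square square_diff_square_factored abs_mult)
        also have "\<dots> \<le> e * (e + 2 * y)" using xy by (intro mult_mono) auto
        finally have "\<bar>x\<^sup>2 - y\<^sup>2\<bar> \<le> e\<^sup>2 + 2 * (e * y)" by (simp add: power2_eq_square algebra_simps)
        then have "\<bar>x\<^sup>2 - y\<^sup>2\<bar> * poisson z t \<le> (e\<^sup>2 + 2 * (e * y)) * K" using K xy by (intro mult_mono poisson_nonneg z) auto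
        then show "norm (((cmod (F n t))\<^sup>2 - (cmod (H t))\<^sup>2) * poisson z t) \<le> K * ((cmod (F n t - H t))\<^sup>2 + 2 * cmod ((F n t - H t) * H t))"
          using poisson_nonneg[OF z, of t] by (simp add: x_def y_def e_def abs_mult norm_mult mult.commute)
      qed
      also have "\<dots> = K * ((d n)\<^sup>2 + 2 * (\<M> t. cmod ((F n t - H t) * H t)))"
        using i(5)[of n] ih[of n] by (simp add: d_def l2_sq)
      also have "\<dots> \<le> K * ((d n)\<^sup>2 + 2 * (d n * l2 circ H))"
        using K l2_Cauchy_Schwarz[OF sqd sq(2), of n] by (intro mult_left_mono add_left_mono) (auto simp: d_def)
      finally show ?thesis .
    qed
    then show "\<forall>\<^sub>F n in sequentially. norm ((\<M> t. (cmod (F n t))\<^sup>2 * poisson z t) - (\<M> t. (cmod (H t))\<^sup>2 * poisson z t)) \<le> K * ((d n)\<^sup>2 + 2 * (d n * l2 circ H))" by simp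
    have "(\<lambda>n. K * ((d n)\<^sup>2 + 2 * (d n * l2 circ H))) \<longlonglongrightarrow> K * (0\<^sup>2 + 2 * (0 * l2 circ H))"
      by (intro tendsto_intros lim[folded d_def])
    then show "(\<lambda>n. K * ((d n)\<^sup>2 + 2 * (d n * l2 circ H))) \<longlonglongrightarrow> 0" by simp
  qed simp
qed

text \<open>The variance decomposition for the probability density \<open>poisson z\<close>, under
  which F has mean m. With c = m it identifies E^2 as a variance; for other c it shows that m is the
  best constant.\<close>

lemma poisson_variance:
  assumes F: "sqint circ F" and z: "cmod z < 1"
  defines "m \<equiv> (\<M> t. F t * poisson z t)"
  shows "(\<M> t. (cmod (F t - c))\<^sup>2 * poisson z t) = (\<M> t. (cmod (F t))\<^sup>2 * poisson z t) - (cmod m)\<^sup>2 + (cmod (m - c))\<^sup>2"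
proof -
  have i: "integrable circ F" "integrable circ (\<lambda>t. (cmod (F t))\<^sup>2)" using l1_le_l2(1)[OF F] F by (auto simp: sqint_def)
  have ip: "integrable circ (\<lambda>t. (F t * poisson z t) * cnj c)" using integrable_poisson_mult_complex[OF i(1) z] by auto
  have "(\<M> t. Re ((F t * poisson z t) * cnj c)) = Re (\<M> t. (F t * poisson z t) * cnj c)"
    using integral_Re[OF ip] .
  also have "\<dots> = Re (m * cnj c)" unfolding m_def by (subst integral_mult_left_zero) simp
  finally have R: "(\<M> t. Re ((F t * poisson z t) * cnj c)) = Re (m * cnj c)" .
  have Ri: "integrable circ (\<lambda>t. Re ((F t * poisson z t) * cnj c))" using integrable_Re[OF ip] .
  have "(\<M> t. (cmod (F t - c))\<^sup>2 * poisson z t) = (\<M> t. (cmod (F t))\<^sup>2 * poisson z t + (cmod c)\<^sup>2 * poisson z t - 2 * Re ((F t * poisson z t) * cnj c))"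
    unfolding cmod_power2 by (intro Bochner_Integration.integral_cong) (auto simp: power2_eq_square algebra_simps)
  also have "\<dots> = (\<M> t. (cmod (F t))\<^sup>2 * poisson z t) + (cmod c)\<^sup>2 - 2 * Re (m * cnj c)"
  proof -
    define Q where "Q t = Re ((F t * poisson z t) * cnj c)" for t
    have "integrable circ Q" "(\<M> t. Q t) = Re (m * cnj c)" using Ri R by (simp_all only: Q_def[abs_def])
    then show ?thesis unfolding Q_def[symmetric]
      using integrable_poisson_mult[OF i(2) z] integrable_poisson[OF z] integral_poisson[OF z] by simp
  qed
  also have "(cmod c)\<^sup>2 - 2 * Re (m * cnj c) = (cmod (m - c))\<^sup>2 - (cmod m)\<^sup>2"
    unfolding cmod_power2 by (simp add: power2_eq_square algebra_simps)
  then have "X + (cmod c)\<^sup>2 - 2 * Re (m * cnj c) = X - (cmod m)\<^sup>2 + (cmod (m - c))\<^sup>2" for X by linarith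
  finally show ?thesis .
qed

lemma set_integral_shift:
  fixes F :: "real \<Rightarrow> 'a::{banach, second_countable_topology}"
  shows "(LBINT x:{a+b..a+b+L}. F x) = (LBINT x:{a..a+L}. F (x + b))"
proof -
  have ind: "indicator {a+b..a+b+L} (b + 1 * x) = (indicator {a..a+L} x :: real)" for x by (auto simp: indicator_def)
  show ?thesis
    unfolding set_lebesgue_integral_def
    using lborel_integral_real_affine[of 1 "\<lambda>x. indicator {a+b..a+b+L} x *\<^sub>R F x" b]
    unfolding ind by (simp add: add.commute)
qed

text \<open>A Poisson integral is an average of translates of H, and every translate has mean
  oscillation at most B over arcs of this length. Taking for c the same average of the means of the
  translates, Fubini gives the bound for the average. In this way the dilations of an analytic
  function inherit the condition \<open>BMO_w\<close>.\<close>

lemma oscillation_of_Poisson_convolution: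
  fixes H :: "real \<Rightarrow> complex"
  assumes per: "\<And>x. H (x + 2*pi) = H x" and Hm [measurable]: "H \<in> borel_measurable borel" and Hi: "integrable circ H"
    and r: "0 \<le> r" "r < 1" and L: "0 < L" "L \<le> 2*pi"
    and osc: "\<And>a. (LBINT t:{a..a+L}. cmod (H t - (LBINT t:{a..a+L}. H t) / of_real L)) / L \<le> B"
  obtains c where "(\<integral>\<^sup>+t. ennreal (indicator {a..a+L} t * cmod ((\<M> \<phi>. H (t + \<phi>) * poisson (of_real r) \<phi>) - c)) \<partial>lborel) \<le> ennreal (L * B)"
proof -
  have nr: "cmod (complex_of_real r) < 1" using r by simp
  define p where "p = poisson (of_real r)"
  have [measurable]: "p \<in> borel_measurable borel" using nr by (simp add: p_def)
  have p0: "0 \<le> p \<phi>" for \<phi> unfolding p_def by (rule poisson_nonneg[OF nr])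
  define m where "m \<phi> = (LBINT t:{a..a+L}. H (t + \<phi>)) / of_real L" for \<phi>
  have B0: "0 \<le> B" using osc[of 0] L by (auto intro!: order_trans[OF _ osc[of 0]] divide_nonneg_pos simp: set_lebesgue_integral_def)
  have window: "set_integrable lborel {x..x+2*pi} H" for x using integrable_circ_window[of H, OF per Hm] Hi by simp
  have shw: "set_integrable lborel {a..a+L} (\<lambda>t. H (t + \<phi>))" for \<phi>
  proof -
    have per': "H (x + 2*pi + \<phi>) = H (x + \<phi>)" for x using per[of "x + \<phi>"] by (simp add: algebra_simps)
    have "integrable circ (\<lambda>x. H (x + \<phi>))" using integrable_circ_shift[of H, OF per Hm] Hi by simp
    then have "set_integrable lborel {a..a+2*pi} (\<lambda>t. H (t + \<phi>))"
      using integrable_circ_window[of "\<lambda>t. H (t + \<phi>)", OF per'] by simp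
    then show ?thesis by (rule set_integrable_subset) (use L in auto)
  qed
  have mm [measurable]: "m \<in> borel_measurable borel"
    unfolding m_def set_lebesgue_integral_def by measurable
  have meq: "m \<phi> = (LBINT t:{a+\<phi>..a+\<phi>+L}. H t) / of_real L" for \<phi> unfolding m_def set_integral_shift ..
  have mb: "cmod (m \<phi>) \<le> 2*pi * (\<M> t. cmod (H t)) / L" for \<phi>
  proof -
    have "cmod (LBINT t:{a+\<phi>..a+\<phi>+L}. H t) \<le> (LBINT t:{a+\<phi>..a+\<phi>+L}. cmod (H t))"
      by (rule set_integral_norm_bound) (rule set_integrable_subset[OF window[of "a+\<phi>"]], use L in auto)
    also have "\<dots> \<le> (LBINT t:{a+\<phi>..a+\<phi>+2*pi}. cmod (H t))"
      by (rule set_integral_subset_le) (use set_integrable_norm[OF window[of "a+\<phi>"]] L in auto)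
    also have "\<dots> = 2*pi * (\<M> t. cmod (H t))"
      using integral_circ_window[of "\<lambda>t. cmod (H t)"] per by simp
    finally show ?thesis unfolding meq using L by (simp add: norm_divide divide_right_mono)
  qed
  define c where "c = (\<M> \<phi>. m \<phi> * p \<phi>)"
  have mi: "integrable circ m" by (rule integrable_circ_bounded[OF mm mb])
  have Hs: "integrable circ (\<lambda>\<phi>. H (t + \<phi>))" for t
    using integrable_circ_shift[of H, OF per Hm, of t] Hi by (simp add: add.commute)
  have pt: "ennreal (cmod ((\<M> \<phi>. H (t + \<phi>) * p \<phi>) - c)) \<le> (\<integral>\<^sup>+\<phi>. ennreal (cmod (H (t + \<phi>) - m \<phi>) * p \<phi>) \<partial>circ)" for t
  proof -
    have i: "integrable circ (\<lambda>\<phi>. H (t + \<phi>) - m \<phi>)" using Hs mi by auto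
    have "(\<M> \<phi>. H (t + \<phi>) * p \<phi>) - c = (\<M> \<phi>. (H (t + \<phi>) - m \<phi>) * p \<phi>)"
      unfolding c_def left_diff_distrib p_def
      by (intro Bochner_Integration.integral_diff[symmetric] integrable_poisson_mult_complex Hs mi nr)
    also have "cmod \<dots> \<le> (\<M> \<phi>. cmod (H (t + \<phi>) - m \<phi>) * p \<phi>)"
      unfolding p_def by (rule poisson_integral_le_norm[OF i nr])
    finally have "ennreal (cmod ((\<M> \<phi>. H (t + \<phi>) * p \<phi>) - c)) \<le> ennreal (\<M> \<phi>. cmod (H (t + \<phi>) - m \<phi>) * p \<phi>)" by (rule ennreal_leI)
    also have "\<dots> = (\<integral>\<^sup>+\<phi>. ennreal (cmod (H (t + \<phi>) - m \<phi>) * p \<phi>) \<partial>circ)"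
      using integrable_poisson_mult[OF integrable_norm[OF i] nr] p0 by (subst nn_integral_eq_integral) (auto simp: p_def)
    finally show ?thesis .
  qed
  interpret pair_sigma_finite lborel circ ..
  have "(\<integral>\<^sup>+t. ennreal (indicator {a..a+L} t * cmod ((\<M> \<phi>. H (t + \<phi>) * p \<phi>) - c)) \<partial>lborel)
    \<le> (\<integral>\<^sup>+t. (\<integral>\<^sup>+\<phi>. ennreal (indicator {a..a+L} t * (cmod (H (t + \<phi>) - m \<phi>) * p \<phi>)) \<partial>circ) \<partial>lborel)"
  proof (rule nn_integral_mono)
    fix t
    show "ennreal (indicator {a..a+L} t * cmod ((\<M> \<phi>. H (t + \<phi>) * p \<phi>) - c)) \<le> (\<integral>\<^sup>+\<phi>. ennreal (indicator {a..a+L} t * (cmod (H (t + \<phi>) - m \<phi>) * p \<phi>)) \<partial>circ)"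
      using pt[of t] by (cases "t \<in> {a..a+L}") auto
  qed
  also have "\<dots> = (\<integral>\<^sup>+\<phi>. (\<integral>\<^sup>+t. ennreal (indicator {a..a+L} t * (cmod (H (t + \<phi>) - m \<phi>) * p \<phi>)) \<partial>lborel) \<partial>circ)"
    by (rule Fubini'[symmetric]) (simp add: split_beta')
  also have "\<dots> \<le> (\<integral>\<^sup>+\<phi>. ennreal (p \<phi> * (L * B)) \<partial>circ)"
  proof (rule nn_integral_mono)
    fix \<phi>
    have i: "set_integrable lborel {a..a+L} (\<lambda>t. cmod (H (t + \<phi>) - m \<phi>))"
    proof -
      have "set_integrable lborel {a..a+L} (\<lambda>t. m \<phi>)" unfolding set_integrable_def using L by (intro integrable_scaleR_left integrable_real_indicator) (auto simp: emeasure_lborel_Icc_eq)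
      then show ?thesis by (intro set_integrable_norm set_integral_diff(1) shw)
    qed
    have "(\<integral>\<^sup>+t. ennreal (indicator {a..a+L} t * (cmod (H (t + \<phi>) - m \<phi>) * p \<phi>)) \<partial>lborel)
      = (\<integral>\<^sup>+t. ennreal (p \<phi>) * ennreal (indicator {a..a+L} t *\<^sub>R cmod (H (t + \<phi>) - m \<phi>)) \<partial>lborel)"
      by (intro nn_integral_cong) (simp add: p0 ennreal_mult'[symmetric] mult_ac)
    also have "\<dots> = ennreal (p \<phi>) * (\<integral>\<^sup>+t. ennreal (indicator {a..a+L} t *\<^sub>R cmod (H (t + \<phi>) - m \<phi>)) \<partial>lborel)"
      by (rule nn_integral_cmult) simp
    also have "(\<integral>\<^sup>+t. ennreal (indicator {a..a+L} t *\<^sub>R cmod (H (t + \<phi>) - m \<phi>)) \<partial>lborel) = ennreal (LBINT t:{a..a+L}. cmod (H (t + \<phi>) - m \<phi>))"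
      unfolding set_lebesgue_integral_def by (rule nn_integral_eq_integral) (use i in \<open>auto simp: set_integrable_def\<close>)
    also have "(LBINT t:{a..a+L}. cmod (H (t + \<phi>) - m \<phi>)) = (LBINT t:{a+\<phi>..a+\<phi>+L}. cmod (H t - (LBINT t:{a+\<phi>..a+\<phi>+L}. H t) / of_real L))"
      unfolding set_integral_shift[of _ _ _ "\<lambda>t. cmod (H t - (LBINT t:{a+\<phi>..a+\<phi>+L}. H t) / of_real L)"] meq ..
    also have "ennreal (p \<phi>) * ennreal \<dots> \<le> ennreal (p \<phi>) * ennreal (L * B)"
      using osc[of "a+\<phi>"] L by (intro mult_left_mono ennreal_leI) (auto simp: field_simps)
    finally show "(\<integral>\<^sup>+t. ennreal (indicator {a..a+L} t * (cmod (H (t + \<phi>) - m \<phi>) * p \<phi>)) \<partial>lborel) \<le> ennreal (p \<phi> * (L * B))"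
      by (simp add: p0 ennreal_mult')
  qed
  also have "\<dots> = ennreal (\<M> \<phi>. p \<phi> * (L * B))"
    using integrable_poisson[OF nr] p0 L B0 by (intro nn_integral_eq_integral) (auto simp: p_def)
  also have "(\<M> \<phi>. p \<phi> * (L * B)) = L * B" using integral_poisson[OF nr] by (simp add: p_def)
  finally show ?thesis using that by (simp add: p_def)
qed

text \<open>The sum of squares of nonnegative numbers is at most the square of their sum, and 256 =
  16^2. The gain is a bound for E itself that is linear in w, hence summable by a convolution
  argument.\<close>

lemma weighted_square_sum_le:
  fixes \<Phi> :: "nat \<Rightarrow> real"
  assumes "\<And>j. j \<le> n \<Longrightarrow> 0 \<le> \<Phi> j"
  shows "(\<Sum>j\<le>n. 256 / 2^j * ((1 + real j) * \<Phi> j)\<^sup>2) \<le> (\<Sum>j\<le>n. 16 * ((1 + real j) / sqrt (2^j)) * \<Phi> j)\<^sup>2"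
proof -
  define t where "t j = 16 * ((1 + real j) / sqrt (2^j)) * \<Phi> j" for j
  have t0: "0 \<le> t j" if "j \<le> n" for j using assms[OF that] by (simp add: t_def)
  have "(\<Sum>j\<le>n. 256 / 2^j * ((1 + real j) * \<Phi> j)\<^sup>2) = (\<Sum>j\<le>n. (t j)\<^sup>2)"
    by (intro sum.cong refl) (simp add: t_def power_mult_distrib power_divide del: distrib_left_numeral distrib_right_numeral)
  also have "\<dots> \<le> (\<Sum>j\<le>n. t j * (\<Sum>i\<le>n. t i))"
    unfolding power2_eq_square using t0 by (intro sum_mono mult_left_mono member_le_sum) auto
  also have "\<dots> = (\<Sum>j\<le>n. t j)\<^sup>2" by (simp add: power2_eq_square sum_distrib_right)
  finally show ?thesis by (simp add: t_def)
qed

text \<open>The dilations f_k are Poisson integrals of H and have the same oscillation bound, so the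
  continuous case controls P[|f_k|^2](z) - |f_k(z)|^2 uniformly in k. Convergence in norm on the
  circle takes this to k = \<infinity> at every fixed z.\<close>

lemma Garsia_bound:
  assumes w: "majorant w" and dini: "set_integrable lborel {0<..1} (\<lambda>t. w t / t)"
    and f: "hardy f" and bv: "boundary_values f h" and bmo: "BMO_w w h"
  defines "H \<equiv> (\<lambda>\<theta>. h (cis \<theta>))"
  shows "sqint circ H"
    and "(\<lambda>n. l2 circ (\<lambda>\<theta>. dil f (rr n) \<theta> - H \<theta>)) \<longlonglongrightarrow> 0"
    and "\<And>z. cmod z < 1 \<Longrightarrow> (\<M> \<theta>. H \<theta> * poisson z \<theta>) = f z"
    and "\<exists>V. summable V \<and> (\<forall>n. 0 \<le> V n) \<and> (\<forall>n z. 1 / 2^(n+1) \<le> 1 - cmod z \<longrightarrow> 1 - cmod z \<le> 1 / 2^n \<longrightarrow>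
           (\<M> \<theta>. (cmod (H \<theta>))\<^sup>2 * poisson z \<theta>) - (cmod (f z))\<^sup>2 \<le> (V n)\<^sup>2)"
proof -
  have hol: "f holomorphic_on ball 0 1" using f by (simp add: hardy_def)
  have per: "H (x + 2*pi) = H x" for x by (simp add: H_def cis_mult[symmetric])
  have si: "set_integrable lborel {0..2*pi} H" using bmo by (simp add: BMO_w_def H_def)
  have Hm [measurable]: "H \<in> borel_measurable borel"
  proof (rule periodic_measurable[of H, OF per])
    show "set_borel_measurable borel {0..2*pi} H"
      using borel_measurable_integrable[OF si[unfolded set_integrable_def]] by (simp add: set_borel_measurable_def)
  qed
  have rl: "AE \<theta> in circ. ((\<lambda>r. f (of_real r * cis \<theta>)) \<longlongrightarrow> H \<theta>) (at_left 1)"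
    using bv unfolding boundary_values_def H_def by (rule AE_circ)
  show sq: "sqint circ H" by (rule hardy_boundary_sqint[OF f Hm rl])
  show lim: "(\<lambda>n. l2 circ (\<lambda>\<theta>. dil f (rr n) \<theta> - H \<theta>)) \<longlonglongrightarrow> 0" by (rule hardy_boundary_l2[OF f Hm rl])
  have sqd: "sqint circ (dil f (rr n))" for n using rr by (intro sqint_dil hol) auto
  have Hi: "integrable circ H" by (rule l1_le_l2(1)[OF sq])
  have fc: "(\<lambda>n. f (of_real (rr n) * z)) \<longlonglongrightarrow> f z" if z: "cmod z < 1" for z
  proof -
    have "isCont f z" using holomorphic_on_imp_continuous_on[OF hol] z by (simp add: continuous_on_eq_continuous_at)
    moreover have "(\<lambda>n. of_real (rr n) * z) \<longlonglongrightarrow> of_real 1 * z" by (intro tendsto_intros rr_tendsto)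
    ultimately show ?thesis using isCont_tendsto_compose[of z f "\<lambda>n. of_real (rr n) * z"] by simp
  qed
  have Pd: "(\<M> \<theta>. dil f (rr n) \<theta> * poisson z \<theta>) = f (of_real (rr n) * z)" if z: "cmod z < 1" for z n
    using rr by (intro Poisson_dil hol z) auto
  show P: "(\<M> \<theta>. H \<theta> * poisson z \<theta>) = f z" if z: "cmod z < 1" for z
    using l2_poisson_tendsto(1)[OF sqd sq z lim] fc[OF z] unfolding Pd[OF z] by (rule LIMSEQ_unique)
  obtain C where C: "\<And>a L. 0 < L \<Longrightarrow> L \<le> 2*pi \<Longrightarrow>
        (LBINT \<theta>:{a..a+L}. cmod (H \<theta> - (LBINT \<theta>:{a..a+L}. H \<theta>) / of_real L)) / L \<le> C * w (L / (2*pi))"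
    using bmo unfolding BMO_w_def arc_mean_def H_def by blast
  have wmono: "w s \<le> w t" if "0 \<le> s" "s \<le> t" "t \<le> 1" for s t
    using w that unfolding majorant_def mono_on_def by auto
  have wnn: "0 \<le> w t" if "0 \<le> t" "t \<le> 1" for t using wmono[of 0 t] that w by (auto simp: majorant_def)
  define D where "D = \<bar>C\<bar>"
  \<comment> \<open>The factor 2 pays for replacing the constant c produced by the convolution
    argument by the mean over the interval.\<close>
  define \<Phi> where "\<Phi> L = 2 * (D * w (L / (2*pi)))" for L
  have B: "(LBINT \<theta>:{a..a+L}. cmod (H \<theta> - (LBINT \<theta>:{a..a+L}. H \<theta>) / of_real L)) / L \<le> D * w (L / (2*pi))"
    if "0 < L" "L \<le> 2*pi" for a L
  proof -
    have "C * w (L / (2*pi)) \<le> D * w (L / (2*pi))" using that by (intro mult_right_mono wnn) (auto simp: D_def)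
    then show ?thesis using C[OF that, of a] by linarith
  qed
  have osc: "integral {a..a+L} (\<lambda>t. cmod (dil f (rr n) t - mn (dil f (rr n)) a (a+L))) \<le> L * \<Phi> L"
    if L: "0 < L" "L \<le> 2*pi" for a L n
  proof -
    \<comment> \<open>Rotating the kernel moves the angle of the point into the argument of H, so
      that one kernel at the real point \<open>rr n\<close> serves all angles.\<close>
    have ff: "(\<M> \<phi>. H (\<theta> + \<phi>) * poisson (of_real (rr n)) \<phi>) = dil f (rr n) \<theta>" for \<theta>
    proof -
      have z: "cmod (of_real (rr n) * cis \<theta>) < 1" "cmod (complex_of_real (rr n)) < 1" using rr[of n] by (simp_all add: norm_mult)
      have pm: "(\<lambda>\<phi>. H \<phi> * poisson (of_real (rr n)) (\<phi> - \<theta>)) \<in> borel_measurable borel"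
        using poisson_measurable[OF z(2)] by measurable
      have "dil f (rr n) \<theta> = (\<M> \<phi>. H \<phi> * poisson (cis \<theta> * of_real (rr n)) \<phi>)" using P[OF z(1)] by (simp add: mult.commute)
      also have "\<dots> = (\<M> \<phi>. H \<phi> * poisson (of_real (rr n)) (\<phi> - \<theta>))" unfolding poisson_rotate ..
      also have "\<dots> = (\<M> \<phi>. H (\<phi> + \<theta>) * poisson (of_real (rr n)) (\<phi> + \<theta> - \<theta>))"
        by (rule integral_circ_shift[symmetric, OF _ pm]) (use per poisson_periodic in \<open>simp add: add.commute[of _ "2*pi"] add_diff_eq[symmetric] del: add_diff_eq; metis add.commute add_diff_eq\<close>)
      finally show ?thesis by (simp add: add.commute)
    qed
    obtain c where c: "(\<integral>\<^sup>+\<theta>. ennreal (indicator {a..a+L} \<theta> * cmod (dil f (rr n) \<theta> - c)) \<partial>lborel) \<le> ennreal (L * (D * w (L / (2*pi))))"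
      using oscillation_of_Poisson_convolution[of H "rr n" L "D * w (L / (2*pi))" a, OF per Hm Hi rr(1) rr(3) L B[OF L]]
      unfolding ff by blast
    have cont: "continuous_on UNIV (dil f (rr n))" using rr by (intro continuous_on_dil hol) auto
    have si: "set_integrable lborel {a..a+L} (\<lambda>t. cmod (dil f (rr n) t - c))"
      by (rule borel_integrable_atLeastAtMost') (intro continuous_intros continuous_on_subset[OF cont] subset_UNIV)
    have i1: "integral {a..a+L} (\<lambda>t. cmod (dil f (rr n) t - c)) \<le> L * (D * w (L / (2*pi)))"
    proof -
      have "ennreal (LBINT t:{a..a+L}. cmod (dil f (rr n) t - c)) = (\<integral>\<^sup>+\<theta>. ennreal (indicator {a..a+L} \<theta> * cmod (dil f (rr n) \<theta> - c)) \<partial>lborel)"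
        unfolding set_lebesgue_integral_def using si by (subst nn_integral_eq_integral) (auto simp: set_integrable_def)
      then have "(LBINT t:{a..a+L}. cmod (dil f (rr n) t - c)) \<le> L * (D * w (L / (2*pi)))"
        using c L wnn[of "L / (2*pi)"] ennreal_le_iff[of "L * (D * w (L / (2*pi)))" "LBINT t:{a..a+L}. cmod (dil f (rr n) t - c)"]
        by (simp add: D_def)
      then show ?thesis using si by (simp add: set_borel_integral_eq_integral)
    qed
    have "(a + L - a) * cmod (mn (dil f (rr n)) a (a+L) - c) \<le> integral {a..a+L} (\<lambda>t. cmod (dil f (rr n) t - c))"
      by (rule mn_diff_le[OF cont]) (use L in simp)
    then have i2: "L * cmod (c - mn (dil f (rr n)) a (a+L)) \<le> L * (D * w (L / (2*pi)))" using i1 by (simp add: norm_minus_commute)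
    have "integral {a..a+L} (\<lambda>t. cmod (dil f (rr n) t - mn (dil f (rr n)) a (a+L))) \<le> integral {a..a+L} (\<lambda>t. cmod (dil f (rr n) t - c) + cmod (c - mn (dil f (rr n)) a (a+L)))"
    proof (rule integral_le[OF int_norm_diff[OF cont]])
      show "(\<lambda>t. cmod (dil f (rr n) t - c) + cmod (c - mn (dil f (rr n)) a (a+L))) integrable_on {a..a+L}"
        by (intro Henstock_Kurzweil_Integration.integrable_add int_norm_diff[OF cont] integrable_const_ivl)
    qed (use norm_triangle_ineq in \<open>metis add.commute diff_add_cancel diff_add_eq\<close>)
    also have "\<dots> = integral {a..a+L} (\<lambda>t. cmod (dil f (rr n) t - c)) + L * cmod (c - mn (dil f (rr n)) a (a+L))"
      using L by (subst Henstock_Kurzweil_Integration.integral_add[OF int_norm_diff[OF cont] integrable_const_ivl]) auto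
    finally show ?thesis using i1 i2 by (simp add: \<Phi>_def)
  qed
  \<comment> \<open>The j-th arc has normalized length 2^j / 2^n = 2^-(n-j). Hence
    \<open>V n\<close> is a convolution of w(2^-n) with the weight (1 + j) / sqrt(2^j), and both
    sequences are summable.\<close>
  define V where "V n = (\<Sum>j\<le>n. 16 * ((1 + real j) / sqrt (2^j)) * (2 * (D * w (1 / 2^(n-j)))))" for n
  have V0: "0 \<le> V n" for n unfolding V_def
    by (intro sum_nonneg mult_nonneg_nonneg wnn) (auto simp: D_def)
  have Vs: "summable V"
  proof -
    have "summable (\<lambda>n. \<Sum>j\<le>n. ((1 + real j) / sqrt (2^j)) * w (1 / 2^(n-j)))"
      by (rule summable_convolution[OF summable_weight Dini_summable[OF w dini]]) (auto intro!: wnn)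
    then have "summable (\<lambda>n. 32 * D * (\<Sum>j\<le>n. ((1 + real j) / sqrt (2^j)) * w (1 / 2^(n-j))))" by (rule summable_mult)
    moreover have "32 * D * (\<Sum>j\<le>n. ((1 + real j) / sqrt (2^j)) * w (1 / 2^(n-j))) = V n" for n
      unfolding V_def sum_distrib_left by (intro sum.cong refl) simp
    ultimately show ?thesis by (simp only:)
  qed
  have main: "(\<M> \<theta>. (cmod (H \<theta>))\<^sup>2 * poisson z \<theta>) - (cmod (f z))\<^sup>2 \<le> (V n)\<^sup>2"
    if z: "1 / 2^(n+1) \<le> 1 - cmod z" "1 - cmod z \<le> 1 / 2^n" for n z
  proof -
    have "(0::real) < 1 / 2^(n+1)" by simp
    then have z1: "cmod z < 1" using z(1) by linarith
    have bound: "(\<M> \<theta>. (cmod (dil f (rr k) \<theta>))\<^sup>2 * poisson z \<theta>) - (cmod (f (of_real (rr k) * z)))\<^sup>2 \<le> (V n)\<^sup>2" for k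
    proof -
      have cont: "continuous_on UNIV (dil f (rr k))" using rr by (intro continuous_on_dil hol) auto
      obtain c where c: "(\<M> \<theta>. (cmod (dil f (rr k) \<theta> - c))\<^sup>2 * poisson z \<theta>) \<le> (\<Sum>j\<le>n. 256 / 2^j * ((1 + real j) * \<Phi> (2*pi*2^j/2^n))\<^sup>2)"
      proof (rule poisson_oscillation[OF cont _ osc _ _ z])
        show "dil f (rr k) (x + 2*pi) = dil f (rr k) x" for x by (simp add: cis_mult[symmetric])
        show "\<Phi> s \<le> \<Phi> t" if "0 < s" "s \<le> t" "t \<le> 2*pi" for s t
          unfolding \<Phi>_def using that by (intro mult_left_mono wmono divide_right_mono) (auto simp: D_def)
        show "0 \<le> \<Phi> s" if "0 < s" "s \<le> 2*pi" for s
          unfolding \<Phi>_def using that by (intro mult_nonneg_nonneg wnn) (auto simp: D_def)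
      qed
      have "(\<M> \<theta>. (cmod (dil f (rr k) \<theta>))\<^sup>2 * poisson z \<theta>) - (cmod (f (of_real (rr k) * z)))\<^sup>2 \<le> (\<M> \<theta>. (cmod (dil f (rr k) \<theta> - c))\<^sup>2 * poisson z \<theta>)"
        unfolding poisson_variance[OF sqd z1] Pd[OF z1] by simp
      also note c
      also have "(\<Sum>j\<le>n. 256 / 2^j * ((1 + real j) * \<Phi> (2*pi*2^j/2^n))\<^sup>2) = (\<Sum>j\<le>n. 256 / 2^j * ((1 + real j) * (2 * (D * w (1 / 2^(n-j)))))\<^sup>2)"
      proof (intro sum.cong refl)
        fix j assume "j \<in> {..n}"
        then have "(2::real)^j / 2^n = 1 / 2^(n-j)" by (simp add: power_diff)
        then have "2*pi*2^j/2^n / (2*pi) = 1 / (2::real)^(n-j)" by simp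
        then show "256 / 2^j * ((1 + real j) * \<Phi> (2*pi*2^j/2^n))\<^sup>2 = 256 / 2^j * ((1 + real j) * (2 * (D * w (1 / 2^(n-j)))))\<^sup>2"
          by (simp only: \<Phi>_def)
      qed
      also have "\<dots> \<le> (V n)\<^sup>2" unfolding V_def
        by (rule weighted_square_sum_le) (auto simp: D_def intro!: mult_nonneg_nonneg wnn)
      finally show ?thesis .
    qed
    have "(\<lambda>k. (\<M> \<theta>. (cmod (dil f (rr k) \<theta>))\<^sup>2 * poisson z \<theta>) - (cmod (f (of_real (rr k) * z)))\<^sup>2)
       \<longlonglongrightarrow> (\<M> \<theta>. (cmod (H \<theta>))\<^sup>2 * poisson z \<theta>) - (cmod (f z))\<^sup>2"
      by (intro tendsto_intros l2_poisson_tendsto(2)[OF sqd sq z1 lim] fc z1)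
    then show ?thesis by (rule LIMSEQ_le_const2) (use bound in auto)
  qed
  show "\<exists>V. summable V \<and> (\<forall>n. 0 \<le> V n) \<and> (\<forall>n z. 1 / 2^(n+1) \<le> 1 - cmod z \<longrightarrow> 1 - cmod z \<le> 1 / 2^n \<longrightarrow>
           (\<M> \<theta>. (cmod (H \<theta>))\<^sup>2 * poisson z \<theta>) - (cmod (f z))\<^sup>2 \<le> (V n)\<^sup>2)"
    by (rule exI[of _ V]) (use Vs V0 main in auto)
qed

section \<open>Cauchy transforms\<close>

definition cauchy_transform :: "(real \<Rightarrow> complex) \<Rightarrow> complex \<Rightarrow> complex" where
  "cauchy_transform u z = (\<M> t. u t / (1 - z * cnj (cis t)))"

lemma cauchy_kernel_ge: "1 - cmod z \<le> cmod (1 - z * cnj (cis t))"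
  using norm_triangle_ineq2[of 1 "z * cnj (cis t)"] by (simp add: norm_mult)

lemma cauchy_kernel_nz: "cmod z < 1 \<Longrightarrow> 1 - z * cnj (cis t) \<noteq> 0"
  using cauchy_kernel_ge[of z t] by auto

lemma cauchy_kernel_measurable [measurable]: "(\<lambda>t. 1 - z * cnj (cis t)) \<in> borel_measurable borel"
  by (intro borel_measurable_continuous_onI continuous_intros)

lemma cauchy_kernel_le: "cmod z < 1 \<Longrightarrow> cmod (u / (1 - z * cnj (cis t))) \<le> cmod u / (1 - cmod z)"
  unfolding norm_divide using cauchy_kernel_ge[of z t] by (intro divide_left_mono mult_pos_pos) (auto intro: less_le_trans)

lemma integrable_cauchy_transform:
  assumes u: "integrable circ u" and z: "cmod z < 1"
  shows "integrable circ (\<lambda>t. u t / (1 - z * cnj (cis t)))"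
proof (rule Bochner_Integration.integrable_bound)
  have [measurable]: "u \<in> borel_measurable borel" using borel_measurable_integrable[OF u] by simp
  show "integrable circ (\<lambda>t. cmod (u t) / (1 - cmod z))" using u by auto
  show "(\<lambda>t. u t / (1 - z * cnj (cis t))) \<in> borel_measurable circ" by simp
  show "AE t in circ. norm (u t / (1 - z * cnj (cis t))) \<le> norm (cmod (u t) / (1 - cmod z))"
    using cauchy_kernel_le[OF z] z by (intro AE_I2) simp
qed

lemma norm_cauchy_transform_le:
  assumes u: "integrable circ u" and z: "cmod z < 1"
  shows "cmod (cauchy_transform u z) \<le> (\<M> t. cmod (u t)) / (1 - cmod z)"
proof -
  have "cmod (cauchy_transform u z) \<le> (\<M> t. cmod (u t / (1 - z * cnj (cis t))))"
    unfolding cauchy_transform_def by (rule integral_norm_bound)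
  also have "\<dots> \<le> (\<M> t. cmod (u t) / (1 - cmod z))"
    using integrable_cauchy_transform[OF u z] u by (intro integral_mono cauchy_kernel_le z) auto
  finally show ?thesis by simp
qed

lemma cauchy_transform_diff:
  assumes "integrable circ u" "integrable circ v" "cmod z < 1"
  shows "cauchy_transform u z - cauchy_transform v z = cauchy_transform (\<lambda>t. u t - v t) z"
  unfolding cauchy_transform_def diff_divide_distrib
  by (intro Bochner_Integration.integral_diff[symmetric] integrable_cauchy_transform assms)

text \<open>The difference quotient is again a Cauchy transform, of a function that depends on z but
  not on y. Boundedness of Cauchy transforms therefore gives continuity at z, and continuity of this
  second transform gives differentiability.\<close>

lemma cauchy_transform_difference_quotient:
  assumes u: "integrable circ u" and z: "cmod z < 1" and y: "cmod y < 1"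
  shows "cauchy_transform u y - cauchy_transform u z = cauchy_transform (\<lambda>t. u t * cnj (cis t) / (1 - z * cnj (cis t))) y * (y - z)"
proof -
  have "cauchy_transform u y - cauchy_transform u z = (\<M> t. u t / (1 - y * cnj (cis t)) - u t / (1 - z * cnj (cis t)))"
    unfolding cauchy_transform_def by (intro Bochner_Integration.integral_diff[symmetric] integrable_cauchy_transform u z y)
  also have "\<dots> = (\<M> t. (u t * cnj (cis t) / (1 - z * cnj (cis t))) / (1 - y * cnj (cis t)) * (y - z))"
  proof (rule Bochner_Integration.integral_cong[OF refl])
    fix t
    show "u t / (1 - y * cnj (cis t)) - u t / (1 - z * cnj (cis t)) = (u t * cnj (cis t) / (1 - z * cnj (cis t))) / (1 - y * cnj (cis t)) * (y - z)"
    proof -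
      have "U / b - U / a = (U * c / a) / b * (y - z)" if "a \<noteq> 0" "b \<noteq> 0" "a - b = (y - z) * c" for U a b c :: complex
      proof -
        have "U / b - U / a = U * (a - b) / (a * b)" using that(1,2) by (simp add: field_simps)
        then show ?thesis unfolding that(3) by (simp add: mult_ac)
      qed
      from this[OF cauchy_kernel_nz[OF z, of t] cauchy_kernel_nz[OF y, of t], of "cnj (cis t)"]
      show ?thesis by (simp add: left_diff_distrib)
    qed
  qed
  also have "\<dots> = cauchy_transform (\<lambda>t. u t * cnj (cis t) / (1 - z * cnj (cis t))) y * (y - z)"
    unfolding cauchy_transform_def by (rule integral_mult_left_zero)
  finally show ?thesis .
qed

lemma integrable_mult_cnj_cis:
  assumes "integrable circ u"
  shows "integrable circ (\<lambda>t. u t * cnj (cis t) ^ n)"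
proof (rule Bochner_Integration.integrable_bound[OF integrable_norm[OF assms]])
  have [measurable]: "u \<in> borel_measurable borel" using borel_measurable_integrable[OF assms] by simp
  have [measurable]: "(\<lambda>t. cnj (cis t) ^ n) \<in> borel_measurable borel" by (intro borel_measurable_continuous_onI continuous_intros)
  show "(\<lambda>t. u t * cnj (cis t) ^ n) \<in> borel_measurable circ" by simp
qed (auto simp: norm_mult norm_power)

lemma isCont_cauchy_transform:
  assumes u: "integrable circ u" and z: "cmod z < 1"
  shows "isCont (cauchy_transform u) z"
proof -
  define u' where "u' t = u t * cnj (cis t) / (1 - z * cnj (cis t))" for t
  have u': "integrable circ u'" unfolding u'_def using integrable_mult_cnj_cis[OF u, of 1] by (intro integrable_cauchy_transform z) simp
  define K where "K = (\<M> t. cmod (u' t)) * (2 / (1 - cmod z))"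
  have "((\<lambda>y. cauchy_transform u y - cauchy_transform u z) \<longlongrightarrow> 0) (at z)"
  proof (rule Lim_null_comparison)
    have "eventually (\<lambda>y. y \<in> ball z ((1 - cmod z)/2)) (at z)" using z by (intro eventually_at_in_open') auto
    then show "eventually (\<lambda>y. norm (cauchy_transform u y - cauchy_transform u z) \<le> K * cmod (y - z)) (at z)"
    proof eventually_elim
      case (elim y)
      then have "cmod (y - z) < (1 - cmod z)/2" by (simp add: dist_norm norm_minus_commute)
      then have y: "(1 - cmod z)/2 \<le> 1 - cmod y" using norm_triangle_ineq2[of y z] by simp
      then have y1: "cmod y < 1" using z by simp
      have "cmod (cauchy_transform u' y) \<le> (\<M> t. cmod (u' t)) / (1 - cmod y)" by (rule norm_cauchy_transform_le[OF u' y1])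
      also have "\<dots> \<le> (\<M> t. cmod (u' t)) / ((1 - cmod z)/2)" using y z by (intro divide_left_mono) auto
      finally have "cmod (cauchy_transform u' y) \<le> K" by (simp add: K_def)
      then show ?case unfolding cauchy_transform_difference_quotient[OF u z y1] u'_def[symmetric] norm_mult by (intro mult_right_mono) auto
    qed
    have "((\<lambda>y. K * cmod (y - z)) \<longlongrightarrow> K * cmod (z - z)) (at z)" by (intro tendsto_intros)
    then show "((\<lambda>y. K * cmod (y - z)) \<longlongrightarrow> 0) (at z)" by simp
  qed
  then show ?thesis unfolding isCont_def by (rule LIM_zero_cancel)
qed

lemma has_field_derivative_cauchy_transform:
  assumes u: "integrable circ u" and z: "cmod z < 1"
  shows "(cauchy_transform u has_field_derivative (\<M> t. u t * cnj (cis t) / (1 - z * cnj (cis t))\<^sup>2)) (at z)"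
proof -
  define u' where "u' t = u t * cnj (cis t) / (1 - z * cnj (cis t))" for t
  have u': "integrable circ u'" unfolding u'_def using integrable_mult_cnj_cis[OF u, of 1] by (intro integrable_cauchy_transform z) simp
  have "((\<lambda>y. (cauchy_transform u y - cauchy_transform u z) / (y - z)) \<longlongrightarrow> cauchy_transform u' z) (at z)"
  proof (rule Lim_transform_eventually)
    show "(cauchy_transform u' \<longlongrightarrow> cauchy_transform u' z) (at z)" using isCont_cauchy_transform[OF u' z] by (simp add: isCont_def)
    have "eventually (\<lambda>y. y \<in> ball 0 1) (at z)" using z by (intro eventually_at_in_open') auto
    moreover have "eventually (\<lambda>y. y \<noteq> z) (at z)" by (rule eventually_neq_at_within)
    ultimately show "eventually (\<lambda>y. cauchy_transform u' y = (cauchy_transform u y - cauchy_transform u z) / (y - z)) (at z)"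
    proof eventually_elim
      case (elim y)
      then show ?case using cauchy_transform_difference_quotient[OF u z, of y] by (simp add: u'_def[abs_def])
    qed
  qed
  moreover have "cauchy_transform u' z = (\<M> t. u t * cnj (cis t) / (1 - z * cnj (cis t))\<^sup>2)"
    by (simp add: cauchy_transform_def u'_def power2_eq_square)
  ultimately show ?thesis by (simp add: has_field_derivative_iff)
qed

text \<open>After Fubini the inner integral is Cauchy's formula for the dilation of F at the point
  \<rho> cis \<phi>. One factor \<rho> comes from the dilation of F and one from that of the
  transform, hence the radius \<rho>^2.\<close>

lemma cauchy_transform_pairing:
  assumes F: "F holomorphic_on ball 0 1" and \<rho>: "0 \<le> \<rho>" "\<rho> < 1"
    and um [measurable]: "u \<in> borel_measurable borel" and ub: "\<And>t. cmod (u t) \<le> B"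
  shows "(\<M> t. dil F \<rho> t * cnj (dil (cauchy_transform u) \<rho> t)) = (\<M> t. cnj (u t) * dil F (\<rho>\<^sup>2) t)"
proof -
  have Fm [measurable]: "dil F \<rho> \<in> borel_measurable borel" by (rule dil_measurable[OF F \<rho>])
  obtain M where M: "\<And>t. cmod (dil F \<rho> t) \<le> M" by (rule dil_bounded[OF F \<rho>]) blast
  have M0: "0 \<le> M" using M[of 0] norm_ge_zero order_trans by blast
  have B0: "0 \<le> B" using ub[of 0] norm_ge_zero order_trans by blast
  have nz: "cmod (of_real \<rho> * cis t) < 1" "cmod (of_real \<rho> * cis t) = \<rho>" for t using \<rho> by (simp_all add: norm_mult)
  interpret P: pair_sigma_finite circ circ ..
  have fin: "finite_measure (circ \<Otimes>\<^sub>M circ)"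
    by (intro finite_measure_pair_measure circ.finite_measure_axioms)
  interpret Q: finite_measure "circ \<Otimes>\<^sub>M circ" by (rule fin)
  define K where "K t \<phi> = dil F \<rho> t * cnj (u \<phi> / (1 - of_real \<rho> * cis t * cnj (cis \<phi>)))" for t \<phi>
  have Kb: "cmod (K t \<phi>) \<le> M * (B / (1 - \<rho>))" for t \<phi>
  proof -
    have "cmod (u \<phi> / (1 - of_real \<rho> * cis t * cnj (cis \<phi>))) \<le> cmod (u \<phi>) / (1 - \<rho>)" using cauchy_kernel_le[OF nz(1)[of t], of "u \<phi>" \<phi>] nz(2)[of t] by simp
    also have "\<dots> \<le> B / (1 - \<rho>)" using ub \<rho> by (intro divide_right_mono) auto
    finally show ?thesis unfolding K_def norm_mult complex_mod_cnj using M M0 by (intro mult_mono) auto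
  qed
  have Kmeas: "(\<lambda>x. K (fst x) (snd x)) \<in> borel_measurable (circ \<Otimes>\<^sub>M circ)"
    unfolding K_def by measurable
  have Kint: "integrable (circ \<Otimes>\<^sub>M circ) (\<lambda>(t, \<phi>). K t \<phi>)"
    unfolding split_beta' by (rule Q.integrable_const_bound[where B="M * (B / (1 - \<rho>))"]) (use Kb Kmeas in auto)
  have "(\<M> t. dil F \<rho> t * cnj (dil (cauchy_transform u) \<rho> t)) = (\<M> t. (\<M> \<phi>. K t \<phi>))"
    unfolding cauchy_transform_def K_def integral_mult_right_zero Bochner_Integration.integral_cnj ..
  also have "\<dots> = (\<M> \<phi>. (\<M> t. K t \<phi>))" using P.Fubini_integral[OF Kint] by simp
  also have "\<dots> = (\<M> \<phi>. cnj (u \<phi>) * dil F (\<rho>\<^sup>2) \<phi>)"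
  proof (rule Bochner_Integration.integral_cong[OF refl])
    fix \<phi>
    have eq: "K t \<phi> = cnj (u \<phi>) * (dil F \<rho> t * (cis t / (cis t - of_real \<rho> * cis \<phi>)))" for t
    proof -
      have "cis t * cnj (cis t) = 1" by (simp add: cis_cnj cis_mult)
      then have "cnj (1 - of_real \<rho> * cis t * cnj (cis \<phi>)) * cis t = cis t - of_real \<rho> * cis \<phi>"
        by (simp add: algebra_simps)
      moreover have "cis t \<noteq> 0" by simp
      ultimately have "1 / cnj (1 - of_real \<rho> * cis t * cnj (cis \<phi>)) = cis t / (cis t - of_real \<rho> * cis \<phi>)"
        by (metis divide_divide_eq_right mult_divide_mult_cancel_right mult_1 )
      then show ?thesis unfolding K_def complex_cnj_divide by (metis (no_types, lifting) mult.left_commute mult.right_neutral times_divide_eq_right)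
    qed
    obtain R where R: "1 < R" "(\<lambda>z. F (of_real \<rho> * z)) holomorphic_on ball 0 R" using dil_holomorphic[OF F \<rho>] .
    have "(\<M> t. K t \<phi>) = cnj (u \<phi>) * (\<M> t. dil F \<rho> t * (cis t / (cis t - of_real \<rho> * cis \<phi>)))"
      unfolding eq by (rule integral_mult_right_zero)
    also have "(\<M> t. dil F \<rho> t * (cis t / (cis t - of_real \<rho> * cis \<phi>))) = F (of_real \<rho> * (of_real \<rho> * cis \<phi>))"
      using Cauchy_circ[OF R(2,1) nz(1)] by simp
    finally show "(\<M> t. K t \<phi>) = cnj (u \<phi>) * dil F (\<rho>\<^sup>2) \<phi>" by (simp add: power2_eq_square mult.assoc)
  qed
  finally show ?thesis .
qed

lemma bloch_pairing_eqI:
  assumes F: "F holomorphic_on ball 0 1" and g: "g holomorphic_on ball 0 1"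
    and lim: "((\<lambda>r. \<integral>t. dil F r t * cnj (dil g r t) \<partial>circ) \<longlongrightarrow> X) (at_left 1)"
  shows "bloch_pairing F g = X"
proof -
  have "((\<lambda>r. (LBINT t:{0..2*pi}. F (of_real r * cis t) * cnj (g (of_real r * cis t))) / (2 * pi)) \<longlongrightarrow> X) (at_left 1)"
  proof (rule Lim_transform_eventually[OF lim])
    have "eventually (\<lambda>r::real. r \<in> {0<..<1}) (at_left 1)" by (rule eventually_at_leftI[of 0]) auto
    then show "eventually (\<lambda>r. (\<M> t. dil F r t * cnj (dil g r t)) = (LBINT t:{0..2*pi}. F (of_real r * cis t) * cnj (g (of_real r * cis t))) / (2 * pi)) (at_left 1)"
    proof eventually_elim
      case (elim r)
      have [measurable]: "dil F r \<in> borel_measurable borel" "dil g r \<in> borel_measurable borel" using elim by (auto intro!: dil_measurable F g)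
      show ?case by (subst integral_circ) (auto simp: scaleR_conv_of_real)
    qed
  qed
  then show ?thesis unfolding bloch_pairing_def by (intro tendsto_Lim) auto
qed

section \<open>Annihilators of the polynomial multiples of an inner function\<close>

text \<open>On the n-th ring |k'| is at most 2^(n+1) V_n, and the area is at most 2 \<pi> / 2^n, so
  the ring contributes at most 4 \<pi> V_n.\<close>

lemma W1_of_dyadic_bound:
  assumes k: "k holomorphic_on ball 0 1" and V: "summable V" "\<And>n. 0 \<le> V n"
    and b: "\<And>n z. 1 / 2^(n+1) \<le> 1 - cmod z \<Longrightarrow> 1 - cmod z \<le> 1 / 2^n \<Longrightarrow> (1 - cmod z) * cmod (deriv k z) \<le> V n"
  shows "W1 k"
proof -
  \<comment> \<open>These sets are nested rather than disjoint; for an upper bound it is enough that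
    each point of the ring 2^-(n+1) \<le> 1 - |z| \<le> 2^-n lies in the n-th set.\<close>
  define A where "A n = ball (0::complex) 1 - ball 0 (1 - 1/2^n)" for n :: nat
  have Am [measurable]: "A n \<in> sets borel" for n unfolding A_def by auto
  have Aem: "emeasure lborel (A n) \<le> ennreal (2 * pi / 2^n)" for n
  proof -
    have p: "(0::real) \<le> 1 - 1/2^n" "(1::real) - 1/2^n \<le> 1" by (auto simp: field_simps)
    have "emeasure lborel (A n) = emeasure lborel (ball (0::complex) 1) - emeasure lborel (ball (0::complex) (1 - 1/2^n))"
      unfolding A_def by (rule emeasure_Diff) (use p emeasure_bounded_finite[of "ball (0::complex) (1 - 1/2^n)"] in \<open>auto intro: less_le_trans[OF _ p(2)]\<close>)
    also have "emeasure lborel (ball (0::complex) 1) = ennreal pi" using emeasure_ball[of 1 "0::complex"] by (simp add: unit_ball_vol_2)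
    also have "emeasure lborel (ball (0::complex) (1 - 1/2^n)) = ennreal (pi * (1 - 1/2^n)\<^sup>2)" using emeasure_ball[OF p(1), of "0::complex"] by (simp add: unit_ball_vol_2)
    also have "ennreal pi - ennreal (pi * (1 - 1/2^n)\<^sup>2) = ennreal (pi - pi * (1 - 1/2^n)\<^sup>2)" by (rule ennreal_minus) simp
    also have "\<dots> \<le> ennreal (2 * pi / 2^n)"
    proof (rule ennreal_leI)
      have "1 - (1 - 1/2^n)\<^sup>2 \<le> 2 / (2::real)^n" by (simp add: power2_eq_square algebra_simps)
      then have "pi * (1 - (1 - 1/2^n)\<^sup>2) \<le> pi * (2 / 2^n)" by (intro mult_left_mono) auto
      then show "pi - pi * (1 - 1/2^n)\<^sup>2 \<le> 2 * pi / 2^n" by (simp add: algebra_simps)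
    qed
    finally show ?thesis .
  qed
  have dk: "deriv k holomorphic_on ball 0 1" by (intro holomorphic_deriv k) auto
  have km: "(\<lambda>z. indicator (ball 0 1) z *\<^sub>R cmod (deriv k z)) \<in> borel_measurable borel"
    by (intro borel_measurable_continuous_on_indicator continuous_intros holomorphic_on_imp_continuous_on[OF dk]) auto
  have pt: "ennreal (norm (indicator (ball 0 1) z *\<^sub>R cmod (deriv k z))) \<le> (\<Sum>n. ennreal (V n * 2^(n+1)) * indicator (A n) z)" for z
  proof (cases "z \<in> ball 0 1")
    case True
    then have z: "0 < 1 - cmod z" by simp
    define n where "n = nat \<lfloor>log 2 (1 / (1 - cmod z))\<rfloor>"
    have "1 \<le> 1 / (1 - cmod z)" using z by (simp add: field_simps)
    then have lg: "0 \<le> log 2 (1 / (1 - cmod z))" using z by (subst zero_le_log_cancel_iff) auto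
    have n1: "real n \<le> log 2 (1 / (1 - cmod z))" "log 2 (1 / (1 - cmod z)) < real (n + 1)" unfolding n_def using lg by linarith+
    have "2 powr real n \<le> 1 / (1 - cmod z)" using n1(1) z by (subst (asm) le_log_iff) auto
    then have a: "1 - cmod z \<le> 1 / 2^n" using z by (simp add: powr_realpow field_simps)
    have "1 / (1 - cmod z) < 2 powr (real (n+1))" using log_less_iff[of 2 "1 / (1 - cmod z)" "real (n+1)"] n1(2) z by simp
    then have a': "1 / 2^(n+1) \<le> 1 - cmod z" using z by (simp only: powr_realpow) (simp add: field_simps)
    have "(1 / 2^(n+1)) * cmod (deriv k z) \<le> (1 - cmod z) * cmod (deriv k z)" using a' by (intro mult_right_mono) auto
    also have "\<dots> \<le> V n" by (rule b[OF a' a])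
    finally have "cmod (deriv k z) \<le> V n * 2^(n+1)" by (simp add: field_simps)
    moreover have "z \<in> A n" using True a by (auto simp: A_def)
    ultimately have "ennreal (norm (indicator (ball 0 1) z *\<^sub>R cmod (deriv k z))) \<le> ennreal (V n * 2^(n+1)) * indicator (A n) z"
      using True by (simp add: ennreal_leI)
    also have "\<dots> \<le> (\<Sum>n. ennreal (V n * 2^(n+1)) * indicator (A n) z)"
    proof -
      define t where "t n = ennreal (V n * 2^(n+1)) * indicator (A n) z" for n
      show ?thesis using sum_le_suminf[of t "{n}"] unfolding t_def[symmetric] by simp
    qed
    finally show ?thesis .
  qed simp
  have "(\<integral>\<^sup>+z. ennreal (norm (indicator (ball 0 1) z *\<^sub>R cmod (deriv k z))) \<partial>lborel) \<le> (\<integral>\<^sup>+z. (\<Sum>n. ennreal (V n * 2^(n+1)) * indicator (A n) z) \<partial>lborel)"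
    by (rule nn_integral_mono) (rule pt)
  also have "\<dots> = (\<Sum>n. \<integral>\<^sup>+z. ennreal (V n * 2^(n+1)) * indicator (A n) z \<partial>lborel)" by (rule nn_integral_suminf) simp
  also have "\<dots> = (\<Sum>n. ennreal (V n * 2^(n+1)) * emeasure lborel (A n))" by (subst nn_integral_cmult_indicator) auto
  also have "\<dots> \<le> (\<Sum>n. ennreal (4 * pi * V n))"
  proof (rule suminf_le)
    fix n
    have "ennreal (V n * 2^(n+1)) * emeasure lborel (A n) \<le> ennreal (V n * 2^(n+1)) * ennreal (2 * pi / 2^n)" by (intro mult_left_mono Aem) simp
    also have "\<dots> = ennreal (4 * pi * V n)" using V(2)[of n] by (simp add: ennreal_mult'[symmetric])
    finally show "ennreal (V n * 2^(n+1)) * emeasure lborel (A n) \<le> ennreal (4 * pi * V n)" .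
  qed auto
  also have "\<dots> = ennreal (\<Sum>n. 4 * pi * V n)" by (rule suminf_ennreal2) (use V summable_mult[OF V(1), of "4*pi"] in auto)
  finally have fin: "(\<integral>\<^sup>+z. ennreal (norm (indicator (ball 0 1) z *\<^sub>R cmod (deriv k z))) \<partial>lborel) \<le> ennreal (\<Sum>n. 4 * pi * V n)" .
  have "integrable lborel (\<lambda>z. indicator (ball 0 1) z *\<^sub>R cmod (deriv k z))"
    by (rule integrableI_bounded) (use km fin in \<open>auto simp: less_top[symmetric] top_unique\<close>)
  then show ?thesis using k by (simp add: W1_def set_integrable_def)
qed

text \<open>The variance of |F| about its own Poisson mean is nonnegative.\<close>

lemma poisson_l1_le_l2:
  assumes F: "sqint circ F" and z: "cmod z < 1" and e: "0 \<le> e"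
    and b: "(\<M> t. (cmod (F t))\<^sup>2 * poisson z t) \<le> e\<^sup>2"
  shows "(\<M> t. cmod (F t) * poisson z t) \<le> e"
proof -
  define G where "G t = complex_of_real (cmod (F t))" for t
  have G: "sqint circ G" using F by (auto simp: sqint_def G_def[abs_def])
  define m where "m = (\<M> t. G t * poisson z t)"
  have m: "m = complex_of_real (\<M> t. cmod (F t) * poisson z t)"
    unfolding m_def G_def by (simp flip: of_real_mult)
  have "0 \<le> (\<M> t. (cmod (G t - m))\<^sup>2 * poisson z t)"
    by (intro integral_nonneg_AE AE_I2 mult_nonneg_nonneg poisson_nonneg z) auto
  also have "\<dots> = (\<M> t. (cmod (F t))\<^sup>2 * poisson z t) - (cmod m)\<^sup>2"
    using poisson_variance[OF G z, of m] unfolding m_def[symmetric] by (simp add: G_def)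
  finally have "(cmod m)\<^sup>2 \<le> e\<^sup>2" using b by simp
  then have "cmod m \<le> e" using e by (rule power2_le_imp_le)
  then show ?thesis by (simp add: m)
qed

text \<open>The variance of the dilation of \<psi> about its Poisson mean \<psi>(r z) is a
  difference of two terms. The first is at most the value at r z of the harmonic majorant, the
  second is at least |f(r z)|^2. Thus any analytic function squeezed in modulus between f and the
  majorant oscillates no more than E allows; this is applied to the outer function and to its
  product with S.\<close>

lemma Garsia_dilation:
  assumes psi: "\<psi> holomorphic_on ball 0 1" and H: "sqint circ H"
    and up: "\<And>z. cmod z < 1 \<Longrightarrow> (cmod (\<psi> z))\<^sup>2 \<le> (\<M> t. (cmod (H t))\<^sup>2 * poisson z t)"
    and lo: "\<And>z. cmod z < 1 \<Longrightarrow> cmod (f z) \<le> cmod (\<psi> z)"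
    and r: "0 \<le> r" "r < 1" and z: "cmod z < 1"
  shows "(\<M> t. cmod (dil \<psi> r t - \<psi> (of_real r * z)) * poisson z t)
     \<le> sqrt ((\<M> t. (cmod (H t))\<^sup>2 * poisson (of_real r * z) t) - (cmod (f (of_real r * z)))\<^sup>2)"
proof -
  define U where "U w = (\<M> t. (cmod (H t))\<^sup>2 * poisson w t)" for w
  have Hi: "integrable circ (\<lambda>t. (cmod (H t))\<^sup>2)" using H by (simp add: sqint_def)
  define A where "A = log_outer (\<lambda>t. (cmod (H t))\<^sup>2)"
  have A: "A holomorphic_on ball 0 1" unfolding A_def by (rule log_outer_holomorphic[OF Hi])
  have UA: "U w = Re (A w)" if "cmod w < 1" for w unfolding U_def A_def Re_log_outer[OF Hi that] ..
  have "cmod (of_real r * z) \<le> 1 * cmod z" unfolding norm_mult using r by (intro mult_right_mono) auto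
  then have rz: "cmod (of_real r * z) < 1" using z by simp
  have rc: "cmod (of_real r * cis t) < 1" for t using r by (simp add: norm_mult)
  have sq: "sqint circ (dil \<psi> r)" by (rule sqint_dil[OF psi r])
  have cA: "integrable circ (dil A r)" by (intro integrable_circ_continuous continuous_on_dil A r)
  have iA: "integrable circ (\<lambda>t. Re (dil A r t))" using integrable_Re[OF cA] .
  have "(\<M> t. (cmod (dil \<psi> r t))\<^sup>2 * poisson z t) \<le> (\<M> t. Re (dil A r t) * poisson z t)"
  proof (rule poisson_integral_mono[OF _ iA z])
    show "integrable circ (\<lambda>t. (cmod (dil \<psi> r t))\<^sup>2)" using sq by (simp add: sqint_def)
    show "(cmod (dil \<psi> r t))\<^sup>2 \<le> Re (dil A r t)" for t using up[OF rc, of t] UA[OF rc, of t] by (simp add: U_def)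
  qed
  also have "\<dots> = (\<M> t. Re (dil A r t * poisson z t))" by simp
  also have "\<dots> = Re (\<M> t. dil A r t * poisson z t)" by (rule integral_Re[OF integrable_poisson_mult_complex[OF cA z]])
  \<comment> \<open>The majorant is the real part of an analytic function, so its dilation is
    reproduced by the Poisson kernel.\<close>
  also have "\<dots> = U (of_real r * z)" unfolding Poisson_dil[OF A r z] UA[OF rz] ..
  finally have 1: "(\<M> t. (cmod (dil \<psi> r t))\<^sup>2 * poisson z t) \<le> U (of_real r * z)" .
  have c: "sqint circ (\<lambda>t. \<psi> (of_real r * z))" by (simp add: sqint_def)
  define e2 where "e2 = U (of_real r * z) - (cmod (f (of_real r * z)))\<^sup>2"
  have f2: "(cmod (f (of_real r * z)))\<^sup>2 \<le> (cmod (\<psi> (of_real r * z)))\<^sup>2" by (intro power_mono lo rz) auto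
  have "(\<M> t. (cmod (dil \<psi> r t - \<psi> (of_real r * z)))\<^sup>2 * poisson z t) = (\<M> t. (cmod (dil \<psi> r t))\<^sup>2 * poisson z t) - (cmod (\<psi> (of_real r * z)))\<^sup>2"
    using poisson_variance[OF sq z, of "\<psi> (of_real r * z)"] unfolding Poisson_dil[OF psi r z] by simp
  also have "\<dots> \<le> e2" unfolding e2_def using 1 f2 by linarith
  finally have 2: "(\<M> t. (cmod (dil \<psi> r t - \<psi> (of_real r * z)))\<^sup>2 * poisson z t) \<le> e2" .
  moreover have "0 \<le> (\<M> t. (cmod (dil \<psi> r t - \<psi> (of_real r * z)))\<^sup>2 * poisson z t)"
    by (intro integral_nonneg_AE AE_I2 mult_nonneg_nonneg poisson_nonneg z) auto
  ultimately have "0 \<le> e2" by simp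
  then have "(\<M> t. cmod (dil \<psi> r t - \<psi> (of_real r * z)) * poisson z t) \<le> sqrt e2"
    using 2 by (intro poisson_l1_le_l2 sqint_diff sq c z) auto
  then show ?thesis by (simp add: e2_def U_def)
qed

text \<open>The kernel \<open>\<zeta>\<^sup>-\<^sup>N\<^sup>-\<^sup>2 / (1 - z / \<zeta>)\<^sup>2\<close> annihilates constants, so both factors of the product may be
  replaced by their oscillation around \<open>b\<close> and \<open>a\<close>; the factor \<open>|a|\<close> is absorbed by
  \<open>a (s - b) = (p s - a b) - s (p - a)\<close>.\<close>

lemma cauchy_derivative_bound:
  assumes s: "s \<in> borel_measurable borel" "\<And>t. cmod (s t) \<le> 1" and p: "integrable circ p" and z: "cmod z < 1"
    and e1: "(\<M> t. cmod (p t - a) * poisson z t) \<le> e"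
    and e2: "(\<M> t. cmod (p t * s t - a * b) * poisson z t) \<le> e"
  shows "cmod (\<M> t. (s t * cnj (p t) * cnj (cis t) ^ (N+1)) * cnj (cis t) / (1 - z * cnj (cis t))\<^sup>2) \<le> 3 * e / (1 - (cmod z)\<^sup>2)"
proof -
  have [measurable]: "s \<in> borel_measurable borel" by (rule s)
  have [measurable]: "p \<in> borel_measurable borel" using borel_measurable_integrable[OF p] by simp
  \<comment> \<open>The modulus of this kernel is \<open>poisson z t\<close> / (1 - |z|^2), so
    bounds for Poisson means bound the derivative.\<close>
  define k where "k t = cnj (cis t) ^ (N+1) * cnj (cis t) / (1 - z * cnj (cis t))\<^sup>2" for t
  have q: "0 < 1 - (cmod z)\<^sup>2" using z by (simp add: abs_square_less_1)
  have nk: "cmod (k t) = poisson z t / (1 - (cmod z)\<^sup>2)" for t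
  proof -
    have "1 - z * cnj (cis t) = (cis t - z) * cnj (cis t)" by (simp add: algebra_simps cis_cnj cis_mult)
    then have "cmod (1 - z * cnj (cis t)) = cmod (cis t - z)" by (simp only: norm_mult complex_mod_cnj norm_cis mult_1_right)
    then show ?thesis using q by (simp add: k_def poisson_def norm_mult norm_divide norm_power)
  qed
  have kc: "continuous_on UNIV k" unfolding k_def
    by (intro continuous_intros) (use cauchy_kernel_nz[OF z] in auto)
  have km [measurable]: "k \<in> borel_measurable borel" using kc by (rule borel_measurable_continuous_onI)
  \<comment> \<open>The conjugate of the kernel is u^(N+2) / (1 - cnj z u)^2 on the circle, analytic
    near the closed disc and zero at the origin.\<close>
  have k0: "(\<M> t. k t) = 0"
  proof -
    define R where "R = (if z = 0 then 2 else 1/cmod z)"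
    have R: "1 < R" using z by (auto simp: R_def)
    define g where "g u = u^(N+2) / (1 - cnj z * u)\<^sup>2" for u
    have nz: "1 - cnj z * u \<noteq> 0" if "u \<in> ball 0 R" for u
    proof
      assume "1 - cnj z * u = 0"
      then have "cmod (cnj z * u) = 1" by (metis norm_one right_minus_eq)
      then have *: "cmod z * cmod u = 1" by (simp add: norm_mult)
      then have "z \<noteq> 0" by auto
      then have "cmod u < 1 / cmod z" using that by (auto simp: R_def)
      then show False using * \<open>z \<noteq> 0\<close> by (simp add: field_simps)
    qed
    have "g holomorphic_on ball 0 R" unfolding g_def by (intro holomorphic_intros) (use nz in auto)
    from mean_value_circ[OF this R] have "(\<M> t. g (cis t)) = 0" by (simp add: g_def)
    then have "cnj (\<M> t. g (cis t)) = 0" by simp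
    then have "(\<M> t. cnj (g (cis t))) = 0" by (subst Bochner_Integration.integral_cnj)
    moreover have "cnj (g (cis t)) = k t" for t by (simp add: g_def k_def)
    ultimately show ?thesis by simp
  qed
  define D where "D t = (s t * cnj (p t) - cnj a * b) * k t" for t
  have kb: "cmod (k t) \<le> 2 / (1 - cmod z) / (1 - (cmod z)\<^sup>2)" for t
    unfolding nk using q poisson_le[OF z] by (intro divide_right_mono) auto
  have i1: "integrable circ (\<lambda>t. s t * cnj (p t) * k t)"
  proof (rule Bochner_Integration.integrable_bound)
    show "integrable circ (\<lambda>t. 2 / (1 - cmod z) / (1 - (cmod z)\<^sup>2) * cmod (p t))" using p by auto
    show "AE t in circ. norm (s t * cnj (p t) * k t) \<le> norm (2 / (1 - cmod z) / (1 - (cmod z)\<^sup>2) * cmod (p t))"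
    proof (rule AE_I2)
      fix t
      have "cmod (s t) * cmod (p t) * cmod (k t) \<le> 1 * cmod (p t) * (2 / (1 - cmod z) / (1 - (cmod z)\<^sup>2))"
        by (intro mult_mono kb s) auto
      then show "norm (s t * cnj (p t) * k t) \<le> norm (2 / (1 - cmod z) / (1 - (cmod z)\<^sup>2) * cmod (p t))"
        using z q by (simp add: norm_mult mult_ac)
    qed
  qed measurable
  have i2: "integrable circ (\<lambda>t. cnj a * b * k t)" using integrable_circ_continuous[OF kc] by auto
  have "(\<M> t. (s t * cnj (p t) * cnj (cis t) ^ (N+1)) * cnj (cis t) / (1 - z * cnj (cis t))\<^sup>2) = (\<M> t. s t * cnj (p t) * k t)"
    by (simp add: k_def mult.assoc)
  also have "\<dots> = (\<M> t. D t) + (\<M> t. cnj a * b * k t)"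
    unfolding D_def left_diff_distrib using i1 i2 by simp
  also have "(\<M> t. cnj a * b * k t) = 0" using k0 by simp
  finally have "cmod (\<M> t. (s t * cnj (p t) * cnj (cis t) ^ (N+1)) * cnj (cis t) / (1 - z * cnj (cis t))\<^sup>2) = cmod (\<M> t. D t)" by simp
  also have "\<dots> \<le> (\<M> t. cmod (D t))" by (rule integral_norm_bound)
  also have "\<dots> \<le> (\<M> t. (2 * (cmod (p t - a) * poisson z t) + cmod (p t * s t - a * b) * poisson z t) / (1 - (cmod z)\<^sup>2))"
  proof (rule integral_mono)
    show "integrable circ (\<lambda>t. cmod (D t))" unfolding D_def left_diff_distrib using i1 i2 by (intro integrable_norm Bochner_Integration.integrable_diff)
    have ps: "integrable circ (\<lambda>t. p t * s t)"
      by (rule Bochner_Integration.integrable_bound[OF integrable_norm[OF p]]) (use s in \<open>auto simp: norm_mult intro!: mult_left_le\<close>)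
    show "integrable circ (\<lambda>t. (2 * (cmod (p t - a) * poisson z t) + cmod (p t * s t - a * b) * poisson z t) / (1 - (cmod z)\<^sup>2))"
      using p ps by (intro integrable_divide_zero Bochner_Integration.integrable_add integrable_mult_right integrable_poisson_mult z integrable_norm Bochner_Integration.integrable_diff) auto
    fix t
    have "s t * cnj (p t) - cnj a * b = s t * cnj (p t - a) + cnj a * (s t - b)" by (simp add: algebra_simps)
    then have "cmod (s t * cnj (p t) - cnj a * b) \<le> cmod (s t) * cmod (p t - a) + cmod a * cmod (s t - b)"
      by (metis complex_mod_cnj norm_mult norm_triangle_ineq)
    moreover have "cmod a * cmod (s t - b) \<le> cmod (p t * s t - a * b) + cmod (s t) * cmod (p t - a)"
    proof -
      have "a * (s t - b) = (p t * s t - a * b) - s t * (p t - a)" by (simp add: algebra_simps)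
      then show ?thesis by (metis norm_mult norm_triangle_ineq4)
    qed
    moreover have "cmod (s t) * cmod (p t - a) \<le> cmod (p t - a)" using s(2)[of t] by (intro mult_left_le_one_le) auto
    ultimately have "cmod (s t * cnj (p t) - cnj a * b) \<le> 2 * cmod (p t - a) + cmod (p t * s t - a * b)" by linarith
    then have "cmod (D t) \<le> (2 * cmod (p t - a) + cmod (p t * s t - a * b)) * (poisson z t / (1 - (cmod z)\<^sup>2))"
      unfolding D_def norm_mult nk using poisson_nonneg[OF z, of t] q by (intro mult_right_mono) auto
    then show "cmod (D t) \<le> (2 * (cmod (p t - a) * poisson z t) + cmod (p t * s t - a * b) * poisson z t) / (1 - (cmod z)\<^sup>2)"
      by (simp add: distrib_right mult.assoc)
  qed
  also have "\<dots> = (2 * (\<M> t. cmod (p t - a) * poisson z t) + (\<M> t. cmod (p t * s t - a * b) * poisson z t)) / (1 - (cmod z)\<^sup>2)"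
  proof -
    have ps: "integrable circ (\<lambda>t. p t * s t)"
      by (rule Bochner_Integration.integrable_bound[OF integrable_norm[OF p]]) (use s in \<open>auto simp: norm_mult intro!: mult_left_le\<close>)
    have "integrable circ (\<lambda>t. cmod (p t - a) * poisson z t)" "integrable circ (\<lambda>t. cmod (p t * s t - a * b) * poisson z t)"
      using p ps by (auto intro!: integrable_poisson_mult z)
    then show ?thesis by simp
  qed
  also have "\<dots> \<le> 3 * e / (1 - (cmod z)\<^sup>2)" using e1 e2 q by (intro divide_right_mono) auto
  finally show ?thesis .
qed

text \<open>\<open>k\<close> is the Cauchy transform of the limit of the functions
  \<open>u n\<close>, but the limit is taken only after the transform. The transforms converge
  locally uniformly since the \<open>u n\<close> are Cauchy in mean; the derivative bound, which
  holds with E at \<open>rr n\<close> z, passes to the limit by continuity of E; and the pairing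
  with \<open>k\<close> is evaluated by letting n tend to infinity at a fixed radius.\<close>

lemma annihilator_exists:
  assumes S: "S holomorphic_on ball 0 1" and S1: "\<And>z. cmod z < 1 \<Longrightarrow> cmod (S z) \<le> 1" and ph: "hardy \<phi>"
    and E: "continuous_on (ball 0 1) E"
    and o1: "\<And>r z. 0 \<le> r \<Longrightarrow> r < 1 \<Longrightarrow> cmod z < 1 \<Longrightarrow>
      (\<M> t. cmod (dil \<phi> r t - \<phi> (of_real r * z)) * poisson z t) \<le> E (of_real r * z)"
    and o2: "\<And>r z. 0 \<le> r \<Longrightarrow> r < 1 \<Longrightarrow> cmod z < 1 \<Longrightarrow>
      (\<M> t. cmod (dil \<phi> r t * dil S r t - \<phi> (of_real r * z) * S (of_real r * z)) * poisson z t) \<le> E (of_real r * z)"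
    and V: "summable V" "\<And>n. 0 \<le> V n"
    and EV: "\<And>n z. 1 / 2^(n+1) \<le> 1 - cmod z \<Longrightarrow> 1 - cmod z \<le> 1 / 2^n \<Longrightarrow> E z \<le> V n"
  obtains k where "W1 k"
    "\<And>F B. F holomorphic_on ball 0 1 \<Longrightarrow> (\<And>z. cmod z < 1 \<Longrightarrow> cmod (F z) \<le> B) \<Longrightarrow>
       (\<lambda>n. \<integral>t. (cnj (dil S (rr n) t) * dil \<phi> (rr n) t * cis t ^ (N+1)) * dil F (rr n) t \<partial>circ) \<longlonglongrightarrow> bloch_pairing F k"
proof -
  have ph_hol: "\<phi> holomorphic_on ball 0 1" using ph by (rule hardy_holomorphic)
  obtain Bp where Bp: "\<And>r. 0 \<le> r \<Longrightarrow> r < 1 \<Longrightarrow> l2 circ (dil \<phi> r) \<le> Bp" using ph by (auto simp: hardy_def)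
  \<comment> \<open>The maximum with 1 makes \<open>b\<close> positive, so that it can be divided
    by.\<close>
  define b where "b = max Bp 1"
  have b: "0 < b" "\<And>n. l2 circ (dil \<phi> (rr n)) \<le> b" using Bp rr by (auto simp: b_def intro: max.coboundedI1)
  have Sh: "hardy S" by (rule bounded_imp_hardy[OF S]) (use S1 in auto)
  have rc: "cmod (of_real (rr n) * cis t) < 1" for n t using rr[of n] by (simp add: norm_mult)
  have Sb: "cmod (dil S (rr n) t) \<le> 1" for n t by (rule S1[OF rc])
  have Sm [measurable]: "dil S (rr n) \<in> borel_measurable borel" for n using rr by (intro dil_measurable S) auto
  have pm [measurable]: "dil \<phi> (rr n) \<in> borel_measurable borel" for n using rr by (intro dil_measurable ph_hol) auto
  have cm [measurable]: "(\<lambda>t. cnj (cis t) ^ j) \<in> borel_measurable borel" for j by (intro borel_measurable_continuous_onI continuous_intros)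
  have sqS: "sqint circ (dil S (rr n))" and sqp: "sqint circ (dil \<phi> (rr n))" for n using rr by (auto intro!: sqint_dil S ph_hol)
  define u where "u n t = dil S (rr n) t * cnj (dil \<phi> (rr n) t) * cnj (cis t) ^ (N+1)" for n t
  have um [measurable]: "u n \<in> borel_measurable borel" for n unfolding u_def by measurable
  have ub: "\<exists>B. \<forall>t. cmod (u n t) \<le> B" for n
  proof -
    obtain B where B: "\<And>t. cmod (dil \<phi> (rr n) t) \<le> B" by (rule dil_bounded[OF ph_hol rr(1) rr(3)]) blast
    have "cmod (u n t) = cmod (dil S (rr n) t) * cmod (dil \<phi> (rr n) t)" for t
      by (simp only: u_def norm_mult norm_power complex_mod_cnj norm_cis power_one mult_1_right)
    also have "cmod (dil S (rr n) t) * cmod (dil \<phi> (rr n) t) \<le> 1 * B" for t using Sb B by (intro mult_mono) auto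
    finally show ?thesis by blast
  qed
  have ui: "integrable circ (u n)" for n using ub[of n] integrable_circ_bounded[OF um] by blast
  have usq: "sqint circ (u n)" "l2 circ (u n) \<le> b" for n
  proof -
    have le: "cmod (u n t) \<le> cmod (dil \<phi> (rr n) t)" for t
      using Sb[of n t] by (auto simp: u_def norm_mult norm_power intro!: mult_left_le_one_le)
    show "sqint circ (u n)" using l2_mono(1)[OF sqp _ le] by simp
    show "l2 circ (u n) \<le> b" using l2_mono(2)[OF sqp _ le] b(2)[of n] by simp
  qed
  \<comment> \<open>A product of two sequences that are Cauchy in L^2 is Cauchy in L^1: one factor
    is bounded by 1, the other by \<open>b\<close> in norm.\<close>
  have uC: "\<exists>M. \<forall>m\<ge>M. \<forall>n\<ge>M. (\<M> t. cmod (u m t - u n t)) < \<epsilon>" if e: "\<epsilon> > 0" for \<epsilon>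
  proof -
    have e2: "\<epsilon> / 2 > 0" "\<epsilon> / (2*b) > 0" using e b by auto
    obtain s1 where s1: "0 \<le> s1" "s1 < 1"
      "\<And>r s. s1 \<le> r \<Longrightarrow> s1 \<le> s \<Longrightarrow> r < 1 \<Longrightarrow> s < 1 \<Longrightarrow> l2 circ (\<lambda>t. dil \<phi> r t - dil \<phi> s t) < \<epsilon>/2" using hardy_Cauchy[OF ph e2(1)] by blast
    obtain s2 where s2: "0 \<le> s2" "s2 < 1"
      "\<And>r s. s2 \<le> r \<Longrightarrow> s2 \<le> s \<Longrightarrow> r < 1 \<Longrightarrow> s < 1 \<Longrightarrow> l2 circ (\<lambda>t. dil S r t - dil S s t) < \<epsilon>/(2*b)" using hardy_Cauchy[OF Sh e2(2)] by blast
    obtain M where M: "\<And>n. n \<ge> M \<Longrightarrow> s1 \<le> rr n \<and> s2 \<le> rr n"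
      using eventually_conj[OF rr_eventually[OF s1(2)] rr_eventually[OF s2(2)]] by (auto simp: eventually_sequentially)
    show ?thesis
    proof (intro exI[of _ M] allI impI)
      fix m n assume mn: "m \<ge> M" "n \<ge> M"
      have d1: "l2 circ (\<lambda>t. dil \<phi> (rr m) t - dil \<phi> (rr n) t) < \<epsilon>/2" using s1(3) M mn rr by blast
      have d2: "l2 circ (\<lambda>t. dil S (rr m) t - dil S (rr n) t) < \<epsilon>/(2*b)" using s2(3) M mn rr by blast
      have sd1: "sqint circ (\<lambda>t. dil \<phi> (rr m) t - dil \<phi> (rr n) t)" by (rule sqint_diff[OF sqp sqp])
      have sd2: "sqint circ (\<lambda>t. dil S (rr m) t - dil S (rr n) t)" by (rule sqint_diff[OF sqS sqS])
      have "(\<M> t. cmod (u m t - u n t)) \<le> (\<M> t. cmod (dil \<phi> (rr m) t - dil \<phi> (rr n) t) + cmod ((dil S (rr m) t - dil S (rr n) t) * dil \<phi> (rr n) t))"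
      proof (rule integral_mono)
        show "integrable circ (\<lambda>t. cmod (u m t - u n t))" using ui by auto
        show "integrable circ (\<lambda>t. cmod (dil \<phi> (rr m) t - dil \<phi> (rr n) t) + cmod ((dil S (rr m) t - dil S (rr n) t) * dil \<phi> (rr n) t))"
          by (intro Bochner_Integration.integrable_add integrable_norm l1_le_l2(1)[OF sd1] sqint_mult_integrable[OF sd2 sqp])
        fix t
        have "u m t - u n t = (dil S (rr m) t * cnj (dil \<phi> (rr m) t - dil \<phi> (rr n) t) + (dil S (rr m) t - dil S (rr n) t) * cnj (dil \<phi> (rr n) t)) * cnj (cis t) ^ (N+1)"
          by (simp add: u_def algebra_simps)
        then have "cmod (u m t - u n t) = cmod (dil S (rr m) t * cnj (dil \<phi> (rr m) t - dil \<phi> (rr n) t) + (dil S (rr m) t - dil S (rr n) t) * cnj (dil \<phi> (rr n) t))"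
          by (simp only: norm_mult norm_power complex_mod_cnj norm_cis power_one mult_1_right)
        also have "\<dots> \<le> cmod (dil S (rr m) t * cnj (dil \<phi> (rr m) t - dil \<phi> (rr n) t)) + cmod ((dil S (rr m) t - dil S (rr n) t) * cnj (dil \<phi> (rr n) t))" by (rule norm_triangle_ineq)
        also have "cmod (dil S (rr m) t * cnj (dil \<phi> (rr m) t - dil \<phi> (rr n) t)) \<le> cmod (dil \<phi> (rr m) t - dil \<phi> (rr n) t)"
          unfolding norm_mult complex_mod_cnj using Sb[of m t] by (intro mult_left_le_one_le) auto
        finally show "cmod (u m t - u n t) \<le> cmod (dil \<phi> (rr m) t - dil \<phi> (rr n) t) + cmod ((dil S (rr m) t - dil S (rr n) t) * dil \<phi> (rr n) t)"
          by (simp only: norm_mult complex_mod_cnj)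
      qed
      also have "\<dots> = (\<M> t. cmod (dil \<phi> (rr m) t - dil \<phi> (rr n) t)) + (\<M> t. cmod ((dil S (rr m) t - dil S (rr n) t) * dil \<phi> (rr n) t))"
        by (intro Bochner_Integration.integral_add integrable_norm l1_le_l2(1)[OF sd1] sqint_mult_integrable[OF sd2 sqp])
      also have "\<dots> \<le> l2 circ (\<lambda>t. dil \<phi> (rr m) t - dil \<phi> (rr n) t) + l2 circ (\<lambda>t. dil S (rr m) t - dil S (rr n) t) * l2 circ (dil \<phi> (rr n))"
        by (intro add_mono l1_le_l2(2)[OF sd1] l2_Cauchy_Schwarz[OF sd2 sqp])
      also have "\<dots> < \<epsilon>/2 + \<epsilon>/2"
      proof -
        have "l2 circ (\<lambda>t. dil S (rr m) t - dil S (rr n) t) * l2 circ (dil \<phi> (rr n)) \<le> \<epsilon>/(2*b) * b"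
          using d2 b(2)[of n] e2 by (intro mult_mono less_imp_le[OF d2]) auto
        then show ?thesis using d1 b(1) by simp
      qed
      finally show "(\<M> t. cmod (u m t - u n t)) < \<epsilon>" by simp
    qed
  qed
  define f where "f n = cauchy_transform (u n)" for n
  have fd: "cmod (f m z - f n z) \<le> (\<M> t. cmod (u m t - u n t)) / (1 - cmod z)" if z: "cmod z < 1" for m n z
    unfolding f_def cauchy_transform_diff[OF ui ui z] by (intro norm_cauchy_transform_le Bochner_Integration.integrable_diff ui z)
  have fconv: "convergent (\<lambda>n. f n z)" if z: "cmod z < 1" for z
  proof (rule Cauchy_convergent, rule CauchyI)
    fix e :: real assume "0 < e"
    then have "e * (1 - cmod z) > 0" using z by simp
    from uC[OF this] obtain M where M: "\<forall>m\<ge>M. \<forall>n\<ge>M. (\<M> t. cmod (u m t - u n t)) < e * (1 - cmod z)" by blast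
    show "\<exists>M. \<forall>m\<ge>M. \<forall>n\<ge>M. norm (f m z - f n z) < e"
    proof (intro exI[of _ M] allI impI)
      fix m n assume "m \<ge> M" "n \<ge> M"
      then have "(\<M> t. cmod (u m t - u n t)) / (1 - cmod z) < e" using M z by (simp add: divide_less_eq)
      then show "norm (f m z - f n z) < e" using fd[OF z, of m n] by linarith
    qed
  qed
  define k where "k z = lim (\<lambda>n. f n z)" for z
  have klim: "(\<lambda>n. f n z) \<longlonglongrightarrow> k z" if "cmod z < 1" for z
    using fconv[OF that] by (simp add: k_def convergent_LIMSEQ_iff)
  have kunif: "\<exists>M. \<forall>n\<ge>M. \<forall>z. cmod z < 1 \<longrightarrow> cmod (f n z - k z) \<le> \<epsilon> / (1 - cmod z)" if e: "\<epsilon> > 0" for \<epsilon>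
  proof -
    from uC[OF e] obtain M where M: "\<forall>m\<ge>M. \<forall>n\<ge>M. (\<M> t. cmod (u m t - u n t)) < \<epsilon>" by blast
    show ?thesis
    proof (intro exI[of _ M] allI impI)
      fix n z assume n: "n \<ge> M" and z: "cmod z < 1"
      have "(\<lambda>m. cmod (f n z - f m z)) \<longlonglongrightarrow> cmod (f n z - k z)" by (intro tendsto_intros klim z)
      moreover have "\<exists>N. \<forall>m\<ge>N. cmod (f n z - f m z) \<le> \<epsilon> / (1 - cmod z)"
      proof (intro exI[of _ M] allI impI)
        fix m assume "m \<ge> M"
        then have "(\<M> t. cmod (u n t - u m t)) / (1 - cmod z) \<le> \<epsilon> / (1 - cmod z)" using M n z by (intro divide_right_mono) (auto intro: less_imp_le)
        then show "cmod (f n z - f m z) \<le> \<epsilon> / (1 - cmod z)" using fd[OF z, of n m] by linarith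
      qed
      ultimately show "cmod (f n z - k z) \<le> \<epsilon> / (1 - cmod z)" by (rule LIMSEQ_le_const2)
    qed
  qed
  have ulim: "uniform_limit (cball 0 \<rho>) f k sequentially" if rho: "\<rho> < 1" for \<rho>
  proof (rule uniform_limitI)
    fix e :: real assume e: "0 < e"
    then have "e/2 * (1 - \<rho>) > 0" using rho by simp
    from kunif[OF this] obtain M where M: "\<forall>n\<ge>M. \<forall>z. cmod z < 1 \<longrightarrow> cmod (f n z - k z) \<le> e/2 * (1 - \<rho>) / (1 - cmod z)" by blast
    have "\<forall>x\<in>cball 0 \<rho>. dist (f n x) (k x) < e" if "n \<ge> M" for n
    proof
      fix x :: complex assume x: "x \<in> cball 0 \<rho>"
      then have x1: "cmod x < 1" "1 - \<rho> \<le> 1 - cmod x" using rho by auto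
      have "cmod (f n x - k x) \<le> e/2 * (1 - \<rho>) / (1 - cmod x)" using M that x1 by blast
      also have "\<dots> \<le> e/2 * (1 - cmod x) / (1 - cmod x)" using x1 e by (intro divide_right_mono mult_left_mono) auto
      also have "\<dots> = e/2" using x1 by (subst nonzero_mult_div_cancel_right) auto
      finally show "dist (f n x) (k x) < e" using e by (simp add: dist_norm)
    qed
    then show "\<forall>\<^sub>F n in sequentially. \<forall>x\<in>cball 0 \<rho>. dist (f n x) (k x) < e" by (auto simp: eventually_sequentially)
  qed
  define f' where "f' n z = (\<M> t. u n t * cnj (cis t) / (1 - z * cnj (cis t))\<^sup>2)" for n z
  have hfd: "(f n has_field_derivative f' n z) (at z)" if "z \<in> ball 0 1" for n z
    unfolding f_def f'_def by (rule has_field_derivative_cauchy_transform[OF ui]) (use that in simp)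
  have "\<exists>g'. \<forall>x\<in>ball 0 1. (k has_field_derivative g' x) (at x) \<and> (\<lambda>n. f' n x) \<longlonglongrightarrow> g' x"
  proof (rule has_complex_derivative_uniform_sequence[OF open_ball hfd])
    fix x :: complex assume x: "x \<in> ball 0 1"
    define d where "d = (1 - cmod x)/2"
    have d: "0 < d" "cmod x + d < 1" using x by (auto simp: d_def field_simps)
    have sub: "cball x d \<subseteq> cball 0 (cmod x + d)"
    proof
      fix y assume "y \<in> cball x d"
      then have "cmod (y - x) \<le> d" by (simp add: dist_norm norm_minus_commute)
      then show "y \<in> cball 0 (cmod x + d)" using norm_triangle_ineq[of x "y - x"] by simp
    qed
    show "\<exists>d>0. cball x d \<subseteq> ball 0 1 \<and> uniform_limit (cball x d) f k sequentially"
      using d sub uniform_limit_on_subset[OF ulim[OF d(2)] sub] by (intro exI[of _ d]) auto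
  qed
  then obtain k' where k': "\<And>x. x \<in> ball 0 1 \<Longrightarrow> (k has_field_derivative k' x) (at x)"
    "\<And>x. x \<in> ball 0 1 \<Longrightarrow> (\<lambda>n. f' n x) \<longlonglongrightarrow> k' x" by blast
  have khol: "k holomorphic_on ball 0 1"
    unfolding holomorphic_on_open[OF open_ball] using k'(1) by blast
  have kd: "(1 - cmod z) * cmod (deriv k z) \<le> 3 * E z" if z: "cmod z < 1" for z
  proof -
    have q: "0 < 1 - (cmod z)\<^sup>2" using z by (simp add: abs_square_less_1)
    have bd: "cmod (f' n z) \<le> 3 * E (of_real (rr n) * z) / (1 - (cmod z)\<^sup>2)" for n
      unfolding f'_def u_def
      by (rule cauchy_derivative_bound[OF Sm Sb l1_le_l2(1)[OF sqp] z o1[OF rr(1) rr(3) z] o2[OF rr(1) rr(3) z]])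
    have El: "(\<lambda>n. E (of_real (rr n) * z)) \<longlonglongrightarrow> E z"
    proof -
      have "isCont E z" using E z by (simp add: continuous_on_eq_continuous_at)
      moreover have "(\<lambda>n. of_real (rr n) * z) \<longlonglongrightarrow> of_real 1 * z" by (intro tendsto_intros rr_tendsto)
      ultimately show ?thesis using isCont_tendsto_compose[of z E "\<lambda>n. of_real (rr n) * z"] by simp
    qed
    have "(\<lambda>n. cmod (f' n z)) \<longlonglongrightarrow> cmod (k' z)" using k'(2)[of z] z by (intro tendsto_norm) auto
    moreover have "(\<lambda>n. 3 * E (of_real (rr n) * z) / (1 - (cmod z)\<^sup>2)) \<longlonglongrightarrow> 3 * E z / (1 - (cmod z)\<^sup>2)" by (intro tendsto_intros El) (use q in auto)
    ultimately have "cmod (k' z) \<le> 3 * E z / (1 - (cmod z)\<^sup>2)" using bd by (intro LIMSEQ_le) auto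
    moreover have "deriv k z = k' z" using k'(1)[of z] z by (intro DERIV_imp_deriv) auto
    ultimately have "(1 - (cmod z)\<^sup>2) * cmod (deriv k z) \<le> 3 * E z" using q by (simp add: field_simps)
    moreover have "1 - cmod z \<le> 1 - (cmod z)\<^sup>2" using z by (simp add: power2_eq_square mult_left_le_one_le)
    then have "(1 - cmod z) * cmod (deriv k z) \<le> (1 - (cmod z)\<^sup>2) * cmod (deriv k z)" by (intro mult_right_mono) auto
    ultimately show ?thesis by linarith
  qed
  have W: "W1 k"
  proof (rule W1_of_dyadic_bound[OF khol, where V="\<lambda>n. 3 * V n"])
    show "summable (\<lambda>n. 3 * V n)" using V by (intro summable_mult)
    show "0 \<le> 3 * V n" for n using V by simp
    fix n z assume z: "1 / 2^(n+1) \<le> 1 - cmod z" "1 - cmod z \<le> 1 / 2^n"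
    have "(0::real) < 1 / 2^(n+1)" by simp
    then have "cmod z < 1" using z(1) by linarith
    then show "(1 - cmod z) * cmod (deriv k z) \<le> 3 * V n" using kd[of z] EV[OF z] by simp
  qed
  have pair: "(\<lambda>n. \<integral>t. (cnj (dil S (rr n) t) * dil \<phi> (rr n) t * cis t ^ (N+1)) * dil F (rr n) t \<partial>circ) \<longlonglongrightarrow> bloch_pairing F k"
    if F: "F holomorphic_on ball 0 1" and FB: "\<And>z. cmod z < 1 \<Longrightarrow> cmod (F z) \<le> B" for F B
  proof -
    define B' where "B' = max B 1"
    have B': "0 < B'" "\<And>z. cmod z < 1 \<Longrightarrow> cmod (F z) \<le> B'" using FB by (auto simp: B'_def intro: max.coboundedI1)
    have Fh: "hardy F" by (rule bounded_imp_hardy[OF F]) (use FB in auto)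
    have Fb: "cmod (dil F (rr n) t) \<le> B'" for n t by (rule B'(2)[OF rc])
    have Fsq: "sqint circ (dil F r)" if "0 \<le> r" "r < 1" for r by (rule sqint_dil[OF F that])
    define X where "X n = (\<M> t. cnj (u n t) * dil F (rr n) t)" for n
    have cui: "integrable circ (\<lambda>t. cnj (u n t) * dil F r t)" if "0 \<le> r" "r < 1" for n r
      by (rule sqint_mult_integrable[OF sqint_cnj[OF usq(1)] Fsq[OF that]])
    have est: "cmod (\<integral>t. cnj (u n t) * dil F r t \<partial>circ - (\<M> t. cnj (u n t) * dil F s t)) \<le> b * l2 circ (\<lambda>t. dil F r t - dil F s t)"
      if r: "0 \<le> r" "r < 1" and s: "0 \<le> s" "s < 1" for n r s
    proof -
      have sd: "sqint circ (\<lambda>t. dil F r t - dil F s t)" by (rule sqint_diff[OF Fsq[OF r] Fsq[OF s]])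
      have "(\<M> t. cnj (u n t) * dil F r t) - (\<M> t. cnj (u n t) * dil F s t) = (\<M> t. cnj (u n t) * (dil F r t - dil F s t))"
        unfolding right_diff_distrib by (rule Bochner_Integration.integral_diff[symmetric, OF cui[OF r] cui[OF s]])
      also have "cmod \<dots> \<le> (\<M> t. cmod (cnj (u n t) * (dil F r t - dil F s t)))" by (rule integral_norm_bound)
      also have "\<dots> \<le> l2 circ (\<lambda>t. cnj (u n t)) * l2 circ (\<lambda>t. dil F r t - dil F s t)" by (rule l2_Cauchy_Schwarz[OF sqint_cnj[OF usq(1)] sd])
      also have "\<dots> \<le> b * l2 circ (\<lambda>t. dil F r t - dil F s t)" using usq(2)[of n] by (intro mult_right_mono) (auto simp: l2_def)
      finally show ?thesis .
    qed
    have "Cauchy X"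
    proof (rule CauchyI)
      fix e :: real assume e: "0 < e"
      have e2: "e/(2*B') > 0" "e/(2*b) > 0" using e B' b by auto
      obtain M1 where M1: "\<forall>m\<ge>M1. \<forall>n\<ge>M1. (\<M> t. cmod (u m t - u n t)) < e/(2*B')" using uC[OF e2(1)] by blast
      obtain s0 where s0: "0 \<le> s0" "s0 < 1"
        "\<And>r s. s0 \<le> r \<Longrightarrow> s0 \<le> s \<Longrightarrow> r < 1 \<Longrightarrow> s < 1 \<Longrightarrow> l2 circ (\<lambda>t. dil F r t - dil F s t) < e/(2*b)" using hardy_Cauchy[OF Fh e2(2)] by blast
      obtain M2 where M2: "\<And>n. n \<ge> M2 \<Longrightarrow> s0 \<le> rr n" using rr_eventually[OF s0(2)] by (auto simp: eventually_sequentially)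
      show "\<exists>M. \<forall>m\<ge>M. \<forall>n\<ge>M. norm (X m - X n) < e"
      proof (intro exI[of _ "max M1 M2"] allI impI)
        fix m n assume mn: "m \<ge> max M1 M2" "n \<ge> max M1 M2"
        have 1: "cmod ((\<M> t. cnj (u n t) * dil F (rr m) t) - X n) \<le> b * l2 circ (\<lambda>t. dil F (rr m) t - dil F (rr n) t)"
          unfolding X_def using rr by (intro est) auto
        have "l2 circ (\<lambda>t. dil F (rr m) t - dil F (rr n) t) < e/(2*b)" using s0(3) M2 mn rr by auto
        then have "b * l2 circ (\<lambda>t. dil F (rr m) t - dil F (rr n) t) < b * (e/(2*b))" using b by (intro mult_strict_left_mono) auto
        then have 2: "cmod ((\<M> t. cnj (u n t) * dil F (rr m) t) - X n) < e/2" using 1 b by simp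
        have "X m - (\<M> t. cnj (u n t) * dil F (rr m) t) = (\<M> t. cnj (u m t - u n t) * dil F (rr m) t)"
          unfolding X_def complex_cnj_diff left_diff_distrib
          by (rule Bochner_Integration.integral_diff[symmetric, OF cui[OF rr(1) rr(3)] cui[OF rr(1) rr(3)]])
        also have "cmod \<dots> \<le> (\<M> t. cmod (cnj (u m t - u n t) * dil F (rr m) t))" by (rule integral_norm_bound)
        also have "\<dots> \<le> (\<M> t. B' * cmod (u m t - u n t))"
        proof (rule integral_mono)
          show "integrable circ (\<lambda>t. cmod (cnj (u m t - u n t) * dil F (rr m) t))"
            unfolding complex_cnj_diff left_diff_distrib by (intro integrable_norm Bochner_Integration.integrable_diff cui rr)
          show "integrable circ (\<lambda>t. B' * cmod (u m t - u n t))" using ui by auto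
          show "cmod (cnj (u m t - u n t) * dil F (rr m) t) \<le> B' * cmod (u m t - u n t)" for t
            unfolding norm_mult complex_mod_cnj using mult_right_mono[OF Fb[of m t] norm_ge_zero[of "u m t - u n t"]] by (simp add: mult.commute)
        qed
        also have "\<dots> = B' * (\<M> t. cmod (u m t - u n t))" by simp
        also have "\<dots> < B' * (e/(2*B'))" using M1 mn B' by (intro mult_strict_left_mono) auto
        also have "\<dots> = e/2" using B' by simp
        finally have 3: "cmod (X m - (\<M> t. cnj (u n t) * dil F (rr m) t)) < e/2" .
        show "norm (X m - X n) < e" using 2 3 norm_triangle_ineq[of "X m - (\<M> t. cnj (u n t) * dil F (rr m) t)" "(\<M> t. cnj (u n t) * dil F (rr m) t) - X n"] by simp
      qed
    qed
    then obtain Y where Y: "X \<longlonglongrightarrow> Y" using Cauchy_convergent convergent_def by blast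
    have "((\<lambda>r. \<integral>t. dil F r t * cnj (dil k r t) \<partial>circ) \<longlongrightarrow> Y) (at_left 1)"
    proof (rule tendstoI)
      fix e :: real assume e: "0 < e"
      have e2: "e/(2*b) > 0" using e b by auto
      obtain s0 where s0: "0 \<le> s0" "s0 < 1"
        "\<And>r s. s0 \<le> r \<Longrightarrow> s0 \<le> s \<Longrightarrow> r < 1 \<Longrightarrow> s < 1 \<Longrightarrow> l2 circ (\<lambda>t. dil F r t - dil F s t) < e/(2*b)" using hardy_Cauchy[OF Fh e2] by blast
      \<comment> \<open>The pairing at radius \<rho> evaluates F at radius \<rho>^2, and it is
        \<rho>^2 that has to lie beyond \<open>s0\<close>; this explains the square root.\<close>
      have bound: "dist (\<M> t. dil F \<rho> t * cnj (dil k \<rho> t)) Y < e" if rho: "sqrt s0 \<le> \<rho>" "\<rho> < 1" for \<rho>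
      proof -
        have r0: "0 \<le> \<rho>" using rho(1) s0(1) by (meson order_trans real_sqrt_ge_zero)
        have r2: "s0 \<le> \<rho>\<^sup>2" "\<rho>\<^sup>2 < 1" "0 \<le> \<rho>\<^sup>2" using rho r0 s0(1) by (auto simp: sqrt_le_D power_less_one_iff)
        define Q where "Q n = (\<M> t. dil F \<rho> t * cnj (dil (f n) \<rho> t))" for n
        have Qeq: "Q n = (\<M> t. cnj (u n t) * dil F (\<rho>\<^sup>2) t)" for n
        proof -
          obtain B where "\<And>t. cmod (u n t) \<le> B" using ub by blast
          then show ?thesis unfolding Q_def f_def by (intro cauchy_transform_pairing[OF F r0 rho(2) um])
        qed
        have fh: "f n holomorphic_on ball 0 1" for n unfolding holomorphic_on_open[OF open_ball] using hfd by blast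
        obtain BF where BF: "\<And>t. cmod (dil F \<rho> t) \<le> BF" by (rule dil_bounded[OF F r0 rho(2)]) blast
        have nr: "cmod (of_real \<rho> * cis t) = \<rho>" for t using r0 by (simp add: norm_mult)
        have Qlim: "Q \<longlonglongrightarrow> (\<M> t. dil F \<rho> t * cnj (dil k \<rho> t))"
        proof -
          \<comment> \<open>Only the terms beyond M have a common bound, hence the shifted sequence
            in the dominated convergence argument.\<close>
          from kunif[of 1] obtain M where M: "\<forall>n\<ge>M. \<forall>z. cmod z < 1 \<longrightarrow> cmod (f n z - k z) \<le> 1 / (1 - cmod z)" by auto
          obtain Bk where Bk: "\<And>t. cmod (dil k \<rho> t) \<le> Bk" by (rule dil_bounded[OF khol r0 rho(2)]) blast
          have "(\<lambda>n. Q (n + M)) \<longlonglongrightarrow> (\<M> t. dil F \<rho> t * cnj (dil k \<rho> t))"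
            unfolding Q_def
          proof (rule integral_dominated_convergence[where w="\<lambda>_. BF * (Bk + 1/(1-\<rho>))"])
            have [measurable]: "dil F \<rho> \<in> borel_measurable borel" "dil k \<rho> \<in> borel_measurable borel" "dil (f n) \<rho> \<in> borel_measurable borel" for n
              by (auto intro!: dil_measurable F khol fh r0 rho)
            show "(\<lambda>t. dil F \<rho> t * cnj (dil k \<rho> t)) \<in> borel_measurable circ" "(\<lambda>t. dil F \<rho> t * cnj (dil (f (n + M)) \<rho> t)) \<in> borel_measurable circ" for n by simp_all
            show "integrable circ (\<lambda>_. BF * (Bk + 1/(1-\<rho>)))" by simp
            show "AE t in circ. (\<lambda>n. dil F \<rho> t * cnj (dil (f (n + M)) \<rho> t)) \<longlonglongrightarrow> dil F \<rho> t * cnj (dil k \<rho> t)"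
              by (intro AE_I2 tendsto_intros LIMSEQ_ignore_initial_segment klim) (use nr rho in simp)
            show "AE t in circ. norm (dil F \<rho> t * cnj (dil (f (n + M)) \<rho> t)) \<le> BF * (Bk + 1/(1-\<rho>))" for n
            proof (rule AE_I2)
              fix t
              have "cmod (dil (f (n + M)) \<rho> t - dil k \<rho> t) \<le> 1 / (1 - \<rho>)" using M nr[of t] rho by (metis le_add2)
              then have "cmod (dil (f (n + M)) \<rho> t) \<le> Bk + 1/(1-\<rho>)" using Bk[of t] norm_triangle_ineq[of "dil k \<rho> t" "dil (f (n + M)) \<rho> t - dil k \<rho> t"] by simp
              moreover have "0 \<le> BF" using BF[of 0] norm_ge_zero order_trans by blast
              ultimately show "norm (dil F \<rho> t * cnj (dil (f (n + M)) \<rho> t)) \<le> BF * (Bk + 1/(1-\<rho>))"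
                unfolding norm_mult complex_mod_cnj by (intro mult_mono BF) auto
            qed
          qed
          then show ?thesis by (rule LIMSEQ_offset)
        qed
        obtain M where M: "\<And>n. n \<ge> M \<Longrightarrow> s0 \<le> rr n" using rr_eventually[OF s0(2)] by (auto simp: eventually_sequentially)
        have "(\<lambda>n. cmod (Q n - X n)) \<longlonglongrightarrow> cmod ((\<M> t. dil F \<rho> t * cnj (dil k \<rho> t)) - Y)" by (intro tendsto_intros Qlim Y)
        moreover have "\<exists>N. \<forall>n\<ge>N. cmod (Q n - X n) \<le> e/2"
        proof (intro exI[of _ M] allI impI)
          fix n assume n: "n \<ge> M"
          have "cmod (Q n - X n) \<le> b * l2 circ (\<lambda>t. dil F (\<rho>\<^sup>2) t - dil F (rr n) t)"
            unfolding Qeq X_def by (rule est) (use r2 rr in auto)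
          also have "\<dots> \<le> b * (e/(2*b))" using s0(3)[of "\<rho>\<^sup>2" "rr n"] M[OF n] r2 rr b by (intro mult_left_mono) (auto intro: less_imp_le)
          also have "\<dots> = e/2" using b by simp
          finally show "cmod (Q n - X n) \<le> e/2" .
        qed
        ultimately have "cmod ((\<M> t. dil F \<rho> t * cnj (dil k \<rho> t)) - Y) \<le> e/2" by (rule LIMSEQ_le_const2)
        then show ?thesis using e by (simp add: dist_norm)
      qed
      have "sqrt s0 < 1" using s0 by (simp add: real_sqrt_lt_1_iff)
      then show "\<forall>\<^sub>F r in at_left 1. dist (\<M> t. dil F r t * cnj (dil k r t)) Y < e"
        by (intro eventually_at_leftI[of "sqrt s0"]) (auto intro!: bound)
    qed
    then have "bloch_pairing F k = Y" by (rule bloch_pairing_eqI[OF F khol])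
    moreover have "X = (\<lambda>n. \<integral>t. (cnj (dil S (rr n) t) * dil \<phi> (rr n) t * cis t ^ (N+1)) * dil F (rr n) t \<partial>circ)"
      by (rule ext) (simp add: X_def u_def)
    ultimately show ?thesis using Y by (simp only:)
  qed
  show ?thesis by (rule that[OF W pair])
qed

section \<open>Division by the singular inner factor\<close>

context
  fixes Y :: "nat \<Rightarrow> real \<Rightarrow> complex" and M :: real
  assumes Y: "\<And>n. sqint circ (Y n)" and YM: "\<And>n. l2 circ (Y n) \<le> M"
    and ann: "\<And>N. (\<lambda>n. \<integral>t. Y n t * cis t ^ (N+1) \<partial>circ) \<longlonglongrightarrow> 0"
begin

lemma Y_mult_integrable:
  assumes "continuous_on UNIV f" "\<And>t. cmod (f t) \<le> B" shows "integrable circ (\<lambda>t. Y n t * f t)"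
  by (intro sqint_mult_integrable Y sqint_circ_bounded(1)[of f B] borel_measurable_continuous_onI assms)

lemma annihilates_poly: "(\<lambda>n. \<integral>t. Y n t * (cis t * poly q (cis t)) \<partial>circ) \<longlonglongrightarrow> 0"
proof -
  have eq: "(\<M> t. Y n t * (cis t * poly q (cis t))) = (\<Sum>i\<le>degree q. coeff q i * (\<M> t. Y n t * cis t ^ (i+1)))" for n
  proof -
    have "Y n t * (cis t * poly q (cis t)) = (\<Sum>i\<le>degree q. coeff q i * (Y n t * cis t ^ (i+1)))" for t
      unfolding poly_altdef sum_distrib_left by (intro sum.cong refl) (simp add: mult_ac)
    moreover have "integrable circ (\<lambda>t. coeff q i * (Y n t * cis t ^ (i+1)))" for i
      by (intro integrable_mult_right Y_mult_integrable[where B=1] continuous_intros) (simp add: norm_mult norm_power)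
    ultimately show ?thesis by (simp only: Bochner_Integration.integral_sum integral_mult_right_zero)
  qed
  have "(\<lambda>n. \<Sum>i\<le>degree q. coeff q i * (\<M> t. Y n t * cis t ^ (i+1))) \<longlonglongrightarrow> (\<Sum>i\<le>degree q. coeff q i * 0)"
    by (intro tendsto_intros ann)
  then show ?thesis unfolding eq by simp
qed

lemma annihilates_holomorphic:
  assumes G: "G holomorphic_on ball 0 R" and R: "1 < R"
  shows "(\<lambda>n. \<integral>t. Y n t * (cis t * G (cis t)) \<partial>circ) \<longlonglongrightarrow> 0"
proof (rule LIMSEQ_I)
  fix e :: real assume e: "0 < e"
  define \<epsilon> where "\<epsilon> = e / (2 * (\<bar>M\<bar> + 1))"
  have eps: "0 < \<epsilon>" using e by (simp add: \<epsilon>_def)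
  \<comment> \<open>G is the dilation by 1/\<rho> of a function on the unit disc, and such dilations
    are uniform limits of polynomials on the closed disc.\<close>
  obtain \<rho> where rho: "1 < \<rho>" "\<rho> < R" using R dense by blast
  have "(\<lambda>z. G (of_real \<rho> * z)) holomorphic_on ball 0 1"
  proof -
    have "(G \<circ> (\<lambda>z. of_real \<rho> * z)) holomorphic_on ball 0 1"
    proof (rule holomorphic_on_compose_gen[OF _ G])
      have "cmod (of_real \<rho> * z) < R" if "cmod z < 1" for z
      proof -
        have "\<rho> * cmod z \<le> \<rho> * 1" using that rho by (intro mult_left_mono) auto
        then have "\<rho> * cmod z < R" using rho by linarith
        then show ?thesis using rho by (simp add: norm_mult)
      qed
      then show "(*) (complex_of_real \<rho>) ` ball 0 1 \<subseteq> ball 0 R" by auto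
    qed (intro holomorphic_intros)
    then show ?thesis by (simp add: o_def)
  qed
  from dil_poly_approx[OF this, of "1/\<rho>" \<epsilon>] rho eps
  obtain q where q: "\<And>z. cmod z \<le> 1 \<Longrightarrow> cmod (G z - poly q z) < \<epsilon>" by auto
  have Gc: "continuous_on UNIV (\<lambda>t. G (cis t))" by (rule continuous_on_circle[OF G R])
  obtain no where no: "\<And>n. n \<ge> no \<Longrightarrow> cmod (\<M> t. Y n t * (cis t * poly q (cis t))) < e/2"
    using LIMSEQ_D[OF annihilates_poly, of "e/2" q] e by auto
  define D where "D t = cis t * (G (cis t) - poly q (cis t))" for t
  have Dc: "continuous_on UNIV D" unfolding D_def by (intro continuous_intros Gc)
  have Db: "cmod (D t) \<le> \<epsilon>" for t using q[of "cis t"] by (simp add: D_def norm_mult)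
  have Dsq: "sqint circ D" "l2 circ D \<le> \<epsilon>" using sqint_circ_bounded[OF borel_measurable_continuous_onI[OF Dc] Db] by auto
  show "\<exists>no. \<forall>n\<ge>no. norm ((\<M> t. Y n t * (cis t * G (cis t))) - 0) < e"
  proof (intro exI[of _ no] allI impI)
    fix n assume n: "n \<ge> no"
    have qi: "integrable circ (\<lambda>t. Y n t * (cis t * poly q (cis t)))"
    proof (rule sqint_mult_integrable[OF Y])
      have "cmod (cis t) \<le> 1" for t by simp
      from sqint_mult_bounded(1)[OF sqint_poly _ this] show "sqint circ (\<lambda>t. cis t * poly q (cis t))" by simp
    qed
    have "(\<M> t. Y n t * (cis t * G (cis t))) = (\<M> t. Y n t * D t + Y n t * (cis t * poly q (cis t)))"
      by (intro Bochner_Integration.integral_cong) (auto simp: D_def algebra_simps)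
    also have "\<dots> = (\<M> t. Y n t * D t) + (\<M> t. Y n t * (cis t * poly q (cis t)))"
      by (intro Bochner_Integration.integral_add qi sqint_mult_integrable Y Dsq)
    also have "cmod \<dots> \<le> cmod (\<M> t. Y n t * D t) + cmod (\<M> t. Y n t * (cis t * poly q (cis t)))" by (rule norm_triangle_ineq)
    also have "cmod (\<M> t. Y n t * D t) \<le> \<bar>M\<bar> * \<epsilon>"
    proof -
      have "cmod (\<M> t. Y n t * D t) \<le> (\<M> t. cmod (Y n t * D t))" by (rule integral_norm_bound)
      also have "\<dots> \<le> l2 circ (Y n) * l2 circ D" by (rule l2_Cauchy_Schwarz[OF Y Dsq(1)])
      also have "\<dots> \<le> \<bar>M\<bar> * \<epsilon>" using YM[of n] Dsq(2) by (intro mult_mono) auto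
      finally show ?thesis .
    qed
    also have "\<bar>M\<bar> * \<epsilon> \<le> e/2"
    proof -
      have "\<bar>M\<bar> * \<epsilon> \<le> (\<bar>M\<bar> + 1) * \<epsilon>" using eps by (intro mult_right_mono) auto
      also have "\<dots> = e/2" unfolding \<epsilon>_def by (simp add: field_simps add_pos_nonneg)
      finally show ?thesis .
    qed
    finally show "norm ((\<M> t. Y n t * (cis t * G (cis t))) - 0) < e" using no[OF n] by simp
  qed
qed

lemma sqint_poly_poisson: "cmod z < 1 \<Longrightarrow> sqint circ (\<lambda>t. poisson z t * f t)" if "sqint circ f" for f :: "real \<Rightarrow> complex"
  by (rule sqint_mult_bounded(1)[OF that, where B="2 / (1 - cmod z)"])
     (auto simp: poisson_le poisson_nonneg)

text \<open>q(u) - q(z) is divisible by u - z, which cancels the only pole of the Poisson kernel in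
  the closed disc. What remains is cis t times a function analytic near the closed disc, and this is
  annihilated in the limit.\<close>

lemma multiplicative_poly:
  assumes z: "cmod z < 1"
  shows "(\<lambda>n. (\<M> t. Y n t * (poisson z t * poly q (cis t))) - poly q z * (\<M> t. Y n t * poisson z t)) \<longlonglongrightarrow> 0"
proof -
  have "[:-z, 1:] dvd q - [:poly q z:]" by (simp add: poly_eq_0_iff_dvd[symmetric])
  then obtain d where d: "q - [:poly q z:] = [:-z, 1:] * d" by (auto elim: dvdE)
  have qd: "poly q u - poly q z = (u - z) * poly d u" for u
    using arg_cong[OF d, of "\<lambda>p. poly p u"] by (simp add: algebra_simps)
  define R where "R = (if z = 0 then 2 else 1/cmod z)"
  have R: "1 < R" using z by (auto simp: R_def)
  have nz: "1 - cnj z * u \<noteq> 0" if "u \<in> ball 0 R" for u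
  proof
    assume "1 - cnj z * u = 0"
    then have "cmod (cnj z * u) = 1" by (metis norm_one right_minus_eq)
    then have *: "cmod z * cmod u = 1" by (simp add: norm_mult)
    then have "z \<noteq> 0" by auto
    then have "cmod u < 1 / cmod z" using that by (auto simp: R_def)
    then show False using * \<open>z \<noteq> 0\<close> by (simp add: field_simps)
  qed
  define G where "G u = (1 - z * cnj z) * poly d u / (1 - cnj z * u)" for u
  have G: "G holomorphic_on ball 0 R" unfolding G_def by (intro holomorphic_intros) (use nz in auto)
  have eq: "poisson z t * (poly q (cis t) - poly q z) = cis t * G (cis t)" for t
    unfolding poisson_decomp(2)[OF z] qd G_def using cis_neq(1)[OF z, of t] by simp
  have i: "integrable circ (\<lambda>t. Y n t * (poisson z t * poly q (cis t)))" "integrable circ (\<lambda>t. Y n t * poisson z t)" for n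
    using sqint_mult_integrable[OF Y sqint_poly_poisson[OF sqint_poly z]] integrable_poisson_mult_complex[OF l1_le_l2(1)[OF Y] z] by auto
  have "(\<M> t. Y n t * (poisson z t * poly q (cis t))) - poly q z * (\<M> t. Y n t * poisson z t) = (\<M> t. Y n t * (cis t * G (cis t)))" for n
  proof -
    have "(\<M> t. Y n t * (cis t * G (cis t))) = (\<M> t. Y n t * (poisson z t * poly q (cis t)) - poly q z * (Y n t * poisson z t))"
      unfolding eq[symmetric] by (intro Bochner_Integration.integral_cong) (auto simp: algebra_simps)
    also have "\<dots> = (\<M> t. Y n t * (poisson z t * poly q (cis t))) - (\<M> t. poly q z * (Y n t * poisson z t))"
      by (intro Bochner_Integration.integral_diff i integrable_mult_right)
    finally show ?thesis by simp
  qed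
  then show ?thesis using annihilates_holomorphic[OF G R] by simp
qed

text \<open>In the limit \<open>Y\<close> behaves like the boundary function of an analytic function: its Poisson
  integral is multiplicative against bounded analytic factors.\<close>

lemma multiplicative_hardy:
  assumes z: "cmod z < 1" and G: "hardy G"
    and GM: "\<And>n. sqint circ (\<lambda>t. poisson z t * dil G (rr n) t)"
  shows "(\<lambda>n. (\<M> t. Y n t * (poisson z t * dil G (rr n) t)) - G z * (\<M> t. Y n t * poisson z t)) \<longlonglongrightarrow> 0"
proof (rule LIMSEQ_I)
  fix e :: real assume e: "0 < e"
  have hol: "G holomorphic_on ball 0 1" using G by (rule hardy_holomorphic)
  define K where "K = 2 / (1 - cmod z)"
  have K: "0 < K" "\<And>t. poisson z t \<le> K" using z poisson_le[OF z] by (auto simp: K_def)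
  define M' where "M' = \<bar>M\<bar> + 1"
  have M': "0 < M'" "l2 circ (Y n) \<le> M'" for n using YM[of n] by (auto simp: M'_def)
  \<comment> \<open>K M' \<epsilon> is the cost of replacing G by q under the integral, K \<epsilon>
    K M' that of replacing the factor G z by q z; the last e/2 is the error for the polynomial
    itself.\<close>
  define C where "C = K * M' + K * K * M'"
  have C: "0 < C" unfolding C_def using K M' by (intro add_pos_pos mult_pos_pos) auto
  define \<epsilon> where "\<epsilon> = e / (2 * C)"
  have eps: "0 < \<epsilon>" using e C by (simp add: \<epsilon>_def)
  obtain q s0 where q: "0 \<le> s0" "s0 < 1" "\<And>r. s0 \<le> r \<Longrightarrow> r < 1 \<Longrightarrow> l2 circ (\<lambda>t. dil G r t - poly q (cis t)) < \<epsilon>"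
    by (rule hardy_poly_approx[OF G eps]) blast
  obtain n1 where n1: "\<And>n. n \<ge> n1 \<Longrightarrow> s0 \<le> rr n" using rr_eventually[OF q(2)] by (auto simp: eventually_sequentially)
  have Gsq: "sqint circ (dil G (rr n))" for n using rr by (intro sqint_dil hol) auto
  have dsq: "sqint circ (\<lambda>t. dil G (rr n) t - poly q (cis t))" for n by (rule sqint_diff[OF Gsq sqint_poly])
  have dl: "l2 circ (\<lambda>t. dil G (rr n) t - poly q (cis t)) < \<epsilon>" if "n \<ge> n1" for n by (rule q(3)[OF n1[OF that] rr(3)])
  have Pd: "(\<M> t. dil G (rr n) t * poisson z t) = G (of_real (rr n) * z)" for n using rr by (intro Poisson_dil hol z) auto
  have Pq: "(\<M> t. poly q (cis t) * poisson z t) = poly q z" by (rule Poisson_formula[of _ 2]) (auto intro!: holomorphic_intros z)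
  have Gq: "cmod (G z - poly q z) \<le> K * \<epsilon>"
  proof -
    have "isCont G z" using holomorphic_on_imp_continuous_on[OF hol] z by (simp add: continuous_on_eq_continuous_at)
    moreover have "(\<lambda>n. of_real (rr n) * z) \<longlonglongrightarrow> of_real 1 * z" by (intro tendsto_intros rr_tendsto)
    ultimately have "(\<lambda>n. G (of_real (rr n) * z)) \<longlonglongrightarrow> G z" using isCont_tendsto_compose[of z G "\<lambda>n. of_real (rr n) * z"] by simp
    then have "(\<lambda>n. cmod (G (of_real (rr n) * z) - poly q z)) \<longlonglongrightarrow> cmod (G z - poly q z)" by (intro tendsto_intros)
    moreover have "\<exists>N. \<forall>n\<ge>N. cmod (G (of_real (rr n) * z) - poly q z) \<le> K * \<epsilon>"
    proof (intro exI[of _ n1] allI impI)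
      fix n assume n: "n \<ge> n1"
      have "G (of_real (rr n) * z) - poly q z = (\<M> t. (dil G (rr n) t - poly q (cis t)) * poisson z t)"
        unfolding Pd[symmetric] Pq[symmetric] left_diff_distrib
        by (rule Bochner_Integration.integral_diff[symmetric]) (intro integrable_poisson_mult_complex z l1_le_l2(1) Gsq sqint_poly)+
      also have "cmod \<dots> \<le> (\<M> t. cmod (dil G (rr n) t - poly q (cis t)) * poisson z t)" by (rule poisson_integral_le_norm[OF l1_le_l2(1)[OF dsq] z])
      also have "\<dots> \<le> (\<M> t. K * cmod (dil G (rr n) t - poly q (cis t)))"
      proof (rule integral_mono)
        show "integrable circ (\<lambda>t. cmod (dil G (rr n) t - poly q (cis t)) * poisson z t)" by (intro integrable_poisson_mult z integrable_norm l1_le_l2(1) dsq)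
        show "integrable circ (\<lambda>t. K * cmod (dil G (rr n) t - poly q (cis t)))" by (intro integrable_mult_right integrable_norm l1_le_l2(1) dsq)
        show "cmod (dil G (rr n) t - poly q (cis t)) * poisson z t \<le> K * cmod (dil G (rr n) t - poly q (cis t))" for t
          using mult_left_mono[OF K(2)[of t] norm_ge_zero[of "dil G (rr n) t - poly q (cis t)"]] by (simp add: mult.commute)
      qed
      also have "\<dots> = K * (\<M> t. cmod (dil G (rr n) t - poly q (cis t)))" by simp
      also have "\<dots> \<le> K * \<epsilon>" using l1_le_l2(2)[OF dsq, of n] dl[OF n] K by (intro mult_left_mono) auto
      finally show "cmod (G (of_real (rr n) * z) - poly q z) \<le> K * \<epsilon>" .
    qed
    ultimately show ?thesis by (rule LIMSEQ_le_const2)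
  qed
  obtain n2 where n2: "\<And>n. n \<ge> n2 \<Longrightarrow> cmod ((\<M> t. Y n t * (poisson z t * poly q (cis t))) - poly q z * (\<M> t. Y n t * poisson z t)) < e/2"
    using LIMSEQ_D[OF multiplicative_poly[OF z], of "e/2" q] e by auto
  show "\<exists>no. \<forall>n\<ge>no. norm ((\<M> t. Y n t * (poisson z t * dil G (rr n) t)) - G z * (\<M> t. Y n t * poisson z t) - 0) < e"
  proof (intro exI[of _ "max n1 n2"] allI impI)
    fix n assume n: "n \<ge> max n1 n2"
    define I where "I = (\<M> t. Y n t * (poisson z t * dil G (rr n) t))"
    define J where "J = (\<M> t. Y n t * (poisson z t * poly q (cis t)))"
    define T where "T = (\<M> t. Y n t * poisson z t)"
    have pb: "cmod (complex_of_real (poisson z t)) \<le> K" for t using K(2)[of t] poisson_nonneg[OF z, of t] by simp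
    have pmeas: "(\<lambda>t. complex_of_real (poisson z t)) \<in> borel_measurable circ" using z by simp
    have psq: "sqint circ (\<lambda>t. poisson z t * (dil G (rr n) t - poly q (cis t)))"
      "l2 circ (\<lambda>t. poisson z t * (dil G (rr n) t - poly q (cis t))) \<le> K * l2 circ (\<lambda>t. dil G (rr n) t - poly q (cis t))"
      using sqint_mult_bounded[OF dsq pmeas pb] by auto
    have "I - J = (\<M> t. Y n t * (poisson z t * (dil G (rr n) t - poly q (cis t))))"
      unfolding I_def J_def right_diff_distrib
      by (rule Bochner_Integration.integral_diff[symmetric]) (intro sqint_mult_integrable Y GM sqint_poly_poisson sqint_poly z)+
    also have "cmod \<dots> \<le> (\<M> t. cmod (Y n t * (poisson z t * (dil G (rr n) t - poly q (cis t)))))" by (rule integral_norm_bound)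
    also have "\<dots> \<le> l2 circ (Y n) * l2 circ (\<lambda>t. poisson z t * (dil G (rr n) t - poly q (cis t)))" by (rule l2_Cauchy_Schwarz[OF Y psq(1)])
    also have "\<dots> \<le> M' * (K * \<epsilon>)"
    proof (intro mult_mono M')
      have "l2 circ (\<lambda>t. dil G (rr n) t - poly q (cis t)) < \<epsilon>" using dl n by simp
      then show "l2 circ (\<lambda>t. poisson z t * (dil G (rr n) t - poly q (cis t))) \<le> K * \<epsilon>"
        using psq(2) K(1) by (smt (verit) mult_left_mono)
    qed (use M' in auto)
    finally have IJ: "cmod (I - J) \<le> M' * (K * \<epsilon>)" .
    have T: "cmod T \<le> K * M'"
    proof -
      have "cmod T \<le> (\<M> t. cmod (poisson z t * Y n t))" unfolding T_def using integral_norm_bound[of circ "\<lambda>t. Y n t * poisson z t"] by (simp add: mult.commute)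
      also have "\<dots> \<le> l2 circ (\<lambda>t. poisson z t * Y n t)" by (rule l1_le_l2(2)[OF sqint_mult_bounded(1)[OF Y pmeas pb]])
      also have "\<dots> \<le> K * l2 circ (Y n)" by (rule sqint_mult_bounded(2)[OF Y pmeas pb])
      also have "\<dots> \<le> K * M'" using K M' by (intro mult_left_mono) auto
      finally show ?thesis .
    qed
    have "I - G z * T = (I - J) + (J - poly q z * T) + (poly q z - G z) * T" by (simp add: algebra_simps)
    then have "cmod (I - G z * T) \<le> cmod (I - J) + cmod (J - poly q z * T) + cmod ((poly q z - G z) * T)"
      by (metis add_mono_thms_linordered_semiring(3) norm_triangle_ineq order_trans)
    also have "cmod ((poly q z - G z) * T) \<le> (K * \<epsilon>) * (K * M')"
      unfolding norm_mult using Gq T K eps by (intro mult_mono) (auto simp: norm_minus_commute)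
    also have "cmod (J - poly q z * T) < e/2" using n2[of n] n by (simp add: J_def T_def)
    finally have "cmod (I - G z * T) < M' * (K * \<epsilon>) + e/2 + (K * \<epsilon>) * (K * M')" using IJ by linarith
    also have "\<dots> = C * \<epsilon> + e/2" by (simp add: C_def algebra_simps)
    also have "\<dots> = e" using C by (simp add: \<epsilon>_def)
    finally show "norm ((\<M> t. Y n t * (poisson z t * dil G (rr n) t)) - G z * (\<M> t. Y n t * poisson z t) - 0) < e"
      by (simp add: I_def T_def)
  qed
qed

end

text \<open>The circle means of |\<psi>|^2 are at most those of the harmonic majorant, all of which
  equal its value at 0.\<close>

lemma hardy_of_harmonic_majorant:
  assumes psi: "\<psi> holomorphic_on ball 0 1" and H: "sqint circ H"
    and up: "\<And>z. cmod z < 1 \<Longrightarrow> (cmod (\<psi> z))\<^sup>2 \<le> (\<M> t. (cmod (H t))\<^sup>2 * poisson z t)"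
  shows "hardy \<psi>"
proof -
  have Hi: "integrable circ (\<lambda>t. (cmod (H t))\<^sup>2)" using H by (simp add: sqint_def)
  define A where "A = log_outer (\<lambda>t. (cmod (H t))\<^sup>2)"
  have A: "A holomorphic_on ball 0 1" unfolding A_def by (rule log_outer_holomorphic[OF Hi])
  have "l2 circ (dil \<psi> r) \<le> sqrt (Re (A 0))" if r: "0 \<le> r" "r < 1" for r
  proof -
    have rc: "cmod (of_real r * cis t) < 1" for t using r by (simp add: norm_mult)
    have cA: "integrable circ (dil A r)" by (intro integrable_circ_continuous continuous_on_dil A r)
    have "(\<M> t. (cmod (dil \<psi> r t))\<^sup>2) \<le> (\<M> t. Re (dil A r t))"
    proof (rule integral_mono)
      show "integrable circ (\<lambda>t. (cmod (dil \<psi> r t))\<^sup>2)" using sqint_dil[OF psi r] by (simp add: sqint_def)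
      show "integrable circ (\<lambda>t. Re (dil A r t))" using integrable_Re[OF cA] .
      show "(cmod (dil \<psi> r t))\<^sup>2 \<le> Re (dil A r t)" for t
        using up[OF rc, of t] Re_log_outer[OF Hi rc, of t] by (simp add: A_def)
    qed
    also have "\<dots> = Re (\<M> t. dil A r t)" by (rule integral_Re[OF cA])
    also have "(\<M> t. dil A r t) = A 0"
    proof -
      have "poisson 0 t = 1" for t by (simp add: poisson_def)
      then show ?thesis using Poisson_dil[OF A r, of 0] by simp
    qed
    finally show ?thesis unfolding l2_def by (rule real_sqrt_le_mono)
  qed
  then show ?thesis using psi unfolding hardy_def by blast
qed

text \<open>The reciprocal of the outer function O with modulus |H| may be unbounded. The
  truncations, outer with boundary modulus 1 / max |H| \<epsilon>, are bounded and thus admissible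
  multipliers. Their product with O has modulus at most 1 everywhere and tends to modulus 1 as
  \<epsilon> tends to 0.\<close>

lemma truncated_outer:
  assumes Hm: "H \<in> borel_measurable borel" and nz: "AE t in circ. H t \<noteq> 0"
    and int: "integrable circ (\<lambda>t. ln (cmod (H t)))" and z: "cmod z < 1"
  shows "\<And>\<epsilon>. 0 < \<epsilon> \<Longrightarrow> \<epsilon> \<le> 1 \<Longrightarrow> integrable circ (\<lambda>t. - ln (max (cmod (H t)) \<epsilon>))"
    and "\<And>\<epsilon>. 0 < \<epsilon> \<Longrightarrow> \<epsilon> \<le> 1 \<Longrightarrow> cmod (outer (\<lambda>t. - ln (max (cmod (H t)) \<epsilon>)) z) \<le> 1 / \<epsilon>"
    and "\<And>\<epsilon>. 0 < \<epsilon> \<Longrightarrow> \<epsilon> \<le> 1 \<Longrightarrow> cmod (outer (\<lambda>t. ln (cmod (H t))) z * outer (\<lambda>t. - ln (max (cmod (H t)) \<epsilon>)) z) \<le> 1"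
    and "(\<lambda>k. cmod (outer (\<lambda>t. ln (cmod (H t))) z * outer (\<lambda>t. - ln (max (cmod (H t)) (1 / (real k + 1)))) z)) \<longlonglongrightarrow> 1"
proof -
  have [measurable]: "H \<in> borel_measurable borel" by fact
  have tint: "integrable circ (\<lambda>t. - ln (max (cmod (H t)) \<epsilon>))" if e: "0 < \<epsilon>" "\<epsilon> \<le> 1" for \<epsilon>
  proof (rule Bochner_Integration.integrable_bound)
    show "integrable circ (\<lambda>t. \<bar>ln (cmod (H t))\<bar> + \<bar>ln \<epsilon>\<bar>)" using int by auto
  qed (auto simp: max_def)
  then show "\<And>\<epsilon>. 0 < \<epsilon> \<Longrightarrow> \<epsilon> \<le> 1 \<Longrightarrow> integrable circ (\<lambda>t. - ln (max (cmod (H t)) \<epsilon>))" by blast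
  show "cmod (outer (\<lambda>t. - ln (max (cmod (H t)) \<epsilon>)) z) \<le> 1 / \<epsilon>" if e: "0 < \<epsilon>" "\<epsilon> \<le> 1" for \<epsilon>
  proof -
    have "(\<M> t. - ln (max (cmod (H t)) \<epsilon>) * poisson z t) \<le> (\<M> t. (- ln \<epsilon>) * poisson z t)"
      by (rule poisson_integral_mono[OF tint[OF e] _ z]) (use e in auto)
    also have "\<dots> = - ln \<epsilon>" using integral_poisson[OF z] by simp
    finally have "exp (\<M> t. - ln (max (cmod (H t)) \<epsilon>) * poisson z t) \<le> exp (- ln \<epsilon>)" by simp
    then show ?thesis unfolding norm_outer[OF tint[OF e] z] using e by (simp add: exp_minus field_simps)
  qed
  have prod: "cmod (outer (\<lambda>t. ln (cmod (H t))) z * outer (\<lambda>t. - ln (max (cmod (H t)) \<epsilon>)) z) = exp (\<M> t. (ln (cmod (H t)) - ln (max (cmod (H t)) \<epsilon>)) * poisson z t)"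
    if e: "0 < \<epsilon>" "\<epsilon> \<le> 1" for \<epsilon>
  proof -
    have "(\<M> t. (ln (cmod (H t)) - ln (max (cmod (H t)) \<epsilon>)) * poisson z t) = (\<M> t. ln (cmod (H t)) * poisson z t + - ln (max (cmod (H t)) \<epsilon>) * poisson z t)"
      by (intro Bochner_Integration.integral_cong) (auto simp: algebra_simps)
    also have "\<dots> = (\<M> t. ln (cmod (H t)) * poisson z t) + (\<M> t. - ln (max (cmod (H t)) \<epsilon>) * poisson z t)"
      by (intro Bochner_Integration.integral_add integrable_poisson_mult int tint e z)
    finally show ?thesis unfolding norm_mult norm_outer[OF int z] norm_outer[OF tint[OF e] z] by (simp only: exp_add)
  qed
  show "cmod (outer (\<lambda>t. ln (cmod (H t))) z * outer (\<lambda>t. - ln (max (cmod (H t)) \<epsilon>)) z) \<le> 1" if e: "0 < \<epsilon>" "\<epsilon> \<le> 1" for \<epsilon>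
  proof -
    have "(\<M> t. (ln (cmod (H t)) - ln (max (cmod (H t)) \<epsilon>)) * poisson z t) \<le> (\<M> t. 0)"
    proof (rule integral_mono_AE)
      have "integrable circ (\<lambda>t. ln (cmod (H t)) + - ln (max (cmod (H t)) \<epsilon>))" by (rule Bochner_Integration.integrable_add[OF int tint[OF e]])
      then show "integrable circ (\<lambda>t. (ln (cmod (H t)) - ln (max (cmod (H t)) \<epsilon>)) * poisson z t)" by (intro integrable_poisson_mult z) simp
      show "AE t in circ. (ln (cmod (H t)) - ln (max (cmod (H t)) \<epsilon>)) * poisson z t \<le> 0" using nz
      proof eventually_elim
        case (elim t)
        have "ln (cmod (H t)) \<le> ln (max (cmod (H t)) \<epsilon>)" using elim e by (subst ln_le_cancel_iff) auto
        then show ?case using poisson_nonneg[OF z, of t] by (intro mult_nonpos_nonneg) auto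
      qed
    qed auto
    then show ?thesis unfolding prod[OF e] by simp
  qed
  define \<epsilon> where "\<epsilon> k = 1 / (real k + 1)" for k
  have e: "0 < \<epsilon> k" "\<epsilon> k \<le> 1" for k by (auto simp: \<epsilon>_def)
  have elim0: "\<epsilon> \<longlonglongrightarrow> 0" unfolding \<epsilon>_def by real_asymp
  have "(\<lambda>k. \<integral>t. (ln (cmod (H t)) - ln (max (cmod (H t)) (\<epsilon> k))) * poisson z t \<partial>circ) \<longlonglongrightarrow> (\<M> t. 0)"
  proof (rule integral_dominated_convergence[where w="\<lambda>t. \<bar>ln (cmod (H t))\<bar> * poisson z t"])
    show "integrable circ (\<lambda>t. \<bar>ln (cmod (H t))\<bar> * poisson z t)" using int by (intro integrable_poisson_mult z) auto
    show "AE t in circ. (\<lambda>k. (ln (cmod (H t)) - ln (max (cmod (H t)) (\<epsilon> k))) * poisson z t) \<longlonglongrightarrow> 0" using nz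
    proof eventually_elim
      case (elim t)
      then have "0 < cmod (H t)" by simp
      then have "eventually (\<lambda>k. \<epsilon> k < cmod (H t)) sequentially" using order_tendstoD(2)[OF elim0] by blast
      then have "eventually (\<lambda>k. (ln (cmod (H t)) - ln (max (cmod (H t)) (\<epsilon> k))) * poisson z t = 0) sequentially"
        by eventually_elim (simp add: max_def)
      then show ?case by (rule tendsto_eventually)
    qed
    show "AE t in circ. norm ((ln (cmod (H t)) - ln (max (cmod (H t)) (\<epsilon> k))) * poisson z t) \<le> \<bar>ln (cmod (H t))\<bar> * poisson z t" for k
      using nz
    proof eventually_elim
      case (elim t)
      \<comment> \<open>The difference is 0 unless |H| < \<epsilon> \<le> 1, and then it is part of
        |ln |H||, because ln \<epsilon> \<le> 0.\<close>
      have "\<bar>ln (cmod (H t)) - ln (max (cmod (H t)) (\<epsilon> k))\<bar> \<le> \<bar>ln (cmod (H t))\<bar>"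
      proof (cases "\<epsilon> k \<le> cmod (H t)")
        case False
        have "ln (\<epsilon> k) \<le> 0" using e[of k] by simp
        moreover have "ln (cmod (H t)) \<le> ln (\<epsilon> k)" using False elim e[of k] by (subst ln_le_cancel_iff) auto
        ultimately show ?thesis using False by (simp add: max_def)
      qed (simp add: max_def)
      then show ?case using poisson_nonneg[OF z, of t] by (simp add: abs_mult mult_right_mono)
    qed
  qed (use z in measurable)
  then have "(\<lambda>k. exp (\<M> t. (ln (cmod (H t)) - ln (max (cmod (H t)) (\<epsilon> k))) * poisson z t)) \<longlonglongrightarrow> exp 0"
    by (intro tendsto_intros) simp
  then show "(\<lambda>k. cmod (outer (\<lambda>t. ln (cmod (H t))) z * outer (\<lambda>t. - ln (max (cmod (H t)) (1 / (real k + 1)))) z)) \<longlonglongrightarrow> 1"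
    unfolding \<epsilon>_def using prod[OF e, unfolded \<epsilon>_def] by simp
qed

section \<open>Unimodularity of S on the circle, in mean\<close>

context singular
begin

abbreviation "S \<equiv> sing_inner \<mu>"

lemma one_minus_norm_bounds:
  assumes "cmod z < 1"
  shows "0 \<le> 1 - cmod (S z)" "1 - cmod (S z) \<le> 1 - (cmod (S z))\<^sup>2" "(1 - cmod (S z))\<^sup>2 \<le> 1 - (cmod (S z))\<^sup>2" "1 - (cmod (S z))\<^sup>2 \<le> 2 * (1 - cmod (S z))" "(1 - (cmod (S z))\<^sup>2)\<^sup>2 \<le> 1 - (cmod (S z))\<^sup>2" "0 \<le> 1 - (cmod (S z))\<^sup>2"
proof -
  define x where "x = cmod (S z)"
  have x: "0 \<le> x" "x \<le> 1" using norm_sing_inner_le[OF assms] by (auto simp: x_def)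
  have x2: "x\<^sup>2 \<le> x" "0 \<le> x\<^sup>2" using x by (auto simp: power2_eq_square mult_left_le_one_le)
  have y: "0 \<le> 1 - x\<^sup>2" "1 - x\<^sup>2 \<le> 1" using x2 x by auto
  have "(1 - x\<^sup>2) * (1 - x\<^sup>2) \<le> (1 - x\<^sup>2) * 1" by (intro mult_left_mono y)
  then have 5: "(1 - x\<^sup>2)\<^sup>2 \<le> 1 - x\<^sup>2" by (simp add: power2_eq_square)
  have 4: "1 - x\<^sup>2 \<le> 2 * (1 - x)" using zero_le_power2[of "1 - x"] by (simp add: power2_eq_square algebra_simps)
  have 3: "(1 - x)\<^sup>2 \<le> 1 - x\<^sup>2" using x2 x by (simp add: power2_eq_square algebra_simps)
  show "0 \<le> 1 - cmod (S z)" "1 - cmod (S z) \<le> 1 - (cmod (S z))\<^sup>2" "(1 - cmod (S z))\<^sup>2 \<le> 1 - (cmod (S z))\<^sup>2" "1 - (cmod (S z))\<^sup>2 \<le> 2 * (1 - cmod (S z))" "(1 - (cmod (S z))\<^sup>2)\<^sup>2 \<le> 1 - (cmod (S z))\<^sup>2" "0 \<le> 1 - (cmod (S z))\<^sup>2"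
    using x x2 y 3 4 5 by (auto simp: x_def[symmetric])
qed

lemma rr_cis: "cmod (of_real (rr n) * cis t) < 1"
  using rr[of n] by (simp add: norm_mult)

lemma dil_S_measurable [measurable]: "dil S (rr n) \<in> borel_measurable borel"
  using rr by (intro dil_measurable sing_inner_holomorphic) auto

lemma integrable_one_minus_sq: "integrable circ (\<lambda>t. 1 - (cmod (dil S (rr n) t))\<^sup>2)"
  by (rule integrable_circ_bounded[where B=1]) (use one_minus_norm_bounds(6)[OF rr_cis] in auto)

text \<open>For x = |S| in [0, 1] both (1 - x)^2 and (1 - x^2)^2 are at most 1 - x^2, whose mean
  tends to 0.\<close>

lemma l2_one_minus_tendsto:
  "(\<lambda>n. l2 circ (\<lambda>t. complex_of_real (1 - cmod (dil S (rr n) t)))) \<longlonglongrightarrow> 0"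
  "(\<lambda>n. l2 circ (\<lambda>t. complex_of_real (1 - (cmod (dil S (rr n) t))\<^sup>2))) \<longlonglongrightarrow> 0"
  and sqint_one_minus: "sqint circ (\<lambda>t. complex_of_real (1 - cmod (dil S (rr n) t)))"
  "sqint circ (\<lambda>t. complex_of_real (1 - (cmod (dil S (rr n) t))\<^sup>2))"
proof -
  have sq: "sqint circ (\<lambda>t. complex_of_real (1 - cmod (dil S (rr n) t)))"
    "sqint circ (\<lambda>t. complex_of_real (1 - (cmod (dil S (rr n) t))\<^sup>2))" for n
  proof -
    show "sqint circ (\<lambda>t. complex_of_real (1 - cmod (dil S (rr n) t)))"
      by (rule sqint_circ_bounded(1)[where B=1]) (use one_minus_norm_bounds(1)[OF rr_cis] in \<open>auto simp flip: of_real_diff\<close>)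
    show "sqint circ (\<lambda>t. complex_of_real (1 - (cmod (dil S (rr n) t))\<^sup>2))"
    proof (rule sqint_circ_bounded(1)[where B=1])
      show "cmod (complex_of_real (1 - (cmod (dil S (rr n) t))\<^sup>2)) \<le> 1" for t
        unfolding norm_of_real using one_minus_norm_bounds(6)[OF rr_cis, of n t] by simp
    qed measurable
  qed
  then show "sqint circ (\<lambda>t. complex_of_real (1 - cmod (dil S (rr n) t)))"
    "sqint circ (\<lambda>t. complex_of_real (1 - (cmod (dil S (rr n) t))\<^sup>2))" by auto
  have lim: "(\<lambda>n. sqrt (\<M> t. 1 - (cmod (dil S (rr n) t))\<^sup>2)) \<longlonglongrightarrow> 0"
    using tendsto_real_sqrt[OF integral_one_minus_sing_inner] by simp
  have le: "l2 circ (\<lambda>t. complex_of_real (1 - cmod (dil S (rr n) t))) \<le> sqrt (\<M> t. 1 - (cmod (dil S (rr n) t))\<^sup>2)"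
    "l2 circ (\<lambda>t. complex_of_real (1 - (cmod (dil S (rr n) t))\<^sup>2)) \<le> sqrt (\<M> t. 1 - (cmod (dil S (rr n) t))\<^sup>2)" for n
    unfolding l2_def norm_of_real power2_abs
    using sq[of n] one_minus_norm_bounds(3,5)[OF rr_cis] integrable_one_minus_sq[of n] unfolding sqint_def norm_of_real power2_abs
    by (intro real_sqrt_le_mono integral_mono; simp)+
  show "(\<lambda>n. l2 circ (\<lambda>t. complex_of_real (1 - cmod (dil S (rr n) t)))) \<longlonglongrightarrow> 0"
    by (rule tendsto_sandwich[OF _ _ tendsto_const lim]) (use le(1) in auto)
  show "(\<lambda>n. l2 circ (\<lambda>t. complex_of_real (1 - (cmod (dil S (rr n) t))\<^sup>2))) \<longlonglongrightarrow> 0"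
    by (rule tendsto_sandwich[OF _ _ tendsto_const lim]) (use le(2) in auto)
qed

text \<open>For h = 1/S one has |h| = 1 + |h| (1 - |S|) \<le> 1 + B (1 - |S|^2). Averaging over
  circles tending to the boundary gives |h(0)| \<le> 1, that is |S(0)| \<ge> 1, while |S(0)| =
  exp(-\<mu>(UNIV)).\<close>

lemma sing_inner_bounded_below_trivial:
  assumes h: "h holomorphic_on ball 0 1" "\<And>z. cmod z < 1 \<Longrightarrow> cmod (h z) \<le> B" and inv: "\<And>z. cmod z < 1 \<Longrightarrow> 1 = S z * h z"
  shows "measure \<mu> UNIV = 0"
proof -
  have B0: "0 \<le> B" using order_trans[OF norm_ge_zero h(2)[of 0]] by simp
  have pt: "cmod (h z) \<le> 1 + B * (1 - (cmod (S z))\<^sup>2)" if z: "cmod z < 1" for z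
  proof -
    have "cmod (S z) * cmod (h z) = 1" using inv[OF z] by (metis norm_mult norm_one)
    then have "cmod (h z) = 1 + cmod (h z) * (1 - cmod (S z))" by (simp add: algebra_simps)
    also have "cmod (h z) * (1 - cmod (S z)) \<le> B * (1 - (cmod (S z))\<^sup>2)"
      using h(2)[OF z] one_minus_norm_bounds[OF z] B0 by (intro mult_mono) auto
    finally show ?thesis by simp
  qed
  have "cmod (h 0) \<le> 1 + B * (\<M> t. 1 - (cmod (dil S (rr n) t))\<^sup>2)" for n
  proof -
    have hs: "integrable circ (dil h (rr n))" using rr by (intro integrable_circ_continuous continuous_on_dil h) auto
    have "poisson 0 t = 1" for t by (simp add: poisson_def)
    then have "h 0 = (\<M> t. dil h (rr n) t)" using Poisson_dil[OF h(1) rr(1) rr(3), of 0 n] by simp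
    also have "cmod \<dots> \<le> (\<M> t. cmod (dil h (rr n) t))" by (rule integral_norm_bound)
    also have "\<dots> \<le> (\<M> t. 1 + B * (1 - (cmod (dil S (rr n) t))\<^sup>2))"
    proof (rule integral_mono)
      show "integrable circ (\<lambda>t. cmod (dil h (rr n) t))" using hs by auto
      show "integrable circ (\<lambda>t. 1 + B * (1 - (cmod (dil S (rr n) t))\<^sup>2))"
        using integrable_one_minus_sq[of n] by (intro Bochner_Integration.integrable_add integrable_mult_right) auto
    qed (rule pt[OF rr_cis])
    also have "\<dots> = (\<M> t. 1) + (\<M> t. B * (1 - (cmod (dil S (rr n) t))\<^sup>2))"
      by (intro Bochner_Integration.integral_add integrable_mult_right integrable_one_minus_sq) auto
    finally show ?thesis by simp
  qed
  moreover have "(\<lambda>n. 1 + B * (\<M> t. 1 - (cmod (dil S (rr n) t))\<^sup>2)) \<longlonglongrightarrow> 1 + B * 0"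
    by (intro tendsto_intros integral_one_minus_sing_inner)
  ultimately have "cmod (h 0) \<le> 1 + B * 0" by (intro LIMSEQ_le_const) auto
  moreover have "cmod (S 0) * cmod (h 0) = 1" using inv[of 0] by (metis norm_mult norm_one norm_zero zero_less_one)
  ultimately have "1 \<le> cmod (S 0)" by (metis add.right_neutral mult_left_le mult_zero_right norm_ge_zero)
  then have "- measure \<mu> UNIV \<ge> 0" unfolding norm_sing_inner_0 by simp
  then show ?thesis using measure_nonneg[of \<mu> UNIV] by linarith
qed

text \<open>Dividing by S does not change the boundary modulus: |g| = (1 - |S|) |g| + |f|, where the
  first term tends to 0 in mean by the Cauchy-Schwarz inequality and |f| tends to |H|.\<close>

lemma norm_quotient_tendsto:
  assumes f: "f holomorphic_on ball 0 1" and g: "hardy g" and fg: "\<And>z. cmod z < 1 \<Longrightarrow> f z = S z * g z"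
    and H: "sqint circ H" and lim: "(\<lambda>n. l2 circ (\<lambda>t. dil f (rr n) t - H t)) \<longlonglongrightarrow> 0"
  shows "(\<lambda>n. \<integral>t. \<bar>cmod (dil g (rr n) t) - cmod (H t)\<bar> \<partial>circ) \<longlonglongrightarrow> 0"
proof -
  have gh: "g holomorphic_on ball 0 1" using g by (rule hardy_holomorphic)
  obtain Bg where Bg: "\<And>r. 0 \<le> r \<Longrightarrow> r < 1 \<Longrightarrow> l2 circ (dil g r) \<le> Bg" using g by (auto simp: hardy_def)
  have gsq: "sqint circ (dil g (rr n))" and fsq: "sqint circ (dil f (rr n))" for n using rr by (auto intro!: sqint_dil gh f)
  define q where "q n t = complex_of_real (1 - cmod (dil S (rr n) t))" for n t
  have qsq: "sqint circ (q n)" for n unfolding q_def by (rule sqint_one_minus(1))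
  have le: "(\<M> t. \<bar>cmod (dil g (rr n) t) - cmod (H t)\<bar>) \<le> l2 circ (q n) * Bg + l2 circ (\<lambda>t. dil f (rr n) t - H t)" for n
  proof -
    have dsq: "sqint circ (\<lambda>t. dil f (rr n) t - H t)" by (rule sqint_diff[OF fsq H])
    have "(\<M> t. \<bar>cmod (dil g (rr n) t) - cmod (H t)\<bar>) \<le> (\<M> t. cmod (q n t * dil g (rr n) t) + cmod (dil f (rr n) t - H t))"
    proof (rule integral_mono)
      show "integrable circ (\<lambda>t. \<bar>cmod (dil g (rr n) t) - cmod (H t)\<bar>)" using l1_le_l2(1)[OF gsq] l1_le_l2(1)[OF H] by auto
      show "integrable circ (\<lambda>t. cmod (q n t * dil g (rr n) t) + cmod (dil f (rr n) t - H t))"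
        by (intro Bochner_Integration.integrable_add integrable_norm sqint_mult_integrable qsq gsq l1_le_l2(1) dsq)
      fix t
      have "cmod (dil f (rr n) t) = cmod (dil S (rr n) t) * cmod (dil g (rr n) t)" unfolding fg[OF rr_cis] norm_mult ..
      moreover have "cmod (q n t * dil g (rr n) t) = (1 - cmod (dil S (rr n) t)) * cmod (dil g (rr n) t)"
        unfolding q_def norm_mult norm_of_real using one_minus_norm_bounds(1)[OF rr_cis, of n t] by simp
      ultimately have "cmod (dil g (rr n) t) = cmod (q n t * dil g (rr n) t) + cmod (dil f (rr n) t)" by (simp add: algebra_simps)
      moreover have "\<bar>cmod (dil f (rr n) t) - cmod (H t)\<bar> \<le> cmod (dil f (rr n) t - H t)" by (rule norm_triangle_ineq3)
      moreover have "0 \<le> cmod (q n t * dil g (rr n) t)" by simp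
      ultimately show "\<bar>cmod (dil g (rr n) t) - cmod (H t)\<bar> \<le> cmod (q n t * dil g (rr n) t) + cmod (dil f (rr n) t - H t)" by linarith
    qed
    also have "\<dots> = (\<M> t. cmod (q n t * dil g (rr n) t)) + (\<M> t. cmod (dil f (rr n) t - H t))"
      by (intro Bochner_Integration.integral_add integrable_norm sqint_mult_integrable qsq gsq l1_le_l2(1) dsq)
    also have "\<dots> \<le> l2 circ (q n) * l2 circ (dil g (rr n)) + l2 circ (\<lambda>t. dil f (rr n) t - H t)"
      by (intro add_mono l2_Cauchy_Schwarz qsq gsq l1_le_l2(2) dsq)
    also have "l2 circ (q n) * l2 circ (dil g (rr n)) \<le> l2 circ (q n) * Bg" using Bg[OF rr(1) rr(3)] by (intro mult_left_mono) auto
    finally show ?thesis by simp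
  qed
  have "(\<lambda>n. l2 circ (q n) * Bg + l2 circ (\<lambda>t. dil f (rr n) t - H t)) \<longlonglongrightarrow> 0 * Bg + 0"
    unfolding q_def by (intro tendsto_intros l2_one_minus_tendsto(1) lim)
  then have l: "(\<lambda>n. l2 circ (q n) * Bg + l2 circ (\<lambda>t. dil f (rr n) t - H t)) \<longlonglongrightarrow> 0" by simp
  show ?thesis by (rule tendsto_sandwich[OF _ _ tendsto_const l]) (use le in auto)
qed

end

section \<open>From annihilation to divisibility by S\<close>

context singular
begin

text \<open>\<open>Y n\<close> is cnj S F O on the circle of radius \<open>rr n\<close>. Tested
  against h, a truncation of 1/O, and against S h, it gives Poisson means \<open>P1\<close> and
  \<open>P2\<close> with P2 - S(z) P1 tending to 0. Since |O h| \<le> 1, \<open>P1\<close> is at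
  most B; since |S|^2 tends to 1 in mean, \<open>P2\<close> tends to F(z) O(z) h(z). Hence |F O h|
  \<le> B |S| at z, and |O h| tends to 1 as the truncation is removed.\<close>

lemma division_of_annihilated:
  assumes F: "F holomorphic_on ball 0 1" and FB: "\<And>z. cmod z < 1 \<Longrightarrow> cmod (F z) \<le> B"
    and H: "sqint circ H" and nz: "AE t in circ. H t \<noteq> 0" and int: "integrable circ (\<lambda>t. ln (cmod (H t)))"
  defines "\<O> \<equiv> outer (\<lambda>t. ln (cmod (H t)))"
  assumes hO: "hardy \<O>"
    and ann: "\<And>N. (\<lambda>n. \<integral>t. (cnj (dil S (rr n) t) * dil \<O> (rr n) t * cis t ^ (N+1)) * dil F (rr n) t \<partial>circ) \<longlonglongrightarrow> 0"
    and z: "cmod z < 1"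
  shows "cmod (F z) \<le> B * cmod (S z)"
proof -
  have Hm: "H \<in> borel_measurable borel" using sqint_measurable[OF H] by simp
  have Oh: "\<O> holomorphic_on ball 0 1" using hO by (rule hardy_holomorphic)
  obtain BO where BO: "\<And>r. 0 \<le> r \<Longrightarrow> r < 1 \<Longrightarrow> l2 circ (dil \<O> r) \<le> BO" using hO by (auto simp: hardy_def)
  have B0: "0 \<le> B" using order_trans[OF norm_ge_zero FB[of 0]] by simp
  define Y where "Y n t = (cnj (dil S (rr n) t) * dil F (rr n) t) * dil \<O> (rr n) t" for n t
  have Fm [measurable]: "dil F (rr n) \<in> borel_measurable borel" for n using rr by (intro dil_measurable F) auto
  have sF: "cmod (cnj (dil S (rr n) t) * dil F (rr n) t) \<le> B" for n t
  proof -
    have "cmod (cnj (dil S (rr n) t) * dil F (rr n) t) \<le> 1 * B"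
      unfolding norm_mult complex_mod_cnj using norm_sing_inner_le[OF rr_cis] FB[OF rr_cis] by (intro mult_mono) auto
    then show ?thesis by simp
  qed
  have sFm: "(\<lambda>t. cnj (dil S (rr n) t) * dil F (rr n) t) \<in> borel_measurable circ" for n by simp
  have Osq: "sqint circ (dil \<O> (rr n))" for n using rr by (intro sqint_dil Oh) auto
  have Y: "sqint circ (Y n)" for n unfolding Y_def by (rule sqint_mult_bounded(1)[OF Osq sFm sF])
  have YM: "l2 circ (Y n) \<le> B * BO" for n
  proof -
    have "l2 circ (Y n) \<le> B * l2 circ (dil \<O> (rr n))" unfolding Y_def by (rule sqint_mult_bounded(2)[OF Osq sFm sF])
    also have "\<dots> \<le> B * BO" using BO[OF rr(1) rr(3)] B0 by (intro mult_left_mono)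
    finally show ?thesis .
  qed
  have Yann: "(\<lambda>n. \<integral>t. Y n t * cis t ^ (N+1) \<partial>circ) \<longlonglongrightarrow> 0" for N
  proof -
    have "(\<lambda>t. Y n t * cis t ^ (N+1)) = (\<lambda>t. (cnj (dil S (rr n) t) * dil \<O> (rr n) t * cis t ^ (N+1)) * dil F (rr n) t)" for n
      unfolding Y_def by (rule ext) (simp only: mult_ac)
    then show ?thesis using ann[of N] by simp
  qed
  have pb: "cmod (complex_of_real (poisson z t)) \<le> 2 / (1 - cmod z)" for t using poisson_le[OF z, of t] poisson_nonneg[OF z, of t] by simp
  have pmeas: "(\<lambda>t. complex_of_real (poisson z t)) \<in> borel_measurable circ" using z by simp
  have main: "cmod (F z) * cmod (\<O> z * outer (\<lambda>t. - ln (max (cmod (H t)) \<epsilon>)) z) \<le> B * cmod (S z)" if e: "0 < \<epsilon>" "\<epsilon> \<le> 1" for \<epsilon>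
  proof -
    define h where "h = outer (\<lambda>t. - ln (max (cmod (H t)) \<epsilon>))"
    have hh: "h holomorphic_on ball 0 1" unfolding h_def by (intro outer_holomorphic truncated_outer(1)[OF Hm nz int z e])
    have hb: "cmod (h u) \<le> 1 / \<epsilon>" if "cmod u < 1" for u unfolding h_def by (rule truncated_outer(2)[OF Hm nz int that e])
    have Ohb: "cmod (\<O> u * h u) \<le> 1" if "cmod u < 1" for u unfolding h_def \<O>_def by (rule truncated_outer(3)[OF Hm nz int that e])
    have hH: "hardy h" by (rule bounded_imp_hardy[OF hh]) (use hb in auto)
    have shh: "(\<lambda>u. S u * h u) holomorphic_on ball 0 1" by (intro holomorphic_intros hh sing_inner_holomorphic)
    have shb: "cmod (S u * h u) \<le> 1 / \<epsilon>" if "cmod u < 1" for u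
    proof -
      have "cmod (S u * h u) \<le> 1 * (1 / \<epsilon>)" unfolding norm_mult using norm_sing_inner_le[OF that] hb[OF that] by (intro mult_mono) auto
      then show ?thesis by simp
    qed
    have shH: "hardy (\<lambda>u. S u * h u)" by (rule bounded_imp_hardy[OF shh]) (use shb in auto)
    have sq1: "sqint circ (\<lambda>t. poisson z t * dil h (rr n) t)" for n
      by (rule sqint_mult_bounded(1)[OF sqint_dil[OF hh rr(1) rr(3)] pmeas pb])
    have sq2: "sqint circ (\<lambda>t. poisson z t * dil (\<lambda>u. S u * h u) (rr n) t)" for n
      by (rule sqint_mult_bounded(1)[OF sqint_dil[OF shh rr(1) rr(3)] pmeas pb])
    define T where "T n = (\<M> t. Y n t * poisson z t)" for n
    define P1 where "P1 n = (\<M> t. Y n t * (poisson z t * dil h (rr n) t))" for n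
    define P2 where "P2 n = (\<M> t. Y n t * (poisson z t * dil (\<lambda>u. S u * h u) (rr n) t))" for n
    have m1: "(\<lambda>n. P1 n - h z * T n) \<longlonglongrightarrow> 0" unfolding P1_def T_def by (rule multiplicative_hardy[OF Y YM Yann z hH sq1])
    have m2: "(\<lambda>n. P2 n - (S z * h z) * T n) \<longlonglongrightarrow> 0" unfolding P2_def T_def by (rule multiplicative_hardy[OF Y YM Yann z shH sq2])
    \<comment> \<open>Eliminating \<open>T n\<close>, the Poisson mean of \<open>Y n\<close> itself,
      avoids any statement about its convergence.\<close>
    have "(\<lambda>n. (P2 n - (S z * h z) * T n) - S z * (P1 n - h z * T n)) \<longlonglongrightarrow> 0 - S z * 0" by (intro tendsto_intros m1 m2)
    then have d: "(\<lambda>n. P2 n - S z * P1 n) \<longlonglongrightarrow> 0" by (simp add: algebra_simps)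
    have P1b: "cmod (P1 n) \<le> B" for n
    proof -
      have eq: "Y n t * (poisson z t * dil h (rr n) t) = ((cnj (dil S (rr n) t) * dil F (rr n) t) * (dil \<O> (rr n) t * dil h (rr n) t)) * poisson z t" for t
        by (simp add: Y_def mult_ac)
      have "cmod (P1 n) \<le> (\<M> t. cmod (Y n t * (poisson z t * dil h (rr n) t)))" unfolding P1_def by (rule integral_norm_bound)
      also have "\<dots> \<le> (\<M> t. B * poisson z t)"
      proof (rule integral_mono)
        show "integrable circ (\<lambda>t. cmod (Y n t * (poisson z t * dil h (rr n) t)))" by (intro integrable_norm sqint_mult_integrable Y sq1)
        show "integrable circ (\<lambda>t. B * poisson z t)" by (intro integrable_mult_right integrable_poisson z)
        fix t
        have "cmod ((cnj (dil S (rr n) t) * dil F (rr n) t) * (dil \<O> (rr n) t * dil h (rr n) t)) \<le> B * 1"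
          unfolding norm_mult[of "cnj (dil S (rr n) t) * dil F (rr n) t"] using sF Ohb[OF rr_cis] B0 by (intro mult_mono) auto
        then show "cmod (Y n t * (poisson z t * dil h (rr n) t)) \<le> B * poisson z t"
          unfolding eq norm_mult[of _ "complex_of_real (poisson z t)"] norm_of_real using poisson_nonneg[OF z, of t]
          by (simp only: abs_of_nonneg mult_1_right) (rule mult_right_mono)
      qed
      also have "\<dots> = B" using integral_poisson[OF z] by simp
      finally show ?thesis .
    qed
    define G where "G u = F u * (\<O> u * h u)" for u
    have Gh: "G holomorphic_on ball 0 1" unfolding G_def by (intro holomorphic_intros F Oh hh)
    have Gb: "cmod (G u) \<le> B" if "cmod u < 1" for u
    proof -
      have "cmod (G u) \<le> B * 1" unfolding G_def norm_mult[of "F u"] using FB[OF that] Ohb[OF that] B0 by (intro mult_mono) auto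
      then show ?thesis by simp
    qed
    have Gm: "dil G (rr n) \<in> borel_measurable borel" for n using rr by (intro dil_measurable Gh) auto
    have P2d: "cmod (P2 n - G (of_real (rr n) * z)) \<le> B * (2 / (1 - cmod z)) * (\<M> t. 1 - (cmod (dil S (rr n) t))\<^sup>2)" for n
    proof -
      \<comment> \<open>The factor S in S h meets cnj S in \<open>Y n\<close>, so that |S|^2 = 1 -
        (1 - |S|^2) appears next to an analytic function bounded by B.\<close>
      have eq: "Y n t * (poisson z t * dil (\<lambda>u. S u * h u) (rr n) t) = (dil G (rr n) t * poisson z t) - (dil G (rr n) t * poisson z t) * complex_of_real (1 - (cmod (dil S (rr n) t))\<^sup>2)" for t
      proof -
        have "complex_of_real ((cmod (dil S (rr n) t))\<^sup>2) = dil S (rr n) t * cnj (dil S (rr n) t)" by (rule complex_norm_square)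
        then have c: "1 - complex_of_real (1 - (cmod (dil S (rr n) t))\<^sup>2) = dil S (rr n) t * cnj (dil S (rr n) t)" by simp
        have "(dil G (rr n) t * poisson z t) - (dil G (rr n) t * poisson z t) * complex_of_real (1 - (cmod (dil S (rr n) t))\<^sup>2)
          = (dil G (rr n) t * poisson z t) * (1 - complex_of_real (1 - (cmod (dil S (rr n) t))\<^sup>2))" by (simp only: right_diff_distrib mult_1_right)
        also have "\<dots> = Y n t * (poisson z t * dil (\<lambda>u. S u * h u) (rr n) t)" unfolding c Y_def G_def by (simp only: mult_ac)
        finally show ?thesis by simp
      qed
      have Gi: "integrable circ (\<lambda>t. dil G (rr n) t * poisson z t)"
        using rr by (intro integrable_poisson_mult_complex z integrable_circ_continuous continuous_on_dil Gh) auto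
      have Yi: "integrable circ (\<lambda>t. Y n t * (poisson z t * dil (\<lambda>u. S u * h u) (rr n) t))" by (intro sqint_mult_integrable Y sq2)
      have d: "P2 n - G (of_real (rr n) * z) = (\<M> t. Y n t * (poisson z t * dil (\<lambda>u. S u * h u) (rr n) t) - dil G (rr n) t * poisson z t)"
        unfolding P2_def Poisson_dil[OF Gh rr(1) rr(3) z, symmetric] by (rule Bochner_Integration.integral_diff[symmetric, OF Yi Gi])
      have "cmod (P2 n - G (of_real (rr n) * z)) \<le> (\<M> t. cmod (Y n t * (poisson z t * dil (\<lambda>u. S u * h u) (rr n) t) - dil G (rr n) t * poisson z t))"
        unfolding d by (rule integral_norm_bound)
      also have "\<dots> \<le> (\<M> t. B * (2 / (1 - cmod z)) * (1 - (cmod (dil S (rr n) t))\<^sup>2))"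
      proof (rule integral_mono)
        show "integrable circ (\<lambda>t. cmod (Y n t * (poisson z t * dil (\<lambda>u. S u * h u) (rr n) t) - dil G (rr n) t * poisson z t))"
          by (intro integrable_norm Bochner_Integration.integrable_diff Yi Gi)
        show "integrable circ (\<lambda>t. B * (2 / (1 - cmod z)) * (1 - (cmod (dil S (rr n) t))\<^sup>2))" by (intro integrable_mult_right integrable_one_minus_sq)
        fix t
        have "cmod (Y n t * (poisson z t * dil (\<lambda>u. S u * h u) (rr n) t) - dil G (rr n) t * poisson z t) = cmod (dil G (rr n) t * poisson z t) * (1 - (cmod (dil S (rr n) t))\<^sup>2)"
        proof -
          have dn: "cmod ((a - a * of_real b) - a) = cmod a * b" if "0 \<le> b" for a :: complex and b :: real
            using that by (simp add: norm_mult)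
          show ?thesis unfolding eq by (rule dn[OF one_minus_norm_bounds(6)[OF rr_cis]])
        qed
        also have "\<dots> \<le> (B * (2 / (1 - cmod z))) * (1 - (cmod (dil S (rr n) t))\<^sup>2)"
          unfolding norm_mult using Gb[OF rr_cis] pb B0 one_minus_norm_bounds(6)[OF rr_cis, of n t] by (intro mult_right_mono mult_mono) auto
        finally show "cmod (Y n t * (poisson z t * dil (\<lambda>u. S u * h u) (rr n) t) - dil G (rr n) t * poisson z t) \<le> B * (2 / (1 - cmod z)) * (1 - (cmod (dil S (rr n) t))\<^sup>2)" .
      qed
      also have "\<dots> = B * (2 / (1 - cmod z)) * (\<M> t. 1 - (cmod (dil S (rr n) t))\<^sup>2)" by (rule integral_mult_right_zero)
      finally show ?thesis .
    qed
    have Gl: "(\<lambda>n. G (of_real (rr n) * z)) \<longlonglongrightarrow> G z"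
    proof -
      have "isCont G z" using holomorphic_on_imp_continuous_on[OF Gh] z by (simp add: continuous_on_eq_continuous_at)
      moreover have "(\<lambda>n. of_real (rr n) * z) \<longlonglongrightarrow> of_real 1 * z" by (intro tendsto_intros rr_tendsto)
      ultimately show ?thesis using isCont_tendsto_compose[of z G "\<lambda>n. of_real (rr n) * z"] by simp
    qed
    have "(\<lambda>n. B * (2 / (1 - cmod z)) * (\<M> t. 1 - (cmod (dil S (rr n) t))\<^sup>2)) \<longlonglongrightarrow> B * (2 / (1 - cmod z)) * 0"
      by (intro tendsto_intros integral_one_minus_sing_inner)
    then have z0: "(\<lambda>n. B * (2 / (1 - cmod z)) * (\<M> t. 1 - (cmod (dil S (rr n) t))\<^sup>2)) \<longlonglongrightarrow> 0" by simp
    have "(\<lambda>n. P2 n - G (of_real (rr n) * z)) \<longlonglongrightarrow> 0"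
      by (rule Lim_null_comparison[OF _ z0]) (use P2d in auto)
    from tendsto_add[OF this Gl] have P2l: "P2 \<longlonglongrightarrow> G z" by simp
    from tendsto_diff[OF P2l d] have SP: "(\<lambda>n. S z * P1 n) \<longlonglongrightarrow> G z" by simp
    have "cmod (G z) \<le> cmod (S z) * B"
      by (rule LIMSEQ_le_const2[OF tendsto_norm[OF SP]]) (use P1b in \<open>auto simp: norm_mult intro!: mult_left_mono\<close>)
    then show ?thesis by (simp add: G_def h_def norm_mult mult.commute)
  qed
  have "(\<lambda>k. cmod (F z) * cmod (\<O> z * outer (\<lambda>t. - ln (max (cmod (H t)) (1 / (real k + 1)))) z)) \<longlonglongrightarrow> cmod (F z) * 1"
    unfolding \<O>_def by (intro tendsto_intros truncated_outer(4)[OF Hm nz int z])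
  moreover have "\<exists>N. \<forall>k\<ge>N. cmod (F z) * cmod (\<O> z * outer (\<lambda>t. - ln (max (cmod (H t)) (1 / (real k + 1)))) z) \<le> B * cmod (S z)"
    by (intro exI[of _ 0] allI impI main) auto
  ultimately have "cmod (F z) * 1 \<le> B * cmod (S z)" by (rule LIMSEQ_le_const2)
  then show ?thesis by simp
qed

text \<open>A zero-free value of g makes ln |H| integrable, and Jensen's inequality gives |g| \<le>
  |O|. Hence |f|, |O S|, |O| and the square root of the Poisson integral of |H|^2 increase in this
  order, which is what makes the oscillation estimate available for both O and O S with the same
  E.\<close>

lemma permanence:
  assumes w: "majorant w" and dini: "set_integrable lborel {0<..1} (\<lambda>t. w t / t)"
    and f: "BMOA_w w f" and f0: "\<exists>z\<in>ball 0 1. f z \<noteq> 0"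
    and g: "H2 g" "\<And>z. cmod z < 1 \<Longrightarrow> f z = S z * g z"
    and F: "F \<in> bloch_invariant_subspace S" "Hinf F"
  shows "\<exists>h. Hinf h \<and> (\<forall>z\<in>ball 0 1. F z = S z * h z)"
proof -
  have hf: "hardy f" using f by (auto simp: BMOA_w_def intro: H2_imp_hardy)
  have hg: "hardy g" by (rule H2_imp_hardy[OF g(1)])
  have fh: "f holomorphic_on ball 0 1" and gh: "g holomorphic_on ball 0 1" using hf hg by (auto simp: hardy_def)
  obtain h where h: "boundary_values f h" "BMO_w w h" using f by (auto simp: BMOA_w_def)
  define H where "H \<theta> = h (cis \<theta>)" for \<theta>
  note GB = Garsia_bound[OF w dini hf h, folded H_def]
  have H: "sqint circ H" and Hlim: "(\<lambda>n. l2 circ (\<lambda>\<theta>. dil f (rr n) \<theta> - H \<theta>)) \<longlonglongrightarrow> 0" using GB(1,2) by auto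
  obtain V where V: "summable V" "\<And>n. 0 \<le> V n"
    and VE: "\<And>n z. 1 / 2^(n+1) \<le> 1 - cmod z \<Longrightarrow> 1 - cmod z \<le> 1 / 2^n \<Longrightarrow> (\<M> \<theta>. (cmod (H \<theta>))\<^sup>2 * poisson z \<theta>) - (cmod (f z))\<^sup>2 \<le> (V n)\<^sup>2"
    using GB(4) by auto
  note gl = norm_quotient_tendsto[OF fh hg g(2) H Hlim]
  have reg: "cmod (g z) \<le> exp (\<M> \<theta>. ln (cmod (H \<theta>) + \<delta>) * poisson z \<theta>)" if "\<delta> > 0" "cmod z < 1" for \<delta> z
    by (rule log_majorant_regularized[OF gh H gl that])
  obtain z0 where z0: "cmod z0 < 1" "f z0 \<noteq> 0" using f0 by auto
  then have gz0: "0 < cmod (g z0)" using g(2)[of z0] by auto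
  have nz: "AE \<theta> in circ. H \<theta> \<noteq> 0" and int: "integrable circ (\<lambda>\<theta>. ln (cmod (H \<theta>)))"
    using integrable_log_boundary[OF H z0(1) gz0 reg[OF _ z0(1)]] by auto
  define \<O> where "\<O> = outer (\<lambda>\<theta>. ln (cmod (H \<theta>)))"
  have gO: "cmod (g z) \<le> cmod (\<O> z)" if "cmod z < 1" for z
    unfolding \<O>_def norm_outer[OF int that] by (rule log_majorant[OF H that nz int reg[OF _ that]])
  have Oh: "\<O> holomorphic_on ball 0 1" unfolding \<O>_def by (rule outer_holomorphic[OF int])
  have OU: "(cmod (\<O> z))\<^sup>2 \<le> (\<M> \<theta>. (cmod (H \<theta>))\<^sup>2 * poisson z \<theta>)" if "cmod z < 1" for z
    unfolding \<O>_def by (rule norm_outer_sq_le[OF H that nz int])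
  have hO: "hardy \<O>" by (rule hardy_of_harmonic_majorant[OF Oh H OU])
  have OSh: "(\<lambda>u. \<O> u * S u) holomorphic_on ball 0 1" by (intro holomorphic_intros Oh sing_inner_holomorphic)
  have OSO: "cmod (\<O> z * S z) \<le> cmod (\<O> z)" if "cmod z < 1" for z
    unfolding norm_mult using norm_sing_inner_le[OF that] by (intro mult_right_le_one_le) auto
  have OSU: "(cmod (\<O> z * S z))\<^sup>2 \<le> (\<M> \<theta>. (cmod (H \<theta>))\<^sup>2 * poisson z \<theta>)" if "cmod z < 1" for z
    using power_mono[OF OSO[OF that] norm_ge_zero, of 2] OU[OF that] by linarith
  have fOS: "cmod (f z) \<le> cmod (\<O> z * S z)" if "cmod z < 1" for z
    unfolding g(2)[OF that] norm_mult using gO[OF that] by (simp add: mult.commute mult_right_mono)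
  have fO: "cmod (f z) \<le> cmod (\<O> z)" if "cmod z < 1" for z using fOS[OF that] OSO[OF that] by linarith
  define U where "U z = (\<M> \<theta>. (cmod (H \<theta>))\<^sup>2 * poisson z \<theta>)" for z
  define E where "E z = sqrt (U z - (cmod (f z))\<^sup>2)" for z
  have Hi: "integrable circ (\<lambda>\<theta>. (cmod (H \<theta>))\<^sup>2)" using H by (simp add: sqint_def)
  have Uc: "continuous_on (ball 0 1) U"
  proof -
    have "continuous_on (ball 0 1) (\<lambda>z. Re (log_outer (\<lambda>\<theta>. (cmod (H \<theta>))\<^sup>2) z))"
      by (intro continuous_intros holomorphic_on_imp_continuous_on log_outer_holomorphic Hi)
    moreover have "Re (log_outer (\<lambda>\<theta>. (cmod (H \<theta>))\<^sup>2) z) = U z" if "z \<in> ball 0 1" for z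
      unfolding U_def by (rule Re_log_outer[OF Hi]) (use that in simp)
    ultimately show ?thesis by (rule continuous_on_eq)
  qed
  have Ec: "continuous_on (ball 0 1) E"
    unfolding E_def by (intro continuous_intros Uc holomorphic_on_imp_continuous_on[OF fh])
  have o1: "(\<M> \<theta>. cmod (dil \<O> r \<theta> - \<O> (of_real r * z)) * poisson z \<theta>) \<le> E (of_real r * z)"
    if "0 \<le> r" "r < 1" "cmod z < 1" for r z
    unfolding E_def U_def by (rule Garsia_dilation[OF Oh H OU fO that])
  have o2: "(\<M> \<theta>. cmod (dil \<O> r \<theta> * dil S r \<theta> - \<O> (of_real r * z) * S (of_real r * z)) * poisson z \<theta>) \<le> E (of_real r * z)"
    if "0 \<le> r" "r < 1" "cmod z < 1" for r z
    unfolding E_def U_def by (rule Garsia_dilation[OF OSh H OSU fOS that])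
  have EV: "E z \<le> V n" if "1 / 2^(n+1) \<le> 1 - cmod z" "1 - cmod z \<le> 1 / 2^n" for n z
    unfolding E_def U_def using VE[OF that] V(2)[of n] by (intro real_le_lsqrt) auto
  have Fh: "F holomorphic_on ball 0 1" using F by (simp add: Hinf_def)
  obtain B where "\<forall>x\<in>ball 0 1. cmod (F x) \<le> B"
    using F(2) unfolding Hinf_def bounded_iff by auto
  then have B: "cmod (F z) \<le> B" if "cmod z < 1" for z using that by simp
  have ann: "(\<lambda>n. \<integral>\<theta>. (cnj (dil S (rr n) \<theta>) * dil \<O> (rr n) \<theta> * cis \<theta> ^ (N+1)) * dil F (rr n) \<theta> \<partial>circ) \<longlonglongrightarrow> 0" for N
  proof -
    obtain k where k: "W1 k" and kp: "\<And>F B. F holomorphic_on ball 0 1 \<Longrightarrow> (\<And>z. cmod z < 1 \<Longrightarrow> cmod (F z) \<le> B) \<Longrightarrow>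
       (\<lambda>n. \<integral>\<theta>. (cnj (dil S (rr n) \<theta>) * dil \<O> (rr n) \<theta> * cis \<theta> ^ (N+1)) * dil F (rr n) \<theta> \<partial>circ) \<longlonglongrightarrow> bloch_pairing F k"
      by (rule annihilator_exists[OF sing_inner_holomorphic norm_sing_inner_le hO Ec o1 o2 V EV, where N=N]) blast+
    obtain BO where BO: "\<And>r. 0 \<le> r \<Longrightarrow> r < 1 \<Longrightarrow> l2 circ (dil \<O> r) \<le> BO" using hO by (auto simp: hardy_def)
    \<comment> \<open>On the circle of radius \<open>rr n\<close> the integrand is |S|^2 times p O
      \<zeta>^(N+1). The analytic function has mean 0, and the remaining factor 1 - |S|^2 is small
      in norm.\<close>
    have poly0: "bloch_pairing (\<lambda>z. poly p z * S z) k = 0" for p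
    proof -
      define G where "G u = poly p u * S u" for u
      have "compact (poly p ` cball 0 1)" by (intro compact_continuous_image continuous_intros) auto
      then have "bounded (poly p ` cball 0 1)" by (rule compact_imp_bounded)
      then obtain Bp where "\<forall>u\<in>cball 0 1. cmod (poly p u) \<le> Bp" unfolding bounded_iff by auto
      then have Bp: "cmod (poly p u) \<le> Bp" if "cmod u \<le> 1" for u using that by auto
      have Bp0: "0 \<le> Bp" using order_trans[OF norm_ge_zero Bp[of 0]] by simp
      have Gh: "G holomorphic_on ball 0 1" unfolding G_def by (intro holomorphic_intros sing_inner_holomorphic)
      have Gb: "cmod (G u) \<le> Bp" if "cmod u < 1" for u
      proof -
        have "cmod (G u) \<le> Bp * 1" unfolding G_def norm_mult using Bp[of u] norm_sing_inner_le[OF that] that Bp0 by (intro mult_mono) auto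
        then show ?thesis by simp
      qed
      define X where "X n = (\<M> \<theta>. (cnj (dil S (rr n) \<theta>) * dil \<O> (rr n) \<theta> * cis \<theta> ^ (N+1)) * dil G (rr n) \<theta>)" for n
      have Xl: "X \<longlonglongrightarrow> bloch_pairing G k" unfolding X_def by (rule kp[OF Gh Gb])
      define q where "q n \<theta> = complex_of_real (1 - (cmod (dil S (rr n) \<theta>))\<^sup>2)" for n \<theta>
      have qsq: "sqint circ (q n)" for n unfolding q_def by (rule sqint_one_minus(2))
      have Osq: "sqint circ (dil \<O> (rr n))" for n using rr by (intro sqint_dil Oh) auto
      have Xb: "cmod (X n) \<le> l2 circ (q n) * (Bp * BO)" for n
      proof -
        define t where "t \<theta> = dil (poly p) (rr n) \<theta> * cis \<theta> ^ (N+1)" for \<theta>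
        have tc: "continuous_on UNIV t" unfolding t_def by (intro continuous_intros)
        have tb: "cmod (t \<theta>) \<le> Bp" for \<theta> unfolding t_def norm_mult norm_power norm_cis power_one mult_1_right using rr_cis[of n \<theta>] by (intro Bp) simp
        have tm: "t \<in> borel_measurable circ" using borel_measurable_continuous_onI[OF tc] by simp
        have toq: "sqint circ (\<lambda>\<theta>. t \<theta> * dil \<O> (rr n) \<theta>)" "l2 circ (\<lambda>\<theta>. t \<theta> * dil \<O> (rr n) \<theta>) \<le> Bp * l2 circ (dil \<O> (rr n))"
          by (rule sqint_mult_bounded[OF Osq tm tb])+
        have eq: "(cnj (dil S (rr n) \<theta>) * dil \<O> (rr n) \<theta> * cis \<theta> ^ (N+1)) * dil G (rr n) \<theta> = t \<theta> * dil \<O> (rr n) \<theta> - q n \<theta> * (t \<theta> * dil \<O> (rr n) \<theta>)" for \<theta>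
        proof -
          have "complex_of_real ((cmod (dil S (rr n) \<theta>))\<^sup>2) = dil S (rr n) \<theta> * cnj (dil S (rr n) \<theta>)" by (rule complex_norm_square)
          then have c: "1 - q n \<theta> = dil S (rr n) \<theta> * cnj (dil S (rr n) \<theta>)" by (simp add: q_def)
          have "t \<theta> * dil \<O> (rr n) \<theta> - q n \<theta> * (t \<theta> * dil \<O> (rr n) \<theta>) = (1 - q n \<theta>) * (t \<theta> * dil \<O> (rr n) \<theta>)" by (simp only: left_diff_distrib mult_1)
          also have "\<dots> = (cnj (dil S (rr n) \<theta>) * dil \<O> (rr n) \<theta> * cis \<theta> ^ (N+1)) * dil G (rr n) \<theta>" unfolding c t_def G_def by (simp only: mult_ac)
          finally show ?thesis by simp
        qed
        \<comment> \<open>The exponent N + 1 is positive, so the integrand is the boundary value of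
          an analytic function that vanishes at 0.\<close>
        have z0: "(\<M> \<theta>. t \<theta> * dil \<O> (rr n) \<theta>) = 0"
        proof -
          obtain R where R: "1 < R" "(\<lambda>z. \<O> (of_real (rr n) * z)) holomorphic_on ball 0 R" using dil_holomorphic[OF Oh rr(1) rr(3)] .
          have "(\<lambda>u. poly p (of_real (rr n) * u) * u ^ (N+1) * \<O> (of_real (rr n) * u)) holomorphic_on ball 0 R" by (intro holomorphic_intros R)
          from mean_value_circ[OF this R(1)] show ?thesis by (simp add: t_def)
        qed
        have "X n = (\<M> \<theta>. t \<theta> * dil \<O> (rr n) \<theta>) - (\<M> \<theta>. q n \<theta> * (t \<theta> * dil \<O> (rr n) \<theta>))"
          unfolding X_def eq by (intro Bochner_Integration.integral_diff l1_le_l2(1) sqint_mult_integrable qsq toq)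
        then have "cmod (X n) = cmod (\<M> \<theta>. q n \<theta> * (t \<theta> * dil \<O> (rr n) \<theta>))" by (simp add: z0)
        also have "\<dots> \<le> (\<M> \<theta>. cmod (q n \<theta> * (t \<theta> * dil \<O> (rr n) \<theta>)))" by (rule integral_norm_bound)
        also have "\<dots> \<le> l2 circ (q n) * l2 circ (\<lambda>\<theta>. t \<theta> * dil \<O> (rr n) \<theta>)" by (rule l2_Cauchy_Schwarz[OF qsq toq(1)])
        also have "\<dots> \<le> l2 circ (q n) * (Bp * BO)"
        proof (intro mult_left_mono)
          have "Bp * l2 circ (dil \<O> (rr n)) \<le> Bp * BO" using BO[OF rr(1) rr(3)] Bp0 by (rule mult_left_mono)
          then show "l2 circ (\<lambda>\<theta>. t \<theta> * dil \<O> (rr n) \<theta>) \<le> Bp * BO" using toq(2) by linarith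
        qed simp
        finally show ?thesis .
      qed
      have "(\<lambda>n. l2 circ (q n) * (Bp * BO)) \<longlonglongrightarrow> 0 * (Bp * BO)" unfolding q_def by (intro tendsto_intros l2_one_minus_tendsto(2))
      then have "(\<lambda>n. l2 circ (q n) * (Bp * BO)) \<longlonglongrightarrow> 0" by simp
      then have "X \<longlonglongrightarrow> 0" by (rule Lim_null_comparison[rotated]) (use Xb in auto)
      then have "bloch_pairing G k = 0" using Xl LIMSEQ_unique by blast
      then show ?thesis by (simp add: G_def[abs_def])
    qed
    have "cmod (bloch_pairing F k) < e" if e: "e > 0" for e
    proof -
      \<comment> \<open>The neighbourhood given by \<open>k\<close> alone suffices, because all p S
        pair to 0 with it.\<close>
      have fin: "finite {k}" "{k} \<subseteq> Collect W1" using k by auto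
      have "\<forall>G e. finite G \<longrightarrow> G \<subseteq> Collect W1 \<longrightarrow> e > 0 \<longrightarrow> (\<exists>p :: complex poly. \<forall>g\<in>G. cmod (bloch_pairing F g - bloch_pairing (\<lambda>z. poly p z * S z) g) < e)"
        using F(1) unfolding bloch_invariant_subspace_def by blast
      then have "\<exists>p :: complex poly. \<forall>g\<in>{k}. cmod (bloch_pairing F g - bloch_pairing (\<lambda>z. poly p z * S z) g) < e" using fin e by blast
      then show ?thesis by (simp add: poly0)
    qed
    then have "bloch_pairing F k = 0" by (metis less_irrefl zero_less_norm_iff)
    then show ?thesis using kp[OF Fh B] by simp
  qed
  have main: "cmod (F z) \<le> B * cmod (S z)" if "cmod z < 1" for z
    using division_of_annihilated[OF Fh B H nz int _ _ that] hO ann unfolding \<O>_def by blast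
  define h where "h z = F z / S z" for z
  have hh: "h holomorphic_on ball 0 1" unfolding h_def
    by (intro holomorphic_intros Fh sing_inner_holomorphic) (simp add: sing_inner_nonzero)
  have hb: "cmod (h z) \<le> B" if "cmod z < 1" for z
    using main[OF that] sing_inner_nonzero[of z] by (simp add: h_def norm_divide divide_le_eq)
  have "Hinf h" unfolding Hinf_def bounded_iff using hh hb by (auto intro!: exI[of _ B])
  moreover have "\<forall>z\<in>ball 0 1. F z = S z * h z" by (simp add: h_def sing_inner_nonzero)
  ultimately show ?thesis by blast
qed

end

section \<open>Weak-star continuity of bounded functions\<close>

text \<open>Rotations map balls to balls of the same radius, and a Vitali covering fills an open set by disjoint
  balls up to a null set; so they preserve the area of open sets.\<close>

lemma lborel_distr_rotation:
  fixes u :: complex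
  assumes u: "cmod u = 1"
  shows "distr lborel borel ((*) u) = lborel"
proof (rule sym, rule lborel_eqI)
  have [measurable]: "(*) u \<in> borel_measurable borel" by simp
  fix l v :: complex assume le: "\<And>b. b \<in> Basis \<Longrightarrow> l \<bullet> b \<le> v \<bullet> b"
  define W where "W = (*) u -` box l v"
  have Wo: "open W" unfolding W_def by (intro open_vimage open_box continuous_intros)
  have uc: "u * cnj u = 1" using u complex_norm_square[of u] by simp
  have im: "x \<in> box l v \<Longrightarrow> \<exists>y\<in>W. x = u * y" for x
    using uc by (intro bexI[of _ "cnj u * x"]) (simp_all add: W_def mult.assoc[symmetric])
  have db: "x \<in> ball (u * a) r \<longleftrightarrow> (\<exists>y\<in>ball a r. x = u * y)" for x a r
  proof
    assume "\<exists>y\<in>ball a r. x = u * y"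
    then show "x \<in> ball (u * a) r" using u by (auto simp: dist_norm norm_mult simp flip: right_diff_distrib)
  next
    assume x: "x \<in> ball (u * a) r"
    have "x = u * (cnj u * x)" using uc by (simp add: mult.assoc[symmetric])
    moreover from this have "u * a - x = u * (a - cnj u * x)" by (simp add: right_diff_distrib)
    then have "dist (u * a) x = dist a (cnj u * x)" using u by (simp add: dist_norm norm_mult)
    ultimately show "\<exists>y\<in>ball a r. x = u * y" using x by (intro bexI[of _ "cnj u * x"]) auto
  qed
  have inj: "u * x = u * y \<longleftrightarrow> x = y" for x y using u by auto
  define K where "K = {(x::complex, r::real). 0 < r \<and> ball x r \<subseteq> W}"
  obtain C where C: "countable C" "C \<subseteq> K" "pairwise (\<lambda>i j. disjnt (ball (fst i) (snd i)) (ball (fst j) (snd j))) C"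
    and neg: "negligible (W - (\<Union>i\<in>C. ball (fst i) (snd i)))"
  proof (rule Vitali_covering_theorem_balls[of W K fst snd])
    fix x d assume x: "x \<in> W" and d: "(0::real) < d"
    obtain e where "e > 0" "ball x e \<subseteq> W" using Wo x openE by blast
    then have "(x, min e (d/2)) \<in> K" "min e (d/2) < d" "x \<in> ball x (min e (d/2))" using d by (auto simp: K_def)
    then show "\<exists>i. i \<in> K \<and> x \<in> ball (fst i) (snd i) \<and> snd i < d" by (intro exI[of _ "(x, min e (d/2))"]) auto
  qed
  define N where "N = W - (\<Union>i\<in>C. ball (fst i) (snd i))"
  have "ball (fst i) (snd i) \<subseteq> W" if "i \<in> C" for i using subsetD[OF C(2) that] by (simp add: K_def case_prod_unfold)
  then have CW: "(\<Union>i\<in>C. ball (fst i) (snd i)) \<subseteq> W" by blast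
  have eq1: "W = (\<Union>i\<in>C. ball (fst i) (snd i)) \<union> N" using CW by (auto simp: N_def)
  have eq2: "box l v = (\<Union>i\<in>C. ball (u * fst i) (snd i)) \<union> (*) u ` N"
  proof (intro equalityI subsetI)
    fix x assume "x \<in> box l v"
    then obtain y where "y \<in> W" "x = u * y" using im by blast
    then show "x \<in> (\<Union>i\<in>C. ball (u * fst i) (snd i)) \<union> (*) u ` N" unfolding UN_iff Un_iff db using eq1 by blast
  next
    fix x assume "x \<in> (\<Union>i\<in>C. ball (u * fst i) (snd i)) \<union> (*) u ` N"
    then obtain y where "y \<in> W" "x = u * y" unfolding UN_iff Un_iff db using eq1 by blast
    then show "x \<in> box l v" by (simp add: W_def)
  qed
  have Uo: "open (\<Union>i\<in>C. ball (fst i) (snd i))" "open (\<Union>i\<in>C. ball (u * fst i) (snd i))" by auto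
  have meas: "emeasure lborel T = emeasure lborel (\<Union>i\<in>C. ball (c i) (snd i))"
    if T: "open T" "T = (\<Union>i\<in>C. ball (c i) (snd i)) \<union> M" and M: "negligible M" for T M and c :: "complex \<times> real \<Rightarrow> complex"
  proof -
    have "negligible (T - (\<Union>i\<in>C. ball (c i) (snd i)))" by (rule negligible_subset[OF M]) (use T in auto)
    moreover have "T - (\<Union>i\<in>C. ball (c i) (snd i)) \<in> sets borel" using T by (intro sets.Diff borel_open) auto
    ultimately have nul: "T - (\<Union>i\<in>C. ball (c i) (snd i)) \<in> null_sets lborel"
      by (simp add: negligible_iff_null_sets null_sets_completion_iff)
    have "emeasure lborel T = emeasure lborel ((\<Union>i\<in>C. ball (c i) (snd i)) \<union> (T - (\<Union>i\<in>C. ball (c i) (snd i))))"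
      using T by (intro arg_cong[where f="emeasure lborel"]) auto
    also have "\<dots> = emeasure lborel (\<Union>i\<in>C. ball (c i) (snd i))" by (rule emeasure_Un_null_set[OF _ nul]) (auto intro!: borel_open)
    finally show ?thesis .
  qed
  have "negligible ((*) u ` N)"
  proof (rule negligible_locally_Lipschitz_image)
    show "\<exists>T B. open T \<and> x \<in> T \<and> (\<forall>y\<in>N \<inter> T. cmod (u * y - u * x) \<le> B * cmod (y - x))" for x
      using u by (intro exI[of _ UNIV] exI[of _ "1::real"]) (simp add: norm_mult flip: right_diff_distrib)
  qed (use neg in \<open>auto simp: N_def[symmetric]\<close>)
  then have e2: "emeasure lborel (box l v) = emeasure lborel (\<Union>i\<in>C. ball (u * fst i) (snd i))" by (rule meas[OF open_box eq2])
  have e1: "emeasure lborel W = emeasure lborel (\<Union>i\<in>C. ball (fst i) (snd i))" using meas[OF Wo eq1] neg by (simp add: N_def)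
  have d1: "disjoint_family_on (\<lambda>i. ball (fst i) (snd i)) C"
    using C(3) by (auto simp: disjoint_family_on_def pairwise_def disjnt_def)
  have d2: "disjoint_family_on (\<lambda>i. ball (u * fst i) (snd i)) C"
  proof (unfold disjoint_family_on_def, intro ballI impI)
    fix i j assume ij: "i \<in> C" "j \<in> C" "i \<noteq> j"
    then have "ball (fst i) (snd i) \<inter> ball (fst j) (snd j) = {}" using d1 by (simp add: disjoint_family_on_def)
    then have n: "\<not> (y \<in> ball (fst i) (snd i) \<and> y \<in> ball (fst j) (snd j))" for y by blast
    show "ball (u * fst i) (snd i) \<inter> ball (u * fst j) (snd j) = {}"
    proof (rule equals0I)
      fix x assume "x \<in> ball (u * fst i) (snd i) \<inter> ball (u * fst j) (snd j)"
      then obtain y y' where "y \<in> ball (fst i) (snd i)" "y' \<in> ball (fst j) (snd j)" "x = u * y" "x = u * y'"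
        unfolding Int_iff db by blast
      then show False using n[of y] inj[of y y'] by metis
    qed
  qed
  have "emeasure lborel (\<Union>i\<in>C. ball (u * fst i) (snd i)) = (\<integral>\<^sup>+i. emeasure lborel (ball (u * fst i) (snd i)) \<partial>count_space C)"
    by (rule emeasure_UN_countable[OF _ C(1) d2]) auto
  also have "\<dots> = (\<integral>\<^sup>+i. emeasure lborel (ball (fst i) (snd i)) \<partial>count_space C)"
  proof (intro nn_integral_cong)
    fix i assume "i \<in> space (count_space C)"
    then have r: "0 \<le> snd i" using C(2) by (auto simp: K_def)
    show "emeasure lborel (ball (u * fst i) (snd i)) = emeasure lborel (ball (fst i) (snd i))"
      using emeasure_ball[OF r, of "u * fst i"] emeasure_ball[OF r, of "fst i"] by simp
  qed
  also have "\<dots> = emeasure lborel (\<Union>i\<in>C. ball (fst i) (snd i))"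
    by (rule emeasure_UN_countable[OF _ C(1) d1, symmetric]) auto
  finally have "emeasure lborel W = emeasure lborel (box l v)" using e1 e2 by simp
  then show "emeasure (distr lborel borel ((*) u)) (box l v) = (\<Prod>b\<in>Basis. (v - l) \<bullet> b)"
    using le by (simp add: emeasure_distr W_def)
qed simp

text \<open>On the circle of radius r, |u| is at most the Poisson integral of |u| from the circle of
  radius s, taken at the relative radius t = r/s. That Poisson integral is harmonic, so its circle
  mean is its value at 0, which is the mean over the circle of radius s.\<close>

lemma circle_mean_mono:
  assumes u: "u holomorphic_on ball 0 1" and rs: "0 \<le> r" "r \<le> s" "s < 1"
  shows "(\<M> \<theta>. cmod (dil u r \<theta>)) \<le> (\<M> \<theta>. cmod (dil u s \<theta>))"
proof (cases "r = s")
  case False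
  define t where "t = r / s"
  have t: "0 \<le> t" "t < 1" "r = s * t" using False rs by (auto simp: t_def field_simps)
  have s: "0 \<le> s" "s < 1" using rs by auto
  define v where "v \<theta> = cmod (dil u s \<theta>)" for \<theta>
  have ui: "integrable circ (dil u s)" by (intro integrable_circ_continuous continuous_on_dil u s)
  then have vi: "integrable circ v" unfolding v_def by (rule integrable_norm)
  define A where "A = log_outer v"
  have A: "A holomorphic_on ball 0 1" unfolding A_def by (rule log_outer_holomorphic[OF vi])
  have tc: "cmod (of_real t * cis \<theta>) < 1" for \<theta> using t by (simp add: norm_mult)
  have cA: "integrable circ (dil A t)" by (intro integrable_circ_continuous continuous_on_dil A t)
  have "(\<M> \<theta>. cmod (dil u r \<theta>)) \<le> (\<M> \<theta>. Re (dil A t \<theta>))"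
  proof (rule integral_mono)
    show "integrable circ (\<lambda>\<theta>. cmod (dil u r \<theta>))" using rs by (intro integrable_norm integrable_circ_continuous continuous_on_dil u) auto
    show "integrable circ (\<lambda>\<theta>. Re (dil A t \<theta>))" using integrable_Re[OF cA] .
    fix \<theta>
    have "dil u r \<theta> = u (of_real s * (of_real t * cis \<theta>))" by (simp add: t(3) mult.assoc)
    also have "\<dots> = (\<M> \<phi>. dil u s \<phi> * poisson (of_real t * cis \<theta>) \<phi>)" by (rule Poisson_dil[OF u s tc, symmetric])
    also have "cmod \<dots> \<le> (\<M> \<phi>. v \<phi> * poisson (of_real t * cis \<theta>) \<phi>)" unfolding v_def by (rule poisson_integral_le_norm[OF ui tc])
    also have "\<dots> = Re (dil A t \<theta>)" unfolding A_def by (rule Re_log_outer[OF vi tc, symmetric])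
    finally show "cmod (dil u r \<theta>) \<le> Re (dil A t \<theta>)" .
  qed
  also have "\<dots> = Re (\<M> \<theta>. dil A t \<theta>)" by (rule integral_Re[OF cA])
  also have "(\<M> \<theta>. dil A t \<theta>) = A 0"
  proof -
    have "poisson 0 \<theta> = 1" for \<theta> by (simp add: poisson_def)
    then show ?thesis using Poisson_dil[OF A t(1,2), of 0] by simp
  qed
  also have "Re (A 0) = (\<M> \<theta>. v \<theta>)" unfolding A_def by (subst Re_log_outer[OF vi]) (simp_all add: poisson_def)
  finally show ?thesis by (simp add: v_def)
qed simp

definition dyadic_radius :: "nat \<Rightarrow> real" where "dyadic_radius n = 1 - 1/2^n"

lemma dyadic_radius: "0 \<le> dyadic_radius n" "dyadic_radius n < 1" "dyadic_radius n < dyadic_radius (Suc n)"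
    "dyadic_radius (Suc n) - dyadic_radius n = 1 / 2^Suc n"
  by (auto simp: dyadic_radius_def field_simps)

lemma dyadic_radius_tendsto: "dyadic_radius \<longlonglongrightarrow> 1"
  unfolding dyadic_radius_def by real_asymp

lemma dyadic_radius_mono: "m \<le> n \<Longrightarrow> dyadic_radius m \<le> dyadic_radius n"
  by (rule lift_Suc_mono_le[of dyadic_radius]) (use dyadic_radius(3) in \<open>auto intro: less_imp_le\<close>)

text \<open>The area integral is invariant under rotations, so it equals its average over all
  rotations. After Fubini the integrand at z becomes the circle mean at radius |z|, which on the
  n-th dyadic ring is at least the mean at the inner radius; the area of that ring is at least
  2^-(n+1).\<close>

lemma summable_circle_means:
  assumes u: "u holomorphic_on ball 0 1" and i: "set_integrable lborel (ball 0 1) (\<lambda>z. cmod (u z))"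
  shows "summable (\<lambda>n. (\<M> t. cmod (dil u (dyadic_radius n) t)) / 2^n)"
proof -
  define \<phi> where "\<phi> z = indicator (ball 0 1) z *\<^sub>R cmod (u z)" for z
  have m [measurable]: "\<phi> \<in> borel_measurable borel" unfolding \<phi>_def
    by (intro borel_measurable_continuous_on_indicator continuous_intros holomorphic_on_imp_continuous_on[OF u]) auto
  define M where "M r = (\<M> t. cmod (dil u r t))" for r
  have M0: "0 \<le> M r" for r unfolding M_def by simp
  define A where "A n = ball (0::complex) (dyadic_radius (Suc n)) - ball 0 (dyadic_radius n)" for n
  have Am [measurable]: "A n \<in> sets borel" for n unfolding A_def by auto
  have Aem: "ennreal (1 / 2^Suc n) \<le> emeasure lborel (A n)" for n
  proof -
    have "emeasure lborel (A n) = emeasure lborel (ball (0::complex) (dyadic_radius (Suc n))) - emeasure lborel (ball (0::complex) (dyadic_radius n))"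
      unfolding A_def by (rule emeasure_Diff) (use dyadic_radius(3)[of n] emeasure_bounded_finite[of "ball (0::complex) (dyadic_radius n)"] in auto)
    also have "emeasure lborel (ball (0::complex) (dyadic_radius (Suc n))) = ennreal (pi * (dyadic_radius (Suc n))\<^sup>2)" using emeasure_ball[OF dyadic_radius(1), of "0::complex"] by (simp add: unit_ball_vol_2)
    also have "emeasure lborel (ball (0::complex) (dyadic_radius n)) = ennreal (pi * (dyadic_radius n)\<^sup>2)" using emeasure_ball[OF dyadic_radius(1), of "0::complex"] by (simp add: unit_ball_vol_2)
    also have "ennreal (pi * (dyadic_radius (Suc n))\<^sup>2) - ennreal (pi * (dyadic_radius n)\<^sup>2) = ennreal (pi * (dyadic_radius (Suc n))\<^sup>2 - pi * (dyadic_radius n)\<^sup>2)" by (rule ennreal_minus) simp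
    \<comment> \<open>With x = 2^-n this is (1 - x/2)^2 - (1 - x)^2 = x (1 - 3x/4), and the bracket
      is at least 1/4.\<close>
    also have "pi * (dyadic_radius (Suc n))\<^sup>2 - pi * (dyadic_radius n)\<^sup>2 = pi * ((1 / 2^n) * (1 - 3/4 * (1 / 2^n)))"
      by (simp add: dyadic_radius_def power2_eq_square field_simps)
    finally have eq: "emeasure lborel (A n) = ennreal (pi * ((1 / 2^n) * (1 - 3/4 * (1 / 2^n))))" .
    have "(1/2^n) * (1/2) \<le> (1/2^n) * (pi * (1 - 3/4 * (1 / (2::real)^n)))"
    proof (rule mult_left_mono)
      have "3 * (1/4) \<le> pi * (1 - 3/4 * (1 / 2^n))" using pi_gt3 by (intro mult_mono) (auto simp: field_simps)
      then show "1/2 \<le> pi * (1 - 3/4 * (1 / 2^n))" by simp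
    qed simp
    then show ?thesis unfolding eq by (intro ennreal_leI) (simp add: algebra_simps)
  qed
  have rot: "(\<integral>\<^sup>+z. ennreal (\<phi> z) \<partial>lborel) = (\<integral>\<^sup>+z. ennreal (\<phi> (cis t * z)) \<partial>lborel)" for t
  proof -
    have "(\<integral>\<^sup>+z. ennreal (\<phi> z) \<partial>lborel) = (\<integral>\<^sup>+z. ennreal (\<phi> z) \<partial>distr lborel borel ((*) (cis t)))" by (simp add: lborel_distr_rotation)
    also have "\<dots> = (\<integral>\<^sup>+z. ennreal (\<phi> (cis t * z)) \<partial>lborel)" by (rule nn_integral_distr) auto
    finally show ?thesis .
  qed
  interpret P: pair_sigma_finite circ "lborel :: complex measure" by standard
  have inner: "ennreal (M (dyadic_radius n)) * indicator (A n) z \<le> (\<integral>\<^sup>+t. ennreal (\<phi> (cis t * z)) \<partial>circ)" for n z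
  proof (cases "z \<in> A n")
    case True
    then have z: "dyadic_radius n \<le> cmod z" "cmod z < 1" using dyadic_radius(2)[of "Suc n"] by (auto simp: A_def)
    have c: "continuous_on UNIV (dil u (cmod z))" by (rule continuous_on_dil[OF u]) (use z in auto)
    obtain a where a: "z = of_real (cmod z) * cis a" using rcis_cmod_Arg[of z] by (metis rcis_def)
    have "M (dyadic_radius n) \<le> M (cmod z)" unfolding M_def by (rule circle_mean_mono[OF u dyadic_radius(1) z])
    also have "\<dots> = (\<M> t. cmod (dil u (cmod z) (t + a)))"
      unfolding M_def
    proof (rule integral_circ_shift[symmetric])
      show "(\<lambda>t. cmod (dil u (cmod z) t)) \<in> borel_measurable borel" using borel_measurable_continuous_onI[OF c] by simp
      show "cmod (dil u (cmod z) (t + 2*pi)) = cmod (dil u (cmod z) t)" for t by (simp add: cis_mult[symmetric])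
    qed
    also have "\<dots> = (\<M> t. \<phi> (cis t * z))"
    proof (rule Bochner_Integration.integral_cong[OF refl])
      fix t
      have "cis t * z = of_real (cmod z) * cis (t + a)" by (subst a) (simp add: cis_mult[symmetric])
      then show "cmod (dil u (cmod z) (t + a)) = \<phi> (cis t * z)" using z by (simp add: \<phi>_def norm_mult)
    qed
    finally have le: "M (dyadic_radius n) \<le> (\<M> t. \<phi> (cis t * z))" .
    have "integrable circ (\<lambda>t. \<phi> (cis t * z))"
    proof -
      have "\<phi> (cis t * z) = cmod (u (cis t * z))" for t using z by (simp add: \<phi>_def norm_mult)
      moreover have "continuous_on UNIV (\<lambda>t. cmod (u (cis t * z)))"
        by (intro continuous_intros continuous_on_compose2[OF holomorphic_on_imp_continuous_on[OF u]]) (use z in \<open>auto simp: norm_mult\<close>)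
      ultimately show ?thesis by (simp add: integrable_circ_continuous)
    qed
    then have "(\<integral>\<^sup>+t. ennreal (\<phi> (cis t * z)) \<partial>circ) = ennreal (\<M> t. \<phi> (cis t * z))" by (rule nn_integral_eq_integral) (simp add: \<phi>_def)
    then show ?thesis using True le by (simp add: ennreal_leI)
  qed simp
  \<comment> \<open>The dyadic rings are disjoint, so at most one term of the series is nonzero at
    each z.\<close>
  have disj: "(\<Sum>n. ennreal (M (dyadic_radius n)) * indicator (A n) z) \<le> (\<integral>\<^sup>+t. ennreal (\<phi> (cis t * z)) \<partial>circ)" for z
  proof (cases "\<exists>n. z \<in> A n")
    case True
    then obtain n where n: "z \<in> A n" by blast
    have "z \<notin> A m" if "m \<noteq> n" for m
      using n that dyadic_radius_mono[of "Suc m" n] dyadic_radius_mono[of "Suc n" m] by (cases "m < n") (auto simp: A_def)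
    then have "(\<Sum>n. ennreal (M (dyadic_radius n)) * indicator (A n) z) = (\<Sum>k\<in>{n}. ennreal (M (dyadic_radius k)) * indicator (A k) z)"
      by (intro suminf_finite) auto
    also have "\<dots> = ennreal (M (dyadic_radius n)) * indicator (A n) z" by (simp only: sum.insert sum.empty finite.emptyI empty_iff if_False not_False_eq_True add_0_right)
    also have "\<dots> \<le> (\<integral>\<^sup>+t. ennreal (\<phi> (cis t * z)) \<partial>circ)" by (rule inner)
    finally show ?thesis .
  qed (simp add: indicator_def)
  have "(\<Sum>n. ennreal (M (dyadic_radius n) / 2^Suc n)) \<le> (\<Sum>n. ennreal (M (dyadic_radius n)) * emeasure lborel (A n))"
  proof (rule suminf_le)
    fix n
    have "ennreal (M (dyadic_radius n) / 2^Suc n) = ennreal (M (dyadic_radius n)) * ennreal (1 / 2^Suc n)" using M0 by (simp flip: ennreal_mult)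
    also have "\<dots> \<le> ennreal (M (dyadic_radius n)) * emeasure lborel (A n)" by (intro mult_left_mono Aem) simp
    finally show "ennreal (M (dyadic_radius n) / 2^Suc n) \<le> ennreal (M (dyadic_radius n)) * emeasure lborel (A n)" .
  qed auto
  also have "\<dots> = (\<Sum>n. \<integral>\<^sup>+z. ennreal (M (dyadic_radius n)) * indicator (A n) z \<partial>lborel)" by (subst nn_integral_cmult_indicator) auto
  also have "\<dots> = (\<integral>\<^sup>+z. (\<Sum>n. ennreal (M (dyadic_radius n)) * indicator (A n) z) \<partial>lborel)" by (rule nn_integral_suminf[symmetric]) simp
  also have "\<dots> \<le> (\<integral>\<^sup>+z. (\<integral>\<^sup>+t. ennreal (\<phi> (cis t * z)) \<partial>circ) \<partial>lborel)" by (intro nn_integral_mono disj)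
  also have "\<dots> = (\<integral>\<^sup>+t. (\<integral>\<^sup>+z. ennreal (\<phi> (cis t * z)) \<partial>lborel) \<partial>circ)"
    by (rule P.Fubini') measurable
  also have "\<dots> = (\<integral>\<^sup>+z. ennreal (\<phi> z) \<partial>lborel)" by (simp add: rot[symmetric] emeasure_circ_UNIV)
  also have "\<dots> < \<infinity>"
  proof -
    have "integrable lborel \<phi>" using i by (simp add: set_integrable_def \<phi>_def[abs_def])
    then show ?thesis by (subst nn_integral_eq_integral) (auto simp: \<phi>_def)
  qed
  finally have "(\<Sum>n. ennreal (M (dyadic_radius n) / 2^Suc n)) \<noteq> \<infinity>" by simp
  then have "summable (\<lambda>n. M (dyadic_radius n) / 2^Suc n)" by (intro summable_suminf_not_top) (auto simp: M0)
  from summable_mult[OF this, of 2] show ?thesis by (simp add: M_def)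
qed

section \<open>The pairing of bounded functions with \<open>W1\<close>\<close>

lemma integral_dil_series:
  assumes g: "g holomorphic_on ball 0 1"
    and a: "\<And>z. cmod z < 1 \<Longrightarrow> (\<lambda>n. a n * z^n) sums f z" "\<And>r. 0 \<le> r \<Longrightarrow> r < 1 \<Longrightarrow> summable (\<lambda>n. cmod (a n) * r^n)"
    and b: "\<And>z. cmod z < 1 \<Longrightarrow> (\<lambda>n. b n * z^n) sums g z" "\<And>r. 0 \<le> r \<Longrightarrow> r < 1 \<Longrightarrow> summable (\<lambda>n. cmod (b n) * r^n)"
    and r: "0 \<le> r" "r < 1" and s: "0 \<le> s" "s < 1"
  shows "(\<lambda>n. a n * cnj (b n) * of_real (r * s) ^ n) sums (\<M> t. dil f r t * cnj (dil g s t))"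
proof -
  obtain B where B: "\<And>t. cmod (g (of_real s * cis t)) \<le> B" by (rule dil_bounded[OF g s]) blast
  have gc: "continuous_on UNIV (dil g s)" by (rule continuous_on_dil[OF g s])
  define F where "F n t = (a n * of_real r ^ n) * (cis t ^ n * cnj (dil g s t))" for n t
  have Fi: "integrable circ (F n)" for n unfolding F_def by (intro integrable_circ_continuous continuous_intros gc)
  have nF: "norm (F n t) \<le> (cmod (a n) * r ^ n) * B" for n t
    unfolding F_def norm_mult norm_power norm_of_real norm_cis complex_mod_cnj using r B by (auto intro!: mult_left_mono)
  have sF: "(\<lambda>n. F n t) sums (dil f r t * cnj (dil g s t))" for t
    using sums_mult2[OF dil_sums[OF a(1) r, of t], of "cnj (dil g s t)"] by (simp add: F_def mult.assoc)
  have smB: "summable (\<lambda>n. (cmod (a n) * r ^ n) * B)" by (intro summable_mult2 a(2) r)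
  have "(\<lambda>n. integral\<^sup>L circ (F n)) sums (\<M> t. (\<Sum>n. F n t))"
  proof (rule sums_integral[OF Fi])
    show "AE t in circ. summable (\<lambda>n. norm (F n t))"
      by (intro AE_I2 summable_comparison_test'[OF smB, of 0]) (use nF in auto)
    show "summable (\<lambda>n. \<integral>t. norm (F n t) \<partial>circ)"
    proof (rule summable_comparison_test'[OF smB, of 0])
      fix n
      have "(\<M> t. norm (F n t)) \<le> (\<M> t. (cmod (a n) * r ^ n) * B)"
        by (intro integral_mono integrable_norm Fi circ.integrable_const nF)
      then show "norm (\<M> t. norm (F n t)) \<le> (cmod (a n) * r ^ n) * B" by simp
    qed
  qed
  moreover have "(\<lambda>t. \<Sum>n. F n t) = (\<lambda>t. dil f r t * cnj (dil g s t))" using sF by (auto simp: sums_iff)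
  moreover have "integral\<^sup>L circ (F n) = a n * cnj (b n) * of_real (r * s) ^ n" for n
  proof -
    have "(\<M> t. dil g s t * cnj (cis t ^ n)) = b n * of_real s ^ n"
    proof (rule Fourier_coeff_series[where c = "\<lambda>n. b n * of_real s ^ n"])
      show "summable (\<lambda>n. cmod (b n * of_real s ^ n))" using b(2)[OF s] s by (simp add: norm_mult norm_power)
      show "(\<lambda>n. b n * of_real s ^ n * cis t ^ n) sums dil g s t" for t by (rule dil_sums[OF b(1) s])
    qed
    moreover have "(\<M> t. cis t ^ n * cnj (dil g s t)) = cnj (\<M> t. dil g s t * cnj (cis t ^ n))"
      by (simp add: Bochner_Integration.integral_cnj[symmetric] mult.commute)
    ultimately have "(\<M> t. cis t ^ n * cnj (dil g s t)) = cnj (b n * of_real s ^ n)" by simp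
    then show ?thesis unfolding F_def by (subst integral_mult_right_zero) (simp add: power_mult_distrib)
  qed
  ultimately show ?thesis by simp
qed

lemma integral_dil_product_cong:
  assumes "f holomorphic_on ball 0 1" "g holomorphic_on ball 0 1"
    and "0 \<le> r" "r < 1" "0 \<le> s" "s < 1" "0 \<le> r'" "r' < 1" "0 \<le> s'" "s' < 1" and eq: "r * s = r' * s'"
  shows "(\<M> t. dil f r t * cnj (dil g s t)) = (\<M> t. dil f r' t * cnj (dil g s' t))"
proof -
  obtain a where a: "\<And>z. cmod z < 1 \<Longrightarrow> (\<lambda>n. a n * z^n) sums f z" "\<And>r. 0 \<le> r \<Longrightarrow> r < 1 \<Longrightarrow> summable (\<lambda>n. cmod (a n) * r^n)"
    by (rule disc_power_series[OF assms(1)]) blast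
  obtain b where b: "\<And>z. cmod z < 1 \<Longrightarrow> (\<lambda>n. b n * z^n) sums g z" "\<And>r. 0 \<le> r \<Longrightarrow> r < 1 \<Longrightarrow> summable (\<lambda>n. cmod (b n) * r^n)"
    by (rule disc_power_series[OF assms(2)]) blast
  show ?thesis
    using integral_dil_series[OF assms(2) a b assms(3-6)] integral_dil_series[OF assms(2) a b assms(7-10)] unfolding eq by (rule sums_unique2)
qed

text \<open>The increment is the integral of g' along the radius. After exchanging the integrations,
  every circle mean of |g'| with radius in [a, b] is at most the one with radius b.\<close>

lemma circle_mean_diff_le:
  assumes g: "g holomorphic_on ball 0 1" and ab: "0 \<le> a" "a \<le> b" "b < 1"
  shows "(\<M> t. cmod (dil g b t - dil g a t)) \<le> (b - a) * (\<M> t. cmod (dil (deriv g) b t))"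
proof -
  have dg: "deriv g holomorphic_on ball 0 1" by (intro holomorphic_deriv g) auto
  define \<phi> where "\<phi> z = indicator (ball 0 1) z *\<^sub>R cmod (deriv g z)" for z
  have m [measurable]: "\<phi> \<in> borel_measurable borel" unfolding \<phi>_def
    by (intro borel_measurable_continuous_on_indicator continuous_intros holomorphic_on_imp_continuous_on[OF dg]) auto
  define M where "M r = (\<M> t. cmod (dil (deriv g) r t))" for r
  have pt: "ennreal (cmod (dil g b t - dil g a t)) \<le> (\<integral>\<^sup>+x. ennreal (\<phi> (of_real x * cis t)) * indicator {a..b} x \<partial>lborel)" for t
  proof -
    define D where "D x = cis t * deriv g (of_real x * cis t)" for x :: real
    have Dc: "continuous_on {a..b} D" unfolding D_def
      by (intro continuous_intros continuous_on_compose2[OF holomorphic_on_imp_continuous_on[OF dg]]) (use ab in \<open>auto simp: norm_mult\<close>)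
    have "(\<integral>x. indicator {a..b} x *\<^sub>R D x \<partial>lborel) = dil g b t - dil g a t"
    proof (rule integral_FTC_atLeastAtMost[OF ab(2) _ Dc])
      fix x assume x: "a \<le> x" "x \<le> b"
      then have "of_real x * cis t \<in> ball 0 1" using ab by (simp add: norm_mult)
      then have gd: "(g has_field_derivative deriv g (of_real x * cis t)) (at (of_real x * cis t))"
        using g by (metis holomorphic_derivI open_ball)
      have "((\<lambda>x::real. of_real x * cis t) has_vector_derivative cis t) (at x within {a..b})"
        by (auto intro!: derivative_eq_intros)
      from field_vector_diff_chain_within[OF this has_field_derivative_at_within[OF gd]]
      show "((\<lambda>x. dil g x t) has_vector_derivative D x) (at x within {a..b})" by (simp add: o_def D_def)
    qed
    moreover have "integrable lborel (\<lambda>x. indicator {a..b} x *\<^sub>R D x)" by (rule borel_integrable_compact[OF _ Dc, unfolded indicator_scaleR_eq_if[symmetric]]) auto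
    ultimately have "ennreal (cmod (dil g b t - dil g a t)) \<le> (\<integral>\<^sup>+x. ennreal (norm (indicator {a..b} x *\<^sub>R D x)) \<partial>lborel)"
      using integral_norm_bound_ennreal by metis
    also have "\<dots> = (\<integral>\<^sup>+x. ennreal (\<phi> (of_real x * cis t)) * indicator {a..b} x \<partial>lborel)"
      by (intro nn_integral_cong) (use ab in \<open>auto simp: indicator_def D_def \<phi>_def norm_mult\<close>)
    finally show ?thesis .
  qed
  have inner: "(\<integral>\<^sup>+t. ennreal (\<phi> (of_real x * cis t)) * indicator {a..b} x \<partial>circ) \<le> ennreal (M b) * indicator {a..b} x" for x
  proof (cases "x \<in> {a..b}")
    case True
    then have x: "0 \<le> x" "x \<le> b" "x < 1" using ab by auto
    have "(\<integral>\<^sup>+t. ennreal (\<phi> (of_real x * cis t)) * indicator {a..b} x \<partial>circ) = (\<integral>\<^sup>+t. ennreal (cmod (dil (deriv g) x t)) \<partial>circ)"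
      by (intro nn_integral_cong) (use True x in \<open>auto simp: \<phi>_def norm_mult\<close>)
    also have "\<dots> = ennreal (M x)" unfolding M_def
      by (rule nn_integral_eq_integral) (use x in \<open>auto intro!: continuous_intros integrable_circ_continuous continuous_on_dil[OF dg]\<close>)
    also have "\<dots> \<le> ennreal (M b)" unfolding M_def by (intro ennreal_leI circle_mean_mono dg x ab)
    finally show ?thesis using True by simp
  qed simp
  interpret P: pair_sigma_finite circ "lborel :: real measure" by standard
  have di: "integrable circ (\<lambda>t. cmod (dil g b t - dil g a t))"
    using ab by (intro integrable_norm Bochner_Integration.integrable_diff integrable_circ_continuous continuous_on_dil g) auto
  have "ennreal (\<M> t. cmod (dil g b t - dil g a t)) = (\<integral>\<^sup>+t. ennreal (cmod (dil g b t - dil g a t)) \<partial>circ)"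
    by (rule nn_integral_eq_integral[symmetric, OF di]) simp
  also have "\<dots> \<le> (\<integral>\<^sup>+t. (\<integral>\<^sup>+x. ennreal (\<phi> (of_real x * cis t)) * indicator {a..b} x \<partial>lborel) \<partial>circ)" by (intro nn_integral_mono pt)
  also have "\<dots> = (\<integral>\<^sup>+x. (\<integral>\<^sup>+t. ennreal (\<phi> (of_real x * cis t)) * indicator {a..b} x \<partial>circ) \<partial>lborel)"
    by (rule P.Fubini'[symmetric]) measurable
  also have "\<dots> \<le> (\<integral>\<^sup>+x. ennreal (M b) * indicator {a..b} x \<partial>lborel)" by (intro nn_integral_mono inner)
  also have "\<dots> = ennreal ((b - a) * M b)" using ab by (subst nn_integral_cmult_indicator) (auto simp: M_def mult.commute simp flip: ennreal_mult)
  finally show ?thesis using ab by (subst (asm) ennreal_le_iff) (auto simp: M_def)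
qed

text \<open>The integral of \<^term>\<open>dil F r t * cnj (dil g s t)\<close> depends only on the product of the two radii, so the whole increment
  can be moved to \<^term>\<open>g\<close>.\<close>

lemma pairing_increment:
  assumes F: "F holomorphic_on ball 0 1" and FB: "\<And>z. cmod z < 1 \<Longrightarrow> cmod (F z) \<le> B"
    and g: "g holomorphic_on ball 0 1" and rs: "0 \<le> r" "r \<le> s" "s < 1"
  shows "cmod ((\<M> \<theta>. dil F s \<theta> * cnj (dil g s \<theta>)) - (\<M> \<theta>. dil F r \<theta> * cnj (dil g r \<theta>)))
    \<le> 2 * B * ((s - r) * (\<M> \<theta>. cmod (dil (deriv g) s \<theta>)))"
proof (cases "s = 0")
  case False
  then have s: "0 < s" using rs by auto
  have B0: "0 \<le> B" using order_trans[OF norm_ge_zero FB[of 0]] by simp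
  \<comment> \<open>The radius for which s t = r r, so that the pairing at radius r can be written
    with F at radius s.\<close>
  define t where "t = r * r / s"
  have "r * r \<le> s * s" using rs by (intro mult_mono) auto
  then have ts: "t \<le> s" using s by (simp add: t_def divide_le_eq)
  have "t < 1" using rs ts by linarith
  then have t: "0 \<le> t" "t < 1" "s * t = r * r" using rs s by (auto simp: t_def)
  note t = t(1) ts t(2,3)
  define M where "M = (\<M> \<theta>. cmod (dil (deriv g) s \<theta>))"
  have sc: "cmod (of_real s * cis \<theta>) < 1" for \<theta> using rs s by (simp add: norm_mult)
  have c: "continuous_on UNIV (dil F s)" "continuous_on UNIV (dil g s)" "continuous_on UNIV (dil g t)"
    using rs s t by (auto intro!: continuous_on_dil F g)
  have "(\<M> \<theta>. dil F r \<theta> * cnj (dil g r \<theta>)) = (\<M> \<theta>. dil F s \<theta> * cnj (dil g t \<theta>))"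
    by (rule integral_dil_product_cong[OF F g]) (use rs s t in auto)
  then have d: "(\<M> \<theta>. dil F s \<theta> * cnj (dil g s \<theta>)) - (\<M> \<theta>. dil F r \<theta> * cnj (dil g r \<theta>))
      = (\<M> \<theta>. dil F s \<theta> * cnj (dil g s \<theta>) - dil F s \<theta> * cnj (dil g t \<theta>))"
    by (simp only:) (intro Bochner_Integration.integral_diff[symmetric] integrable_circ_continuous continuous_intros c)
  have "cmod ((\<M> \<theta>. dil F s \<theta> * cnj (dil g s \<theta>)) - (\<M> \<theta>. dil F r \<theta> * cnj (dil g r \<theta>))) \<le> (\<M> \<theta>. cmod (dil F s \<theta> * cnj (dil g s \<theta>) - dil F s \<theta> * cnj (dil g t \<theta>)))"
    unfolding d by (rule integral_norm_bound)
  also have "\<dots> \<le> (\<M> \<theta>. B * cmod (dil g s \<theta> - dil g t \<theta>))"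
  proof (rule integral_mono)
    show "integrable circ (\<lambda>\<theta>. cmod (dil F s \<theta> * cnj (dil g s \<theta>) - dil F s \<theta> * cnj (dil g t \<theta>)))"
      by (intro integrable_circ_continuous continuous_intros c)
    show "integrable circ (\<lambda>\<theta>. B * cmod (dil g s \<theta> - dil g t \<theta>))" by (intro integrable_circ_continuous continuous_intros c)
    show "cmod (dil F s \<theta> * cnj (dil g s \<theta>) - dil F s \<theta> * cnj (dil g t \<theta>)) \<le> B * cmod (dil g s \<theta> - dil g t \<theta>)" for \<theta>
      unfolding right_diff_distrib[symmetric] complex_cnj_diff[symmetric] norm_mult complex_mod_cnj by (rule mult_right_mono[OF FB[OF sc]]) simp
  qed
  also have "\<dots> = B * (\<M> \<theta>. cmod (dil g s \<theta> - dil g t \<theta>))" by (rule integral_mult_right_zero)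
  also have "\<dots> \<le> B * ((s - t) * M)" unfolding M_def by (intro mult_left_mono circle_mean_diff_le g t rs B0)
  also have "\<dots> \<le> B * ((2 * (s - r)) * M)"
  proof -
    \<comment> \<open>Equivalent to s - r^2 / s \<le> 2 (s - r): moving the whole increment to g at
      most doubles it.\<close>
    have "0 \<le> (s - r)\<^sup>2 / s" using s by simp
    also have "\<dots> = 2 * (s - r) - (s - t)" using s by (simp add: t_def power2_eq_square field_simps)
    finally have "s - t \<le> 2 * (s - r)" by simp
    then show ?thesis using B0 by (intro mult_left_mono mult_right_mono) (auto simp: M_def)
  qed
  finally show ?thesis by (simp add: M_def algebra_simps)
qed (use rs in simp)

text \<open>Between the k-th and the next dyadic radius, r grows by at most 2^-(k+1) and the circle
  means of |g'| are at most the one at the right end. The pairing therefore changes by at most 2 B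
  v(k+1), and these bounds add up over the intervals met.\<close>

lemma pairing_tail:
  assumes F: "F holomorphic_on ball 0 1" and FB: "\<And>z. cmod z < 1 \<Longrightarrow> cmod (F z) \<le> B" and g: "W1 g"
  defines "v \<equiv> \<lambda>k. (\<M> t. cmod (dil (deriv g) (dyadic_radius k) t)) / 2^k"
  assumes r: "dyadic_radius n \<le> r"
  shows "r \<le> s \<Longrightarrow> s < 1 \<Longrightarrow> cmod ((\<M> t. dil F s t * cnj (dil g s t)) - (\<M> t. dil F r t * cnj (dil g r t)))
    \<le> 2 * B * (\<Sum>k. v (Suc (k + n)))"
proof -
  define I where "I r = (\<M> t. dil F r t * cnj (dil g r t))" for r
  have gh: "g holomorphic_on ball 0 1" and gi: "set_integrable lborel (ball 0 1) (\<lambda>z. cmod (deriv g z))" using g by (auto simp: W1_def)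
  have dg: "deriv g holomorphic_on ball 0 1" by (intro holomorphic_deriv gh) auto
  have B0: "0 \<le> B" using order_trans[OF norm_ge_zero FB[of 0]] by simp
  have v0: "0 \<le> v k" for k by (simp add: v_def)
  have "summable v" unfolding v_def by (rule summable_circle_means[OF dg gi])
  then have vs: "summable (\<lambda>k. v (Suc (k + n)))" using summable_ignore_initial_segment[of v "Suc n"] by simp
  have step: "cmod (I s - I r) \<le> 2 * B * v (Suc k)" if "dyadic_radius k \<le> r" "r \<le> s" "s \<le> dyadic_radius (Suc k)" for r s k
  proof -
    have r0: "0 \<le> r" "s < 1" "0 \<le> s" using that dyadic_radius(1)[of k] dyadic_radius(2)[of "Suc k"] by linarith+
    have "s - r \<le> dyadic_radius (Suc k) - dyadic_radius k" using that by linarith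
    also have "\<dots> = 1 / 2 ^ Suc k" by (rule dyadic_radius(4))
    finally have sr: "s - r \<le> 1 / 2 ^ Suc k" .
    have "cmod (I s - I r) \<le> 2 * B * ((s - r) * (\<M> t. cmod (dil (deriv g) s t)))"
      unfolding I_def by (rule pairing_increment[OF F FB gh r0(1) that(2) r0(2)])
    also have "\<dots> \<le> 2 * B * ((1 / 2 ^ Suc k) * (\<M> t. cmod (dil (deriv g) (dyadic_radius (Suc k)) t)))"
      using B0 sr by (intro mult_left_mono mult_mono circle_mean_mono dg that r0 dyadic_radius(2)) auto
    also have "\<dots> = 2 * B * v (Suc k)" by (simp add: v_def)
    finally show ?thesis .
  qed
  have main: "cmod (I s - I r) \<le> 2 * B * (\<Sum>k<m. v (Suc (k + n)))" if "r \<le> s" "s \<le> dyadic_radius (n + m)" for m s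
    using that
  proof (induction m arbitrary: s)
    case 0
    then have "s = r" using r by simp
    then show ?case by simp
  next
    case (Suc m)
    show ?case
    proof (cases "s \<le> dyadic_radius (n + m)")
      case True
      have "2 * B * (\<Sum>k<m. v (Suc (k + n))) \<le> 2 * B * (\<Sum>k<Suc m. v (Suc (k + n)))" using B0 v0 by (intro mult_left_mono) auto
      then show ?thesis using Suc.IH[OF Suc.prems(1) True] by linarith
    next
      case False
      define x where "x = max r (dyadic_radius (n + m))"
      have x: "dyadic_radius (n + m) \<le> x" "r \<le> x" "x \<le> s" "s \<le> dyadic_radius (Suc (n + m))" using False Suc.prems by (auto simp: x_def)
      have a: "cmod (I s - I x) \<le> 2 * B * v (Suc (n + m))" by (rule step[OF x(1) x(3) x(4)])
      have b: "cmod (I x - I r) \<le> 2 * B * (\<Sum>k<m. v (Suc (k + n)))"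
      proof (cases "r \<le> dyadic_radius (n + m)")
        case True
        then show ?thesis using Suc.IH[of x] by (simp add: x_def)
      next
        case False
        then have "x = r" by (simp add: x_def)
        moreover have "0 \<le> 2 * B * (\<Sum>k<m. v (Suc (k + n)))" using B0 v0 by (intro mult_nonneg_nonneg sum_nonneg) auto
        ultimately show ?thesis by simp
      qed
      have "cmod (I s - I r) \<le> cmod (I s - I x) + cmod (I x - I r)" using norm_triangle_ineq[of "I s - I x" "I x - I r"] by simp
      also have "\<dots> \<le> 2 * B * v (Suc (n + m)) + 2 * B * (\<Sum>k<m. v (Suc (k + n)))" by (rule add_mono[OF a b])
      finally show ?thesis by (simp add: algebra_simps)
    qed
  qed
  assume s: "r \<le> s" "s < 1"
  have "eventually (\<lambda>m. s < dyadic_radius m) sequentially" by (rule order_tendstoD(1)[OF dyadic_radius_tendsto s(2)])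
  then obtain m where m: "s < dyadic_radius m" by (auto simp: eventually_sequentially)
  also have "dyadic_radius m \<le> dyadic_radius (n + m)" by (rule dyadic_radius_mono) simp
  finally have "cmod (I s - I r) \<le> 2 * B * (\<Sum>k<m. v (Suc (k + n)))" using s by (intro main) auto
  also have "\<dots> \<le> 2 * B * (\<Sum>k. v (Suc (k + n)))" using B0 v0 by (intro mult_left_mono sum_le_suminf vs) auto
  finally show "cmod ((\<M> t. dil F s t * cnj (dil g s t)) - (\<M> t. dil F r t * cnj (dil g r t))) \<le> 2 * B * (\<Sum>k. v (Suc (k + n)))"
    by (simp add: I_def)
qed

text \<open>\<tau> is twice the tail of the convergent series of circle means and depends on
  \<open>g\<close> only. The limit defining the pairing is thus uniform over all F with a common
  bound, which permits exchanging it with a limit in F.\<close>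

lemma bounded_pairing_limit:
  assumes g: "W1 g"
  obtains \<tau> :: "nat \<Rightarrow> real" where "\<tau> \<longlonglongrightarrow> 0" and "\<And>F B. F holomorphic_on ball 0 1 \<Longrightarrow> (\<And>z. cmod z < 1 \<Longrightarrow> cmod (F z) \<le> B) \<Longrightarrow>
     \<exists>X. ((\<lambda>r. \<integral>\<theta>. dil F r \<theta> * cnj (dil g r \<theta>) \<partial>circ) \<longlongrightarrow> X) (at_left 1) \<and>
        (\<forall>n. cmod (X - (\<M> \<theta>. dil F (dyadic_radius n) \<theta> * cnj (dil g (dyadic_radius n) \<theta>))) \<le> B * \<tau> n)"
proof -
  define v where "v k = (\<M> \<theta>. cmod (dil (deriv g) (dyadic_radius k) \<theta>)) / 2^k" for k
  define \<tau> where "\<tau> n = 2 * (\<Sum>k. v (Suc (k + n)))" for n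
  have gh: "g holomorphic_on ball 0 1" and gi: "set_integrable lborel (ball 0 1) (\<lambda>z. cmod (deriv g z))" using g by (auto simp: W1_def)
  have dg: "deriv g holomorphic_on ball 0 1" by (intro holomorphic_deriv gh) auto
  have "summable v" unfolding v_def by (rule summable_circle_means[OF dg gi])
  then have "summable (\<lambda>k. v (Suc k))" by (simp add: summable_Suc_iff)
  from suminf_exist_split2[OF this] have tl: "(\<lambda>n. \<Sum>k. v (Suc (k + n))) \<longlonglongrightarrow> 0" by simp
  have t: "\<tau> \<longlonglongrightarrow> 0" unfolding \<tau>_def using tendsto_mult[OF tendsto_const tl, of 2] by simp
  have ex: "\<exists>X. ((\<lambda>r. \<integral>\<theta>. dil F r \<theta> * cnj (dil g r \<theta>) \<partial>circ) \<longlongrightarrow> X) (at_left 1) \<and>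
        (\<forall>n. cmod (X - (\<M> \<theta>. dil F (dyadic_radius n) \<theta> * cnj (dil g (dyadic_radius n) \<theta>))) \<le> B * \<tau> n)"
    if F: "F holomorphic_on ball 0 1" "\<And>z. cmod z < 1 \<Longrightarrow> cmod (F z) \<le> B" for F B
  proof -
    define I where "I r = (\<M> \<theta>. dil F r \<theta> * cnj (dil g r \<theta>))" for r
    have tail: "cmod (I s - I r) \<le> B * \<tau> n" if "dyadic_radius n \<le> r" "r \<le> s" "s < 1" for n r s
      using pairing_tail[OF F g that] by (simp add: I_def \<tau>_def v_def mult_ac)
    have Bt: "(\<lambda>n. B * \<tau> n) \<longlonglongrightarrow> 0" using tendsto_mult[OF tendsto_const t, of B] by simp
    have "Cauchy (\<lambda>m. I (dyadic_radius m))"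
    proof (rule metric_CauchyI)
      fix e :: real assume "e > 0"
      then have "eventually (\<lambda>n. B * \<tau> n < e/2) sequentially" by (intro order_tendstoD(2)[OF Bt]) auto
      then obtain N where N: "B * \<tau> N < e/2" by (auto simp: eventually_sequentially)
      have c: "dist (I (dyadic_radius m)) (I (dyadic_radius N)) < e/2" if "m \<ge> N" for m
        using tail[of N "dyadic_radius N" "dyadic_radius m"] dyadic_radius_mono[OF that] dyadic_radius(2) N by (simp add: dist_norm)
      show "\<exists>M. \<forall>m\<ge>M. \<forall>n\<ge>M. dist (I (dyadic_radius m)) (I (dyadic_radius n)) < e"
        by (intro exI[of _ N] allI impI) (rule dist_triangle_half_l[OF c c])
    qed
    then obtain X where X: "(\<lambda>m. I (dyadic_radius m)) \<longlonglongrightarrow> X" using Cauchy_convergent convergentD by blast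
    have XI: "cmod (X - I r) \<le> B * \<tau> n" if r: "dyadic_radius n \<le> r" "r < 1" for r n
    proof -
      have "eventually (\<lambda>m. r < dyadic_radius m) sequentially" by (rule order_tendstoD(1)[OF dyadic_radius_tendsto r(2)])
      then have "eventually (\<lambda>m. cmod (I (dyadic_radius m) - I r) \<le> B * \<tau> n) sequentially"
        by eventually_elim (intro tail r dyadic_radius(2) less_imp_le)
      then show ?thesis by (intro tendsto_upperbound[OF tendsto_norm[OF tendsto_diff[OF X tendsto_const]]]) auto
    qed
    have "(I \<longlongrightarrow> X) (at_left 1)"
    proof (rule tendstoI)
      fix e :: real assume "e > 0"
      then have "eventually (\<lambda>n. B * \<tau> n < e) sequentially" by (intro order_tendstoD(2)[OF Bt]) auto
      then obtain N where N: "B * \<tau> N < e" by (auto simp: eventually_sequentially)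
      have "eventually (\<lambda>r. r \<in> {dyadic_radius N<..<1}) (at_left 1)" by (rule eventually_at_leftI[of "dyadic_radius N"]) (use dyadic_radius(2) in auto)
      then show "eventually (\<lambda>r. dist (I r) X < e) (at_left 1)"
      proof eventually_elim
        case (elim r)
        then show ?case using XI[of N r] N by (simp add: dist_norm norm_minus_commute)
      qed
    qed
    moreover have "cmod (X - I (dyadic_radius n)) \<le> B * \<tau> n" for n by (rule XI[OF order_refl dyadic_radius(2)])
    ultimately show ?thesis unfolding I_def by blast
  qed
  show ?thesis by (rule that[OF t ex])
qed

section \<open>Polynomial approximation under a common bound, and the converse inclusion\<close>

lemma Hinf_iff: "Hinf f \<longleftrightarrow> f holomorphic_on ball 0 1 \<and> (\<exists>B. \<forall>z. cmod z < 1 \<longrightarrow> cmod (f z) \<le> B)"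
  unfolding Hinf_def bounded_iff ball_simps(9) mem_ball_0[symmetric] by blast

text \<open>Cauchy's estimate on the disc of radius (1 - |z|)/2 about z, whence the constant 2
  B.\<close>

lemma Hinf_imp_Bloch:
  assumes "Hinf F"
  shows "Bloch F"
proof -
  have F: "F holomorphic_on ball 0 1" using assms by (simp add: Hinf_def)
  obtain B where B: "\<And>z. cmod z < 1 \<Longrightarrow> cmod (F z) \<le> B" using assms by (auto simp: Hinf_iff)
  have "(1 - cmod z) * cmod (deriv F z) \<le> 2 * B" if z: "z \<in> ball 0 1" for z
  proof -
    define r where "r = (1 - cmod z) / 2"
    have r: "0 < r" "1 - cmod z = 2 * r" using z by (auto simp: r_def)
    have sub: "cball z r \<subseteq> ball 0 1"
    proof
      fix x assume "x \<in> cball z r"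
      then have "cmod (x - z) \<le> r" by (simp add: dist_norm norm_minus_commute)
      then show "x \<in> ball 0 1" using norm_triangle_ineq[of z "x - z"] r by simp
    qed
    have "cmod ((deriv ^^ 1) F z) \<le> fact 1 * B / r ^ 1"
    proof (rule Cauchy_inequality)
      show "F holomorphic_on ball z r" by (rule holomorphic_on_subset[OF F]) (use sub in auto)
      show "continuous_on (cball z r) F" by (rule continuous_on_subset[OF holomorphic_on_imp_continuous_on[OF F] sub])
      show "cmod (F x) \<le> B" if "cmod (z - x) = r" for x using sub that by (intro B) (auto simp: dist_norm)
    qed (rule r)
    then have "cmod (deriv F z) * r \<le> B" using r by (simp add: field_simps)
    then show ?thesis unfolding r(2) by (simp add: mult_ac)
  qed
  then show ?thesis using F by (auto simp: Bloch_def intro!: bdd_aboveI2[where M="2*B"])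
qed

text \<open>A dilation of h keeps the bound B on the whole disc, is close to h on the smaller disc
  by uniform continuity, and is a uniform limit of polynomials up to the boundary. The polynomial is
  taken within 1 of it, hence the bound B + 1.\<close>

lemma bounded_poly_approx:
  assumes h: "h holomorphic_on ball 0 1" and B: "\<And>z. cmod z < 1 \<Longrightarrow> cmod (h z) \<le> B"
    and R: "R < 1" and e: "0 < \<eta>"
  obtains p where "\<And>z. cmod z < 1 \<Longrightarrow> cmod (poly p z) \<le> B + 1" and "\<And>z. cmod z \<le> R \<Longrightarrow> cmod (h z - poly p z) < \<eta>"
proof -
  have "uniformly_continuous_on (cball 0 R) h"
    by (intro compact_uniformly_continuous continuous_on_subset[OF holomorphic_on_imp_continuous_on[OF h]]) (use R in auto)
  then obtain d where d: "d > 0" "\<And>x y. x \<in> cball 0 R \<Longrightarrow> y \<in> cball 0 R \<Longrightarrow> dist y x < d \<Longrightarrow> dist (h y) (h x) < \<eta> / 2"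
    unfolding uniformly_continuous_on_def using e by (metis half_gt_zero)
  define t where "t = 1 - min (d/2) (1/2)"
  have t: "0 \<le> t" "t < 1" "1 - t < d" using d(1) by (auto simp: t_def min_def)
  obtain p where p: "\<And>z. cmod z \<le> 1 \<Longrightarrow> cmod (h (of_real t * z) - poly p z) < min (\<eta>/2) 1"
    by (rule dil_poly_approx[OF h t(1,2), of "min (\<eta>/2) 1"]) (use e in auto)
  have tz: "cmod (of_real t * z) \<le> cmod z" for z unfolding norm_mult using t by (intro mult_left_le_one_le) auto
  show ?thesis
  proof (rule that)
    fix z :: complex
    { assume z: "cmod z < 1"
      have "cmod (h (of_real t * z)) \<le> B" using tz[of z] z by (intro B) linarith
      then show "cmod (poly p z) \<le> B + 1" using p[of z] z norm_triangle_ineq3[of "h (of_real t * z)" "poly p z"] by auto }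
    assume z: "cmod z \<le> R"
    have "cmod (of_real t * z - z) = (1 - t) * cmod z"
    proof -
      have "of_real t * z - z = - (of_real (1 - t) * z)" by (simp add: algebra_simps)
      then have "cmod (of_real t * z - z) = cmod (of_real (1 - t) * z)" by (simp only: norm_minus_cancel)
      then show ?thesis using t by (simp only: norm_mult norm_of_real abs_of_nonneg)
    qed
    also have "\<dots> \<le> 1 - t" using z R t by (intro mult_left_le) auto
    finally have "dist (h (of_real t * z)) (h z) < \<eta>/2" using z tz[of z] t by (intro d(2)) (auto simp: dist_norm)
    then have "cmod (h z - h (of_real t * z)) < \<eta>/2" by (simp add: dist_norm norm_minus_commute)
    moreover have "cmod (h (of_real t * z) - poly p z) < \<eta>/2" using p[of z] z R by simp
    ultimately show "cmod (h z - poly p z) < \<eta>" using norm_triangle_ineq[of "h z - h (of_real t * z)" "h (of_real t * z) - poly p z"] by simp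
  qed
qed

text \<open>For F - Q_j, bounded by 2 B, the pairing differs from the integral at the n-th dyadic
  radius by at most 2 B \<tau>_n, uniformly in j. At that one radius, uniform convergence on a
  compact disc is enough.\<close>

lemma bloch_pairing_diff_tendsto:
  assumes g: "W1 g" and F: "F holomorphic_on ball 0 1" "\<And>z. cmod z < 1 \<Longrightarrow> cmod (F z) \<le> B"
    and Q: "\<And>j. Q j holomorphic_on ball 0 1" "\<And>j z. cmod z < 1 \<Longrightarrow> cmod (Q j z) \<le> B"
    and lim: "\<And>R. R < 1 \<Longrightarrow> uniform_limit (cball 0 R) Q F sequentially"
  shows "(\<lambda>j. bloch_pairing F g - bloch_pairing (Q j) g) \<longlonglongrightarrow> 0"
proof -
  have gh: "g holomorphic_on ball 0 1" using g by (simp add: W1_def)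
  obtain \<tau> :: "nat \<Rightarrow> real" where t: "\<tau> \<longlonglongrightarrow> 0" and ex: "\<And>F B. F holomorphic_on ball 0 1 \<Longrightarrow> (\<And>z. cmod z < 1 \<Longrightarrow> cmod (F z) \<le> B) \<Longrightarrow>
     \<exists>X. ((\<lambda>r. \<integral>\<theta>. dil F r \<theta> * cnj (dil g r \<theta>) \<partial>circ) \<longlongrightarrow> X) (at_left 1) \<and>
        (\<forall>n. cmod (X - (\<M> \<theta>. dil F (dyadic_radius n) \<theta> * cnj (dil g (dyadic_radius n) \<theta>))) \<le> B * \<tau> n)"
    by (rule bounded_pairing_limit[OF g]) blast
  define I where "I F r = (\<M> \<theta>. dil F r \<theta> * cnj (dil g r \<theta>))" for F r
  have Dh: "(\<lambda>z. F z - Q j z) holomorphic_on ball 0 1" for j by (intro holomorphic_intros F Q)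
  have DB: "cmod (F z - Q j z) \<le> 2 * B" if "cmod z < 1" for j z
    using norm_triangle_ineq4[of "F z" "Q j z"] F(2)[OF that] Q(2)[OF that, of j] by linarith
  have diff: "cmod (bloch_pairing F g - bloch_pairing (Q j) g) \<le> cmod (I (\<lambda>z. F z - Q j z) (dyadic_radius n)) + 2 * B * \<tau> n" for j n
  proof -
    obtain X where X: "(I F \<longlongrightarrow> X) (at_left 1)" using ex[OF F] unfolding I_def by blast
    obtain Y where Y: "(I (Q j) \<longlongrightarrow> Y) (at_left 1)" using ex[OF Q] unfolding I_def by blast
    obtain Z where Z: "(I (\<lambda>z. F z - Q j z) \<longlongrightarrow> Z) (at_left 1)" and Zb: "cmod (Z - I (\<lambda>z. F z - Q j z) (dyadic_radius n)) \<le> 2 * B * \<tau> n"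
      using ex[OF Dh DB] unfolding I_def by blast
    have "((\<lambda>r. I F r - I (Q j) r) \<longlongrightarrow> Z) (at_left 1)"
    proof (rule Lim_transform_eventually[OF Z])
      have "eventually (\<lambda>r::real. r \<in> {0<..<1}) (at_left 1)" by (rule eventually_at_leftI[of 0]) auto
      then show "eventually (\<lambda>r. I (\<lambda>z. F z - Q j z) r = I F r - I (Q j) r) (at_left 1)"
      proof eventually_elim
        case (elim r)
        then have r: "0 \<le> r" "r < 1" by auto
        show ?case unfolding I_def left_diff_distrib
          by (intro Bochner_Integration.integral_diff integrable_circ_continuous continuous_intros continuous_on_dil F Q gh r)
      qed
    qed
    then have "X - Y = Z" using tendsto_diff[OF X Y] by (intro tendsto_unique[of "at_left (1::real)"]) auto
    moreover have "bloch_pairing F g = X" "bloch_pairing (Q j) g = Y"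
      using X Y unfolding I_def by (auto intro!: bloch_pairing_eqI F Q gh)
    ultimately show ?thesis using Zb norm_triangle_ineq[of "Z - I (\<lambda>z. F z - Q j z) (dyadic_radius n)" "I (\<lambda>z. F z - Q j z) (dyadic_radius n)"] by simp
  qed
  have Il: "(\<lambda>j. I (\<lambda>z. F z - Q j z) (dyadic_radius n)) \<longlonglongrightarrow> 0" for n
  proof (rule tendstoI)
    fix e :: real assume e: "e > 0"
    have r: "0 \<le> dyadic_radius n" "dyadic_radius n < 1" by (rule dyadic_radius)+
    obtain C where C: "\<And>\<theta>. cmod (dil g (dyadic_radius n) \<theta>) \<le> C" by (rule dil_bounded[OF gh r]) blast
    have C0: "0 \<le> C" using order_trans[OF norm_ge_zero C] .
    have "0 < e / (2 * (C + 1))" using e C0 by simp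
    from uniform_limitD[OF lim[OF r(2)] this]
    show "eventually (\<lambda>j. dist (I (\<lambda>z. F z - Q j z) (dyadic_radius n)) 0 < e) sequentially"
    proof eventually_elim
      case (elim j)
      have b: "cmod (F (of_real (dyadic_radius n) * cis \<theta>) - Q j (of_real (dyadic_radius n) * cis \<theta>)) \<le> e / (2 * (C + 1))" for \<theta>
      proof -
        have "of_real (dyadic_radius n) * cis \<theta> \<in> cball 0 (dyadic_radius n)" using r by (simp add: norm_mult)
        then show ?thesis using elim by (metis dist_norm norm_minus_commute less_imp_le)
      qed
      have "cmod (I (\<lambda>z. F z - Q j z) (dyadic_radius n)) \<le> (\<M> \<theta>. cmod ((F (of_real (dyadic_radius n) * cis \<theta>) - Q j (of_real (dyadic_radius n) * cis \<theta>)) * cnj (dil g (dyadic_radius n) \<theta>)))"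
        unfolding I_def by (rule integral_norm_bound)
      also have "\<dots> \<le> e / (2 * (C + 1)) * C"
      proof (rule integral_circ_mono_const)
        show "cmod ((F (of_real (dyadic_radius n) * cis \<theta>) - Q j (of_real (dyadic_radius n) * cis \<theta>)) * cnj (dil g (dyadic_radius n) \<theta>)) \<le> e / (2 * (C + 1)) * C" for \<theta>
          unfolding norm_mult complex_mod_cnj using e C0 by (intro mult_mono b C) auto
      qed (use e C0 in auto)
      also have "\<dots> < e"
      proof -
        have "e * C < e * (2 * (C + 1))" using e C0 by (intro mult_strict_left_mono) auto
        then show ?thesis using C0 by (simp add: field_simps)
      qed
      finally show ?case by simp
    qed
  qed
  show ?thesis
  proof (rule tendstoI)
    fix e :: real assume e: "e > 0"
    have "(\<lambda>n. 2 * B * \<tau> n) \<longlonglongrightarrow> 0" using tendsto_mult[OF tendsto_const t, of "2*B"] by simp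
    then have "eventually (\<lambda>n. 2 * B * \<tau> n < e/2) sequentially" using e by (intro order_tendstoD(2)) auto
    then obtain n where n: "2 * B * \<tau> n < e/2" by (auto simp: eventually_sequentially)
    have "eventually (\<lambda>j. dist (I (\<lambda>z. F z - Q j z) (dyadic_radius n)) 0 < e/2) sequentially" using e by (intro tendstoD[OF Il]) simp
    then show "eventually (\<lambda>j. dist (bloch_pairing F g - bloch_pairing (Q j) g) 0 < e) sequentially"
    proof eventually_elim
      case (elim j)
      then show ?case using diff[of j n] n by (simp add: dist_norm)
    qed
  qed
qed

text \<open>Polynomials p_j with a common bound converge to h locally uniformly. The multiples p_j S
  then converge boundedly to F, so their pairings with each of finitely many test functions
  converge, and one index j serves all of them.\<close>

lemma bounded_multiple_in_invariant_subspace: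
  assumes S: "Hinf S" and h: "Hinf h" and F: "\<And>z. cmod z < 1 \<Longrightarrow> F z = S z * h z"
  shows "Hinf F" and "F \<in> bloch_invariant_subspace S"
proof -
  have Sh: "S holomorphic_on ball 0 1" and hh: "h holomorphic_on ball 0 1" using S h by (auto simp: Hinf_def)
  obtain A where A: "\<And>z. cmod z < 1 \<Longrightarrow> cmod (S z) \<le> A" using S by (auto simp: Hinf_iff)
  obtain B where B: "\<And>z. cmod z < 1 \<Longrightarrow> cmod (h z) \<le> B" using h by (auto simp: Hinf_iff)
  have A0: "0 \<le> A" and B0: "0 \<le> B" using order_trans[OF norm_ge_zero A[of 0]] order_trans[OF norm_ge_zero B[of 0]] by simp_all
  have "(\<lambda>z. S z * h z) holomorphic_on ball 0 1" by (intro holomorphic_intros Sh hh)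
  then have Fh: "F holomorphic_on ball 0 1" by (rule holomorphic_transform) (simp add: F)
  have FB: "cmod (F z) \<le> (B + 1) * A" if "cmod z < 1" for z
    unfolding F[OF that] norm_mult mult.commute[of "cmod (S z)"] using A[OF that] B[OF that] A0 B0 by (intro mult_mono) auto
  show HF: "Hinf F" unfolding Hinf_iff using Fh FB by blast
  have "\<exists>p. (\<forall>z. cmod z < 1 \<longrightarrow> cmod (poly p z) \<le> B + 1) \<and> (\<forall>z. cmod z \<le> dyadic_radius j \<longrightarrow> cmod (h z - poly p z) < 1 / (real j + 1))" for j
    by (rule bounded_poly_approx[OF hh B dyadic_radius(2)[of j], of "1 / (real j + 1)"]) (simp, simp, blast)
  then obtain p where p: "\<And>j z. cmod z < 1 \<Longrightarrow> cmod (poly (p j) z) \<le> B + 1"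
      "\<And>j z. cmod z \<le> dyadic_radius j \<Longrightarrow> cmod (h z - poly (p j) z) < 1 / (real j + 1)" by metis
  have Qh: "(\<lambda>z. poly (p j) z * S z) holomorphic_on ball 0 1" for j by (intro holomorphic_intros Sh)
  have QB: "cmod (poly (p j) z * S z) \<le> (B + 1) * A" if "cmod z < 1" for j z
    unfolding norm_mult using p(1)[OF that] A[OF that] B0 by (intro mult_mono) auto
  have lim: "uniform_limit (cball 0 R) (\<lambda>j z. poly (p j) z * S z) F sequentially" if R: "R < 1" for R
  proof (rule uniform_limitI)
    fix e :: real assume e: "e > 0"
    have "(\<lambda>j. 1 / (real j + 1) * A) \<longlonglongrightarrow> 0 * A" by (intro tendsto_intros) real_asymp
    then have "eventually (\<lambda>j. 1 / (real j + 1) * A < e) sequentially" using e by (intro order_tendstoD(2)) auto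
    moreover have "eventually (\<lambda>j. R < dyadic_radius j) sequentially" by (rule order_tendstoD(1)[OF dyadic_radius_tendsto R])
    ultimately show "eventually (\<lambda>j. \<forall>z\<in>cball 0 R. dist (poly (p j) z * S z) (F z) < e) sequentially"
    proof eventually_elim
      case (elim j)
      show ?case
      proof
        fix z :: complex assume "z \<in> cball 0 R"
        then have z: "cmod z \<le> dyadic_radius j" "cmod z < 1" using elim R by auto
        have "dist (poly (p j) z * S z) (F z) = cmod (h z - poly (p j) z) * cmod (S z)"
          unfolding F[OF z(2)] by (simp add: dist_norm norm_mult[symmetric] norm_minus_commute algebra_simps)
        also have "\<dots> \<le> 1 / (real j + 1) * A" using p(2)[OF z(1)] A[OF z(2)] by (intro mult_mono) auto
        finally show "dist (poly (p j) z * S z) (F z) < e" using elim by simp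
      qed
    qed
  qed
  have "\<exists>q. \<forall>g\<in>G. cmod (bloch_pairing F g - bloch_pairing (\<lambda>z. poly q z * S z) g) < e"
    if G: "finite G" "G \<subseteq> Collect W1" and e: "0 < e" for G e
  proof -
    have "eventually (\<lambda>j. cmod (bloch_pairing F g - bloch_pairing (\<lambda>z. poly (p j) z * S z) g) < e) sequentially" if "g \<in> G" for g
    proof -
      have "W1 g" using that G by auto
      from tendstoD[OF bloch_pairing_diff_tendsto[OF this Fh FB Qh QB lim] e] show ?thesis by simp
    qed
    then have "eventually (\<lambda>j. \<forall>g\<in>G. cmod (bloch_pairing F g - bloch_pairing (\<lambda>z. poly (p j) z * S z) g) < e) sequentially"
      using G(1) by (simp add: eventually_ball_finite)
    then show ?thesis by (auto simp: eventually_sequentially)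
  qed
  then show "F \<in> bloch_invariant_subspace S" unfolding bloch_invariant_subspace_def using Hinf_imp_Bloch[OF HF] by blast
qed

theorem theorem3p1:
  fixes w :: "real \<Rightarrow> real" and \<mu> :: "complex measure" and f :: "complex \<Rightarrow> complex"
  assumes "majorant w"
    and "\<exists>\<gamma>. 0 < \<gamma> \<and> \<gamma> < 1 \<and>
           (\<forall>s t. 0 < s \<longrightarrow> s \<le> t \<longrightarrow> t \<le> 1 \<longrightarrow> w t / t powr \<gamma> \<le> w s / s powr \<gamma>)"
    and "set_integrable lborel {0<..1} (\<lambda>t. w t / t)"
    and "singular_circle_measure \<mu>" and "emeasure \<mu> UNIV \<noteq> 0"
    and "BMOA_w w f" and "\<exists>z\<in>ball 0 1. f z \<noteq> 0"
    and "\<exists>g. H2 g \<and> (\<forall>z\<in>ball 0 1. f z = sing_inner \<mu> z * g z)"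
  shows "(\<forall>F. (F \<in> bloch_invariant_subspace (sing_inner \<mu>) \<and> Hinf F) \<longleftrightarrow>
              (\<exists>h. Hinf h \<and> (\<forall>z\<in>ball 0 1. F z = sing_inner \<mu> z * h z)))
         \<and> \<not> bloch_cyclic (sing_inner \<mu>)"
proof -
  interpret singular \<mu> by unfold_locales (rule assms(4))
  obtain g where g: "H2 g" "\<And>z. cmod z < 1 \<Longrightarrow> f z = sing_inner \<mu> z * g z" using assms(8) by auto
  have S: "Hinf (sing_inner \<mu>)" unfolding Hinf_iff using sing_inner_holomorphic norm_sing_inner_le by blast
  have perm: "\<exists>h. Hinf h \<and> (\<forall>z\<in>ball 0 1. F z = sing_inner \<mu> z * h z)"
    if "F \<in> bloch_invariant_subspace (sing_inner \<mu>)" "Hinf F" for F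
    by (rule permanence[OF assms(1,3,6,7) g that])
  have conv: "F \<in> bloch_invariant_subspace (sing_inner \<mu>) \<and> Hinf F"
    if h: "Hinf h" "\<forall>z\<in>ball 0 1. F z = sing_inner \<mu> z * h z" for F h
  proof -
    have "F z = sing_inner \<mu> z * h z" if "cmod z < 1" for z using h(2) that by simp
    from bounded_multiple_in_invariant_subspace[OF S h(1) this] show ?thesis by blast
  qed
  have "\<not> bloch_cyclic (sing_inner \<mu>)"
  proof
    assume "bloch_cyclic (sing_inner \<mu>)"
    \<comment> \<open>The constant 1 is the test function: permanence would make it S h with h
      bounded.\<close>
    moreover have one: "Hinf (\<lambda>_. 1)" unfolding Hinf_iff by (auto intro!: exI[of _ 1])
    ultimately have "(\<lambda>_. 1) \<in> bloch_invariant_subspace (sing_inner \<mu>)" by (simp add: bloch_cyclic_def Hinf_imp_Bloch)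
    from perm[OF this one] obtain h where h: "Hinf h" "\<forall>z\<in>ball 0 1. 1 = sing_inner \<mu> z * h z" by blast
    then obtain B where "h holomorphic_on ball 0 1" "\<forall>z. cmod z < 1 \<longrightarrow> cmod (h z) \<le> B" by (auto simp: Hinf_iff)
    then have "measure \<mu> UNIV = 0" by (intro sing_inner_bounded_below_trivial[of h B]) (use h(2) in auto)
    then show False using assms(5) by (simp add: emeasure_eq_measure)
  qed
  then show ?thesis using perm conv by blast
qed

end
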